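(* Let $\mathcal{C}_c$ be the space of all stable and sequentially continuous functions $f:(L^0)^d\to L^0$ with stably compact conditional support, and let $L:\mathcal{C}_c\to L^0$ be stable, $L^0$-linear and such that $L(f)\ge0$ whenever $f\ge0$. Then there exists a stable measure $\mu$ on $\mathcal{B}^d$ such that $$L(f)=\int_{(L^0)^d}f\,d\mu\quad\text{for all }f\in\mathcal{C}_c.$$ Moreover, it holds: (1) $\mu([x,y])<\infty$ for all stably compact intervals $[x,y]:=\{z\in(L^0)^d:x\le z\le y\}$; (2) $\mu(V|A)=\sup\{\mu(W|B):W|B\sqsubseteq V|A\text{ stably compact}\}$ for all $V|A\in\mathcal{B}^d$ with $\mu(V|A)<\infty$.
   Context: $(\Omega,\mathscr{F},\mathbb{P})$ is a complete probability space; $A,B\in\mathscr{F}$ are identified if $\mathbb{P}(A\Delta B)=0$, and inclusions and (in)equalities between (extended) random variables are understood a.s. $L^0$, $L^0_+$, $\bar L^0_+$ are the sets of measurable functions on $\Omega$ with values in $\mathbb{R}$, $[0,\infty)$, $[0,\infty]$; $L^0_{++}=\{x\in L^0:x>0\}$. Suprema of families in $\mathscr{F}$ and in $\bar L^0_+$ are essential suprema. A partition (of $\Omega$) is a countable pairwise disjoint family $(A_k)$ in $\mathscr{F}$ with union $\Omega$. For a function $x$ on $\Omega$ and $A\in\mathscr{F}$, $x|A$ is the restriction to $A$; $x|A$ and $y|B$ are identified if $\mathbb{P}(A\Delta B)=0$ and $x=y$ a.e. on $A\cap B$. $\sum x_k|A_k$ is the function equal to $x_k$ on $A_k$ for each $k$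 (so $r|A+0|A^c$ equals $r$ on $A$ and $0$ on $A^c$). For a set $X$ of functions on $\Omega$, $X|A:=\{x|A: x\in X\}$, $(X|A)|B:=X|A\cap B$, $X|\emptyset=\{\ast\}$, $X|\Omega=X$. A set $X$ of functions on $\Omega$ with values in a fixed set is stable if $X\neq\emptyset$ and $\sum x_k|A_k\in X$ for all partitions $(A_k)$ and sequences $(x_k)$ in $X$. $\mathcal{P}(X)$ is the collection of all conditional subsets $V|A$, $V\subseteq X$ stable, $A\in\mathscr{F}$. For stable $V_k\subseteq X$, $\sum V_k|A_k:=\{\sum x_k|A_k: x_k\in V_k\ \forall k\}$, and $\sum (V_k|B_k)|A_k:=(\sum V_k|A_k)|\bigcup_k(A_k\cap B_k)$. A subset of $\mathcal{P}(X)$ is a stable collection if nonempty and closed under such countable concatenations. $V|A\sqsubseteq W|B$ iff $A\subseteq B$ and $V|A\subseteq W|A$. $(\mathcal{P}(X),\sqsubseteq)$ is a complete Boolean algebra with greatest element $X$ and least element $\{\ast\}$; $\sqcup,\sqcap,{}^\sqsubset$ are its supremum, infimum, complement; disjoint means $V|A\sqcap W|B=\{\ast\}$. A stable collection $\mathcal{X}$ is a stable $\sigma$-algebra if $X\in\mathcal{X}$ and it is closed under ${}^\sqsubset$ and countable $\sqcup$. A stable measure on a stable $\sigma$-algebra $\mathcal{X}$ is a function $\mu:\mathcal{X}\to\bar L^0_+$ with $\mu(\sum(V_k|B_k)|A_k)=\sum\mu(V_k|B_k)|A_k$ (stability), (M1) $\mu(V|A)=\mu(V|A)|A+0|A^c$,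 and (M2) $\mu(\sqcup_k(V_k|A_k))=\sum_{k}\mu(V_k|A_k)$ for sequences of pairwise disjoint elements of $\mathcal{X}$. A function $f:X\to Y$ between stable sets is stable if $f(\sum x_k|A_k)=\sum f(x_k)|A_k$. For $W|A\in\mathcal{P}(Y)$, with $C_\ast:=\sup\{A'\subseteq A:\exists x\in X,\ f(x)|A'\in W|A'\}$ (attained), the conditional preimage is $f^{-1}(W|A):=\{x\in X:f(x)|C_\ast\in W|C_\ast\}|C_\ast$. A stable function is stably measurable if preimages of elements of the stable $\sigma$-algebra on $Y$ belong to that on $X$. The stable indicator function is $1_{V|A}(x):=1|A_x+0|A_x^c$, with $A_x:=\sup\{A'\subseteq A: x|A'\in V|A'\}$. A stable elementary function is $\sum_{k\le n}r_k1_{V_k|A_k}$ with $r_k\in L^0_+$ and pairwise disjoint $V_k|A_k\in\mathcal{X}$ with $\sqcup_kV_k|A_k=X$; its integral is $\sum_{k\le n}r_k\mu(V_k|A_k)\in\bar L^0_+$ ($0\cdot\infty=0$). For stably measurable $f:X\to L^0_+$, $\int_Xf\,d\mu:=\sup_n\int_Xf_n\,d\mu$ for any increasing sequence $(f_n)$ of stable elementary functions with $\sup_nf_n=f$ pointwise (exists; independent of the choice). A stably measurable $f:X\to L^0$ is integrable if $\int_X f^\pm d\mu\in L^0$, and then $\int_Xf\,d\mu:=\int_Xf^+d\mu-\int_Xf^-d\mu$. $(L^0)^d=L^0(\mathbb{R}^d)$ (measurable functions $\Omega\to\mathbb{R}^d$) carries the $L^0$-valued Euclidean norm $\|x\|(\omega):=\|x(\omega)\|$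 and the order $(x_1,\dots,x_d)\le(y_1,\dots,y_d)$ iff $x_i\le y_i$ for all $i$. $\mathcal{B}^d$ is the stable $\sigma$-algebra on $(L^0)^d$ generated by the stable open balls $\{y:\|x-y\|<r\}$, $x\in(L^0)^d$, $r\in L^0_{++}$; $\mathcal{B}(L^0)$, the stable $\sigma$-algebra on $L^0$, is the case $d=1$. A conditional subset $V|A$ of $(L^0)^d$ is $L^0$-bounded if there is $M\in L^0_+$ with $\|x\||A\le M|A$ for all $x|A\in V|A$; sequentially closed if it contains the limit of every a.s. convergent sequence in $V|A$; stably compact if it is $L^0$-bounded and sequentially closed. A function $f:(L^0)^d\to L^0$ is sequentially continuous if $f(x_n)\to f(x)$ a.s. whenever $x_n\to x$ a.s. The conditional support of a stable function $f:(L^0)^d\to L^0$ is $\mathrm{supp}(f):=\mathrm{cl}(f^{-1}(\{0\}^\sqsubset))$, where $\mathrm{cl}$ denotes sequential closure. For functions, $f\ge0$ means $f(x)\ge0$ for all $x$, and $(\sum f_k|A_k)(x):=\sum f_k(x)|A_k$. $L:\mathcal{C}_c\to L^0$ is stable if $L(\sum f_k|A_k)=\sum L(f_k)|A_k$ for all sequences $(f_k)$ in $\mathcal{C}_c$ and partitions $(A_k)$; $L^0$-linear if $L(f+rg)=L(f)+rL(g)$ for all $f,g\in\mathcal{C}_c$, $r\in L^0$. *)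

theory Defs
  imports "HOL-Probability.Probability_Measure"
begin

text \<open>
  Random variables are represented by measurable functions, and (in)equalities between them are
  stated almost everywhere. The restriction of a function \<open>x\<close> to \<open>A\<close> is the almost-everywhere
  class of the partial function that is \<open>x\<close> on \<open>A\<close> and undefined elsewhere. Hence the
  identification of \<open>x|A\<close> with \<open>y|B\<close> (when \<open>A = B\<close> almost surely and \<open>x = y\<close> almost everywhere on
  \<open>A \<inter> B\<close>) is an equality of objects, and so is the equality of conditional subsets.
\<close>

type_synonym ('w, 'b) condset = "('w \<Rightarrow> 'b option) set set"

abbreviation L0 :: "'w measure \<Rightarrow> ('w \<Rightarrow> 'b::euclidean_space) set"
  where "L0 M \<equiv> borel_measurable M"

definition L0_plus :: "'w measure \<Rightarrow> ('w \<Rightarrow> real) set"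
  where "L0_plus M = {x \<in> L0 M. AE \<omega> in M. 0 \<le> x \<omega>}"

definition L0_pp :: "'w measure \<Rightarrow> ('w \<Rightarrow> real) set"
  where "L0_pp M = {x \<in> L0 M. AE \<omega> in M. 0 < x \<omega>}"

definition ae_subset :: "'w measure \<Rightarrow> 'w set \<Rightarrow> 'w set \<Rightarrow> bool"
  where "ae_subset M A B \<longleftrightarrow> (AE \<omega> in M. \<omega> \<in> A \<longrightarrow> \<omega> \<in> B)"

text \<open>Essential suprema; a version of the supremum of a family of events is picked by choice.\<close>

definition ess_Sup_sets :: "'w measure \<Rightarrow> 'w set set \<Rightarrow> 'w set"
  where "ess_Sup_sets M \<A> = (SOME S. S \<in> sets M \<and> (\<forall>A\<in>\<A>. ae_subset M A S) \<and>
           (\<forall>T\<in>sets M. (\<forall>A\<in>\<A>. ae_subset M A T) \<longrightarrow> ae_subset M S T))"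

definition is_ess_Sup :: "'w measure \<Rightarrow> ('w \<Rightarrow> ennreal) set \<Rightarrow> ('w \<Rightarrow> ennreal) \<Rightarrow> bool"
  where "is_ess_Sup M F s \<longleftrightarrow> s \<in> borel_measurable M \<and> (\<forall>x\<in>F. AE \<omega> in M. x \<omega> \<le> s \<omega>) \<and>
           (\<forall>t\<in>borel_measurable M. (\<forall>x\<in>F. AE \<omega> in M. x \<omega> \<le> t \<omega>) \<longrightarrow> (AE \<omega> in M. s \<omega> \<le> t \<omega>))"


section \<open>Stable sets and conditional subsets\<close>

text \<open>Partitions are indexed by \<open>nat\<close>; finite ones are padded with empty sets.\<close>

definition partition_of :: "'w measure \<Rightarrow> (nat \<Rightarrow> 'w set) \<Rightarrow> bool"
  where "partition_of M A \<longleftrightarrow>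
           range A \<subseteq> sets M \<and> disjoint_family A \<and> (\<Union>k. A k) = space M"

text \<open>\<open>glue A x\<close> is \<open>\<Sum> x\<^sub>k|A\<^sub>k\<close>: on a partition, \<open>LEAST\<close> selects the unique index.\<close>

definition glue :: "(nat \<Rightarrow> 'w set) \<Rightarrow> (nat \<Rightarrow> 'w \<Rightarrow> 'b) \<Rightarrow> 'w \<Rightarrow> 'b"
  where "glue A x = (\<lambda>\<omega>. x (LEAST k. \<omega> \<in> A k) \<omega>)"

definition stable_set :: "'w measure \<Rightarrow> ('w \<Rightarrow> 'b) set \<Rightarrow> bool"
  where "stable_set M V \<longleftrightarrow> V \<noteq> {} \<and>
           (\<forall>A x. partition_of M A \<longrightarrow> (\<forall>k. x k \<in> V) \<longrightarrow> glue A x \<in> V)"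

definition rst :: "'w measure \<Rightarrow> ('w \<Rightarrow> 'b) \<Rightarrow> 'w set \<Rightarrow> ('w \<Rightarrow> 'b option) set"
  where "rst M x A = {g. AE \<omega> in M. g \<omega> = (if \<omega> \<in> A then Some (x \<omega>) else None)}"

definition restr :: "'w measure \<Rightarrow> ('w \<Rightarrow> 'b) set \<Rightarrow> 'w set \<Rightarrow> ('w, 'b) condset"
  where "restr M V A = (\<lambda>x. rst M x A) ` V"

definition cond_subsets :: "'w measure \<Rightarrow> ('w \<Rightarrow> 'b) set \<Rightarrow> ('w, 'b) condset set"
  where "cond_subsets M X = {restr M V A | V A. V \<subseteq> X \<and> stable_set M V \<and> A \<in> sets M}"

text \<open>
  A presentation \<open>P = V|A\<close> of a conditional subset \<open>P\<close> of \<open>X\<close>, picked by choice. The event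
  \<open>cdom M X P = A\<close> is unique up to null sets, and \<open>V|A\<close> determines \<open>V|B\<close> whenever \<open>B \<subseteq> A\<close>;
  the notions below do not depend on the presentation.
\<close>

definition presentation :: "'w measure \<Rightarrow> ('w \<Rightarrow> 'b) set \<Rightarrow> ('w, 'b) condset \<Rightarrow>
    ('w \<Rightarrow> 'b) set \<times> 'w set"
  where "presentation M X P =
           (SOME (V, A). V \<subseteq> X \<and> stable_set M V \<and> A \<in> sets M \<and> P = restr M V A)"

definition cset :: "'w measure \<Rightarrow> ('w \<Rightarrow> 'b) set \<Rightarrow> ('w, 'b) condset \<Rightarrow> ('w \<Rightarrow> 'b) set"
  where "cset M X P = fst (presentation M X P)"

definition cdom :: "'w measure \<Rightarrow> ('w \<Rightarrow> 'b) set \<Rightarrow> ('w, 'b) condset \<Rightarrow> 'w set"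
  where "cdom M X P = snd (presentation M X P)"

definition cglue :: "'w measure \<Rightarrow> ('w \<Rightarrow> 'b) set \<Rightarrow> (nat \<Rightarrow> 'w set) \<Rightarrow>
    (nat \<Rightarrow> ('w, 'b) condset) \<Rightarrow> ('w, 'b) condset"
  where "cglue M X A P =
           restr M {glue A x | x. \<forall>k. x k \<in> cset M X (P k)} (\<Union>k. A k \<inter> cdom M X (P k))"

definition stable_collection ::
    "'w measure \<Rightarrow> ('w \<Rightarrow> 'b) set \<Rightarrow> ('w, 'b) condset set \<Rightarrow> bool"
  where "stable_collection M X \<X> \<longleftrightarrow> \<X> \<subseteq> cond_subsets M X \<and> \<X> \<noteq> {} \<and>
           (\<forall>A P. partition_of M A \<longrightarrow> (\<forall>k. P k \<in> \<X>) \<longrightarrow> cglue M X A P \<in> \<X>)"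


section \<open>The Boolean algebra of conditional subsets\<close>

definition cle :: "'w measure \<Rightarrow> ('w \<Rightarrow> 'b) set \<Rightarrow> ('w, 'b) condset \<Rightarrow> ('w, 'b) condset \<Rightarrow> bool"
  where "cle M X P Q \<longleftrightarrow> ae_subset M (cdom M X P) (cdom M X Q) \<and>
           P \<subseteq> restr M (cset M X Q) (cdom M X P)"

definition cbot :: "'w measure \<Rightarrow> ('w \<Rightarrow> 'b) set \<Rightarrow> ('w, 'b) condset"
  where "cbot M X = restr M X {}"

definition ctop :: "'w measure \<Rightarrow> ('w \<Rightarrow> 'b) set \<Rightarrow> ('w, 'b) condset"
  where "ctop M X = restr M X (space M)"

definition cSup ::
    "'w measure \<Rightarrow> ('w \<Rightarrow> 'b) set \<Rightarrow> ('w, 'b) condset set \<Rightarrow> ('w, 'b) condset"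
  where "cSup M X \<C> = (THE S. S \<in> cond_subsets M X \<and> (\<forall>P\<in>\<C>. cle M X P S) \<and>
           (\<forall>T\<in>cond_subsets M X. (\<forall>P\<in>\<C>. cle M X P T) \<longrightarrow> cle M X S T))"

definition cInf ::
    "'w measure \<Rightarrow> ('w \<Rightarrow> 'b) set \<Rightarrow> ('w, 'b) condset set \<Rightarrow> ('w, 'b) condset"
  where "cInf M X \<C> = (THE S. S \<in> cond_subsets M X \<and> (\<forall>P\<in>\<C>. cle M X S P) \<and>
           (\<forall>T\<in>cond_subsets M X. (\<forall>P\<in>\<C>. cle M X T P) \<longrightarrow> cle M X T S))"

definition ccompl ::
    "'w measure \<Rightarrow> ('w \<Rightarrow> 'b) set \<Rightarrow> ('w, 'b) condset \<Rightarrow> ('w, 'b) condset"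
  where "ccompl M X P = (THE Q. Q \<in> cond_subsets M X \<and>
           cInf M X {P, Q} = cbot M X \<and> cSup M X {P, Q} = ctop M X)"

definition cdisjoint ::
    "'w measure \<Rightarrow> ('w \<Rightarrow> 'b) set \<Rightarrow> ('w, 'b) condset \<Rightarrow> ('w, 'b) condset \<Rightarrow> bool"
  where "cdisjoint M X P Q \<longleftrightarrow> cInf M X {P, Q} = cbot M X"


section \<open>Stable measures and stably measurable functions\<close>

definition stable_sigma_algebra ::
    "'w measure \<Rightarrow> ('w \<Rightarrow> 'b) set \<Rightarrow> ('w, 'b) condset set \<Rightarrow> bool"
  where "stable_sigma_algebra M X \<X> \<longleftrightarrow> stable_collection M X \<X> \<and> ctop M X \<in> \<X> \<and>
           (\<forall>P\<in>\<X>. ccompl M X P \<in> \<X>) \<and>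
           (\<forall>P::nat \<Rightarrow> _. (\<forall>k. P k \<in> \<X>) \<longrightarrow> cSup M X (range P) \<in> \<X>)"

definition generated_stable_sigma ::
    "'w measure \<Rightarrow> ('w \<Rightarrow> 'b) set \<Rightarrow> ('w, 'b) condset set \<Rightarrow> ('w, 'b) condset set"
  where "generated_stable_sigma M X \<G> = \<Inter>{\<X>. stable_sigma_algebra M X \<X> \<and> \<G> \<subseteq> \<X>}"

definition stable_ball ::
    "'w measure \<Rightarrow> ('w \<Rightarrow> 'b::euclidean_space) \<Rightarrow> ('w \<Rightarrow> real) \<Rightarrow> ('w \<Rightarrow> 'b) set"
  where "stable_ball M x r = {y \<in> L0 M. AE \<omega> in M. norm (x \<omega> - y \<omega>) < r \<omega>}"

definition stable_borel :: "'w measure \<Rightarrow> ('w, 'b::euclidean_space) condset set"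
  where "stable_borel M = generated_stable_sigma M (L0 M)
           {restr M (stable_ball M x r) (space M) | x r. x \<in> L0 M \<and> r \<in> L0_pp M}"

text \<open>
  Values of a stable measure are \<open>ennreal\<close>-valued random variables. In (M1), \<open>\<mu> P\<close> vanishes
  almost surely off the event \<open>A\<close> of \<open>P = V|A\<close>.
\<close>

definition stable_measure :: "'w measure \<Rightarrow> ('w \<Rightarrow> 'b) set \<Rightarrow> ('w, 'b) condset set \<Rightarrow>
    (('w, 'b) condset \<Rightarrow> 'w \<Rightarrow> ennreal) \<Rightarrow> bool"
  where "stable_measure M X \<X> \<mu> \<longleftrightarrow>
           (\<forall>P\<in>\<X>. \<mu> P \<in> borel_measurable M) \<and>
           (\<forall>A P. partition_of M A \<longrightarrow> (\<forall>k. P k \<in> \<X>) \<longrightarrow>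
              (AE \<omega> in M. \<mu> (cglue M X A P) \<omega> = glue A (\<lambda>k. \<mu> (P k)) \<omega>)) \<and>
           (\<forall>P\<in>\<X>. AE \<omega> in M. \<mu> P \<omega> = (if \<omega> \<in> cdom M X P then \<mu> P \<omega> else 0)) \<and>
           (\<forall>P::nat \<Rightarrow> _. (\<forall>k. P k \<in> \<X>) \<longrightarrow> (\<forall>i j. i \<noteq> j \<longrightarrow> cdisjoint M X (P i) (P j)) \<longrightarrow>
              (AE \<omega> in M. \<mu> (cSup M X (range P)) \<omega> = (\<Sum>k. \<mu> (P k) \<omega>)))"

text \<open>
  The second conjunct says that \<open>f\<close> is well defined on almost-everywhere classes.
\<close>

definition stable_fun :: "'w measure \<Rightarrow> ('w \<Rightarrow> 'b) set \<Rightarrow> ('w \<Rightarrow> 'c) set \<Rightarrow>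
    (('w \<Rightarrow> 'b) \<Rightarrow> ('w \<Rightarrow> 'c)) \<Rightarrow> bool"
  where "stable_fun M X Y f \<longleftrightarrow> f \<in> X \<rightarrow> Y \<and>
           (\<forall>x\<in>X. \<forall>y\<in>X. (AE \<omega> in M. x \<omega> = y \<omega>) \<longrightarrow> (AE \<omega> in M. f x \<omega> = f y \<omega>)) \<and>
           (\<forall>A x. partition_of M A \<longrightarrow> (\<forall>k. x k \<in> X) \<longrightarrow>
              (AE \<omega> in M. f (glue A x) \<omega> = glue A (\<lambda>k. f (x k)) \<omega>))"

definition cpreimage :: "'w measure \<Rightarrow> ('w \<Rightarrow> 'b) set \<Rightarrow> ('w \<Rightarrow> 'c) set \<Rightarrow>
    (('w \<Rightarrow> 'b) \<Rightarrow> ('w \<Rightarrow> 'c)) \<Rightarrow> ('w, 'c) condset \<Rightarrow> ('w, 'b) condset"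
  where "cpreimage M X Y f Q =
           (let W = cset M Y Q;
                A = cdom M Y Q;
                C = ess_Sup_sets M {A' \<in> sets M. ae_subset M A' A \<and>
                      (\<exists>x\<in>X. rst M (f x) A' \<in> restr M W A')}
            in restr M {x \<in> X. rst M (f x) C \<in> restr M W C} C)"

definition stably_measurable :: "'w measure \<Rightarrow> ('w \<Rightarrow> 'b) set \<Rightarrow> ('w, 'b) condset set \<Rightarrow>
    ('w \<Rightarrow> 'c) set \<Rightarrow> ('w, 'c) condset set \<Rightarrow> (('w \<Rightarrow> 'b) \<Rightarrow> ('w \<Rightarrow> 'c)) \<Rightarrow> bool"
  where "stably_measurable M X \<X> Y \<Y> f \<longleftrightarrow>
           stable_fun M X Y f \<and> (\<forall>Q\<in>\<Y>. cpreimage M X Y f Q \<in> \<X>)"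


section \<open>The stable Lebesgue integral\<close>

definition cindicator ::
    "'w measure \<Rightarrow> ('w \<Rightarrow> 'b) set \<Rightarrow> ('w, 'b) condset \<Rightarrow> ('w \<Rightarrow> 'b) \<Rightarrow> 'w \<Rightarrow> real"
  where "cindicator M X P x = indicator (ess_Sup_sets M
           {A' \<in> sets M. ae_subset M A' (cdom M X P) \<and> rst M x A' \<in> restr M (cset M X P) A'})"

text \<open>A stable elementary function is given by the data \<open>n\<close>, \<open>r\<^sub>k\<close>, \<open>P\<^sub>k\<close> for \<open>k \<le> n\<close>.\<close>

definition elementary_data :: "'w measure \<Rightarrow> ('w \<Rightarrow> 'b) set \<Rightarrow> ('w, 'b) condset set \<Rightarrow>
    nat \<Rightarrow> (nat \<Rightarrow> 'w \<Rightarrow> real) \<Rightarrow> (nat \<Rightarrow> ('w, 'b) condset) \<Rightarrow> bool"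
  where "elementary_data M X \<X> n r P \<longleftrightarrow> (\<forall>k\<le>n. r k \<in> L0_plus M \<and> P k \<in> \<X>) \<and>
           (\<forall>i\<le>n. \<forall>j\<le>n. i \<noteq> j \<longrightarrow> cdisjoint M X (P i) (P j)) \<and> cSup M X (P ` {..n}) = ctop M X"

definition elementary_fun :: "'w measure \<Rightarrow> ('w \<Rightarrow> 'b) set \<Rightarrow>
    nat \<Rightarrow> (nat \<Rightarrow> 'w \<Rightarrow> real) \<Rightarrow> (nat \<Rightarrow> ('w, 'b) condset) \<Rightarrow> ('w \<Rightarrow> 'b) \<Rightarrow> 'w \<Rightarrow> real"
  where "elementary_fun M X n r P x \<omega> = (\<Sum>k\<le>n. r k \<omega> * cindicator M X (P k) x \<omega>)"

definition elementary_integral :: "(('w, 'b) condset \<Rightarrow> 'w \<Rightarrow> ennreal) \<Rightarrow>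
    nat \<Rightarrow> (nat \<Rightarrow> 'w \<Rightarrow> real) \<Rightarrow> (nat \<Rightarrow> ('w, 'b) condset) \<Rightarrow> 'w \<Rightarrow> ennreal"
  where "elementary_integral \<mu> n r P \<omega> = (\<Sum>k\<le>n. ennreal (r k \<omega>) * \<mu> (P k) \<omega>)"

text \<open>
  The integral of a stably measurable \<open>f \<ge> 0\<close> is a random variable that is almost surely the
  supremum of the integrals along some increasing sequence of elementary functions with pointwise
  supremum \<open>f\<close>; for such \<open>f\<close> it exists and does not depend on the sequence.
\<close>

definition stable_nn_integral :: "'w measure \<Rightarrow> ('w \<Rightarrow> 'b) set \<Rightarrow> ('w, 'b) condset set \<Rightarrow>
    (('w, 'b) condset \<Rightarrow> 'w \<Rightarrow> ennreal) \<Rightarrow> (('w \<Rightarrow> 'b) \<Rightarrow> 'w \<Rightarrow> real) \<Rightarrow> 'w \<Rightarrow> ennreal"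
  where "stable_nn_integral M X \<X> \<mu> f = (SOME I. I \<in> borel_measurable M \<and> (\<exists>n r P.
           (\<forall>m. elementary_data M X \<X> (n m) (r m) (P m)) \<and>
           (\<forall>m. \<forall>x\<in>X. AE \<omega> in M. elementary_fun M X (n m) (r m) (P m) x \<omega>
                 \<le> elementary_fun M X (n (Suc m)) (r (Suc m)) (P (Suc m)) x \<omega>) \<and>
           (\<forall>x\<in>X. AE \<omega> in M.
              (SUP m. ennreal (elementary_fun M X (n m) (r m) (P m) x \<omega>)) = ennreal (f x \<omega>)) \<and>
           (AE \<omega> in M. I \<omega> = (SUP m. elementary_integral \<mu> (n m) (r m) (P m) \<omega>))))"

definition pos_part :: "(('w \<Rightarrow> 'b) \<Rightarrow> 'w \<Rightarrow> real) \<Rightarrow> ('w \<Rightarrow> 'b) \<Rightarrow> 'w \<Rightarrow> real"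
  where "pos_part f = (\<lambda>x \<omega>. max (f x \<omega>) 0)"

definition neg_part :: "(('w \<Rightarrow> 'b) \<Rightarrow> 'w \<Rightarrow> real) \<Rightarrow> ('w \<Rightarrow> 'b) \<Rightarrow> 'w \<Rightarrow> real"
  where "neg_part f = (\<lambda>x \<omega>. max (- f x \<omega>) 0)"

definition stably_integrable :: "'w measure \<Rightarrow> ('w \<Rightarrow> 'b) set \<Rightarrow> ('w, 'b) condset set \<Rightarrow>
    (('w, 'b) condset \<Rightarrow> 'w \<Rightarrow> ennreal) \<Rightarrow> (('w \<Rightarrow> 'b) \<Rightarrow> 'w \<Rightarrow> real) \<Rightarrow> bool"
  where "stably_integrable M X \<X> \<mu> f \<longleftrightarrow>
           stably_measurable M X \<X> (L0 M) (stable_borel M) f \<and>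
           (AE \<omega> in M. stable_nn_integral M X \<X> \<mu> (pos_part f) \<omega> < \<infinity>) \<and>
           (AE \<omega> in M. stable_nn_integral M X \<X> \<mu> (neg_part f) \<omega> < \<infinity>)"

definition stable_integral :: "'w measure \<Rightarrow> ('w \<Rightarrow> 'b) set \<Rightarrow> ('w, 'b) condset set \<Rightarrow>
    (('w, 'b) condset \<Rightarrow> 'w \<Rightarrow> ennreal) \<Rightarrow> (('w \<Rightarrow> 'b) \<Rightarrow> 'w \<Rightarrow> real) \<Rightarrow> 'w \<Rightarrow> real"
  where "stable_integral M X \<X> \<mu> f \<omega> =
           enn2real (stable_nn_integral M X \<X> \<mu> (pos_part f) \<omega>) -
           enn2real (stable_nn_integral M X \<X> \<mu> (neg_part f) \<omega>)"


section \<open>Stably compact sets and the space \<open>\<C>\<^sub>c\<close>\<close>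

definition L0_bounded :: "'w measure \<Rightarrow> ('w, 'b::euclidean_space) condset \<Rightarrow> bool"
  where "L0_bounded M P \<longleftrightarrow> (\<exists>m\<in>L0_plus M. \<forall>x\<in>cset M (L0 M) P.
           AE \<omega> in M. \<omega> \<in> cdom M (L0 M) P \<longrightarrow> norm (x \<omega>) \<le> m \<omega>)"

definition cconverges ::
    "'w measure \<Rightarrow> 'w set \<Rightarrow> (nat \<Rightarrow> 'w \<Rightarrow> 'b::topological_space) \<Rightarrow> ('w \<Rightarrow> 'b) \<Rightarrow> bool"
  where "cconverges M A xs x \<longleftrightarrow> (AE \<omega> in M. \<omega> \<in> A \<longrightarrow> (\<lambda>k. xs k \<omega>) \<longlonglongrightarrow> x \<omega>)"

definition sequentially_closed :: "'w measure \<Rightarrow> ('w, 'b::euclidean_space) condset \<Rightarrow> bool"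
  where "sequentially_closed M P \<longleftrightarrow> (\<forall>xs. \<forall>x\<in>L0 M. (\<forall>k. xs k \<in> cset M (L0 M) P) \<longrightarrow>
           cconverges M (cdom M (L0 M) P) xs x \<longrightarrow> rst M x (cdom M (L0 M) P) \<in> P)"

definition sequential_closure ::
    "'w measure \<Rightarrow> ('w, 'b::euclidean_space) condset \<Rightarrow> ('w, 'b) condset"
  where "sequential_closure M P =
           restr M {x \<in> L0 M. \<exists>xs. (\<forall>k. xs k \<in> cset M (L0 M) P) \<and>
                      cconverges M (cdom M (L0 M) P) xs x} (cdom M (L0 M) P)"

definition stably_compact :: "'w measure \<Rightarrow> ('w, 'b::euclidean_space) condset \<Rightarrow> bool"
  where "stably_compact M P \<longleftrightarrow>
           P \<in> cond_subsets M (L0 M) \<and> L0_bounded M P \<and> sequentially_closed M P"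

definition sequentially_continuous ::
    "'w measure \<Rightarrow> (('w \<Rightarrow> 'b::euclidean_space) \<Rightarrow> ('w \<Rightarrow> real)) \<Rightarrow> bool"
  where "sequentially_continuous M f \<longleftrightarrow> (\<forall>xs. \<forall>x\<in>L0 M. (\<forall>k. xs k \<in> L0 M) \<longrightarrow>
           cconverges M (space M) xs x \<longrightarrow> cconverges M (space M) (\<lambda>k. f (xs k)) (f x))"

definition cond_support ::
    "'w measure \<Rightarrow> (('w \<Rightarrow> 'b::euclidean_space) \<Rightarrow> ('w \<Rightarrow> real)) \<Rightarrow> ('w, 'b) condset"
  where "cond_support M f = sequential_closure M (cpreimage M (L0 M) (L0 M) f
           (ccompl M (L0 M) (restr M {\<lambda>_. 0} (space M))))"

definition C_c :: "'w measure \<Rightarrow> (('w \<Rightarrow> 'b::euclidean_space) \<Rightarrow> ('w \<Rightarrow> real)) set"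
  where "C_c M = {f. stable_fun M (L0 M) (L0 M) f \<and> sequentially_continuous M f \<and>
           stably_compact M (cond_support M f)}"

definition L0_interval ::
    "'w measure \<Rightarrow> ('w \<Rightarrow> real ^ 'n) \<Rightarrow> ('w \<Rightarrow> real ^ 'n) \<Rightarrow> ('w \<Rightarrow> real ^ 'n) set"
  where "L0_interval M x y =
           {z \<in> L0 M. AE \<omega> in M. \<forall>i. x \<omega> $ i \<le> z \<omega> $ i \<and> z \<omega> $ i \<le> y \<omega> $ i}"

end

theory Submission
  imports Defs
begin

text \<open>
  A conditional subset is determined by the events on which the elements of \<open>L0 M\<close> belong to it, and
  in these terms the Boolean operations are pointwise. Every set \<open>B\<close> that is measurable in the product
  of \<open>\<Omega>\<close> and \<open>\<real>\<^sup>d\<close> thus induces the conditional set of random variables whose graph lies in \<open>B\<close>, and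
  this yields exactly the stable Borel algebra. A test function acts as \<open>x \<mapsto> F(\<omega>, x(\<omega>))\<close> for some
  jointly measurable \<open>F\<close>, so that \<open>F \<mapsto> E[L f]\<close> is a positive functional on functions on the product.
  By a conditional version of Dini's theorem it is continuous along decreasing sequences, and
  Daniell's extension turns it into a measure \<open>m\<close>. The stable measure of the conditional set induced
  by \<open>B\<close> is the density of \<open>A \<mapsto> m(B \<inter> (A \<times> \<real>\<^sup>d))\<close> with respect to \<open>M\<close>. It does not depend on \<open>B\<close>:
  by inner regularity with respect to sets with closed sections, and measurable selection from such
  sets, \<open>m\<close> vanishes on sets containing no graph over a non-null event.
\<close>

section \<open>Conditional subsets as local families of events\<close>

text \<open>For a single \<omega> there is no functional to represent: each \<open>L f\<close> is
  known only up to a null set, and the null sets of uncountably many \<open>f\<close> cannot be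
  discarded together. Integrating over \<omega> removes this difficulty, but E[L f] may be infinite.
  \<open>H\<close> therefore keeps only functions for which it is finite, and the events
  \<open>small_event k j\<close>, on which \<open>L\<close> of the cutoff of radius \<open>k\<close>
  is at most \<open>j\<close>, supply enough of them. What integration loses is recovered by
  locality: \<open>L\<close> of a test function times the indicator of \<open>A\<close> is that
  indicator times \<open>L f\<close>. So \<open>A\<close> can be varied freely, and \<open>m\<close>
  charges no cylinder over a null event, which is why densities exist.

  A second obstacle: a test function determines its representing \<open>F\<close>, and a conditional
  set its inducing \<open>B\<close>, only along graphs of random variables, that is up to the sets
  called \<open>polar\<close>. These must be \<open>m\<close>-null before integral and measure are
  well defined. The approximating sets are required to have measurable hitting events, so that the
  domain of a selection is a countable union of such events.\<close>

definition presents :: "'w measure \<Rightarrow> ('w, 'b::euclidean_space) condset \<Rightarrow> ('w \<Rightarrow> 'b) set \<Rightarrow> 'w set \<Rightarrow> bool"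
  where "presents M P V A \<longleftrightarrow> V \<subseteq> L0 M \<and> stable_set M V \<and> A \<in> sets M \<and> P = restr M V A"

text \<open>The event inside \<open>cindicator\<close>, so that the indicator of a conditional set
  is literally the indicator of \<open>cmem\<close>. As \<open>x\<close> varies, it determines
  \<open>P\<close>.\<close>

definition cmem :: "'w measure \<Rightarrow> ('w, 'b::euclidean_space) condset \<Rightarrow> ('w \<Rightarrow> 'b) \<Rightarrow> 'w set"
  where "cmem M P x = ess_Sup_sets M {A' \<in> sets M. ae_subset M A' (cdom M (L0 M) P) \<and>
           rst M x A' \<in> restr M (cset M (L0 M) P) A'}"

text \<open>Locality characterises the maps that arise as membership maps of conditional subsets:
  \<open>cmem_local\<close> gives one direction, \<open>local_events_presents\<close> the
  other.\<close>

definition local_events :: "'w measure \<Rightarrow> (('w \<Rightarrow> 'b::euclidean_space) \<Rightarrow> 'w set) \<Rightarrow> bool"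
  where "local_events M \<phi> \<longleftrightarrow> (\<forall>x\<in>L0 M. \<phi> x \<in> sets M) \<and>
           (\<forall>x\<in>L0 M. \<forall>y\<in>L0 M. AE \<omega> in M. x \<omega> = y \<omega> \<longrightarrow> (\<omega> \<in> \<phi> x \<longleftrightarrow> \<omega> \<in> \<phi> y))"

text \<open>The inverse of \<open>cmem\<close>. The choice is harmless: for local events such a
  \<open>P\<close> exists by the lemma \<open>cset_of\<close>, and \<open>cond_subsets_eqI\<close>
  makes it unique.\<close>

definition cset_of :: "'w measure \<Rightarrow> (('w \<Rightarrow> 'b::euclidean_space) \<Rightarrow> 'w set) \<Rightarrow> ('w, 'b) condset"
  where "cset_of M \<phi> = (SOME P. P \<in> cond_subsets M (L0 M) \<and>
           (\<forall>x\<in>L0 M. AE \<omega> in M. \<omega> \<in> cmem M P x \<longleftrightarrow> \<omega> \<in> \<phi> x))"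

section \<open>Restrictions to events and concatenations along partitions\<close>

lemma rst_eq_iff:
  "rst M x A = rst M y B \<longleftrightarrow> (AE \<omega> in M. (\<omega> \<in> A \<longleftrightarrow> \<omega> \<in> B) \<and> (\<omega> \<in> A \<longrightarrow> x \<omega> = y \<omega>))"
proof
  assume eq: "rst M x A = rst M y B"
  have "(\<lambda>\<omega>. if \<omega> \<in> A then Some (x \<omega>) else None) \<in> rst M x A"
    by (simp add: rst_def)
  then have "(\<lambda>\<omega>. if \<omega> \<in> A then Some (x \<omega>) else None) \<in> rst M y B"
    using eq by simp
  then have "AE \<omega> in M. (if \<omega> \<in> A then Some (x \<omega>) else None) = (if \<omega> \<in> B then Some (y \<omega>) else None)"
    by (simp add: rst_def)
  then show "AE \<omega> in M. (\<omega> \<in> A \<longleftrightarrow> \<omega> \<in> B) \<and> (\<omega> \<in> A \<longrightarrow> x \<omega> = y \<omega>)"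
    by (rule AE_mp) (auto intro!: AE_I2 split: if_splits)
next
  assume ae: "AE \<omega> in M. (\<omega> \<in> A \<longleftrightarrow> \<omega> \<in> B) \<and> (\<omega> \<in> A \<longrightarrow> x \<omega> = y \<omega>)"
  show "rst M x A = rst M y B"
  proof (intro set_eqI)
    fix g
    have "(AE \<omega> in M. g \<omega> = (if \<omega> \<in> A then Some (x \<omega>) else None)) \<longleftrightarrow>
        (AE \<omega> in M. g \<omega> = (if \<omega> \<in> B then Some (y \<omega>) else None))"
      by (rule eventually_subst) (use ae in \<open>eventually_elim, auto\<close>)
    then show "g \<in> rst M x A \<longleftrightarrow> g \<in> rst M y B" by (simp add: rst_def)
  qed
qed

lemma rst_in_restr_iff:
  "rst M x A \<in> restr M V A \<longleftrightarrow> (\<exists>v\<in>V. AE \<omega> in M. \<omega> \<in> A \<longrightarrow> x \<omega> = v \<omega>)"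
  unfolding restr_def image_iff rst_eq_iff by auto

lemma rst_in_restr_iff2:
  "rst M x A \<in> restr M V B \<longleftrightarrow> (\<exists>v\<in>V. AE \<omega> in M. (\<omega> \<in> A \<longleftrightarrow> \<omega> \<in> B) \<and> (\<omega> \<in> A \<longrightarrow> x \<omega> = v \<omega>))"
  unfolding restr_def image_iff rst_eq_iff by auto

lemma restr_subset_iff:
  "restr M V A \<subseteq> restr M W B \<longleftrightarrow>
     (\<forall>v\<in>V. \<exists>w\<in>W. AE \<omega> in M. (\<omega> \<in> A \<longleftrightarrow> \<omega> \<in> B) \<and> (\<omega> \<in> A \<longrightarrow> v \<omega> = w \<omega>))"
  unfolding restr_def image_subset_iff by (simp add: image_iff rst_eq_iff)

lemma restr_cong_dom: "(AE \<omega> in M. \<omega> \<in> A \<longleftrightarrow> \<omega> \<in> B) \<Longrightarrow> restr M V A = restr M V B"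
  unfolding restr_def by (intro image_cong refl) (simp add: rst_eq_iff)

lemma cond_subsets_iff: "P \<in> cond_subsets M (L0 M) \<longleftrightarrow> (\<exists>V A. presents M P V A)"
  unfolding cond_subsets_def presents_def by auto

lemma presents_cset:
  assumes "P \<in> cond_subsets M (L0 M)"
  shows "presents M P (cset M (L0 M) P) (cdom M (L0 M) P)"
proof -
  have "\<exists>p. (case p of (V, A) \<Rightarrow> V \<subseteq> L0 M \<and> stable_set M V \<and> A \<in> sets M \<and> P = restr M V A)"
    using assms unfolding cond_subsets_def by auto
  then have "case presentation M (L0 M) P of (V, A) \<Rightarrow>
      V \<subseteq> L0 M \<and> stable_set M V \<and> A \<in> sets M \<and> P = restr M V A"
    unfolding presentation_def by (rule someI_ex)
  then show ?thesis
    unfolding presents_def cset_def cdom_def by (simp add: case_prod_beta)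
qed

text \<open>The rest of the space is added to cell 0, so gluing along this partition falls back on
  the member with index 0 outside the union.\<close>

lemma partition_of_disjointed:
  fixes A :: "nat \<Rightarrow> 'w set"
  assumes "range A \<subseteq> sets M"
  shows "partition_of M (\<lambda>k. if k = 0 then A 0 \<union> (space M - (\<Union>i. A i)) else disjointed A k)"
    (is "partition_of M ?B")
proof -
  have d: "disjoint_family (disjointed A)" by (rule disjoint_family_disjointed)
  have d0: "disjointed A 0 = A 0" by (simp add: disjointed_def)
  have dU: "(\<Union>i. disjointed A i) = (\<Union>i. A i)" by (rule UN_disjointed_eq)
  have [measurable]: "A i \<in> sets M" for i using assms by auto
  have dm: "disjointed A i \<in> sets M" for i
    using sets.range_disjointed_sets[OF assms] by auto
  have "?B i \<inter> ?B j = {}" if ij: "i < j" for i j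
  proof -
    have "disjointed A i \<inter> disjointed A j = {}" "disjointed A j \<subseteq> A j"
      using ij disjoint_family_onD[OF d, of i j] disjointed_subset[of A j] by auto
    then show ?thesis using ij d0 by (cases "i = 0") auto
  qed
  then have "disjoint_family ?B"
    unfolding disjoint_family_on_def by (metis Int_commute linorder_neqE_nat)
  moreover have "(\<Union>k. ?B k) = space M"
  proof (intro equalityI subsetI)
    fix \<omega> assume "\<omega> \<in> (\<Union>k. ?B k)"
    moreover have "?B k \<subseteq> space M" for k
      using sets.sets_into_space[OF dm[of k]] sets.sets_into_space[of "A 0" M] by auto
    ultimately show "\<omega> \<in> space M" by blast
  next
    fix \<omega> assume w: "\<omega> \<in> space M"
    show "\<omega> \<in> (\<Union>k. ?B k)"
    proof (cases "\<omega> \<in> (\<Union>i. A i)")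
      case True
      then obtain k where "\<omega> \<in> disjointed A k" using dU by blast
      then have "\<omega> \<in> ?B k" using d0 by (cases "k = 0") auto
      then show ?thesis by blast
    next
      case False
      then have "\<omega> \<in> ?B 0" using w by auto
      then show ?thesis by blast
    qed
  qed
  ultimately show ?thesis
    unfolding partition_of_def using dm by auto
qed

lemma glue_eq:
  fixes A :: "nat \<Rightarrow> 'w set"
  assumes "partition_of M A" "\<omega> \<in> A k"
  shows "glue A x \<omega> = x k \<omega>"
proof -
  have "(LEAST k. \<omega> \<in> A k) = k"
  proof (rule Least_equality)
    show "k \<le> y" if "\<omega> \<in> A y" for y
    proof -
      have "y = k"
        using assms that unfolding partition_of_def disjoint_family_on_def by (metis IntI UNIV_I emptyE)
      then show ?thesis by simp
    qed
  qed fact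
  then show ?thesis by (simp add: glue_def)
qed

lemma partition_ofE:
  assumes "partition_of M A" "\<omega> \<in> space M"
  obtains k where "\<omega> \<in> A k"
  using assms unfolding partition_of_def by blast

text \<open>Stability speaks of partitions, whereas events arising from suprema overlap. Selecting
  along the disjointed events closes families of events with witnesses in \<open>V\<close> under
  countable unions, which is what makes essential suprema attained.\<close>

lemma stable_select:
  fixes A :: "nat \<Rightarrow> 'w set"
  assumes V: "stable_set M V" and A: "range A \<subseteq> sets M" and x: "\<And>k. x k \<in> V"
  obtains v where "v \<in> V" "\<And>\<omega>. \<omega> \<in> (\<Union>k. A k) \<Longrightarrow> \<exists>k. \<omega> \<in> A k \<and> v \<omega> = x k \<omega>"
proof -
  let ?B = "\<lambda>k::nat. if k = 0 then A 0 \<union> (space M - (\<Union>i. A i)) else disjointed A k"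
  have p: "partition_of M ?B" using A by (rule partition_of_disjointed)
  have d0: "disjointed A 0 = A 0" by (simp add: disjointed_def)
  show thesis
  proof
    show "glue ?B x \<in> V" using V p x unfolding stable_set_def by blast
    fix \<omega> assume w: "\<omega> \<in> (\<Union>k. A k)"
    then have "\<omega> \<in> space M" using A sets.sets_into_space by blast
    then obtain k where k: "\<omega> \<in> ?B k" by (rule partition_ofE[OF p])
    then have "\<omega> \<in> A k" using w disjointed_subset[of A k] by (auto split: if_splits)
    moreover have "glue ?B x \<omega> = x k \<omega>" using glue_eq[OF p k] .
    ultimately show "\<exists>k. \<omega> \<in> A k \<and> glue ?B x \<omega> = x k \<omega>" by blast
  qed
qed

lemma glue_measurable:
  assumes "partition_of M A" "\<And>k. x k \<in> measurable M N"
  shows "glue A x \<in> measurable M N"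
proof -
  have [measurable]: "A k \<in> sets M" for k using assms(1) unfolding partition_of_def by auto
  have "Measurable.pred M (\<lambda>\<omega>. \<omega> \<in> A k)" for k by measurable
  then have "(\<lambda>\<omega>. LEAST k. \<omega> \<in> A k) \<in> measurable M (count_space UNIV)"
    by (rule measurable_Least)
  with assms(2) show ?thesis unfolding glue_def by (rule measurable_compose_countable)
qed

lemma stable_set_L0: "stable_set M (L0 M :: ('w \<Rightarrow> 'b::euclidean_space) set)"
proof -
  have "(\<lambda>_. 0) \<in> (L0 M :: ('w \<Rightarrow> 'b) set)" by simp
  then show ?thesis unfolding stable_set_def by (blast intro: glue_measurable)
qed

lemma stable_select2:
  assumes V: "stable_set M V" and A: "A \<in> sets M" and x: "x \<in> V" "y \<in> V"
  obtains v where "v \<in> V" "\<And>\<omega>. \<omega> \<in> space M \<Longrightarrow> v \<omega> = (if \<omega> \<in> A then x \<omega> else y \<omega>)"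
proof -
  let ?B = "\<lambda>k::nat. if k = 0 then A else if k = 1 then space M - A else {}"
  have "A \<subseteq> space M" using A by (rule sets.sets_into_space)
  then have p: "partition_of M ?B"
    using A unfolding partition_of_def disjoint_family_on_def
    by (auto split: if_splits)
  let ?x = "\<lambda>k::nat. if k = 0 then x else y"
  show thesis
  proof
    show "glue ?B ?x \<in> V" using V p x unfolding stable_set_def by auto
    fix \<omega> assume "\<omega> \<in> space M"
    then show "glue ?B ?x \<omega> = (if \<omega> \<in> A then x \<omega> else y \<omega>)"
      using glue_eq[OF p, of \<omega> 0 ?x] glue_eq[OF p, of \<omega> 1 ?x] by auto
  qed
qed

section \<open>Essential suprema and membership events\<close>

context prob_space
begin

text \<open>Exhaustion: a union of events whose probabilities approach the supremum attains it, and
  an event exceeding this union on a non-null set would raise the supremum.\<close>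

lemma ess_max_exists:
  assumes sub: "\<A> \<subseteq> sets M" and ne: "\<A> \<noteq> {}"
    and un: "\<And>A :: nat \<Rightarrow> _. range A \<subseteq> \<A> \<Longrightarrow> (\<Union>k. A k) \<in> \<A>"
  obtains S where "S \<in> \<A>" "\<And>A. A \<in> \<A> \<Longrightarrow> ae_subset M A S"
proof -
  let ?s = "SUP A\<in>\<A>. prob A"
  have bdd: "bdd_above (prob ` \<A>)" by (auto intro!: bdd_aboveI[of _ 1])
  have "\<exists>A\<in>\<A>. ?s - 1 / Suc n < prob A" for n
    using less_cSUP_iff[OF ne bdd, of "?s - 1 / Suc n"] by simp
  then obtain A where A: "\<And>n. A n \<in> \<A>" "\<And>n. ?s - 1 / Suc n < prob (A n)" by metis
  define S where "S = (\<Union>n. A n)"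
  have S: "S \<in> \<A>" unfolding S_def using A by (intro un) auto
  then have [measurable]: "S \<in> sets M" using sub by auto
  have max: "?s \<le> prob S"
  proof (rule field_le_epsilon)
    fix e :: real assume "0 < e"
    then obtain n where n: "1 / Suc n < e" by (metis nat_approx_posE)
    have "prob (A n) \<le> prob S" unfolding S_def
      using A(1) sub by (intro finite_measure_mono) auto
    with A(2)[of n] n show "?s \<le> prob S + e" by linarith
  qed
  show thesis
  proof
    fix B assume B: "B \<in> \<A>"
    then have [measurable]: "B \<in> sets M" using sub by auto
    \<comment> \<open>A binary union written as a countable one, because \<open>un\<close> is the
      closure property at hand.\<close>
    have "(\<Union>n::nat. (if n = 0 then S else B)) \<in> \<A>" using S B by (intro un) auto
    moreover have "(\<Union>n::nat. (if n = 0 then S else B)) = S \<union> B" by (auto split: if_splits)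
    ultimately have "prob (S \<union> B) \<le> ?s" by (intro cSUP_upper bdd) auto
    moreover have "prob (S \<union> B) = prob S + prob (B - S)"
      using finite_measure_Union[of S "B - S"] by simp
    ultimately have "prob (B - S) = 0" using max measure_nonneg[of M "B - S"] by linarith
    then have "B - S \<in> null_sets M" by (simp add: emeasure_eq_measure null_setsI)
    then show "ae_subset M B S" unfolding ae_subset_def
      by (auto dest!: AE_not_in elim!: eventually_mono)
  qed fact
qed

text \<open>An attained maximum is an essential supremum, and essential suprema are unique up to
  null sets; so the version picked by choice can be exchanged for any maximal member.\<close>

lemma ess_Sup_sets_eq:
  assumes S: "S \<in> \<A>" "\<A> \<subseteq> sets M" "\<And>A. A \<in> \<A> \<Longrightarrow> ae_subset M A S"
  shows "ess_Sup_sets M \<A> \<in> sets M" "AE \<omega> in M. \<omega> \<in> ess_Sup_sets M \<A> \<longleftrightarrow> \<omega> \<in> S"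
proof -
  let ?Q = "\<lambda>S. S \<in> sets M \<and> (\<forall>A\<in>\<A>. ae_subset M A S) \<and>
           (\<forall>T\<in>sets M. (\<forall>A\<in>\<A>. ae_subset M A T) \<longrightarrow> ae_subset M S T)"
  have "?Q S" using S by auto
  then have Q: "?Q (ess_Sup_sets M \<A>)" unfolding ess_Sup_sets_def by (rule someI[of ?Q])
  then show "ess_Sup_sets M \<A> \<in> sets M" by blast
  have "ae_subset M (ess_Sup_sets M \<A>) S" "ae_subset M S (ess_Sup_sets M \<A>)"
    using Q S by blast+
  then show "AE \<omega> in M. \<omega> \<in> ess_Sup_sets M \<A> \<longleftrightarrow> \<omega> \<in> S"
    unfolding ae_subset_def by eventually_elim auto
qed

lemma sets_eq_L0:
  assumes "x \<in> (L0 M :: ('a \<Rightarrow> 'b::euclidean_space) set)" "y \<in> L0 M"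
  shows "{\<omega>\<in>space M. x \<omega> = y \<omega>} \<in> sets M"
  using assms by measurable

text \<open>Witnesses on countably many events can be selected into one because \<open>V\<close> is
  stable. Hence the supremum is a maximum, and a single \<open>v\<close> agrees with
  \<open>x\<close> on all of it.\<close>

lemma cmem_aux:
  fixes x :: "'a \<Rightarrow> 'b::euclidean_space"
  assumes V: "V \<subseteq> L0 M" "stable_set M V" and A: "A \<in> sets M" and x: "x \<in> L0 M"
  defines "\<A> \<equiv> {A' \<in> sets M. ae_subset M A' A \<and> rst M x A' \<in> restr M V A'}"
  shows "ess_Sup_sets M \<A> \<in> sets M"
    and "\<exists>v\<in>V. AE \<omega> in M. \<omega> \<in> ess_Sup_sets M \<A> \<longrightarrow> \<omega> \<in> A \<and> x \<omega> = v \<omega>"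
    and "\<And>v. v \<in> V \<Longrightarrow> AE \<omega> in M. \<omega> \<in> A \<and> x \<omega> = v \<omega> \<longrightarrow> \<omega> \<in> ess_Sup_sets M \<A>"
proof -
  have AA: "A' \<in> \<A> \<longleftrightarrow> A' \<in> sets M \<and> (\<exists>v\<in>V. AE \<omega> in M. \<omega> \<in> A' \<longrightarrow> \<omega> \<in> A \<and> x \<omega> = v \<omega>)" for A'
    unfolding \<A>_def rst_in_restr_iff ae_subset_def mem_Collect_eq
  proof (intro conj_cong refl iffI)
    assume "(AE \<omega> in M. \<omega> \<in> A' \<longrightarrow> \<omega> \<in> A) \<and> (\<exists>v\<in>V. AE \<omega> in M. \<omega> \<in> A' \<longrightarrow> x \<omega> = v \<omega>)"
    then obtain v where "v \<in> V" "AE \<omega> in M. \<omega> \<in> A' \<longrightarrow> \<omega> \<in> A" "AE \<omega> in M. \<omega> \<in> A' \<longrightarrow> x \<omega> = v \<omega>"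
      by blast
    moreover from this(2,3) have "AE \<omega> in M. \<omega> \<in> A' \<longrightarrow> \<omega> \<in> A \<and> x \<omega> = v \<omega>"
      by eventually_elim auto
    ultimately show "\<exists>v\<in>V. AE \<omega> in M. \<omega> \<in> A' \<longrightarrow> \<omega> \<in> A \<and> x \<omega> = v \<omega>" by blast
  next
    assume "\<exists>v\<in>V. AE \<omega> in M. \<omega> \<in> A' \<longrightarrow> \<omega> \<in> A \<and> x \<omega> = v \<omega>"
    then obtain v where v: "v \<in> V" "AE \<omega> in M. \<omega> \<in> A' \<longrightarrow> \<omega> \<in> A \<and> x \<omega> = v \<omega>" by blast
    have "AE \<omega> in M. \<omega> \<in> A' \<longrightarrow> \<omega> \<in> A" "AE \<omega> in M. \<omega> \<in> A' \<longrightarrow> x \<omega> = v \<omega>"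
      using v(2) by (eventually_elim; simp)+
    then show "(AE \<omega> in M. \<omega> \<in> A' \<longrightarrow> \<omega> \<in> A) \<and> (\<exists>v\<in>V. AE \<omega> in M. \<omega> \<in> A' \<longrightarrow> x \<omega> = v \<omega>)"
      using v(1) by blast
  qed
  have "{} \<in> \<A>" using V(2) unfolding AA stable_set_def by auto
  moreover have "\<A> \<subseteq> sets M" unfolding \<A>_def by auto
  moreover have "(\<Union>k. B k) \<in> \<A>" if B: "range B \<subseteq> \<A>" for B :: "nat \<Rightarrow> _"
  proof -
    have "\<exists>v\<in>V. AE \<omega> in M. \<omega> \<in> B k \<longrightarrow> \<omega> \<in> A \<and> x \<omega> = v \<omega>" for k using B AA by blast
    then obtain v where v: "\<And>k. v k \<in> V" "\<And>k. AE \<omega> in M. \<omega> \<in> B k \<longrightarrow> \<omega> \<in> A \<and> x \<omega> = v k \<omega>"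
      by metis
    have rB: "range B \<subseteq> sets M" using B AA by blast
    obtain u where u: "u \<in> V" "\<And>\<omega>. \<omega> \<in> (\<Union>k. B k) \<Longrightarrow> \<exists>k. \<omega> \<in> B k \<and> u \<omega> = v k \<omega>"
      using stable_select[of M V B v, OF V(2) rB v(1)] by blast
    have "AE \<omega> in M. \<forall>k. \<omega> \<in> B k \<longrightarrow> \<omega> \<in> A \<and> x \<omega> = v k \<omega>"
      using v(2) by (simp add: AE_all_countable)
    then have "AE \<omega> in M. \<omega> \<in> (\<Union>k. B k) \<longrightarrow> \<omega> \<in> A \<and> x \<omega> = u \<omega>"
      by eventually_elim (metis u(2))
    with u(1) rB show ?thesis unfolding AA by blast
  qed
  ultimately obtain S where S: "S \<in> \<A>" "\<And>A. A \<in> \<A> \<Longrightarrow> ae_subset M A S"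
    using ess_max_exists[of \<A>] by blast
  note E = ess_Sup_sets_eq[OF S(1) \<open>\<A> \<subseteq> sets M\<close> S(2)]
  show "ess_Sup_sets M \<A> \<in> sets M" by (rule E(1)) auto
  have E2: "AE \<omega> in M. \<omega> \<in> ess_Sup_sets M \<A> \<longleftrightarrow> \<omega> \<in> S" by (rule E(2)) auto
  obtain v where v: "v \<in> V" "AE \<omega> in M. \<omega> \<in> S \<longrightarrow> \<omega> \<in> A \<and> x \<omega> = v \<omega>"
    using S(1) unfolding AA by blast
  show "\<exists>v\<in>V. AE \<omega> in M. \<omega> \<in> ess_Sup_sets M \<A> \<longrightarrow> \<omega> \<in> A \<and> x \<omega> = v \<omega>"
    by (rule bexI[OF _ v(1)]) (use v(2) E2 in eventually_elim, auto)
  fix v assume v: "v \<in> V"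
  then have [measurable]: "v \<in> L0 M" using V by auto
  note x[measurable] A[measurable]
  have "A \<inter> {\<omega>\<in>space M. x \<omega> = v \<omega>} \<in> \<A>" unfolding AA using v by auto
  from S(2)[OF this] E2 AE_space show "AE \<omega> in M. \<omega> \<in> A \<and> x \<omega> = v \<omega> \<longrightarrow> \<omega> \<in> ess_Sup_sets M \<A>"
    unfolding ae_subset_def by eventually_elim auto
qed

lemma cmem_char0:
  assumes "P \<in> cond_subsets M (L0 M)" "x \<in> L0 M"
  shows "cmem M P x \<in> sets M"
    and "\<exists>v\<in>cset M (L0 M) P. AE \<omega> in M. \<omega> \<in> cmem M P x \<longrightarrow> \<omega> \<in> cdom M (L0 M) P \<and> x \<omega> = v \<omega>"
    and "\<And>v. v \<in> cset M (L0 M) P \<Longrightarrow>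
           AE \<omega> in M. \<omega> \<in> cdom M (L0 M) P \<and> x \<omega> = v \<omega> \<longrightarrow> \<omega> \<in> cmem M P x"
  using presents_cset[OF assms(1)] assms(2) unfolding presents_def cmem_def
  by (auto intro!: cmem_aux(1,2)) (rule cmem_aux(3); auto)

lemma presents_cong:
  assumes "presents M P V A" "presents M P W B" "v \<in> V"
  shows "\<exists>w\<in>W. AE \<omega> in M. (\<omega> \<in> A \<longleftrightarrow> \<omega> \<in> B) \<and> (\<omega> \<in> A \<longrightarrow> v \<omega> = w \<omega>)"
proof -
  have "restr M V A \<subseteq> restr M W B" using assms unfolding presents_def by auto
  then show ?thesis using assms(3) unfolding restr_subset_iff by blast
qed

text \<open>The presentation hidden in \<open>cmem\<close> can be exchanged for any other: the
  restrictions are the same, so each witness from one presentation has a counterpart in the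
  other.\<close>

lemma cmem_char:
  fixes x :: "'a \<Rightarrow> 'b::euclidean_space"
  assumes P: "presents M P V A" and x: "x \<in> L0 M"
  shows "cmem M P x \<in> sets M"
    and "\<exists>v\<in>V. AE \<omega> in M. \<omega> \<in> cmem M P x \<longrightarrow> \<omega> \<in> A \<and> x \<omega> = v \<omega>"
    and "u \<in> V \<Longrightarrow> AE \<omega> in M. \<omega> \<in> A \<and> x \<omega> = u \<omega> \<longrightarrow> \<omega> \<in> cmem M P x"
proof -
  have CS: "P \<in> cond_subsets M (L0 M)" using P cond_subsets_iff by blast
  note c = cmem_char0[OF CS x] and Pc = presents_cset[OF CS]
  show "cmem M P x \<in> sets M" by (rule c)
  obtain v where v: "v \<in> cset M (L0 M) P"
      "AE \<omega> in M. \<omega> \<in> cmem M P x \<longrightarrow> \<omega> \<in> cdom M (L0 M) P \<and> x \<omega> = v \<omega>"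
    using c(2) by blast
  obtain w where w: "w \<in> V"
      "AE \<omega> in M. (\<omega> \<in> cdom M (L0 M) P \<longleftrightarrow> \<omega> \<in> A) \<and> (\<omega> \<in> cdom M (L0 M) P \<longrightarrow> v \<omega> = w \<omega>)"
    using presents_cong[OF Pc P v(1)] by blast
  show "\<exists>v\<in>V. AE \<omega> in M. \<omega> \<in> cmem M P x \<longrightarrow> \<omega> \<in> A \<and> x \<omega> = v \<omega>"
    by (rule bexI[OF _ w(1)]) (use v(2) w(2) in eventually_elim, auto)
  assume "u \<in> V"
  then obtain w where w: "w \<in> cset M (L0 M) P"
      "AE \<omega> in M. (\<omega> \<in> A \<longleftrightarrow> \<omega> \<in> cdom M (L0 M) P) \<and> (\<omega> \<in> A \<longrightarrow> u \<omega> = w \<omega>)"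
    using presents_cong[OF P Pc] by blast
  show "AE \<omega> in M. \<omega> \<in> A \<and> x \<omega> = u \<omega> \<longrightarrow> \<omega> \<in> cmem M P x"
    using c(3)[OF w(1)] w(2) by eventually_elim auto
qed

lemma cmem_sets [simp]:
  "P \<in> cond_subsets M (L0 M) \<Longrightarrow> (x :: 'a \<Rightarrow> 'b::euclidean_space) \<in> L0 M \<Longrightarrow> cmem M P x \<in> sets M"
  using cmem_char0(1) .

text \<open>The way membership events are computed: one witness must realise all of
  \<open>S\<close>, and \<open>S\<close> must absorb every agreement of \<open>x\<close> with an
  element of \<open>V\<close>.\<close>

lemma cmem_eqI:
  fixes x :: "'a \<Rightarrow> 'b::euclidean_space"
  assumes P: "presents M P V A" and x: "x \<in> L0 M"
    and 1: "v \<in> V" "AE \<omega> in M. \<omega> \<in> S \<longrightarrow> \<omega> \<in> A \<and> x \<omega> = v \<omega>"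
    and 2: "\<And>v. v \<in> V \<Longrightarrow> AE \<omega> in M. \<omega> \<in> A \<and> x \<omega> = v \<omega> \<longrightarrow> \<omega> \<in> S"
  shows "AE \<omega> in M. \<omega> \<in> cmem M P x \<longleftrightarrow> \<omega> \<in> S"
proof -
  obtain u where u: "u \<in> V" "AE \<omega> in M. \<omega> \<in> cmem M P x \<longrightarrow> \<omega> \<in> A \<and> x \<omega> = u \<omega>"
    using cmem_char(2)[OF P x] by blast
  show ?thesis using u(2) 2[OF u(1)] 1(2) cmem_char(3)[OF P x 1(1)] by eventually_elim blast
qed

lemma cmem_presented:
  fixes v :: "'a \<Rightarrow> 'b::euclidean_space"
  assumes P: "presents M P V A" and v: "v \<in> V"
  shows "AE \<omega> in M. \<omega> \<in> cmem M P v \<longleftrightarrow> \<omega> \<in> A"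
proof -
  have vL: "v \<in> L0 M" using P v unfolding presents_def by auto
  show ?thesis by (rule cmem_eqI[OF P vL v]) (auto intro!: AE_I2)
qed

lemma cmem_subset_dom:
  fixes x :: "'a \<Rightarrow> 'b::euclidean_space"
  assumes P: "presents M P V A" and x: "x \<in> L0 M"
  shows "AE \<omega> in M. \<omega> \<in> cmem M P x \<longrightarrow> \<omega> \<in> A"
  using cmem_char(2)[OF P x] by (auto elim!: eventually_mono)

text \<open>If \<open>v\<close> and \<open>w\<close> are witnesses for \<open>x\<close> and
  \<open>y\<close>, then at points with \<open>x \<omega> = y \<omega>\<close> agreement with
  \<open>v\<close> or \<open>w\<close> holds for both functions or for neither.\<close>

lemma cmem_local:
  fixes x :: "'a \<Rightarrow> 'b::euclidean_space"
  assumes P: "P \<in> cond_subsets M (L0 M)" and x: "x \<in> L0 M" and y: "y \<in> L0 M"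
  shows "AE \<omega> in M. x \<omega> = y \<omega> \<longrightarrow> (\<omega> \<in> cmem M P x \<longleftrightarrow> \<omega> \<in> cmem M P y)"
proof -
  obtain V A where VA: "presents M P V A" using P cond_subsets_iff by blast
  obtain v where v: "v \<in> V" "AE \<omega> in M. \<omega> \<in> cmem M P x \<longrightarrow> \<omega> \<in> A \<and> x \<omega> = v \<omega>"
    using cmem_char(2)[OF VA x] by blast
  obtain w where w: "w \<in> V" "AE \<omega> in M. \<omega> \<in> cmem M P y \<longrightarrow> \<omega> \<in> A \<and> y \<omega> = w \<omega>"
    using cmem_char(2)[OF VA y] by blast
  show ?thesis
    using v(2) w(2) cmem_char(3)[OF VA x w(1)] cmem_char(3)[OF VA y v(1)]
    by eventually_elim metis
qed

text \<open>The elements of a presentation belong to \<open>P\<close> on its whole domain, so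
  testing inclusion of events on them recovers both conditions in \<open>cle\<close>. From here on
  the order is handled through events only.\<close>

lemma cle_iff:
  assumes P: "P \<in> cond_subsets M (L0 M)" and Q: "Q \<in> cond_subsets M (L0 M :: ('a \<Rightarrow> 'b::euclidean_space) set)"
  shows "cle M (L0 M) P Q \<longleftrightarrow> (\<forall>x\<in>L0 M. ae_subset M (cmem M P x) (cmem M Q x))"
proof -
  let ?V = "cset M (L0 M) P" and ?A = "cdom M (L0 M) P"
  let ?W = "cset M (L0 M) Q" and ?B = "cdom M (L0 M) Q"
  note pP = presents_cset[OF P] and pQ = presents_cset[OF Q]
  have PV: "P = restr M ?V ?A" using pP unfolding presents_def by simp
  have c: "cle M (L0 M) P Q \<longleftrightarrow> ae_subset M ?A ?B \<and>
      (\<forall>v\<in>?V. \<exists>w\<in>?W. AE \<omega> in M. \<omega> \<in> ?A \<longrightarrow> v \<omega> = w \<omega>)"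
    unfolding cle_def by (subst (2) PV) (simp add: restr_subset_iff)
  show ?thesis
  proof
    assume "cle M (L0 M) P Q"
    then have AB: "AE \<omega> in M. \<omega> \<in> ?A \<longrightarrow> \<omega> \<in> ?B"
      and VW: "\<And>v. v \<in> ?V \<Longrightarrow> \<exists>w\<in>?W. AE \<omega> in M. \<omega> \<in> ?A \<longrightarrow> v \<omega> = w \<omega>"
      unfolding c ae_subset_def by auto
    show "\<forall>x\<in>L0 M. ae_subset M (cmem M P x) (cmem M Q x)"
    proof
      fix x :: "'a \<Rightarrow> 'b" assume x: "x \<in> L0 M"
      obtain v where v: "v \<in> ?V" "AE \<omega> in M. \<omega> \<in> cmem M P x \<longrightarrow> \<omega> \<in> ?A \<and> x \<omega> = v \<omega>"
        using cmem_char(2)[OF pP x] by blast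
      obtain w where w: "w \<in> ?W" "AE \<omega> in M. \<omega> \<in> ?A \<longrightarrow> v \<omega> = w \<omega>" using VW[OF v(1)] by blast
      show "ae_subset M (cmem M P x) (cmem M Q x)" unfolding ae_subset_def
        using v(2) w(2) AB cmem_char(3)[OF pQ x w(1)] by eventually_elim auto
    qed
  next
    assume sub: "\<forall>x\<in>L0 M. ae_subset M (cmem M P x) (cmem M Q x)"
    have *: "ae_subset M ?A ?B \<and> (\<exists>w\<in>?W. AE \<omega> in M. \<omega> \<in> ?A \<longrightarrow> v \<omega> = w \<omega>)" if v: "v \<in> ?V" for v
    proof -
      have vL: "v \<in> L0 M" using v pP unfolding presents_def by auto
      have s: "AE \<omega> in M. \<omega> \<in> cmem M P v \<longrightarrow> \<omega> \<in> cmem M Q v"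
        using sub vL unfolding ae_subset_def by blast
      obtain w where w: "w \<in> ?W" "AE \<omega> in M. \<omega> \<in> cmem M Q v \<longrightarrow> \<omega> \<in> ?B \<and> v \<omega> = w \<omega>"
        using cmem_char(2)[OF pQ vL] by blast
      have "AE \<omega> in M. \<omega> \<in> ?A \<longrightarrow> \<omega> \<in> ?B" "AE \<omega> in M. \<omega> \<in> ?A \<longrightarrow> v \<omega> = w \<omega>"
        using s w(2) cmem_presented[OF pP v] by (eventually_elim; auto)+
      then show ?thesis using w(1) unfolding ae_subset_def by blast
    qed
    moreover have "?V \<noteq> {}" using pP unfolding presents_def stable_set_def by auto
    ultimately show "cle M (L0 M) P Q" unfolding c by blast
  qed
qed

text \<open>The conclusion is equality of objects: mutual \<open>cle\<close> makes the two domains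
  almost surely equal, and restricting to almost surely equal events yields the same set of
  classes.\<close>

lemma cond_subsets_eqI:
  fixes P :: "('a, 'b::euclidean_space) condset"
  assumes P: "P \<in> cond_subsets M (L0 M)" and Q: "Q \<in> cond_subsets M (L0 M)"
    and eq: "\<And>x. x \<in> L0 M \<Longrightarrow> AE \<omega> in M. \<omega> \<in> cmem M P x \<longleftrightarrow> \<omega> \<in> cmem M Q x"
  shows "P = Q"
proof -
  have sub: "R \<subseteq> S" if R: "R \<in> cond_subsets M (L0 M)" and S: "S \<in> cond_subsets M (L0 M)"
    and RS: "\<And>x. x \<in> L0 M \<Longrightarrow> AE \<omega> in M. \<omega> \<in> cmem M R x \<longleftrightarrow> \<omega> \<in> cmem M S x"
  for R S :: "('a, 'b) condset"
  proof -
    have "cle M (L0 M) R S" "cle M (L0 M) S R"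
      unfolding cle_iff[OF R S] cle_iff[OF S R] ae_subset_def
      by (intro ballI; drule RS, erule eventually_mono; simp)+
    then have 1: "ae_subset M (cdom M (L0 M) R) (cdom M (L0 M) S)"
        "ae_subset M (cdom M (L0 M) S) (cdom M (L0 M) R)"
        "R \<subseteq> restr M (cset M (L0 M) S) (cdom M (L0 M) R)" unfolding cle_def by auto
    have "AE \<omega> in M. \<omega> \<in> cdom M (L0 M) R \<longleftrightarrow> \<omega> \<in> cdom M (L0 M) S"
      using 1(1,2) unfolding ae_subset_def by eventually_elim auto
    then have "restr M (cset M (L0 M) S) (cdom M (L0 M) R) = S"
      using presents_cset[OF S] restr_cong_dom unfolding presents_def by metis
    with 1(3) show ?thesis by simp
  qed
  have "AE \<omega> in M. \<omega> \<in> cmem M Q x \<longleftrightarrow> \<omega> \<in> cmem M P x" if "x \<in> L0 M" for x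
    using eq[OF that] by eventually_elim simp
  with eq show ?thesis by (intro equalityI sub P Q)
qed

lemma cle_antisym:
  fixes P :: "('a, 'b::euclidean_space) condset"
  assumes P: "P \<in> cond_subsets M (L0 M)" and Q: "Q \<in> cond_subsets M (L0 M)"
    and le: "cle M (L0 M) P Q" "cle M (L0 M) Q P"
  shows "P = Q"
proof (rule cond_subsets_eqI[OF P Q])
  fix x :: "'a \<Rightarrow> 'b" assume x: "x \<in> L0 M"
  have "AE \<omega> in M. \<omega> \<in> cmem M P x \<longrightarrow> \<omega> \<in> cmem M Q x" "AE \<omega> in M. \<omega> \<in> cmem M Q x \<longrightarrow> \<omega> \<in> cmem M P x"
    using le x unfolding cle_iff[OF P Q] cle_iff[OF Q P] ae_subset_def by blast+
  then show "AE \<omega> in M. \<omega> \<in> cmem M P x \<longleftrightarrow> \<omega> \<in> cmem M Q x" by eventually_elim blast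
qed

text \<open>Exhaustion over \<open>x\<close>: witnesses on countably many events are glued, and by
  locality the glued function keeps the events of its pieces. So one \<open>x0\<close> realises the
  largest event.\<close>

lemma local_events_max:
  fixes \<phi> :: "('a \<Rightarrow> 'b::euclidean_space) \<Rightarrow> 'a set"
  assumes \<phi>: "local_events M \<phi>"
  obtains D x0 where "D \<in> sets M" "x0 \<in> L0 M" "AE \<omega> in M. \<omega> \<in> D \<longleftrightarrow> \<omega> \<in> \<phi> x0"
    "\<And>x. x \<in> L0 M \<Longrightarrow> AE \<omega> in M. \<omega> \<in> \<phi> x \<longrightarrow> \<omega> \<in> D"
proof -
  have loc: "AE \<omega> in M. x \<omega> = y \<omega> \<longrightarrow> (\<omega> \<in> \<phi> x \<longleftrightarrow> \<omega> \<in> \<phi> y)" if "x \<in> L0 M" "y \<in> L0 M" for x y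
    using \<phi> that unfolding local_events_def by blast
  have meas: "\<phi> x \<in> sets M" if "x \<in> L0 M" for x using \<phi> that unfolding local_events_def by blast
  define \<A> where "\<A> = {A \<in> sets M. \<exists>x\<in>L0 M. AE \<omega> in M. \<omega> \<in> A \<longrightarrow> \<omega> \<in> \<phi> x}"
  have "(\<lambda>_. 0) \<in> (L0 M :: ('a \<Rightarrow> 'b) set)" by simp
  then have "{} \<in> \<A>" unfolding \<A>_def by fastforce
  moreover have "\<A> \<subseteq> sets M" unfolding \<A>_def by auto
  moreover have "(\<Union>k. B k) \<in> \<A>" if B: "range B \<subseteq> \<A>" for B :: "nat \<Rightarrow> _"
  proof -
    have "\<exists>x\<in>L0 M. AE \<omega> in M. \<omega> \<in> B k \<longrightarrow> \<omega> \<in> \<phi> x" for k using B unfolding \<A>_def by blast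
    then obtain v where v: "\<And>k. v k \<in> L0 M" "\<And>k. AE \<omega> in M. \<omega> \<in> B k \<longrightarrow> \<omega> \<in> \<phi> (v k)" by metis
    have rB: "range B \<subseteq> sets M" using B unfolding \<A>_def by blast
    obtain u where u: "u \<in> L0 M" "\<And>\<omega>. \<omega> \<in> (\<Union>k. B k) \<Longrightarrow> \<exists>k. \<omega> \<in> B k \<and> u \<omega> = v k \<omega>"
      using stable_select[of M "L0 M" B v, OF stable_set_L0 rB v(1)] by blast
    have "AE \<omega> in M. \<forall>k. \<omega> \<in> B k \<longrightarrow> \<omega> \<in> \<phi> (v k)" "AE \<omega> in M. \<forall>k. u \<omega> = v k \<omega> \<longrightarrow> (\<omega> \<in> \<phi> u \<longleftrightarrow> \<omega> \<in> \<phi> (v k))"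
      using v(2) loc[OF u(1) v(1)] by (simp_all add: AE_all_countable)
    then have "AE \<omega> in M. \<omega> \<in> (\<Union>k. B k) \<longrightarrow> \<omega> \<in> \<phi> u"
      by eventually_elim (metis u(2))
    with u(1) rB show ?thesis unfolding \<A>_def by blast
  qed
  ultimately obtain S where S: "S \<in> \<A>" "\<And>A. A \<in> \<A> \<Longrightarrow> ae_subset M A S"
    using ess_max_exists[of \<A>] by blast
  obtain x0 where x0: "x0 \<in> L0 M" "AE \<omega> in M. \<omega> \<in> S \<longrightarrow> \<omega> \<in> \<phi> x0" using S(1) unfolding \<A>_def by blast
  have S': "AE \<omega> in M. \<omega> \<in> \<phi> x \<longrightarrow> \<omega> \<in> S" if "x \<in> L0 M" for x
  proof -
    have "\<phi> x \<in> \<A>" using that meas unfolding \<A>_def by auto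
    from S(2)[OF this] show ?thesis unfolding ae_subset_def .
  qed
  show thesis
  proof
    show "S \<in> sets M" using S(1) unfolding \<A>_def by auto
    show "AE \<omega> in M. \<omega> \<in> S \<longleftrightarrow> \<omega> \<in> \<phi> x0" using x0(2) S'[OF x0(1)] by eventually_elim auto
  qed (use x0 S' in auto)
qed

text \<open>\<open>x0\<close> makes \<open>V\<close> non-empty. A general \<open>x\<close> is
  replaced by \<open>x0\<close> outside \<open>\<phi> x\<close>; the result lies in \<open>V\<close>
  and agrees with \<open>x\<close> on \<open>\<phi> x\<close>, which is the witness that identifies
  the membership event.\<close>

lemma local_events_presents:
  fixes \<phi> :: "('a \<Rightarrow> 'b::euclidean_space) \<Rightarrow> 'a set"
  assumes \<phi>: "local_events M \<phi>"
    and D: "D \<in> sets M" and x0: "x0 \<in> L0 M" "AE \<omega> in M. \<omega> \<in> D \<longrightarrow> \<omega> \<in> \<phi> x0"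
    and sub: "\<And>x. x \<in> L0 M \<Longrightarrow> AE \<omega> in M. \<omega> \<in> \<phi> x \<longrightarrow> \<omega> \<in> D"
  defines "V \<equiv> {x\<in>L0 M. AE \<omega> in M. \<omega> \<in> D \<longrightarrow> \<omega> \<in> \<phi> x}"
  shows "presents M (restr M V D) V D"
    and "x \<in> L0 M \<Longrightarrow> AE \<omega> in M. \<omega> \<in> cmem M (restr M V D) x \<longleftrightarrow> \<omega> \<in> \<phi> x"
proof -
  have loc: "AE \<omega> in M. x \<omega> = y \<omega> \<longrightarrow> (\<omega> \<in> \<phi> x \<longleftrightarrow> \<omega> \<in> \<phi> y)" if "x \<in> L0 M" "y \<in> L0 M" for x y
    using \<phi> that unfolding local_events_def by blast
  have x0V: "x0 \<in> V" using x0 unfolding V_def by auto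
  have "glue A v \<in> V" if A: "partition_of M A" and v: "\<And>k. v k \<in> V" for A v
  proof -
    have vL: "v k \<in> L0 M" for k using v unfolding V_def by auto
    have gL: "glue A v \<in> L0 M" using A vL by (rule glue_measurable)
    have "AE \<omega> in M. \<omega> \<in> D \<longrightarrow> \<omega> \<in> \<phi> (v k)" for k using v[of k] unfolding V_def by simp
    then have "AE \<omega> in M. \<forall>k. \<omega> \<in> D \<longrightarrow> \<omega> \<in> \<phi> (v k)" unfolding AE_all_countable by blast
    moreover have "AE \<omega> in M. \<forall>k. glue A v \<omega> = v k \<omega> \<longrightarrow> (\<omega> \<in> \<phi> (glue A v) \<longleftrightarrow> \<omega> \<in> \<phi> (v k))"
      using loc[OF gL vL] by (simp add: AE_all_countable)
    ultimately have "AE \<omega> in M. \<omega> \<in> D \<longrightarrow> \<omega> \<in> \<phi> (glue A v)"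
      using AE_space
    proof eventually_elim
      case (elim \<omega>)
      obtain k where "\<omega> \<in> A k" using partition_ofE[OF A elim(3)] .
      then show ?case using glue_eq[OF A] elim by metis
    qed
    then show ?thesis using gL unfolding V_def by auto
  qed
  then have st: "stable_set M V" using x0V unfolding stable_set_def by auto
  then show pr: "presents M (restr M V D) V D"
    unfolding presents_def using D by (auto simp: V_def)
  assume x: "x \<in> L0 M"
  have px: "\<phi> x \<in> sets M" using \<phi> x unfolding local_events_def by blast
  obtain v where v: "v \<in> L0 M" "\<And>\<omega>. \<omega> \<in> space M \<Longrightarrow> v \<omega> = (if \<omega> \<in> \<phi> x then x \<omega> else x0 \<omega>)"
    using stable_select2[OF stable_set_L0 px x x0(1)] by blast
  have "AE \<omega> in M. \<omega> \<in> D \<longrightarrow> \<omega> \<in> \<phi> v"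
    using loc[OF v(1) x] loc[OF v(1) x0(1)] x0(2) AE_space
    by eventually_elim (use v(2) in \<open>auto split: if_splits\<close>)
  then have "v \<in> V" using v(1) unfolding V_def by auto
  then show "AE \<omega> in M. \<omega> \<in> cmem M (restr M V D) x \<longleftrightarrow> \<omega> \<in> \<phi> x"
  proof (rule cmem_eqI[OF pr x])
    show "AE \<omega> in M. \<omega> \<in> \<phi> x \<longrightarrow> \<omega> \<in> D \<and> x \<omega> = v \<omega>"
      using sub[OF x] AE_space by eventually_elim (use v(2) in auto)
    fix u assume u: "u \<in> V"
    then have uL: "u \<in> L0 M" and uD: "AE \<omega> in M. \<omega> \<in> D \<longrightarrow> \<omega> \<in> \<phi> u" unfolding V_def by auto
    show "AE \<omega> in M. \<omega> \<in> D \<and> x \<omega> = u \<omega> \<longrightarrow> \<omega> \<in> \<phi> x"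
      using uD loc[OF x uL] by eventually_elim auto
  qed
qed

lemma cset_of:
  fixes \<phi> :: "('a \<Rightarrow> 'b::euclidean_space) \<Rightarrow> 'a set"
  assumes \<phi>: "local_events M \<phi>"
  shows "cset_of M \<phi> \<in> cond_subsets M (L0 M)"
    and "x \<in> L0 M \<Longrightarrow> AE \<omega> in M. \<omega> \<in> cmem M (cset_of M \<phi>) x \<longleftrightarrow> \<omega> \<in> \<phi> x"
proof -
  obtain D x0 where D: "D \<in> sets M" "x0 \<in> L0 M" "AE \<omega> in M. \<omega> \<in> D \<longleftrightarrow> \<omega> \<in> \<phi> x0"
    "\<And>x. x \<in> L0 M \<Longrightarrow> AE \<omega> in M. \<omega> \<in> \<phi> x \<longrightarrow> \<omega> \<in> D" using local_events_max[OF \<phi>] by blast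
  have "AE \<omega> in M. \<omega> \<in> D \<longrightarrow> \<omega> \<in> \<phi> x0" using D(3) by eventually_elim auto
  note lp = local_events_presents[OF \<phi> D(1,2) this D(4)]
  have "\<exists>P. P \<in> cond_subsets M (L0 M) \<and> (\<forall>x\<in>L0 M. AE \<omega> in M. \<omega> \<in> cmem M P x \<longleftrightarrow> \<omega> \<in> \<phi> x)"
    using lp unfolding cond_subsets_iff by blast
  from someI_ex[OF this]
  show "cset_of M \<phi> \<in> cond_subsets M (L0 M)"
    "x \<in> L0 M \<Longrightarrow> AE \<omega> in M. \<omega> \<in> cmem M (cset_of M \<phi>) x \<longleftrightarrow> \<omega> \<in> \<phi> x"
    unfolding cset_of_def by auto
qed


section \<open>Boolean operations and concatenation in terms of membership events\<close>

lemma cSup_cmem: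
  fixes \<C> :: "('a, 'b::euclidean_space) condset set"
  assumes c: "countable \<C>" and C: "\<C> \<subseteq> cond_subsets M (L0 M)"
  shows "cSup M (L0 M) \<C> \<in> cond_subsets M (L0 M)"
    and "x \<in> L0 M \<Longrightarrow> AE \<omega> in M. \<omega> \<in> cmem M (cSup M (L0 M) \<C>) x \<longleftrightarrow> (\<exists>P\<in>\<C>. \<omega> \<in> cmem M P x)"
proof -
  let ?\<phi> = "\<lambda>x. \<Union>P\<in>\<C>. cmem M P x"
  have loc: "local_events M ?\<phi>"
    unfolding local_events_def
  proof (intro conjI ballI)
    fix x y :: "'a \<Rightarrow> 'b" assume x: "x \<in> L0 M" and y: "y \<in> L0 M"
    \<comment> \<open>Countability of \<open>\<C>\<close> enters here and whenever almost sure
      statements are collected over \<open>\<C>\<close>; an uncountable union of versions need not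
      be measurable.\<close>
    show "?\<phi> x \<in> sets M" using C x c by (intro sets.countable_UN') auto
    have "AE \<omega> in M. \<forall>P\<in>\<C>. x \<omega> = y \<omega> \<longrightarrow> (\<omega> \<in> cmem M P x \<longleftrightarrow> \<omega> \<in> cmem M P y)"
      using cmem_local[OF _ x y] C unfolding AE_ball_countable[OF c] by blast
    then show "AE \<omega> in M. x \<omega> = y \<omega> \<longrightarrow> (\<omega> \<in> ?\<phi> x \<longleftrightarrow> \<omega> \<in> ?\<phi> y)"
      by eventually_elim simp
  qed
  let ?S = "cset_of M ?\<phi>"
  have S: "?S \<in> cond_subsets M (L0 M)" by (rule cset_of(1)[OF loc])
  have mS: "AE \<omega> in M. \<omega> \<in> cmem M ?S x \<longleftrightarrow> \<omega> \<in> ?\<phi> x" if "x \<in> L0 M" for x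
    by (rule cset_of(2)[OF loc that])
  have up: "cle M (L0 M) P ?S" if "P \<in> \<C>" for P
  proof -
    have P: "P \<in> cond_subsets M (L0 M)" using that C by auto
    show ?thesis unfolding cle_iff[OF P S] ae_subset_def
      by (intro ballI; drule mS, erule eventually_mono; use that in blast)
  qed
  have least: "cle M (L0 M) ?S T" if T: "T \<in> cond_subsets M (L0 M)" and PT: "\<forall>P\<in>\<C>. cle M (L0 M) P T" for T
    unfolding cle_iff[OF S T] ae_subset_def
  proof
    fix x :: "'a \<Rightarrow> 'b" assume x: "x \<in> L0 M"
    have "AE \<omega> in M. \<forall>P\<in>\<C>. \<omega> \<in> cmem M P x \<longrightarrow> \<omega> \<in> cmem M T x"
      unfolding AE_ball_countable[OF c]
    proof
      fix P assume "P \<in> \<C>"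
      then have "P \<in> cond_subsets M (L0 M)" "cle M (L0 M) P T" using C PT by auto
      then show "AE \<omega> in M. \<omega> \<in> cmem M P x \<longrightarrow> \<omega> \<in> cmem M T x"
        using cle_iff[of P T] T x unfolding ae_subset_def by blast
    qed
    then show "AE \<omega> in M. \<omega> \<in> cmem M ?S x \<longrightarrow> \<omega> \<in> cmem M T x"
      using mS[OF x] by eventually_elim blast
  qed
  \<comment> \<open>\<open>THE\<close> asks for uniqueness of the least upper bound, which is
    antisymmetry of \<open>cle\<close>.\<close>
  have "cSup M (L0 M) \<C> = ?S" unfolding cSup_def
  proof (rule the_equality)
    show "?S \<in> cond_subsets M (L0 M) \<and> (\<forall>P\<in>\<C>. cle M (L0 M) P ?S) \<and>
      (\<forall>T\<in>cond_subsets M (L0 M). (\<forall>P\<in>\<C>. cle M (L0 M) P T) \<longrightarrow> cle M (L0 M) ?S T)"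
      using S up least by blast
    fix R assume R: "R \<in> cond_subsets M (L0 M) \<and> (\<forall>P\<in>\<C>. cle M (L0 M) P R) \<and>
      (\<forall>T\<in>cond_subsets M (L0 M). (\<forall>P\<in>\<C>. cle M (L0 M) P T) \<longrightarrow> cle M (L0 M) R T)"
    then have R1: "R \<in> cond_subsets M (L0 M)" and RS: "cle M (L0 M) R ?S" and SR: "cle M (L0 M) ?S R"
      using S up least by blast+
    show "R = ?S" by (rule cle_antisym[OF R1 S RS SR])
  qed
  then show "cSup M (L0 M) \<C> \<in> cond_subsets M (L0 M)"
    and "x \<in> L0 M \<Longrightarrow> AE \<omega> in M. \<omega> \<in> cmem M (cSup M (L0 M) \<C>) x \<longleftrightarrow> (\<exists>P\<in>\<C>. \<omega> \<in> cmem M P x)"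
    using S mS[of x] by auto
qed

lemma cInf_cmem:
  fixes P Q :: "('a, 'b::euclidean_space) condset"
  assumes P: "P \<in> cond_subsets M (L0 M)" and Q: "Q \<in> cond_subsets M (L0 M)"
  shows "cInf M (L0 M) {P, Q} \<in> cond_subsets M (L0 M)"
    and "x \<in> L0 M \<Longrightarrow> AE \<omega> in M. \<omega> \<in> cmem M (cInf M (L0 M) {P, Q}) x \<longleftrightarrow> \<omega> \<in> cmem M P x \<and> \<omega> \<in> cmem M Q x"
proof -
  let ?\<phi> = "\<lambda>x. cmem M P x \<inter> cmem M Q x"
  have loc: "local_events M ?\<phi>"
    unfolding local_events_def
  proof (intro conjI ballI)
    fix x y :: "'a \<Rightarrow> 'b" assume x: "x \<in> L0 M" and y: "y \<in> L0 M"
    show "AE \<omega> in M. x \<omega> = y \<omega> \<longrightarrow> (\<omega> \<in> ?\<phi> x \<longleftrightarrow> \<omega> \<in> ?\<phi> y)"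
      using cmem_local[OF P x y] cmem_local[OF Q x y] by eventually_elim auto
  qed (use P Q in auto)
  let ?S = "cset_of M ?\<phi>"
  have S: "?S \<in> cond_subsets M (L0 M)" by (rule cset_of(1)[OF loc])
  have mS: "AE \<omega> in M. \<omega> \<in> cmem M ?S x \<longleftrightarrow> \<omega> \<in> ?\<phi> x" if "x \<in> L0 M" for x
    by (rule cset_of(2)[OF loc that])
  have lo: "cle M (L0 M) ?S P" "cle M (L0 M) ?S Q"
    unfolding cle_iff[OF S P] cle_iff[OF S Q] ae_subset_def
    by (intro ballI; drule mS, erule eventually_mono; simp)+
  have greatest: "cle M (L0 M) T ?S" if T: "T \<in> cond_subsets M (L0 M)"
    and PT: "cle M (L0 M) T P" "cle M (L0 M) T Q" for T
    unfolding cle_iff[OF T S] ae_subset_def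
  proof
    fix x :: "'a \<Rightarrow> 'b" assume x: "x \<in> L0 M"
    have "AE \<omega> in M. \<omega> \<in> cmem M T x \<longrightarrow> \<omega> \<in> cmem M P x" "AE \<omega> in M. \<omega> \<in> cmem M T x \<longrightarrow> \<omega> \<in> cmem M Q x"
      using PT x unfolding cle_iff[OF T P] cle_iff[OF T Q] ae_subset_def by blast+
    then show "AE \<omega> in M. \<omega> \<in> cmem M T x \<longrightarrow> \<omega> \<in> cmem M ?S x"
      using mS[OF x] by eventually_elim blast
  qed
  have "cInf M (L0 M) {P, Q} = ?S" unfolding cInf_def
  proof (rule the_equality)
    show "?S \<in> cond_subsets M (L0 M) \<and> (\<forall>P\<in>{P, Q}. cle M (L0 M) ?S P) \<and>
      (\<forall>T\<in>cond_subsets M (L0 M). (\<forall>P\<in>{P, Q}. cle M (L0 M) T P) \<longrightarrow> cle M (L0 M) T ?S)"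
      using S lo greatest by blast
    fix R assume R: "R \<in> cond_subsets M (L0 M) \<and> (\<forall>P\<in>{P, Q}. cle M (L0 M) R P) \<and>
      (\<forall>T\<in>cond_subsets M (L0 M). (\<forall>P\<in>{P, Q}. cle M (L0 M) T P) \<longrightarrow> cle M (L0 M) T R)"
    then have R1: "R \<in> cond_subsets M (L0 M)" and RS: "cle M (L0 M) R ?S" and SR: "cle M (L0 M) ?S R"
      using S lo greatest by blast+
    show "R = ?S" by (rule cle_antisym[OF R1 S RS SR])
  qed
  then show "cInf M (L0 M) {P, Q} \<in> cond_subsets M (L0 M)"
    and "x \<in> L0 M \<Longrightarrow> AE \<omega> in M. \<omega> \<in> cmem M (cInf M (L0 M) {P, Q}) x \<longleftrightarrow> \<omega> \<in> cmem M P x \<and> \<omega> \<in> cmem M Q x"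
    using S mS[of x] by auto
qed

lemma ctop_cmem:
  shows "ctop M (L0 M) \<in> cond_subsets M (L0 M :: ('a \<Rightarrow> 'b::euclidean_space) set)"
    and "(x :: 'a \<Rightarrow> 'b) \<in> L0 M \<Longrightarrow> AE \<omega> in M. \<omega> \<in> cmem M (ctop M (L0 M)) x"
proof -
  have p: "presents M (ctop M (L0 M)) (L0 M :: ('a \<Rightarrow> 'b) set) (space M)"
    unfolding presents_def ctop_def using stable_set_L0 by auto
  then show "ctop M (L0 M) \<in> cond_subsets M (L0 M :: ('a \<Rightarrow> 'b) set)" using cond_subsets_iff by blast
  assume "x \<in> L0 M"
  from cmem_presented[OF p this] AE_space show "AE \<omega> in M. \<omega> \<in> cmem M (ctop M (L0 M)) x"
    by eventually_elim simp
qed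

lemma cbot_cmem:
  shows "cbot M (L0 M) \<in> cond_subsets M (L0 M :: ('a \<Rightarrow> 'b::euclidean_space) set)"
    and "(x :: 'a \<Rightarrow> 'b) \<in> L0 M \<Longrightarrow> AE \<omega> in M. \<omega> \<notin> cmem M (cbot M (L0 M)) x"
proof -
  have p: "presents M (cbot M (L0 M)) (L0 M :: ('a \<Rightarrow> 'b) set) {}"
    unfolding presents_def cbot_def using stable_set_L0 by auto
  then show "cbot M (L0 M) \<in> cond_subsets M (L0 M :: ('a \<Rightarrow> 'b) set)" using cond_subsets_iff by blast
  assume "x \<in> L0 M"
  from cmem_presented[OF p this] show "AE \<omega> in M. \<omega> \<notin> cmem M (cbot M (L0 M)) x"
    by eventually_elim simp
qed

lemma cdisjoint_iff:
  fixes P Q :: "('a, 'b::euclidean_space) condset"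
  assumes P: "P \<in> cond_subsets M (L0 M)" and Q: "Q \<in> cond_subsets M (L0 M)"
  shows "cdisjoint M (L0 M) P Q \<longleftrightarrow> (\<forall>x\<in>L0 M. AE \<omega> in M. \<not> (\<omega> \<in> cmem M P x \<and> \<omega> \<in> cmem M Q x))"
proof
  assume d: "cdisjoint M (L0 M) P Q"
  show "\<forall>x\<in>L0 M. AE \<omega> in M. \<not> (\<omega> \<in> cmem M P x \<and> \<omega> \<in> cmem M Q x)"
  proof
    fix x :: "'a \<Rightarrow> 'b" assume x: "x \<in> L0 M"
    show "AE \<omega> in M. \<not> (\<omega> \<in> cmem M P x \<and> \<omega> \<in> cmem M Q x)"
      using cInf_cmem(2)[OF P Q x, unfolded d[unfolded cdisjoint_def]] cbot_cmem(2)[OF x]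
      by eventually_elim blast
  qed
next
  assume d: "\<forall>x\<in>L0 M. AE \<omega> in M. \<not> (\<omega> \<in> cmem M P x \<and> \<omega> \<in> cmem M Q x)"
  show "cdisjoint M (L0 M) P Q" unfolding cdisjoint_def
  proof (rule cond_subsets_eqI[OF cInf_cmem(1)[OF P Q] cbot_cmem(1)])
    fix x :: "'a \<Rightarrow> 'b" assume x: "x \<in> L0 M"
    have "AE \<omega> in M. \<not> (\<omega> \<in> cmem M P x \<and> \<omega> \<in> cmem M Q x)" using d x by blast
    then show "AE \<omega> in M. \<omega> \<in> cmem M (cInf M (L0 M) {P, Q}) x \<longleftrightarrow> \<omega> \<in> cmem M (cbot M (L0 M)) x"
      using cInf_cmem(2)[OF P Q x] cbot_cmem(2)[OF x] by eventually_elim blast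
  qed
qed

lemma cSup_eq_ctop_iff:
  fixes \<C> :: "('a, 'b::euclidean_space) condset set"
  assumes c: "countable \<C>" and C: "\<C> \<subseteq> cond_subsets M (L0 M)"
  shows "cSup M (L0 M) \<C> = ctop M (L0 M) \<longleftrightarrow> (\<forall>x\<in>L0 M. AE \<omega> in M. \<exists>P\<in>\<C>. \<omega> \<in> cmem M P x)"
proof
  assume e: "cSup M (L0 M) \<C> = ctop M (L0 M)"
  show "\<forall>x\<in>L0 M. AE \<omega> in M. \<exists>P\<in>\<C>. \<omega> \<in> cmem M P x"
  proof
    fix x :: "'a \<Rightarrow> 'b" assume x: "x \<in> L0 M"
    show "AE \<omega> in M. \<exists>P\<in>\<C>. \<omega> \<in> cmem M P x"
      using cSup_cmem(2)[OF c C x, unfolded e] ctop_cmem(2)[OF x] by eventually_elim blast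
  qed
next
  assume d: "\<forall>x\<in>L0 M. AE \<omega> in M. \<exists>P\<in>\<C>. \<omega> \<in> cmem M P x"
  show "cSup M (L0 M) \<C> = ctop M (L0 M)"
  proof (rule cond_subsets_eqI[OF cSup_cmem(1)[OF c C] ctop_cmem(1)])
    fix x :: "'a \<Rightarrow> 'b" assume x: "x \<in> L0 M"
    have "AE \<omega> in M. \<exists>P\<in>\<C>. \<omega> \<in> cmem M P x" using d x by blast
    then show "AE \<omega> in M. \<omega> \<in> cmem M (cSup M (L0 M) \<C>) x \<longleftrightarrow> \<omega> \<in> cmem M (ctop M (L0 M)) x"
      using cSup_cmem(2)[OF c C x] ctop_cmem(2)[OF x] by eventually_elim blast
  qed
qed

text \<open>Disjointness and covering together say that the membership events of \<open>P\<close>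
  and \<open>Q\<close> are complementary for every \<open>x\<close>. This determines
  \<open>Q\<close>, so \<open>THE\<close> has a unique candidate.\<close>

lemma ccompl_cmem:
  fixes P :: "('a, 'b::euclidean_space) condset"
  assumes P: "P \<in> cond_subsets M (L0 M)"
  shows "ccompl M (L0 M) P \<in> cond_subsets M (L0 M)"
    and "x \<in> L0 M \<Longrightarrow> AE \<omega> in M. \<omega> \<in> cmem M (ccompl M (L0 M) P) x \<longleftrightarrow> \<omega> \<notin> cmem M P x"
proof -
  let ?\<phi> = "\<lambda>x. space M - cmem M P x"
  have loc: "local_events M ?\<phi>"
    unfolding local_events_def
  proof (intro conjI ballI)
    fix x y :: "'a \<Rightarrow> 'b" assume x: "x \<in> L0 M" and y: "y \<in> L0 M"
    show "AE \<omega> in M. x \<omega> = y \<omega> \<longrightarrow> (\<omega> \<in> ?\<phi> x \<longleftrightarrow> \<omega> \<in> ?\<phi> y)"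
      using cmem_local[OF P x y] by eventually_elim auto
  qed (use P in auto)
  let ?S = "cset_of M ?\<phi>"
  have S: "?S \<in> cond_subsets M (L0 M)" by (rule cset_of(1)[OF loc])
  have mS: "AE \<omega> in M. \<omega> \<in> cmem M ?S x \<longleftrightarrow> \<omega> \<notin> cmem M P x" if "x \<in> L0 M" for x
    using cset_of(2)[OF loc that] AE_space by eventually_elim auto
  have compl_iff: "cInf M (L0 M) {P, Q} = cbot M (L0 M) \<and> cSup M (L0 M) {P, Q} = ctop M (L0 M) \<longleftrightarrow>
      (\<forall>x\<in>L0 M. AE \<omega> in M. \<omega> \<in> cmem M Q x \<longleftrightarrow> \<omega> \<notin> cmem M P x)"
    if Q: "Q \<in> cond_subsets M (L0 M)" for Q
  proof -
    have "cInf M (L0 M) {P, Q} = cbot M (L0 M) \<longleftrightarrow>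
        (\<forall>x\<in>L0 M. AE \<omega> in M. \<not> (\<omega> \<in> cmem M P x \<and> \<omega> \<in> cmem M Q x))"
      using cdisjoint_iff[OF P Q] unfolding cdisjoint_def .
    moreover have "cSup M (L0 M) {P, Q} = ctop M (L0 M) \<longleftrightarrow>
        (\<forall>x\<in>L0 M. AE \<omega> in M. \<omega> \<in> cmem M P x \<or> \<omega> \<in> cmem M Q x)"
      using P Q by (subst cSup_eq_ctop_iff) auto
    moreover have "(AE \<omega> in M. \<not> (\<omega> \<in> cmem M P x \<and> \<omega> \<in> cmem M Q x)) \<and>
        (AE \<omega> in M. \<omega> \<in> cmem M P x \<or> \<omega> \<in> cmem M Q x) \<longleftrightarrow>
        (AE \<omega> in M. \<omega> \<in> cmem M Q x \<longleftrightarrow> \<omega> \<notin> cmem M P x)" for x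
      unfolding AE_conj_iff[symmetric] by (intro arg_cong[where f = "almost_everywhere M"]) auto
    ultimately show ?thesis by blast
  qed
  have "ccompl M (L0 M) P = ?S" unfolding ccompl_def
  proof (rule the_equality)
    show "?S \<in> cond_subsets M (L0 M) \<and> cInf M (L0 M) {P, ?S} = cbot M (L0 M) \<and> cSup M (L0 M) {P, ?S} = ctop M (L0 M)"
      using compl_iff[OF S] S mS by blast
    fix Q assume Q: "Q \<in> cond_subsets M (L0 M) \<and> cInf M (L0 M) {P, Q} = cbot M (L0 M) \<and> cSup M (L0 M) {P, Q} = ctop M (L0 M)"
    then have Q1: "Q \<in> cond_subsets M (L0 M)" by blast
    show "Q = ?S"
    proof (rule cond_subsets_eqI[OF Q1 S])
      fix x :: "'a \<Rightarrow> 'b" assume x: "x \<in> L0 M"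
      have "AE \<omega> in M. \<omega> \<in> cmem M Q x \<longleftrightarrow> \<omega> \<notin> cmem M P x" using compl_iff[OF Q1] Q x by blast
      then show "AE \<omega> in M. \<omega> \<in> cmem M Q x \<longleftrightarrow> \<omega> \<in> cmem M ?S x"
        using mS[OF x] by eventually_elim blast
    qed
  qed
  then show "ccompl M (L0 M) P \<in> cond_subsets M (L0 M)"
    and "x \<in> L0 M \<Longrightarrow> AE \<omega> in M. \<omega> \<in> cmem M (ccompl M (L0 M) P) x \<longleftrightarrow> \<omega> \<notin> cmem M P x"
    using S mS[of x] by auto
qed

text \<open>The glued elements form a stable set because concatenations along two partitions can be
  interchanged.\<close>

lemma cglue_cmem:
  fixes P :: "nat \<Rightarrow> ('a, 'b::euclidean_space) condset"
  assumes A: "partition_of M A" and P: "\<And>k. P k \<in> cond_subsets M (L0 M)"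
  shows "cglue M (L0 M) A P \<in> cond_subsets M (L0 M)"
    and "x \<in> L0 M \<Longrightarrow> AE \<omega> in M. \<omega> \<in> cmem M (cglue M (L0 M) A P) x \<longleftrightarrow> (\<exists>k. \<omega> \<in> A k \<and> \<omega> \<in> cmem M (P k) x)"
proof -
  let ?V = "\<lambda>k. cset M (L0 M) (P k)" and ?D = "\<lambda>k. cdom M (L0 M) (P k)"
  let ?W = "{glue A x | x. \<forall>k. x k \<in> ?V k}" and ?E = "\<Union>k. A k \<inter> ?D k"
  note pP = presents_cset[OF P]
  have VL: "?V k \<subseteq> L0 M" "stable_set M (?V k)" "?D k \<in> sets M" for k
    using pP[of k] unfolding presents_def by auto
  have Am: "A k \<in> sets M" for k using A unfolding partition_of_def by auto
  have W: "?W \<subseteq> L0 M" using VL(1) glue_measurable[OF A, of _ borel] by blast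
  have sW: "stable_set M ?W" unfolding stable_set_def
  proof (intro conjI allI impI)
    have "\<exists>x. \<forall>k. x k \<in> ?V k" using VL(2) unfolding stable_set_def by (intro choice) blast
    then show "?W \<noteq> {}" by blast
    fix B and y :: "nat \<Rightarrow> 'a \<Rightarrow> 'b" assume B: "partition_of M B" and y: "\<forall>j. y j \<in> ?W"
    have "\<forall>j. \<exists>x. y j = glue A x \<and> (\<forall>k. x k \<in> ?V k)" using y by blast
    then obtain x where x: "\<And>j. y j = glue A (x j)" "\<And>j k. x j k \<in> ?V k" by metis
    have "glue B y = glue A (\<lambda>k. glue B (\<lambda>j. x j k))" unfolding glue_def x(1) by simp
    moreover have "glue B (\<lambda>j. x j k) \<in> ?V k" for k
      using VL(2)[of k] B x(2) unfolding stable_set_def by simp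
    ultimately show "glue B y \<in> ?W" by blast
  qed
  have pr: "presents M (cglue M (L0 M) A P) ?W ?E"
    unfolding presents_def cglue_def using W sW VL(3) Am by auto
  then show "cglue M (L0 M) A P \<in> cond_subsets M (L0 M)" using cond_subsets_iff by blast
  assume x: "x \<in> L0 M"
  have "\<forall>k. \<exists>v. v \<in> ?V k \<and> (AE \<omega> in M. \<omega> \<in> cmem M (P k) x \<longrightarrow> \<omega> \<in> ?D k \<and> x \<omega> = v \<omega>)"
    using cmem_char(2)[OF pP x] by blast
  from choice[OF this] obtain v where v: "\<And>k. v k \<in> ?V k"
    "\<And>k. AE \<omega> in M. \<omega> \<in> cmem M (P k) x \<longrightarrow> \<omega> \<in> ?D k \<and> x \<omega> = v k \<omega>" by blast
  have "AE \<omega> in M. \<omega> \<in> cmem M (cglue M (L0 M) A P) x \<longleftrightarrow> \<omega> \<in> {\<omega>. \<exists>k. \<omega> \<in> A k \<and> \<omega> \<in> cmem M (P k) x}"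
  proof (rule cmem_eqI[OF pr x])
    show "glue A v \<in> ?W" using v(1) by blast
    have "AE \<omega> in M. \<forall>k. \<omega> \<in> cmem M (P k) x \<longrightarrow> \<omega> \<in> ?D k \<and> x \<omega> = v k \<omega>"
      using v(2) unfolding AE_all_countable by blast
    then show "AE \<omega> in M. \<omega> \<in> {\<omega>. \<exists>k. \<omega> \<in> A k \<and> \<omega> \<in> cmem M (P k) x} \<longrightarrow> \<omega> \<in> ?E \<and> x \<omega> = glue A v \<omega>"
    proof eventually_elim
      case (elim \<omega>)
      show ?case
      proof
        assume "\<omega> \<in> {\<omega>. \<exists>k. \<omega> \<in> A k \<and> \<omega> \<in> cmem M (P k) x}"
        then obtain k where k: "\<omega> \<in> A k" "\<omega> \<in> cmem M (P k) x" by blast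
        then show "\<omega> \<in> ?E \<and> x \<omega> = glue A v \<omega>" using elim glue_eq[OF A k(1), of v] by auto
      qed
    qed
    fix u assume "u \<in> ?W"
    then obtain y where y: "u = glue A y" "\<And>k. y k \<in> ?V k" by blast
    have "AE \<omega> in M. \<forall>k. \<omega> \<in> ?D k \<and> x \<omega> = y k \<omega> \<longrightarrow> \<omega> \<in> cmem M (P k) x"
      using cmem_char(3)[OF pP x y(2)] unfolding AE_all_countable by blast
    then show "AE \<omega> in M. \<omega> \<in> ?E \<and> x \<omega> = u \<omega> \<longrightarrow> \<omega> \<in> {\<omega>. \<exists>k. \<omega> \<in> A k \<and> \<omega> \<in> cmem M (P k) x}"
    proof eventually_elim
      case (elim \<omega>)
      show ?case
      proof
        assume a: "\<omega> \<in> ?E \<and> x \<omega> = u \<omega>"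
        then obtain k where k: "\<omega> \<in> A k" "\<omega> \<in> ?D k" by blast
        then have "x \<omega> = y k \<omega>" using a glue_eq[OF A k(1), of y] unfolding y(1) by simp
        then show "\<omega> \<in> {\<omega>. \<exists>k. \<omega> \<in> A k \<and> \<omega> \<in> cmem M (P k) x}" using elim k by blast
      qed
    qed
  qed
  then show "AE \<omega> in M. \<omega> \<in> cmem M (cglue M (L0 M) A P) x \<longleftrightarrow> (\<exists>k. \<omega> \<in> A k \<and> \<omega> \<in> cmem M (P k) x)"
    by simp
qed

text \<open>Gluing \<open>x\<close> on the event \<open>x = y\<close> with \<open>y\<close>
  elsewhere gives back \<open>y\<close>, while stability says that the glued function is sent to
  \<open>f x\<close> on that event.\<close>

lemma stable_fun_local:
  fixes f :: "('a \<Rightarrow> 'b::euclidean_space) \<Rightarrow> 'a \<Rightarrow> 'c"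
  assumes f: "stable_fun M (L0 M) Y f" and x: "x \<in> L0 M" and y: "y \<in> L0 M"
  shows "AE \<omega> in M. x \<omega> = y \<omega> \<longrightarrow> f x \<omega> = f y \<omega>"
proof -
  define E where "E = {\<omega>\<in>space M. x \<omega> = y \<omega>}"
  have E: "E \<in> sets M" unfolding E_def using x y by (rule sets_eq_L0)
  define A where "A = (\<lambda>k::nat. if k = 0 then E else if k = 1 then space M - E else {})"
  have A: "partition_of M A" using E sets.sets_into_space[OF E]
    unfolding partition_of_def disjoint_family_on_def A_def by (auto split: if_splits)
  define z where "z = (\<lambda>k::nat. if k = 0 then x else y)"
  have zL: "z k \<in> L0 M" for k using x y unfolding z_def by auto
  have gE: "glue A g \<omega> = g 0 \<omega>" if "\<omega> \<in> E" for g :: "nat \<Rightarrow> 'a \<Rightarrow> 'd" and \<omega>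
    using glue_eq[OF A, of \<omega> 0 g] that unfolding A_def by simp
  have gE': "glue A g \<omega> = g 1 \<omega>" if "\<omega> \<in> space M - E" for g :: "nat \<Rightarrow> 'a \<Rightarrow> 'd" and \<omega>
    using glue_eq[OF A, of \<omega> 1 g] that unfolding A_def by simp
  have "AE \<omega> in M. f (glue A z) \<omega> = glue A (\<lambda>k. f (z k)) \<omega>"
    using f A zL unfolding stable_fun_def by blast
  moreover have "AE \<omega> in M. f (glue A z) \<omega> = f y \<omega>"
  proof -
    have "AE \<omega> in M. glue A z \<omega> = y \<omega>"
    proof (rule AE_I2)
      fix \<omega> assume "\<omega> \<in> space M"
      then show "glue A z \<omega> = y \<omega>"
      proof (cases "\<omega> \<in> E")
        case True
        then show ?thesis using gE[of \<omega> z] unfolding z_def E_def by simp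
      next
        case False
        then show ?thesis using gE'[of \<omega> z] \<open>\<omega> \<in> space M\<close> unfolding z_def by simp
      qed
    qed
    moreover have "glue A z \<in> L0 M" using A zL by (rule glue_measurable)
    ultimately show ?thesis using f y unfolding stable_fun_def by blast
  qed
  ultimately show ?thesis using AE_space
  proof eventually_elim
    case (elim \<omega>)
    show ?case
    proof
      assume "x \<omega> = y \<omega>"
      then have "\<omega> \<in> E" using elim unfolding E_def by simp
      from gE[OF this, of "\<lambda>k. f (z k)"] elim show "f x \<omega> = f y \<omega>" unfolding z_def by simp
    qed
  qed
qed

text \<open>Locality of \<open>f\<close> makes the membership of \<open>f x\<close> in
  \<open>Q\<close> a local family of events in \<open>x\<close>. The event chosen in
  \<open>cpreimage\<close> is its maximal event, so the preimage has the form treated in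
  \<open>local_events_presents\<close>.\<close>

lemma cpreimage_cmem:
  fixes f :: "('a \<Rightarrow> 'b::euclidean_space) \<Rightarrow> 'a \<Rightarrow> 'c::euclidean_space"
  assumes f: "stable_fun M (L0 M) (L0 M) f" and Q: "Q \<in> cond_subsets M (L0 M)"
  shows "cpreimage M (L0 M) (L0 M) f Q \<in> cond_subsets M (L0 M)"
    and "x \<in> L0 M \<Longrightarrow> AE \<omega> in M. \<omega> \<in> cmem M (cpreimage M (L0 M) (L0 M) f Q) x \<longleftrightarrow> \<omega> \<in> cmem M Q (f x)"
proof -
  let ?\<phi> = "\<lambda>x. cmem M Q (f x)"
  let ?W = "cset M (L0 M) Q" and ?A = "cdom M (L0 M) Q"
  note pQ = presents_cset[OF Q]
  have fL: "f x \<in> L0 M" if "x \<in> L0 M" for x using f that unfolding stable_fun_def by auto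
  have loc: "local_events M ?\<phi>" unfolding local_events_def
  proof (intro conjI ballI)
    fix x y :: "'a \<Rightarrow> 'b" assume x: "x \<in> L0 M" and y: "y \<in> L0 M"
    show "AE \<omega> in M. x \<omega> = y \<omega> \<longrightarrow> (\<omega> \<in> ?\<phi> x \<longleftrightarrow> \<omega> \<in> ?\<phi> y)"
      using cmem_local[OF Q fL[OF x] fL[OF y]] stable_fun_local[OF f x y] by eventually_elim blast
  qed (use Q fL in auto)
  have mem_iff: "(AE \<omega> in M. \<omega> \<in> B \<longrightarrow> \<omega> \<in> ?A) \<and> rst M y B \<in> restr M ?W B \<longleftrightarrow> (AE \<omega> in M. \<omega> \<in> B \<longrightarrow> \<omega> \<in> cmem M Q y)"
    if y: "y \<in> L0 M" for B y
  proof
    assume a: "(AE \<omega> in M. \<omega> \<in> B \<longrightarrow> \<omega> \<in> ?A) \<and> rst M y B \<in> restr M ?W B"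
    then obtain w where w: "w \<in> ?W" "AE \<omega> in M. \<omega> \<in> B \<longrightarrow> y \<omega> = w \<omega>" unfolding rst_in_restr_iff by blast
    have "AE \<omega> in M. \<omega> \<in> B \<longrightarrow> \<omega> \<in> ?A" using a by blast
    then show "AE \<omega> in M. \<omega> \<in> B \<longrightarrow> \<omega> \<in> cmem M Q y"
      using w(2) cmem_char(3)[OF pQ y w(1)] by eventually_elim blast
  next
    assume a: "AE \<omega> in M. \<omega> \<in> B \<longrightarrow> \<omega> \<in> cmem M Q y"
    obtain w where w: "w \<in> ?W" "AE \<omega> in M. \<omega> \<in> cmem M Q y \<longrightarrow> \<omega> \<in> ?A \<and> y \<omega> = w \<omega>"
      using cmem_char(2)[OF pQ y] by blast
    have "AE \<omega> in M. \<omega> \<in> B \<longrightarrow> \<omega> \<in> ?A" "AE \<omega> in M. \<omega> \<in> B \<longrightarrow> y \<omega> = w \<omega>"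
      using a w(2) by (eventually_elim; blast)+
    then show "(AE \<omega> in M. \<omega> \<in> B \<longrightarrow> \<omega> \<in> ?A) \<and> rst M y B \<in> restr M ?W B"
      using w(1) unfolding rst_in_restr_iff by blast
  qed
  obtain D x0 where D: "D \<in> sets M" "x0 \<in> L0 M" "AE \<omega> in M. \<omega> \<in> D \<longleftrightarrow> \<omega> \<in> ?\<phi> x0"
    "\<And>x. x \<in> L0 M \<Longrightarrow> AE \<omega> in M. \<omega> \<in> ?\<phi> x \<longrightarrow> \<omega> \<in> D" using local_events_max[OF loc] by blast
  have D3: "AE \<omega> in M. \<omega> \<in> D \<longrightarrow> \<omega> \<in> ?\<phi> x0" using D(3) by eventually_elim blast
  define \<A> where "\<A> = {A' \<in> sets M. ae_subset M A' ?A \<and> (\<exists>x\<in>L0 M. rst M (f x) A' \<in> restr M ?W A')}"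
  define C where "C = ess_Sup_sets M \<A>"
  have AA: "A' \<in> \<A> \<longleftrightarrow> A' \<in> sets M \<and> (\<exists>x\<in>L0 M. AE \<omega> in M. \<omega> \<in> A' \<longrightarrow> \<omega> \<in> ?\<phi> x)" for A'
    unfolding \<A>_def ae_subset_def using mem_iff[OF fL, of _ A'] by blast
  have DA: "D \<in> \<A>" unfolding AA using D(1,2) D3 by blast
  have AM: "\<A> \<subseteq> sets M" unfolding \<A>_def by auto
  have Dmax: "ae_subset M A' D" if A': "A' \<in> \<A>" for A'
  proof -
    obtain x where x: "x \<in> L0 M" "AE \<omega> in M. \<omega> \<in> A' \<longrightarrow> \<omega> \<in> ?\<phi> x" using A' AA by blast
    show ?thesis unfolding ae_subset_def using x(2) D(4)[OF x(1)] by eventually_elim blast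
  qed
  have C: "C \<in> sets M" "AE \<omega> in M. \<omega> \<in> C \<longleftrightarrow> \<omega> \<in> D"
    unfolding C_def using ess_Sup_sets_eq[OF DA AM Dmax] by auto
  have C3: "AE \<omega> in M. \<omega> \<in> C \<longrightarrow> \<omega> \<in> ?\<phi> x0" using C(2) D3 by eventually_elim blast
  have C4: "AE \<omega> in M. \<omega> \<in> ?\<phi> x \<longrightarrow> \<omega> \<in> C" if "x \<in> L0 M" for x
    using C(2) D(4)[OF that] by eventually_elim blast
  have CA: "AE \<omega> in M. \<omega> \<in> C \<longrightarrow> \<omega> \<in> ?A"
    using C3 cmem_subset_dom[OF pQ fL[OF D(2)]] by eventually_elim blast
  have "{x \<in> L0 M. rst M (f x) C \<in> restr M ?W C} = {x \<in> L0 M. AE \<omega> in M. \<omega> \<in> C \<longrightarrow> \<omega> \<in> ?\<phi> x}"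
    using mem_iff[OF fL, of _ C] CA by blast
  then have eq: "cpreimage M (L0 M) (L0 M) f Q = restr M {x \<in> L0 M. AE \<omega> in M. \<omega> \<in> C \<longrightarrow> \<omega> \<in> ?\<phi> x} C"
    unfolding cpreimage_def Let_def C_def \<A>_def by simp
  note lp = local_events_presents[OF loc C(1) D(2) C3 C4]
  show "cpreimage M (L0 M) (L0 M) f Q \<in> cond_subsets M (L0 M)"
    unfolding eq using lp(1) cond_subsets_iff by blast
  show "x \<in> L0 M \<Longrightarrow> AE \<omega> in M. \<omega> \<in> cmem M (cpreimage M (L0 M) (L0 M) f Q) x \<longleftrightarrow> \<omega> \<in> cmem M Q (f x)"
    unfolding eq using lp(2) by blast
qed

lemma cindicator_eq: "cindicator M (L0 M) P x = indicator (cmem M P x)"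
  unfolding cindicator_def cmem_def ..

end

section \<open>The stable Borel algebra\<close>

definition sec :: "'w measure \<Rightarrow> ('w \<times> 'b) set \<Rightarrow> ('w \<Rightarrow> 'b) \<Rightarrow> 'w set"
  where "sec M B x = {\<omega>\<in>space M. (\<omega>, x \<omega>) \<in> B}"

text \<open>Not injective: two sets induce the same conditional set when they differ only where no
  graph of a random variable goes on a non-null event. Values attached to \<open>B\<close> must
  therefore be shown to depend on \<open>cgraph M B\<close> alone.\<close>

definition cgraph :: "'w measure \<Rightarrow> ('w \<times> 'b::euclidean_space) set \<Rightarrow> ('w, 'b) condset"
  where "cgraph M B = cset_of M (sec M B)"

lemma sec_measurable [measurable]:
  "B \<in> sets (M \<Otimes>\<^sub>M borel) \<Longrightarrow> x \<in> borel_measurable M \<Longrightarrow> sec M B x \<in> sets M"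
proof -
  assume "B \<in> sets (M \<Otimes>\<^sub>M borel)" "x \<in> borel_measurable M"
  then have "(\<lambda>\<omega>. (\<omega>, x \<omega>)) -` B \<inter> space M \<in> sets M" by measurable
  moreover have "(\<lambda>\<omega>. (\<omega>, x \<omega>)) -` B \<inter> space M = sec M B x" by (auto simp: sec_def)
  ultimately show "sec M B x \<in> sets M" by simp
qed

text \<open>Both projections are measurable for \<open>T\<close>, hence so is the identity map into
  the product; open sets suffice in the second factor.\<close>

lemma pair_borel_subset:
  assumes sig: "sigma_algebra (space (M \<Otimes>\<^sub>M (borel :: 'b::euclidean_space measure))) T"
    and fst: "\<And>A. A \<in> sets M \<Longrightarrow> A \<times> UNIV \<in> T"
    and snd: "\<And>U. open U \<Longrightarrow> space M \<times> U \<in> T"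
  shows "sets (M \<Otimes>\<^sub>M (borel :: 'b measure)) \<subseteq> T"
proof
  let ?\<Omega> = "space (M \<Otimes>\<^sub>M (borel :: 'b measure))" and ?S = "sigma (space (M \<Otimes>\<^sub>M (borel :: 'b measure))) T"
  have T: "sets ?S = T" using sig by (metis sigma_algebra.sets_measure_of_eq)
  have sp: "space ?S = ?\<Omega>" using sig by (simp add: space_measure_of_conv)
  have f: "fst \<in> measurable ?S M"
  proof (rule measurableI)
    fix A assume A: "A \<in> sets M"
    have "fst -` A \<inter> space ?S = A \<times> UNIV"
      using sets.sets_into_space[OF A] unfolding sp by (auto simp: space_pair_measure)
    then show "fst -` A \<inter> space ?S \<in> sets ?S" using fst[OF A] T by simp
  qed (simp only: sp, auto simp: space_pair_measure)
  have s: "snd \<in> borel_measurable ?S"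
  proof (rule borel_measurableI)
    fix U :: "'b set" assume U: "open U"
    have "snd -` U \<inter> space ?S = space M \<times> U" unfolding sp by (auto simp: space_pair_measure)
    then show "snd -` U \<inter> space ?S \<in> sets ?S" using snd[OF U] T by simp
  qed
  fix B assume B: "B \<in> sets (M \<Otimes>\<^sub>M (borel :: 'b measure))"
  have "(\<lambda>p. (fst p, snd p)) -` B \<inter> space ?S = B" using sets.sets_into_space[OF B] unfolding sp by auto
  with measurable_sets[OF measurable_Pair[OF f s] B] show "B \<in> T" unfolding T by simp
qed

context prob_space
begin

lemma local_events_sec: "B \<in> sets (M \<Otimes>\<^sub>M borel) \<Longrightarrow> local_events M (sec M B)"
  unfolding local_events_def by (auto simp: sec_def intro!: AE_I2 sec_measurable[unfolded sec_def])

lemma cgraph_cond_subsets [simp]: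
  "B \<in> sets (M \<Otimes>\<^sub>M borel) \<Longrightarrow> cgraph M B \<in> cond_subsets M (L0 M)"
  unfolding cgraph_def by (intro cset_of local_events_sec)

lemma cmem_cgraph:
  assumes "B \<in> sets (M \<Otimes>\<^sub>M borel)" "x \<in> L0 M"
  shows "AE \<omega> in M. \<omega> \<in> cmem M (cgraph M B) x \<longleftrightarrow> (\<omega>, x \<omega>) \<in> B"
  using cset_of(2)[OF local_events_sec[OF assms(1)] assms(2)] AE_space
  unfolding cgraph_def by eventually_elim (simp add: sec_def)

text \<open>The common tool for showing that \<open>cgraph\<close> commutes with the operations:
  each identity is reduced to a comparison of events for one \<open>x\<close>.\<close>

lemma cgraph_eqI:
  fixes P :: "('a, 'b::euclidean_space) condset"
  assumes "P \<in> cond_subsets M (L0 M)" "B \<in> sets (M \<Otimes>\<^sub>M borel)"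
    and "\<And>x. x \<in> L0 M \<Longrightarrow> AE \<omega> in M. \<omega> \<in> cmem M P x \<longleftrightarrow> (\<omega>, x \<omega>) \<in> B"
  shows "P = cgraph M B"
proof (rule cond_subsets_eqI[OF assms(1) cgraph_cond_subsets[OF assms(2)]])
  fix x :: "'a \<Rightarrow> 'b" assume x: "x \<in> L0 M"
  show "AE \<omega> in M. \<omega> \<in> cmem M P x \<longleftrightarrow> \<omega> \<in> cmem M (cgraph M B) x"
    using assms(3)[OF x] cmem_cgraph[OF assms(2) x] by eventually_elim blast
qed

lemma cgraph_top: "ctop M (L0 M) = cgraph M (space (M \<Otimes>\<^sub>M (borel :: 'b::euclidean_space measure)))"
proof (rule cgraph_eqI[OF ctop_cmem(1)])
  fix x :: "'a \<Rightarrow> 'b" assume x: "x \<in> L0 M"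
  show "AE \<omega> in M. \<omega> \<in> cmem M (ctop M (L0 M)) x \<longleftrightarrow> (\<omega>, x \<omega>) \<in> space (M \<Otimes>\<^sub>M (borel :: 'b measure))"
    using ctop_cmem(2)[OF x] AE_space by eventually_elim (simp add: space_pair_measure)
qed simp

lemma cgraph_compl:
  fixes B :: "('a \<times> 'b::euclidean_space) set"
  assumes B: "B \<in> sets (M \<Otimes>\<^sub>M borel)"
  shows "ccompl M (L0 M) (cgraph M B) = cgraph M (space (M \<Otimes>\<^sub>M borel) - B)"
proof (rule cgraph_eqI)
  show "ccompl M (L0 M) (cgraph M B) \<in> cond_subsets M (L0 M)" using B by (intro ccompl_cmem) simp
  show "space (M \<Otimes>\<^sub>M borel) - B \<in> sets (M \<Otimes>\<^sub>M borel)" using B by auto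
  fix x :: "'a \<Rightarrow> 'b" assume x: "x \<in> L0 M"
  show "AE \<omega> in M. \<omega> \<in> cmem M (ccompl M (L0 M) (cgraph M B)) x \<longleftrightarrow> (\<omega>, x \<omega>) \<in> space (M \<Otimes>\<^sub>M borel) - B"
    using ccompl_cmem(2)[OF cgraph_cond_subsets[OF B] x] cmem_cgraph[OF B x] AE_space
    by eventually_elim (simp add: space_pair_measure)
qed

lemma cgraph_Union:
  fixes B :: "nat \<Rightarrow> ('a \<times> 'b::euclidean_space) set"
  assumes B: "\<And>k. B k \<in> sets (M \<Otimes>\<^sub>M borel)"
  shows "cSup M (L0 M) (range (\<lambda>k. cgraph M (B k))) = cgraph M (\<Union>k. B k)"
proof (rule cgraph_eqI)
  have c: "countable (range (\<lambda>k. cgraph M (B k)))" by simp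
  have C: "range (\<lambda>k. cgraph M (B k)) \<subseteq> cond_subsets M (L0 M)" using B by auto
  show "cSup M (L0 M) (range (\<lambda>k. cgraph M (B k))) \<in> cond_subsets M (L0 M)" by (rule cSup_cmem(1)[OF c C])
  show "(\<Union>k. B k) \<in> sets (M \<Otimes>\<^sub>M borel)" using B by auto
  fix x :: "'a \<Rightarrow> 'b" assume x: "x \<in> L0 M"
  have "AE \<omega> in M. \<forall>k. \<omega> \<in> cmem M (cgraph M (B k)) x \<longleftrightarrow> (\<omega>, x \<omega>) \<in> B k"
    unfolding AE_all_countable using cmem_cgraph[OF B x] by blast
  with cSup_cmem(2)[OF c C x]
  show "AE \<omega> in M. \<omega> \<in> cmem M (cSup M (L0 M) (range (\<lambda>k. cgraph M (B k)))) x \<longleftrightarrow> (\<omega>, x \<omega>) \<in> (\<Union>k. B k)"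
    by eventually_elim blast
qed

lemma cgraph_glue:
  fixes B :: "nat \<Rightarrow> ('a \<times> 'b::euclidean_space) set"
  assumes A: "partition_of M A" and B: "\<And>k. B k \<in> sets (M \<Otimes>\<^sub>M borel)"
  shows "cglue M (L0 M) A (\<lambda>k. cgraph M (B k)) = cgraph M (\<Union>k. (A k \<times> UNIV) \<inter> B k)"
proof (rule cgraph_eqI)
  have [measurable]: "A k \<in> sets M" for k using A unfolding partition_of_def by auto
  note cg = cglue_cmem[OF A, of "\<lambda>k. cgraph M (B k)", OF cgraph_cond_subsets[OF B]]
  show "cglue M (L0 M) A (\<lambda>k. cgraph M (B k)) \<in> cond_subsets M (L0 M)" by (rule cg)
  have "A k \<times> (UNIV :: 'b set) \<in> sets (M \<Otimes>\<^sub>M borel)" for k by (intro pair_measureI) auto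
  then show "(\<Union>k. (A k \<times> UNIV) \<inter> B k) \<in> sets (M \<Otimes>\<^sub>M borel)" using B by auto
  fix x :: "'a \<Rightarrow> 'b" assume x: "x \<in> L0 M"
  have "AE \<omega> in M. \<forall>k. \<omega> \<in> cmem M (cgraph M (B k)) x \<longleftrightarrow> (\<omega>, x \<omega>) \<in> B k"
    unfolding AE_all_countable using cmem_cgraph[OF B x] by blast
  with cg(2)[OF x]
  show "AE \<omega> in M. \<omega> \<in> cmem M (cglue M (L0 M) A (\<lambda>k. cgraph M (B k))) x \<longleftrightarrow>
      (\<omega>, x \<omega>) \<in> (\<Union>k. (A k \<times> UNIV) \<inter> B k)"
    by eventually_elim blast
qed

text \<open>One half of the identification of \<open>stable_borel\<close>: the algebra generated by
  balls cannot exceed the induced conditional sets. Inducing sets for a sequence are picked by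
  choice, and the operations are then carried out in the product.\<close>

lemma stable_sigma_algebra_cgraph:
  "stable_sigma_algebra M (L0 M) (cgraph M ` sets (M \<Otimes>\<^sub>M (borel :: 'b::euclidean_space measure)))"
  (is "stable_sigma_algebra M _ ?X")
  unfolding stable_sigma_algebra_def stable_collection_def
proof (intro conjI allI impI ballI)
  have ex: "\<exists>B. (\<forall>k. P k = cgraph M (B k)) \<and> (\<forall>k. B k \<in> sets (M \<Otimes>\<^sub>M borel))"
    if "\<forall>k. P k \<in> ?X" for P :: "nat \<Rightarrow> ('a, 'b) condset"
  proof -
    have "\<forall>k. \<exists>B. P k = cgraph M B \<and> B \<in> sets (M \<Otimes>\<^sub>M borel)" using that by blast
    from choice[OF this] show ?thesis by blast
  qed
  show "?X \<subseteq> cond_subsets M (L0 M)" by auto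
  show "?X \<noteq> {}" using sets.sets_Collect_const by blast
  show "ctop M (L0 M) \<in> ?X" unfolding cgraph_top by blast
  show "ccompl M (L0 M) P \<in> ?X" if "P \<in> ?X" for P :: "('a, 'b) condset"
    using that by (auto simp: cgraph_compl)
  show "cglue M (L0 M) A P \<in> ?X" if A: "partition_of M A" and P: "\<forall>k. P k \<in> ?X"
    for A and P :: "nat \<Rightarrow> ('a, 'b) condset"
  proof -
    obtain B where B: "\<And>k. P k = cgraph M (B k)" "\<And>k. B k \<in> sets (M \<Otimes>\<^sub>M borel)" using ex[OF P] by blast
    have [measurable]: "A k \<in> sets M" for k using A unfolding partition_of_def by auto
    have "A k \<times> (UNIV :: 'b set) \<in> sets (M \<Otimes>\<^sub>M borel)" for k by (intro pair_measureI) auto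
    then have "(\<Union>k. (A k \<times> UNIV) \<inter> B k) \<in> sets (M \<Otimes>\<^sub>M borel)" using B by auto
    moreover have "P = (\<lambda>k. cgraph M (B k))" using B(1) by auto
    ultimately show ?thesis using cgraph_glue[of A B, OF A B(2)] by simp
  qed
  show "cSup M (L0 M) (range P) \<in> ?X" if P: "\<forall>k. P k \<in> ?X" for P :: "nat \<Rightarrow> ('a, 'b) condset"
  proof -
    obtain B where B: "\<And>k. P k = cgraph M (B k)" "\<And>k. B k \<in> sets (M \<Otimes>\<^sub>M borel)" using ex[OF P] by blast
    have "P = (\<lambda>k. cgraph M (B k))" using B(1) by auto
    moreover have "(\<Union>k. B k) \<in> sets (M \<Otimes>\<^sub>M borel)" using B by auto
    ultimately show ?thesis using cgraph_Union[OF B(2)] by simp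
  qed
qed

text \<open>For sets defined by an almost sure pointwise condition. Non-emptiness is essential: it
  supplies a function realising the full domain \<open>space M\<close>.\<close>

lemma restr_space_cmem:
  fixes V :: "('a \<Rightarrow> 'b::euclidean_space) set"
  assumes V: "V \<subseteq> L0 M" "V \<noteq> {}" and B: "B \<in> sets (M \<Otimes>\<^sub>M borel)"
    and eq: "\<And>x. x \<in> L0 M \<Longrightarrow> x \<in> V \<longleftrightarrow> (AE \<omega> in M. (\<omega>, x \<omega>) \<in> B)"
  shows "restr M V (space M) = cgraph M B"
proof -
  have Veq: "V = {x\<in>L0 M. AE \<omega> in M. \<omega> \<in> space M \<longrightarrow> \<omega> \<in> sec M B x}"
    using V eq by (auto simp: sec_def AE_conj_iff)
  obtain x0 where x0: "x0 \<in> V" using V by blast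
  have x0': "x0 \<in> L0 M" using x0 V by auto
  have s1: "AE \<omega> in M. \<omega> \<in> space M \<longrightarrow> \<omega> \<in> sec M B x0" using x0 unfolding Veq by blast
  have s2: "AE \<omega> in M. \<omega> \<in> sec M B x \<longrightarrow> \<omega> \<in> space M" if "x \<in> L0 M" for x
    by (auto simp: sec_def)
  note lp = local_events_presents[OF local_events_sec[OF B] sets.top x0' s1, folded Veq]
  show ?thesis
  proof (rule cgraph_eqI[OF _ B])
    show "restr M V (space M) \<in> cond_subsets M (L0 M)" using lp(1) s2 cond_subsets_iff by blast
    fix x :: "'a \<Rightarrow> 'b" assume x: "x \<in> L0 M"
    show "AE \<omega> in M. \<omega> \<in> cmem M (restr M V (space M)) x \<longleftrightarrow> (\<omega>, x \<omega>) \<in> B"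
      using lp(2)[OF s2 x, simplified] AE_space by eventually_elim (simp add: sec_def)
  qed
qed

lemma stable_ball_cgraph:
  fixes x :: "'a \<Rightarrow> 'b::euclidean_space"
  assumes x [measurable]: "x \<in> L0 M" and r: "r \<in> L0_pp M"
  shows "restr M (stable_ball M x r) (space M) =
           cgraph M {p \<in> space (M \<Otimes>\<^sub>M borel). norm (x (fst p) - snd p) < r (fst p)}"
proof (rule restr_space_cmem)
  have [measurable]: "r \<in> L0 M" using r unfolding L0_pp_def by auto
  show "stable_ball M x r \<subseteq> L0 M" unfolding stable_ball_def by auto
  have "x \<in> stable_ball M x r" using r unfolding stable_ball_def L0_pp_def by simp
  then show "stable_ball M x r \<noteq> {}" by blast
  show "{p \<in> space (M \<Otimes>\<^sub>M borel). norm (x (fst p) - snd p) < r (fst p)} \<in> sets (M \<Otimes>\<^sub>M borel)"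
    by measurable
  fix y :: "'a \<Rightarrow> 'b" assume y: "y \<in> L0 M"
  have "(AE \<omega> in M. norm (x \<omega> - y \<omega>) < r \<omega>) \<longleftrightarrow>
      (AE \<omega> in M. (\<omega>, y \<omega>) \<in> {p \<in> space (M \<Otimes>\<^sub>M borel). norm (x (fst p) - snd p) < r (fst p)})"
    by (intro AE_cong) (simp add: space_pair_measure)
  with y show "y \<in> stable_ball M x r \<longleftrightarrow>
      (AE \<omega> in M. (\<omega>, y \<omega>) \<in> {p \<in> space (M \<Otimes>\<^sub>M borel). norm (x (fst p) - snd p) < r (fst p)})"
    unfolding stable_ball_def by blast
qed

lemma stable_sigma_algebraD:
  assumes "stable_sigma_algebra M X \<X>"
  shows "\<X> \<subseteq> cond_subsets M X" "ctop M X \<in> \<X>"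
    "\<And>P. P \<in> \<X> \<Longrightarrow> ccompl M X P \<in> \<X>"
    "\<And>P :: nat \<Rightarrow> _. (\<And>k. P k \<in> \<X>) \<Longrightarrow> cSup M X (range P) \<in> \<X>"
    "\<And>A P. partition_of M A \<Longrightarrow> (\<And>k. P k \<in> \<X>) \<Longrightarrow> cglue M X A P \<in> \<X>"
  using assms unfolding stable_sigma_algebra_def stable_collection_def by simp_all

lemma stable_sigma_algebraI:
  assumes "\<X> \<subseteq> cond_subsets M X" "ctop M X \<in> \<X>"
    "\<And>P. P \<in> \<X> \<Longrightarrow> ccompl M X P \<in> \<X>"
    "\<And>P :: nat \<Rightarrow> _. (\<And>k. P k \<in> \<X>) \<Longrightarrow> cSup M X (range P) \<in> \<X>"
    "\<And>A P. partition_of M A \<Longrightarrow> (\<And>k. P k \<in> \<X>) \<Longrightarrow> cglue M X A P \<in> \<X>"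
  shows "stable_sigma_algebra M X \<X>"
  using assms unfolding stable_sigma_algebra_def stable_collection_def by auto

text \<open>An intersection over no algebra at all would be the universal set; \<open>\<Y>\<close>
  keeps the intersection inside \<open>cond_subsets M X\<close>.\<close>

lemma stable_sigma_algebra_generated:
  assumes Y: "stable_sigma_algebra M X \<Y>" "\<G> \<subseteq> \<Y>"
  shows "stable_sigma_algebra M X (generated_stable_sigma M X \<G>)"
  unfolding generated_stable_sigma_def
proof (rule stable_sigma_algebraI)
  let ?S = "{\<X>. stable_sigma_algebra M X \<X> \<and> \<G> \<subseteq> \<X>}"
  show "\<Inter>?S \<subseteq> cond_subsets M X" using Y stable_sigma_algebraD(1)[OF Y(1)] by (intro Inf_lower2[OF _ stable_sigma_algebraD(1)[OF Y(1)]]) auto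
  show "ctop M X \<in> \<Inter>?S" using stable_sigma_algebraD(2) by (intro InterI) auto
  show "ccompl M X P \<in> \<Inter>?S" if "P \<in> \<Inter>?S" for P
    using that stable_sigma_algebraD(3) by (intro InterI) auto
  show "cSup M X (range P) \<in> \<Inter>?S" if P: "\<And>k. P k \<in> \<Inter>?S" for P :: "nat \<Rightarrow> _"
  proof (intro InterI)
    fix \<X> assume X: "\<X> \<in> ?S"
    then have "P k \<in> \<X>" for k using P[of k] by (rule InterD[rotated])
    with X show "cSup M X (range P) \<in> \<X>" by (intro stable_sigma_algebraD(4)) auto
  qed
  show "cglue M X A P \<in> \<Inter>?S" if A: "partition_of M A" and P: "\<And>k. P k \<in> \<Inter>?S" for A P
  proof (intro InterI)
    fix \<X> assume X: "\<X> \<in> ?S"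
    then have "P k \<in> \<X>" for k using P[of k] by (rule InterD[rotated])
    with X A show "cglue M X A P \<in> \<X>" by (intro stable_sigma_algebraD(5)) auto
  qed
qed

lemma generated_stable_sigma_subset: "\<G> \<subseteq> generated_stable_sigma M X \<G>"
  unfolding generated_stable_sigma_def by auto

lemma stable_borel_facts:
  shows "stable_borel M \<subseteq> cgraph M ` sets (M \<Otimes>\<^sub>M (borel :: 'b::euclidean_space measure))" (is ?th1)
    and "stable_sigma_algebra M (L0 M) (stable_borel M :: ('a, 'b) condset set)" (is ?th2)
    and "\<And>(x :: 'a \<Rightarrow> 'b) r. x \<in> L0 M \<Longrightarrow> r \<in> L0_pp M \<Longrightarrow>
           restr M (stable_ball M x r) (space M) \<in> stable_borel M"
proof -
  let ?G = "{restr M (stable_ball M x r) (space M) | x r. x \<in> (L0 M :: ('a \<Rightarrow> 'b) set) \<and> r \<in> L0_pp M}"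
  have G: "?G \<subseteq> cgraph M ` sets (M \<Otimes>\<^sub>M (borel :: 'b measure))"
  proof
    fix P assume "P \<in> ?G"
    then obtain x r where xr: "P = restr M (stable_ball M x r) (space M)" "x \<in> L0 M" "r \<in> L0_pp M" by blast
    have [measurable]: "r \<in> L0 M" using xr unfolding L0_pp_def by auto
    have [measurable]: "x \<in> L0 M" by fact
    have "{p \<in> space (M \<Otimes>\<^sub>M borel). norm (x (fst p) - snd p) < r (fst p)} \<in> sets (M \<Otimes>\<^sub>M borel)"
      by measurable
    then show "P \<in> cgraph M ` sets (M \<Otimes>\<^sub>M (borel :: 'b measure))"
      using stable_ball_cgraph[OF xr(2,3)] xr(1) by blast
  qed
  show ?th1 unfolding stable_borel_def generated_stable_sigma_def
    using stable_sigma_algebra_cgraph G by (intro Inter_lower) blast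
  show ?th2 unfolding stable_borel_def
    by (rule stable_sigma_algebra_generated[OF stable_sigma_algebra_cgraph G])
  show "\<And>(x :: 'a \<Rightarrow> 'b) r. x \<in> L0 M \<Longrightarrow> r \<in> L0_pp M \<Longrightarrow>
           restr M (stable_ball M x r) (space M) \<in> stable_borel M"
    unfolding stable_borel_def by (rule subsetD[OF generated_stable_sigma_subset]) blast
qed

text \<open>Balls with rational radii around a countable dense set. A radius below
  \<open>e / 2\<close> lets the ball around a nearby dense point contain \<open>x\<close> and stay
  inside \<open>ball x e\<close>.\<close>

lemma open_countable_balls:
  fixes U :: "'b::euclidean_space set"
  assumes "open U"
  obtains F where "countable F" "F \<subseteq> {ball q r | q r. 0 < r}" "U = \<Union>F"
proof -
  obtain D :: "'b set" where D: "countable D" "\<And>X. open X \<Longrightarrow> X \<noteq> {} \<Longrightarrow> \<exists>d\<in>D. d \<in> X"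
    using countable_dense_exists by blast
  define F where "F = {ball q r | q r. q \<in> D \<and> r \<in> \<rat> \<and> 0 < r \<and> ball q r \<subseteq> U}"
  have "F \<subseteq> (\<lambda>(q, r). ball q r) ` (D \<times> \<rat>)" unfolding F_def by auto
  then have "countable F"
    using D(1) countable_rat by (meson countable_SIGMA countable_image countable_subset)
  moreover have "U \<subseteq> \<Union>F"
  proof
    fix x assume "x \<in> U"
    then obtain e where e: "0 < e" "ball x e \<subseteq> U" using assms by (meson openE)
    obtain r where r: "r \<in> \<rat>" "0 < r" "r < e / 2"
      using Rats_dense_in_real[of 0 "e/2"] e by auto
    obtain q where q: "q \<in> D" "q \<in> ball x r" using D(2)[of "ball x r"] r by auto
    have "ball q r \<subseteq> ball x e"
    proof
      fix z assume "z \<in> ball q r"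
      then have "dist q z < r" by simp
      moreover have "dist x z \<le> dist x q + dist q z" by (rule dist_triangle)
      ultimately show "z \<in> ball x e" using q r by simp
    qed
    then have "ball q r \<in> F" unfolding F_def using q r e by blast
    moreover have "x \<in> ball q r" using q by (simp add: dist_commute)
    ultimately show "x \<in> \<Union>F" by blast
  qed
  moreover have "\<Union>F \<subseteq> U" unfolding F_def by auto
  ultimately show thesis using that[of F] unfolding F_def by blast
qed

text \<open>For the remaining inclusion, the sets inducing members of \<open>stable_borel M\<close>
  form a sigma-algebra. Balls with constant centre and radius bring in
  \<open>space M \<times> U\<close> for open \<open>U\<close>, and gluing the whole space over
  \<open>A\<close> with the empty set elsewhere brings in the cylinders.\<close>

lemma stable_borel_eq:
  "stable_borel M = cgraph M ` sets (M \<Otimes>\<^sub>M (borel :: 'b::euclidean_space measure))"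
proof
  show "stable_borel M \<subseteq> cgraph M ` sets (M \<Otimes>\<^sub>M (borel :: 'b measure))" by (rule stable_borel_facts)
next
  let ?\<Omega> = "space (M \<Otimes>\<^sub>M (borel :: 'b measure))"
  define \<T> where "\<T> = {B \<in> sets (M \<Otimes>\<^sub>M (borel :: 'b measure)). cgraph M B \<in> stable_borel M}"
  note sb = stable_sigma_algebraD[OF stable_borel_facts(2)[where 'b = 'b]]
  have top: "?\<Omega> \<in> \<T>" unfolding \<T>_def using sb(2) by (simp add: cgraph_top)
  have compl: "?\<Omega> - B \<in> \<T>" if "B \<in> \<T>" for B
    using that sb(3)[of "cgraph M B"] unfolding \<T>_def by (simp add: cgraph_compl sets.compl_sets)
  have un: "(\<Union>k. B k) \<in> \<T>" if "range B \<subseteq> \<T>" for B :: "nat \<Rightarrow> _"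
  proof -
    have B: "B k \<in> sets (M \<Otimes>\<^sub>M borel)" "cgraph M (B k) \<in> stable_borel M" for k
      using that unfolding \<T>_def by auto
    have "cSup M (L0 M) (range (\<lambda>k. cgraph M (B k))) \<in> stable_borel M" using B(2) by (rule sb(4))
    then show ?thesis using B(1) unfolding cgraph_Union[OF B(1)] \<T>_def by auto
  qed
  have empty: "{} \<in> \<T>" using compl[OF top] by simp
  have sig: "sigma_algebra ?\<Omega> \<T>"
    unfolding sigma_algebra_iff2
  proof (intro conjI ballI allI impI)
    show "\<T> \<subseteq> Pow ?\<Omega>" unfolding \<T>_def using sets.sets_into_space by auto
  qed (use compl un empty in auto)
  have ball: "space M \<times> ball q r \<in> \<T>" if r: "0 < r" for q :: 'b and r
  proof -
    have "(\<lambda>_. r) \<in> L0_pp M" "(\<lambda>_. q) \<in> L0 M" unfolding L0_pp_def using r by auto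
    from stable_borel_facts(3)[OF this(2,1)] stable_ball_cgraph[OF this(2,1)]
    have "cgraph M {p \<in> ?\<Omega>. norm (q - snd p) < r} \<in> stable_borel M" by simp
    moreover have "{p \<in> ?\<Omega>. norm (q - snd p) < r} \<in> sets (M \<Otimes>\<^sub>M borel)" by measurable
    moreover have "{p \<in> ?\<Omega>. norm (q - snd p) < r} = space M \<times> ball q r"
      by (auto simp: dist_norm space_pair_measure)
    ultimately show ?thesis unfolding \<T>_def by simp
  qed
  have "sets (M \<Otimes>\<^sub>M (borel :: 'b measure)) \<subseteq> \<T>"
  proof (rule pair_borel_subset[OF sig])
    fix U :: "'b set" assume "open U"
    then obtain F where F: "countable F" "F \<subseteq> {ball q r | q r. 0 < r}" "U = \<Union>F"
      by (rule open_countable_balls)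
    have "\<Union>((\<lambda>W. space M \<times> W) ` F) \<in> \<T>"
    proof (rule sigma_algebra.countable_Union[OF sig])
      show "(\<lambda>W. space M \<times> W) ` F \<subseteq> \<T>" using F(2) ball by auto
    qed (use F(1) in simp)
    moreover have "\<Union>((\<lambda>W. space M \<times> W) ` F) = space M \<times> U" using F(3) by auto
    ultimately show "space M \<times> U \<in> \<T>" by simp
  next
    fix A assume A: "A \<in> sets M"
    define E where "E = (\<lambda>k::nat. if k = 0 then A else if k = 1 then space M - A else {})"
    have E: "partition_of M E" using A sets.sets_into_space[OF A]
      unfolding partition_of_def disjoint_family_on_def E_def by (auto split: if_splits)
    define B where "B = (\<lambda>k::nat. if k = 0 then ?\<Omega> else {})"
    have B: "B k \<in> \<T>" for k unfolding B_def using top empty by auto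
    have Bs: "B k \<in> sets (M \<Otimes>\<^sub>M borel)" "cgraph M (B k) \<in> stable_borel M" for k
      using B[of k] unfolding \<T>_def by auto
    have "cglue M (L0 M) E (\<lambda>k. cgraph M (B k)) \<in> stable_borel M" using E Bs(2) by (rule sb(5))
    moreover have "(\<Union>k. (E k \<times> UNIV) \<inter> B k) = A \<times> UNIV"
      using sets.sets_into_space[OF A] by (auto simp: E_def B_def space_pair_measure split: if_splits)
    ultimately have "cgraph M (A \<times> (UNIV :: 'b set)) \<in> stable_borel M" unfolding cgraph_glue[OF E Bs(1)] by simp
    moreover have "A \<times> (UNIV :: 'b set) \<in> sets (M \<Otimes>\<^sub>M borel)" using A by (intro pair_measureI) auto
    ultimately show "A \<times> (UNIV :: 'b set) \<in> \<T>" unfolding \<T>_def by auto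
  qed
  then show "cgraph M ` sets (M \<Otimes>\<^sub>M (borel :: 'b measure)) \<subseteq> stable_borel M" unfolding \<T>_def by blast
qed

text \<open>The sets that conditional subsets cannot see. A priori a polar set may have positive
  measure on the product; \<open>polar_null\<close> excludes this for the measure of
  interest.\<close>

definition polar :: "('a \<times> 'b::euclidean_space) set \<Rightarrow> bool"
  where "polar N \<longleftrightarrow> N \<in> sets (M \<Otimes>\<^sub>M borel) \<and> (\<forall>x\<in>L0 M. AE \<omega> in M. (\<omega>, x \<omega>) \<notin> N)"

end

section \<open>The Daniell extension\<close>

text \<open>The constant 1 need not lie in \<open>H\<close>; the link between functions and sets is
  made in \<open>daniell_extension\<close>, by approximating indicators from \<open>H\<close>.
  \<open>I_cont\<close> is the source of countable additivity.\<close>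

locale daniell =
  fixes \<Omega> :: "'p set" and H :: "('p \<Rightarrow> real) set" and I :: "('p \<Rightarrow> real) \<Rightarrow> real"
  assumes zero: "(\<lambda>_. 0) \<in> H"
    and add: "F \<in> H \<Longrightarrow> G \<in> H \<Longrightarrow> (\<lambda>p. F p + G p) \<in> H"
    and scale: "F \<in> H \<Longrightarrow> (\<lambda>p. c * F p) \<in> H"
    and max: "F \<in> H \<Longrightarrow> G \<in> H \<Longrightarrow> (\<lambda>p. max (F p) (G p)) \<in> H"
    and I_add: "F \<in> H \<Longrightarrow> G \<in> H \<Longrightarrow> I (\<lambda>p. F p + G p) = I F + I G"
    and I_scale: "F \<in> H \<Longrightarrow> I (\<lambda>p. c * F p) = c * I F"
    and I_pos: "F \<in> H \<Longrightarrow> (\<And>p. p \<in> \<Omega> \<Longrightarrow> 0 \<le> F p) \<Longrightarrow> 0 \<le> I F"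
    and I_cont: "\<And>F :: nat \<Rightarrow> 'p \<Rightarrow> real. (\<And>n. F n \<in> H) \<Longrightarrow> (\<And>p. p \<in> \<Omega> \<Longrightarrow> decseq (\<lambda>n. F n p)) \<Longrightarrow>
      (\<And>p. p \<in> \<Omega> \<Longrightarrow> (\<lambda>n. F n p) \<longlonglongrightarrow> 0) \<Longrightarrow> (\<lambda>n. I (F n)) \<longlonglongrightarrow> 0"
begin

lemma uminus: "F \<in> H \<Longrightarrow> (\<lambda>p. - F p) \<in> H"
  using scale[of F "-1"] by simp

lemma diff: "F \<in> H \<Longrightarrow> G \<in> H \<Longrightarrow> (\<lambda>p. F p - G p) \<in> H"
  using add[OF _ uminus, of F G] by simp

lemma min: "F \<in> H \<Longrightarrow> G \<in> H \<Longrightarrow> (\<lambda>p. min (F p) (G p)) \<in> H"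
proof -
  assume "F \<in> H" "G \<in> H"
  then have "(\<lambda>p. - max (- F p) (- G p)) \<in> H" by (intro uminus max)
  moreover have "- max (- a) (- b) = min a b" for a b :: real by (auto simp: max_def min_def)
  ultimately show ?thesis by simp
qed

lemma sum: "finite A \<Longrightarrow> (\<And>i. i \<in> A \<Longrightarrow> F i \<in> H) \<Longrightarrow> (\<lambda>p. \<Sum>i\<in>A. F i p) \<in> H"
  by (induction A rule: finite_induct) (auto simp: zero add)

lemma I_zero: "I (\<lambda>_. 0) = 0"
  using I_scale[OF zero, of 0] by simp

lemma I_diff: "F \<in> H \<Longrightarrow> G \<in> H \<Longrightarrow> I (\<lambda>p. F p - G p) = I F - I G"
  using I_add[OF _ uminus, of F G] I_scale[of G "-1"] by simp

lemma I_sum: "finite A \<Longrightarrow> (\<And>i. i \<in> A \<Longrightarrow> F i \<in> H) \<Longrightarrow> I (\<lambda>p. \<Sum>i\<in>A. F i p) = (\<Sum>i\<in>A. I (F i))"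
  by (induction A rule: finite_induct) (auto simp: I_zero I_add sum)

lemma I_mono: "F \<in> H \<Longrightarrow> G \<in> H \<Longrightarrow> (\<And>p. p \<in> \<Omega> \<Longrightarrow> F p \<le> G p) \<Longrightarrow> I F \<le> I G"
  using I_pos[OF diff, of G F] I_diff[of G F] by simp

lemma I_cong: "F \<in> H \<Longrightarrow> G \<in> H \<Longrightarrow> (\<And>p. p \<in> \<Omega> \<Longrightarrow> F p = G p) \<Longrightarrow> I F = I G"
  by (intro antisym I_mono) auto

text \<open>Half-open in the second coordinate, so that differences split into sets of the same kind
  and adjacent ones fit together without overlap.\<close>

definition slab :: "('p \<Rightarrow> real) \<Rightarrow> ('p \<Rightarrow> real) \<Rightarrow> ('p \<times> real) set"
  where "slab F G = {(p, t). p \<in> \<Omega> \<and> F p \<le> t \<and> t < G p}"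

definition ordered :: "('p \<Rightarrow> real) \<Rightarrow> ('p \<Rightarrow> real) \<Rightarrow> bool"
  where "ordered F G \<longleftrightarrow> F \<in> H \<and> G \<in> H \<and> (\<forall>p\<in>\<Omega>. F p \<le> G p)"

text \<open>A measure on \<open>\<Omega> \<times> UNIV\<close> under which \<open>I F\<close> is the
  volume below the graph of \<open>F\<close>. Regions between two functions of \<open>H\<close> are
  available from the start, whereas subsets of \<open>\<Omega>\<close> are not.\<close>

definition undergraph :: "('p \<times> real) measure"
  where "undergraph = extend_measure (\<Omega> \<times> UNIV) {(F, G). ordered F G} (\<lambda>(F, G). slab F G)
           (\<lambda>(F, G). ennreal (I (\<lambda>p. G p - F p)))"

lemma slab_semiring: "semiring_of_sets (\<Omega> \<times> UNIV) {slab F G | F G. ordered F G}"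
  unfolding semiring_of_sets_def semiring_of_sets_axioms_def subset_class_def
proof (intro conjI allI impI)
  let ?S = "{slab F G | F G. ordered F G}"
  show "?S \<subseteq> Pow (\<Omega> \<times> UNIV)" by (auto simp: slab_def)
  have "slab (\<lambda>_. 0) (\<lambda>_. 0) \<in> ?S" using zero unfolding ordered_def by blast
  moreover have "slab (\<lambda>_. 0) (\<lambda>_. 0) = {}" by (auto simp: slab_def)
  ultimately show "{} \<in> ?S" by metis
  fix a b assume "a \<in> ?S" "b \<in> ?S"
  then obtain F G F' G' where a: "a = slab F G" "ordered F G" and b: "b = slab F' G'" "ordered F' G'" by blast
  then have H: "F \<in> H" "G \<in> H" "F' \<in> H" "G' \<in> H" and
    le: "\<And>p. p \<in> \<Omega> \<Longrightarrow> F p \<le> G p" "\<And>p. p \<in> \<Omega> \<Longrightarrow> F' p \<le> G' p"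
    unfolding ordered_def by auto
  \<comment> \<open>The outer \<open>max\<close> keeps the pair ordered where the two intervals miss
    each other; the fibre is empty there.\<close>
  let ?m = "\<lambda>p. max (F p) (F' p)" and ?M = "\<lambda>p. max (max (F p) (F' p)) (min (G p) (G' p))"
  have "a \<inter> b = slab ?m ?M" unfolding a b slab_def by (auto simp: less_max_iff_disj)
  moreover have "ordered ?m ?M" using H unfolding ordered_def by (auto intro!: max min)
  ultimately show "a \<inter> b \<in> ?S" by blast
  \<comment> \<open>The part of the first interval below \<open>F'\<close> and the part from
    \<open>G'\<close> upwards, with boundaries clipped to the range from \<open>F\<close> to
    \<open>G\<close>.\<close>
  let ?A = "\<lambda>p. max (F p) (min (G p) (F' p))" and ?B = "\<lambda>p. min (G p) (max (F p) (G' p))"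
  have "a - b = slab F ?A \<union> slab ?B G"
    unfolding a b slab_def using le by (auto simp: less_max_iff_disj min_le_iff_disj)
  moreover have "slab F ?A \<inter> slab ?B G = {}"
    unfolding slab_def using le by (fastforce simp: less_max_iff_disj min_le_iff_disj)
  moreover have "ordered F ?A" "ordered ?B G"
    using H unfolding ordered_def by (auto intro!: max min)
  ultimately show "\<exists>C\<subseteq>?S. finite C \<and> disjoint C \<and> a - b = \<Union>C"
    by (intro exI[of _ "{slab F ?A, slab ?B G}"]) (auto simp: disjoint_def)
qed

text \<open>Caratheodory's theorem. Fibrewise, countable additivity is that of Lebesgue measure on
  intervals, so the partial sums leave a remainder \<open>R n\<close> in \<open>H\<close> that
  decreases to 0 pointwise; \<open>I_cont\<close> turns this into additivity of
  \<open>I\<close>.\<close>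

lemma undergraph_slab:
  assumes "ordered F G"
  shows "emeasure undergraph (slab F G) = ennreal (I (\<lambda>p. G p - F p))"
proof (rule extend_measure_caratheodory_pair[OF undergraph_def])
  show "ordered F G" by fact
  show "semiring_of_sets (\<Omega> \<times> UNIV) {slab a b | a b. ordered a b}" by (rule slab_semiring)
  show "ennreal (I (\<lambda>p. G p - F p)) = 0" if "ordered F G" "slab F G = {}" for F G
  proof -
    have "G p - F p = 0" if "p \<in> \<Omega>" for p
    proof -
      have "(p, F p) \<notin> slab F G" using \<open>slab F G = {}\<close> by blast
      then have "\<not> F p < G p" using that unfolding slab_def by simp
      then show ?thesis using \<open>ordered F G\<close> that unfolding ordered_def by force
    qed
    then have "I (\<lambda>p. G p - F p) = I (\<lambda>_. 0)"
      using \<open>ordered F G\<close> zero unfolding ordered_def by (intro I_cong diff) auto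
    then show ?thesis by (simp add: I_zero)
  qed
  show "ennreal (I (\<lambda>p. j p - i p)) = ennreal (I (\<lambda>p. l p - k p))"
    if o: "ordered i j" "ordered k l" and eq: "slab i j = slab k l" for i j k l
  proof -
    have "j p - i p = l p - k p" if p: "p \<in> \<Omega>" for p
    proof -
      have "{i p..<j p} = {t. (p, t) \<in> slab i j}" "{k p..<l p} = {t. (p, t) \<in> slab k l}"
        using p by (auto simp: slab_def)
      then have "{i p..<j p} = {k p..<l p}" using eq by simp
      moreover have "i p \<le> j p" "k p \<le> l p" using o p unfolding ordered_def by auto
      \<comment> \<open>Lebesgue measure recovers the length from the fibre, also when the fibre is
        empty and does not determine its end points.\<close>
      ultimately have "emeasure lborel {i p..<j p} = emeasure lborel {k p..<l p}" "i p \<le> j p" "k p \<le> l p"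
        by simp_all
      then show ?thesis by simp
    qed
    then have "I (\<lambda>p. j p - i p) = I (\<lambda>p. l p - k p)"
      using o unfolding ordered_def by (intro I_cong diff) auto
    then show ?thesis by simp
  qed
  show "0 \<le> ennreal (I (\<lambda>p. j p - i p))" for i j by simp
  fix A B :: "nat \<Rightarrow> 'p \<Rightarrow> real" and F G
  assume AB: "\<And>n. ordered (A n) (B n)" and FG: "ordered F G"
    and disj: "disjoint_family (\<lambda>n. slab (A n) (B n))" and un: "(\<Union>i. slab (A i) (B i)) = slab F G"
  have H: "A n \<in> H" "B n \<in> H" "F \<in> H" "G \<in> H" for n using AB[of n] FG unfolding ordered_def by auto
  have le: "\<And>p. p \<in> \<Omega> \<Longrightarrow> A n p \<le> B n p" "\<And>p. p \<in> \<Omega> \<Longrightarrow> F p \<le> G p" for n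
    using AB[of n] FG unfolding ordered_def by auto
  have sums: "(\<lambda>n. B n p - A n p) sums (G p - F p)" if p: "p \<in> \<Omega>" for p
  proof -
    have sl: "{t. (p, t) \<in> slab U V} = {U p..<V p}" for U V using p by (auto simp: slab_def)
    have "disjoint_family (\<lambda>n. {t. (p, t) \<in> slab (A n) (B n)})"
      using disj unfolding disjoint_family_on_def by blast
    moreover have "(\<Union>n. {t. (p, t) \<in> slab (A n) (B n)}) = {t. (p, t) \<in> slab F G}" using un by blast
    ultimately have d: "disjoint_family (\<lambda>n. {A n p..<B n p})" and u: "(\<Union>n. {A n p..<B n p}) = {F p..<G p}"
      unfolding sl by auto
    have "(\<Sum>n. emeasure lborel {A n p..<B n p}) = emeasure lborel {F p..<G p}"
      using suminf_emeasure[OF _ d, of lborel] u by (simp add: image_subset_iff)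
    then have "(\<Sum>n. ennreal (B n p - A n p)) = ennreal (G p - F p)"
      using le[OF p] by simp
    moreover have "0 \<le> B n p - A n p" for n using le(1)[OF p] by simp
    moreover have "(\<lambda>n. ennreal (B n p - A n p)) sums (\<Sum>n. ennreal (B n p - A n p))"
      by (intro summable_sums summableI)
    ultimately show ?thesis using le(2)[OF p] by (subst sums_ennreal[symmetric]) auto
  qed
  define R where "R = (\<lambda>n p. (G p - F p) - (\<Sum>k<n. B k p - A k p))"
  have RH: "R n \<in> H" for n unfolding R_def by (intro diff sum H) auto
  have "(\<lambda>n. I (R n)) \<longlonglongrightarrow> 0"
  proof (rule I_cont[OF RH])
    fix p assume p: "p \<in> \<Omega>"
    show "decseq (\<lambda>n. R n p)" unfolding R_def decseq_Suc_iff using le(1)[OF p] by simp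
    have "(\<lambda>n. (G p - F p) - (\<Sum>k<n. B k p - A k p)) \<longlonglongrightarrow> (G p - F p) - (G p - F p)"
      using sums[OF p] unfolding sums_def by (intro tendsto_diff tendsto_const)
    then show "(\<lambda>n. R n p) \<longlonglongrightarrow> 0" unfolding R_def by simp
  qed
  moreover have "I (R n) = I (\<lambda>p. G p - F p) - (\<Sum>k<n. I (\<lambda>p. B k p - A k p))" for n
  proof -
    have "I (R n) = I (\<lambda>p. G p - F p) - I (\<lambda>p. \<Sum>k<n. B k p - A k p)"
      unfolding R_def by (intro I_diff diff sum H) auto
    also have "I (\<lambda>p. \<Sum>k<n. B k p - A k p) = (\<Sum>k<n. I (\<lambda>p. B k p - A k p))"
      by (intro I_sum diff H) auto
    finally show ?thesis .
  qed
  ultimately have "(\<lambda>n. I (\<lambda>p. G p - F p) - (\<Sum>k<n. I (\<lambda>p. B k p - A k p))) \<longlonglongrightarrow> 0" by simp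
  then have "(\<lambda>n. I (\<lambda>p. G p - F p) - (I (\<lambda>p. G p - F p) - (\<Sum>k<n. I (\<lambda>p. B k p - A k p))))
      \<longlonglongrightarrow> I (\<lambda>p. G p - F p) - 0" by (intro tendsto_diff tendsto_const)
  then have "(\<lambda>n. I (\<lambda>p. B n p - A n p)) sums I (\<lambda>p. G p - F p)" by (simp add: sums_def)
  moreover have "0 \<le> I (\<lambda>p. B n p - A n p)" for n using H le by (intro I_pos diff) auto
  ultimately show "(\<Sum>n. ennreal (I (\<lambda>p. B n p - A n p))) = ennreal (I (\<lambda>p. G p - F p))"
    by (intro suminf_ennreal_eq) auto
qed

lemma sets_undergraph: "sets undergraph = sigma_sets (\<Omega> \<times> UNIV) {slab F G | F G. ordered F G}"
proof -
  have "(\<lambda>(F, G). slab F G) ` {(F, G). ordered F G} = {slab F G | F G. ordered F G}" by auto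
  moreover have "(\<lambda>(F, G). slab F G) ` {(F, G). ordered F G} \<subseteq> Pow (\<Omega> \<times> UNIV)" by (auto simp: slab_def)
  ultimately show ?thesis unfolding undergraph_def by (subst sets_extend_measure) auto
qed

lemma space_undergraph: "space undergraph = \<Omega> \<times> UNIV"
proof -
  have "(\<lambda>(F, G). slab F G) ` {(F, G). ordered F G} \<subseteq> Pow (\<Omega> \<times> UNIV)" by (auto simp: slab_def)
  then show ?thesis unfolding undergraph_def by (subst space_extend_measure) auto
qed

lemma slab_measurable: "ordered F G \<Longrightarrow> slab F G \<in> sets undergraph"
  unfolding sets_undergraph by blast

text \<open>The measure of \<open>B\<close> is the undergraph measure of the cylinder
  \<open>B \<times> {0..<1}\<close>. Cylinders are measurable because those over generators are
  limits of slabs, and their measure is proportional to the height by uniqueness of measures on an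
  intersection-stable generator. The volume under a graph is then exhausted by cylinders over level
  sets of simple functions.\<close>

lemma daniell_extension:
  fixes N :: "'p measure"
  assumes space: "space N = \<Omega>" and sets: "sets N = sigma_sets \<Omega> \<G>"
    and Pow: "\<G> \<subseteq> Pow \<Omega>" and Int: "Int_stable \<G>"
    and meas: "H \<subseteq> borel_measurable N"
    and approx: "\<And>g. g \<in> \<G> \<Longrightarrow> \<exists>F. (\<forall>n. F n \<in> H) \<and> (\<forall>p\<in>\<Omega>. (\<forall>n. 0 \<le> F n p) \<and>
      incseq (\<lambda>n. F n p) \<and> (\<lambda>n. F n p) \<longlonglongrightarrow> indicator g p)"
    and bound: "\<And>g. g \<in> \<G> \<Longrightarrow> \<exists>F\<in>H. \<forall>p\<in>\<Omega>. indicator g p \<le> F p"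
    and exhaust: "range A \<subseteq> \<G>" "(\<Union>i :: nat. A i) = \<Omega>"
  obtains m where "sets m = sets N"
    "\<And>F. F \<in> H \<Longrightarrow> (\<And>p. p \<in> \<Omega> \<Longrightarrow> 0 \<le> F p) \<Longrightarrow> (\<integral>\<^sup>+p. ennreal (F p) \<partial>m) = ennreal (I F)"
proof -
  let ?U = undergraph
  \<comment> \<open>For generators, proportionality to the height is homogeneity of \<open>I\<close>
    along the approximating sequence.\<close>
  have g_eq: "g \<times> {0..<c} \<in> sets ?U \<and> emeasure ?U (g \<times> {0..<c}) = ennreal c * emeasure ?U (g \<times> {0..<1})"
    if g: "g \<in> \<G>" and c: "0 \<le> c" for g and c :: real
  proof -
    obtain F where F: "\<And>n. F n \<in> H" "\<And>n p. p \<in> \<Omega> \<Longrightarrow> 0 \<le> F n p"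
      "\<And>p. p \<in> \<Omega> \<Longrightarrow> incseq (\<lambda>n. F n p)" "\<And>p. p \<in> \<Omega> \<Longrightarrow> (\<lambda>n. F n p) \<longlonglongrightarrow> indicator g p"
      using approx[OF g] by blast
    have gO: "g \<subseteq> \<Omega>" using g Pow by auto
    have *: "g \<times> {0..<c} \<in> sets ?U \<and> emeasure ?U (g \<times> {0..<c}) = (SUP n. ennreal (c * I (F n)))" if c: "0 \<le> c" for c
    proof -
      have o: "ordered (\<lambda>_. 0) (\<lambda>p. c * F n p)" for n
        unfolding ordered_def using zero scale F c by auto
      \<comment> \<open>The strict upper bound in a slab matters: a height \<open>t < c\<close> over
        \<open>g\<close> is eventually below \<open>c * F n p\<close>, although the limit
        \<open>c\<close> may never be reached.\<close>
      have un: "(\<Union>n. slab (\<lambda>_. 0) (\<lambda>p. c * F n p)) = g \<times> {0..<c}"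
      proof (intro equalityI subsetI)
        fix z assume "z \<in> (\<Union>n. slab (\<lambda>_. 0) (\<lambda>p. c * F n p))"
        then obtain n p t where z: "z = (p, t)" "p \<in> \<Omega>" "0 \<le> t" "t < c * F n p" unfolding slab_def by auto
        have "F n p \<le> indicator g p" by (rule incseq_le[OF F(3,4)]) fact+
        then have "c * F n p \<le> c * indicator g p" using c by (intro mult_left_mono)
        then show "z \<in> g \<times> {0..<c}" using z by (cases "p \<in> g") auto
      next
        fix z assume "z \<in> g \<times> {0..<c}"
        then obtain p t where z: "z = (p, t)" "p \<in> g" "0 \<le> t" "t < c" by auto
        then have p: "p \<in> \<Omega>" using gO by auto
        have "(\<lambda>n. c * F n p) \<longlonglongrightarrow> c * indicator g p" using F(4)[OF p] by (intro tendsto_mult tendsto_const)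
        then have "eventually (\<lambda>n. t < c * F n p) sequentially" using z by (intro order_tendstoD(1)) auto
        then obtain n where "t < c * F n p" by (auto simp: eventually_sequentially)
        then show "z \<in> (\<Union>n. slab (\<lambda>_. 0) (\<lambda>p. c * F n p))" using z p unfolding slab_def by auto
      qed
      have inc: "incseq (\<lambda>n. slab (\<lambda>_. 0) (\<lambda>p. c * F n p))"
        unfolding incseq_def slab_def
      proof (intro allI impI subsetI)
        fix m n :: nat and z assume mn: "m \<le> n" and "z \<in> {(p, t). p \<in> \<Omega> \<and> 0 \<le> t \<and> t < c * F m p}"
        then obtain p t where z: "z = (p, t)" "p \<in> \<Omega>" "0 \<le> t" "t < c * F m p" by auto
        have "c * F m p \<le> c * F n p" using F(3)[OF z(2)] mn c by (intro mult_left_mono) (auto dest: incseqD)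
        then show "z \<in> {(p, t). p \<in> \<Omega> \<and> 0 \<le> t \<and> t < c * F n p}" using z by auto
      qed
      have "(SUP n. emeasure ?U (slab (\<lambda>_. 0) (\<lambda>p. c * F n p))) = emeasure ?U (g \<times> {0..<c})"
        unfolding un[symmetric] using o by (intro SUP_emeasure_incseq inc) (auto intro: slab_measurable)
      moreover have "emeasure ?U (slab (\<lambda>_. 0) (\<lambda>p. c * F n p)) = ennreal (c * I (F n))" for n
        using undergraph_slab[OF o[of n]] I_scale[OF F(1)] by simp
      moreover have "g \<times> {0..<c} \<in> sets ?U"
        unfolding un[symmetric] using slab_measurable[OF o] by auto
      ultimately show ?thesis by simp
    qed
    have "(SUP n. ennreal (c * I (F n))) = ennreal c * (SUP n. ennreal (1 * I (F n)))"
      using c F by (simp add: ennreal_mult SUP_mult_left_ennreal I_pos)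
    then show ?thesis using *[OF c] *[of 1] by simp
  qed
  have cyl_sets: "B \<times> {0..<c} \<in> sets ?U" if B: "B \<in> sets N" and c: "0 \<le> c" for B and c :: real
    using B unfolding sets
  proof (induction rule: sigma_sets.induct)
    case (Basic g)
    then show ?case using g_eq[of g c] c by blast
  next
    case (Compl B)
    \<comment> \<open>Complements are taken inside \<open>\<Omega> \<times> {0..<c}\<close>, whose
      measurability comes from the exhausting generators.\<close>
    have "(\<Union>i. A i \<times> {0..<c}) \<in> sets ?U" using g_eq[of _ c] c exhaust(1) by (intro sets.countable_UN) auto
    moreover have "(\<Union>i. A i \<times> {0..<c}) = \<Omega> \<times> {0..<c}" using exhaust(2) by auto
    ultimately have "\<Omega> \<times> {0..<c} \<in> sets ?U" by simp
    then have "\<Omega> \<times> {0..<c} - B \<times> {0..<c} \<in> sets ?U" using Compl by auto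
    moreover have "\<Omega> \<times> {0..<c} - B \<times> {0..<c} = (\<Omega> - B) \<times> {0..<c}" by auto
    ultimately show ?case by simp
  next
    case (Union B)
    then have "(\<Union>i. B i \<times> {0..<c}) \<in> sets ?U" by auto
    moreover have "(\<Union>i. B i \<times> {0..<c}) = (\<Union>i. B i) \<times> {0..<c}" by auto
    ultimately show ?case by simp
  qed simp
  \<comment> \<open>The height is a parameter so that \<open>mc c\<close> can be compared with
    \<open>c\<close> times \<open>mc 1\<close>.\<close>
  define mc where "mc = (\<lambda>c. distr (restrict_space ?U (\<Omega> \<times> {0..<c})) N fst)"
  have top_sets: "\<Omega> \<times> {0..<c} \<in> sets ?U" if "0 \<le> c" for c :: real
    using cyl_sets[of \<Omega> c] that sets.top[of N] space by simp
  have fst_m: "fst \<in> measurable (restrict_space ?U (\<Omega> \<times> {0..<c})) N"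
    and em_mc: "\<And>B. B \<in> sets N \<Longrightarrow> emeasure (mc c) B = emeasure ?U (B \<times> {0..<c})" if c: "0 \<le> c" for c :: real
  proof -
    have sp: "space (restrict_space ?U (\<Omega> \<times> {0..<c})) = \<Omega> \<times> {0..<c}"
      by (auto simp: space_restrict_space space_undergraph)
    have pre: "fst -` B \<inter> \<Omega> \<times> {0..<c} = B \<times> {0..<c}" if "B \<in> sets N" for B
      using sets.sets_into_space[OF that] space by auto
    show m: "fst \<in> measurable (restrict_space ?U (\<Omega> \<times> {0..<c})) N"
    proof (rule measurableI)
      fix B assume B: "B \<in> sets N"
      have "B \<times> {0..<c} \<subseteq> \<Omega> \<times> {0..<c}" using sets.sets_into_space[OF B] space by auto
      then show "fst -` B \<inter> space (restrict_space ?U (\<Omega> \<times> {0..<c})) \<in> sets (restrict_space ?U (\<Omega> \<times> {0..<c}))"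
        unfolding sp pre[OF B] using cyl_sets[OF B c] top_sets[OF c] by (subst sets_restrict_space_iff) (auto simp: space_undergraph Times_Int_Times)
    qed (auto simp: sp space)
    fix B assume B: "B \<in> sets N"
    have "B \<times> {0..<c} \<subseteq> \<Omega> \<times> {0..<c}" using sets.sets_into_space[OF B] space by auto
    then show "emeasure (mc c) B = emeasure ?U (B \<times> {0..<c})"
      unfolding mc_def emeasure_distr[OF m B] sp pre[OF B] using top_sets[OF c]
      by (intro emeasure_restrict_space) (auto simp: space_undergraph Times_Int_Times)
  qed
  define m where "m = mc 1"
  have sets_m: "sets m = sets N" unfolding m_def mc_def by simp
  have em_m: "emeasure m B = emeasure ?U (B \<times> {0..<1})" if "B \<in> sets N" for B
    unfolding m_def using em_mc[of 1] that by simp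
  have m_fin: "emeasure m g \<noteq> \<infinity>" if g: "g \<in> \<G>" for g
  proof -
    obtain F where F: "F \<in> H" "\<And>p. p \<in> \<Omega> \<Longrightarrow> indicator g p \<le> F p" using bound[OF g] by blast
    have o: "ordered (\<lambda>_. 0) F" unfolding ordered_def
      using F zero by (auto intro!: order_trans[OF _ F(2)])
    have gN: "g \<in> sets N" using g sets by auto
    have "g \<times> {0..<1} \<subseteq> slab (\<lambda>_. 0) F"
    proof
      fix z assume "z \<in> g \<times> {0..<1::real}"
      then obtain p t where z: "z = (p, t)" "p \<in> g" "0 \<le> t" "t < 1" by auto
      then have p: "p \<in> \<Omega>" using g Pow by auto
      from F(2)[OF p] z p show "z \<in> slab (\<lambda>_. 0) F" unfolding slab_def by auto
    qed
    then have "emeasure m g \<le> emeasure ?U (slab (\<lambda>_. 0) F)"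
      unfolding em_m[OF gN] by (intro emeasure_mono slab_measurable o)
    also have "\<dots> < \<infinity>" unfolding undergraph_slab[OF o] by simp
    finally show ?thesis by simp
  qed
  have scale_m: "emeasure ?U (B \<times> {0..<c}) = ennreal c * emeasure m B" if B: "B \<in> sets N" and c: "0 \<le> c" for B c
  proof -
    \<comment> \<open>Agreement on the generator is \<open>g_eq\<close>; finiteness along the
      exhausting sequence comes from \<open>bound\<close>.\<close>
    have "scale_measure (ennreal c) m = mc c"
    proof (rule measure_eqI_generator_eq[OF Int Pow])
      show "emeasure (scale_measure (ennreal c) m) X = emeasure (mc c) X" if X: "X \<in> \<G>" for X
      proof -
        have XN: "X \<in> sets N" using X sets by auto
        show ?thesis using g_eq[OF X c] XN em_mc[OF c XN] em_m[OF XN] sets_m by simp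
      qed
      show "sets (scale_measure (ennreal c) m) = sigma_sets \<Omega> \<G>" using sets_m sets by simp
      show "sets (mc c) = sigma_sets \<Omega> \<G>" unfolding mc_def using sets by simp
      show "range A \<subseteq> \<G>" "(\<Union>i. A i) = \<Omega>" by fact+
      show "emeasure (scale_measure (ennreal c) m) (A i) \<noteq> \<infinity>" for i
        using m_fin[of "A i"] exhaust(1) by (auto simp: ennreal_mult_eq_top_iff)
    qed
    then have "emeasure (scale_measure (ennreal c) m) B = emeasure (mc c) B" by simp
    then show ?thesis using em_mc[OF c B] by simp
  qed
  show thesis
  proof
    show "sets m = sets N" by fact
    fix F assume F: "F \<in> H" and F0: "\<And>p. p \<in> \<Omega> \<Longrightarrow> 0 \<le> F p"
    have sp_m: "space m = \<Omega>" using sets_m space sets_eq_imp_space_eq by blast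
    have o: "ordered (\<lambda>_. 0) F" unfolding ordered_def using F F0 zero by auto
    have "(\<lambda>p. ennreal (F p)) \<in> borel_measurable m"
      using F meas by (subst measurable_cong_sets[OF sets_m refl]) auto
    then obtain s where s: "\<And>i. simple_function m (s i)" "incseq s" "\<And>i x. s i x < top"
      "\<And>x. (SUP i. s i x) = ennreal (F x)"
      using borel_measurable_implies_simple_function_sequence' by blast
    \<comment> \<open>The region under the simple function \<open>s i\<close>: a finite disjoint
      union of cylinders over level sets, with the finite values of \<open>s i\<close> as
      heights.\<close>
    define S where "S = (\<lambda>i. {(p, t). p \<in> \<Omega> \<and> 0 \<le> t \<and> ennreal t < s i p})"
    have S_eq: "S i \<in> sets ?U \<and> emeasure ?U (S i) = (\<integral>\<^sup>+p. s i p \<partial>m)" for i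
    proof -
      let ?L = "\<lambda>y. s i -` {y} \<inter> space m"
      have fin: "finite (s i ` space m)" using s(1)[of i] by (simp add: simple_function_def)
      have L: "?L y \<in> sets N" if "y \<in> s i ` space m" for y
        using simple_functionD(2)[OF s(1)[of i]] sets_m by simp
      have lt: "ennreal t < y \<longleftrightarrow> t < enn2real y" if "y < top" "0 \<le> t" for t y
        using that by (metis enn2real_less_iff ennreal_enn2real ennreal_less_iff)
      have un: "S i = (\<Union>y\<in>s i ` space m. ?L y \<times> {0..<enn2real y})"
      proof (intro equalityI subsetI)
        fix z assume "z \<in> S i"
        then obtain p t where z: "z = (p, t)" "p \<in> \<Omega>" "0 \<le> t" "ennreal t < s i p" unfolding S_def by auto
        then have "t < enn2real (s i p)" using lt s(3) by blast
        with z sp_m show "z \<in> (\<Union>y\<in>s i ` space m. ?L y \<times> {0..<enn2real y})" by auto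
      next
        fix z assume "z \<in> (\<Union>y\<in>s i ` space m. ?L y \<times> {0..<enn2real y})"
        then obtain p t where z: "z = (p, t)" "p \<in> space m" "0 \<le> t" "t < enn2real (s i p)" by auto
        then have "ennreal t < s i p" using lt s(3) by blast
        with z sp_m show "z \<in> S i" unfolding S_def by auto
      qed
      have disj: "disjoint_family_on (\<lambda>y. ?L y \<times> {0..<enn2real y}) (s i ` space m)"
        unfolding disjoint_family_on_def by auto
      have sets: "?L y \<times> {0..<enn2real y} \<in> sets ?U" if "y \<in> s i ` space m" for y
        using L[OF that] by (intro cyl_sets) auto
      have "emeasure ?U (S i) = (\<Sum>y\<in>s i ` space m. emeasure ?U (?L y \<times> {0..<enn2real y}))"
        unfolding un using sets by (intro sum_emeasure[symmetric] disj fin) auto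
      also have "\<dots> = (\<Sum>y\<in>s i ` space m. y * emeasure m (?L y))"
        using L s(3) by (intro sum.cong refl) (auto simp: scale_m)
      also have "\<dots> = (\<integral>\<^sup>+p. s i p \<partial>m)"
        using nn_integral_eq_simple_integral[OF s(1)] by (simp add: simple_integral_def)
      finally show ?thesis using sets.finite_UN[OF fin sets] unfolding un by simp
    qed
    have "slab (\<lambda>_. 0) F = (\<Union>i. S i)"
    proof (intro equalityI subsetI)
      fix z assume "z \<in> slab (\<lambda>_. 0) F"
      then obtain p t where z: "z = (p, t)" "p \<in> \<Omega>" "0 \<le> t" "t < F p" unfolding slab_def by auto
      then have "ennreal t < (SUP i. s i p)" unfolding s(4) by (simp add: ennreal_lessI)
      then show "z \<in> (\<Union>i. S i)" using z unfolding less_SUP_iff S_def by auto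
    next
      fix z assume "z \<in> (\<Union>i. S i)"
      then obtain p t i where z: "z = (p, t)" "p \<in> \<Omega>" "0 \<le> t" "ennreal t < s i p" unfolding S_def by auto
      then have "ennreal t < (SUP i. s i p)" by (auto simp: less_SUP_iff)
      then have "t < F p" unfolding s(4) using z by (simp add: ennreal_less_iff)
      then show "z \<in> slab (\<lambda>_. 0) F" using z unfolding slab_def by auto
    qed
    moreover have "incseq S"
      unfolding incseq_def
    proof (intro allI impI subsetI)
      fix i j :: nat and z assume ij: "i \<le> j" and "z \<in> S i"
      then obtain p t where z: "z = (p, t)" "p \<in> \<Omega>" "0 \<le> t" "ennreal t < s i p" unfolding S_def by auto
      have "s i p \<le> s j p" using s(2) ij by (auto simp: incseq_def le_fun_def)
      then show "z \<in> S j" using z unfolding S_def by auto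
    qed
    ultimately have "emeasure ?U (slab (\<lambda>_. 0) F) = (SUP i. emeasure ?U (S i))"
      using S_eq by (subst SUP_emeasure_incseq) auto
    also have "\<dots> = (SUP i. \<integral>\<^sup>+p. s i p \<partial>m)" using S_eq by simp
    also have "\<dots> = (\<integral>\<^sup>+p. (SUP i. s i p) \<partial>m)"
      using s(1,2) by (intro nn_integral_monotone_convergence_SUP[symmetric]) (auto intro: borel_measurable_simple_function)
    finally show "(\<integral>\<^sup>+p. ennreal (F p) \<partial>m) = ennreal (I F)"
      unfolding s(4) undergraph_slab[OF o] by simp
  qed
qed

end

section \<open>The space of test functions\<close>

context prob_space
begin

lemma stable_funD:
  assumes "stable_fun M (L0 M) (L0 M) f"
  shows "\<And>x. x \<in> L0 M \<Longrightarrow> f x \<in> L0 M"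
    and "\<And>x y. x \<in> L0 M \<Longrightarrow> y \<in> L0 M \<Longrightarrow> AE \<omega> in M. x \<omega> = y \<omega> \<Longrightarrow> AE \<omega> in M. f x \<omega> = f y \<omega>"
    and "\<And>A x. partition_of M A \<Longrightarrow> (\<And>k. x k \<in> L0 M) \<Longrightarrow>
           AE \<omega> in M. f (glue A x) \<omega> = glue A (\<lambda>k. f (x k)) \<omega>"
  using assms unfolding stable_fun_def by auto

lemma sequentially_continuousD:
  assumes "sequentially_continuous M f" "x \<in> L0 M" "\<And>k. xs k \<in> L0 M"
    "AE \<omega> in M. (\<lambda>k. xs k \<omega>) \<longlonglongrightarrow> x \<omega>"
  shows "AE \<omega> in M. (\<lambda>k. f (xs k) \<omega>) \<longlonglongrightarrow> f x \<omega>"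
proof -
  have "cconverges M (space M) xs x" unfolding cconverges_def using assms(4) by (rule eventually_mono) simp
  then have "cconverges M (space M) (\<lambda>k. f (xs k)) (f x)"
    using assms(1-3) unfolding sequentially_continuous_def by blast
  then show ?thesis unfolding cconverges_def using AE_space by eventually_elim simp
qed

lemma sequentially_continuousI:
  fixes f :: "('a \<Rightarrow> 'b::euclidean_space) \<Rightarrow> 'a \<Rightarrow> real"
  assumes "\<And>xs x. x \<in> L0 M \<Longrightarrow> (\<And>k. xs k \<in> L0 M) \<Longrightarrow> AE \<omega> in M. (\<lambda>k. xs k \<omega>) \<longlonglongrightarrow> x \<omega> \<Longrightarrow>
    AE \<omega> in M. (\<lambda>k. f (xs k) \<omega>) \<longlonglongrightarrow> f x \<omega>"
  shows "sequentially_continuous M f"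
  unfolding sequentially_continuous_def
proof (intro allI ballI impI)
  fix xs and x :: "'a \<Rightarrow> 'b" assume x: "x \<in> L0 M" "\<forall>k. xs k \<in> L0 M" and c: "cconverges M (space M) xs x"
  have "AE \<omega> in M. (\<lambda>k. xs k \<omega>) \<longlonglongrightarrow> x \<omega>"
    using c[unfolded cconverges_def] AE_space by eventually_elim simp
  then have "AE \<omega> in M. (\<lambda>k. f (xs k) \<omega>) \<longlonglongrightarrow> f x \<omega>" using assms x by blast
  then show "cconverges M (space M) (\<lambda>k. f (xs k)) (f x)"
    unfolding cconverges_def by (rule eventually_mono) simp
qed

text \<open>Almost sure convergence has no uniform rate, but stability lets the index depend on
  \<omega>: \<open>y j\<close> is used on an event where it is already within \<open>e\<close> of
  the limit.\<close>

lemma stable_approx: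
  fixes v :: "'a \<Rightarrow> 'b::euclidean_space"
  assumes W: "stable_set M W" "W \<subseteq> L0 M" and y: "\<And>j :: nat. y j \<in> W" and v: "v \<in> L0 M"
    and conv: "cconverges M D y v" and e: "0 < e"
  obtains u where "u \<in> W" "AE \<omega> in M. \<omega> \<in> D \<longrightarrow> norm (u \<omega> - v \<omega>) < e"
proof -
  define A where "A = (\<lambda>j. {\<omega>\<in>space M. norm (y j \<omega> - v \<omega>) < e})"
  have "A j \<in> sets M" for j
  proof -
    have [measurable]: "y j \<in> L0 M" "v \<in> L0 M" using y W v by auto
    show ?thesis unfolding A_def by measurable
  qed
  then have A: "range A \<subseteq> sets M" by auto
  obtain u where u: "u \<in> W" "\<And>\<omega>. \<omega> \<in> (\<Union>k. A k) \<Longrightarrow> \<exists>k. \<omega> \<in> A k \<and> u \<omega> = y k \<omega>"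
    using stable_select[of M W A y, OF W(1) A y] by blast
  have "AE \<omega> in M. \<omega> \<in> D \<longrightarrow> norm (u \<omega> - v \<omega>) < e"
    using conv[unfolded cconverges_def] AE_space
  proof eventually_elim
    case (elim \<omega>)
    show ?case
    proof
      assume "\<omega> \<in> D"
      then have "(\<lambda>j. y j \<omega>) \<longlonglongrightarrow> v \<omega>" using elim by blast
      then obtain j where "norm (y j \<omega> - v \<omega>) < e" using e LIMSEQ_D by blast
      then have "\<omega> \<in> (\<Union>k. A k)" using elim unfolding A_def by blast
      then show "norm (u \<omega> - v \<omega>) < e" using u(2) unfolding A_def by force
    qed
  qed
  with u(1) show thesis by (rule that)
qed

text \<open>Approximating sequences of the pieces are glued term by term along the same partition;
  the glued terms converge to the glued limit.\<close>

lemma sequential_closure_presents: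
  fixes P :: "('a, 'b::euclidean_space) condset"
  assumes P: "P \<in> cond_subsets M (L0 M)"
  shows "presents M (sequential_closure M P)
    {x \<in> L0 M. \<exists>xs. (\<forall>k. xs k \<in> cset M (L0 M) P) \<and> cconverges M (cdom M (L0 M) P) xs x} (cdom M (L0 M) P)"
    (is "presents M _ ?V ?D")
  unfolding presents_def
proof (intro conjI)
  note pP = presents_cset[OF P]
  let ?W = "cset M (L0 M) P"
  have W: "stable_set M ?W" "?W \<subseteq> L0 M" using pP unfolding presents_def by auto
  show "?V \<subseteq> L0 M" by auto
  show "?D \<in> sets M" using pP unfolding presents_def by auto
  show "sequential_closure M P = restr M ?V ?D" unfolding sequential_closure_def ..
  show "stable_set M ?V" unfolding stable_set_def
  proof (intro conjI allI impI)
    obtain w where w: "w \<in> ?W" using W unfolding stable_set_def by auto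
    have "w \<in> ?V" using w W(2) by (auto intro!: exI[of _ "\<lambda>_. w"] simp: cconverges_def)
    then show "?V \<noteq> {}" by blast
    fix A and x :: "nat \<Rightarrow> 'a \<Rightarrow> 'b" assume A: "partition_of M A" and x: "\<forall>k. x k \<in> ?V"
    have "\<forall>j. \<exists>xs. (\<forall>k. xs k \<in> ?W) \<and> cconverges M ?D xs (x j)" using x by blast
    from choice[OF this] obtain xs where xs: "\<And>j k. xs j k \<in> ?W" "\<And>j. cconverges M ?D (xs j) (x j)"
      by blast
    let ?y = "\<lambda>k. glue A (\<lambda>j. xs j k)"
    have "\<forall>k. ?y k \<in> ?W" using W(1) A xs(1) unfolding stable_set_def by simp
    moreover have "cconverges M ?D ?y (glue A x)"
    proof -
      have "AE \<omega> in M. \<forall>j. \<omega> \<in> ?D \<longrightarrow> (\<lambda>k. xs j k \<omega>) \<longlonglongrightarrow> x j \<omega>"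
        unfolding AE_all_countable using xs(2) unfolding cconverges_def by blast
      then show ?thesis unfolding cconverges_def glue_def by eventually_elim blast
    qed
    moreover have "glue A x \<in> L0 M" using A x by (intro glue_measurable) auto
    ultimately show "glue A x \<in> ?V" by (intro CollectI conjI exI[of _ ?y])
  qed
qed

text \<open>A diagonal argument: \<open>stable_approx\<close> replaces each approximating sequence
  by a single element within \<open>1 / Suc k\<close> on the domain, and these elements converge to
  the new limit.\<close>

lemma sequential_closure_closed:
  fixes P :: "('a, 'b::euclidean_space) condset"
  assumes P: "P \<in> cond_subsets M (L0 M)"
  shows "sequentially_closed M (sequential_closure M P)"
  unfolding sequentially_closed_def
proof (intro allI ballI impI)
  let ?Q = "sequential_closure M P" and ?D = "cdom M (L0 M) P" and ?W = "cset M (L0 M) P"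
  let ?V = "{x \<in> L0 M. \<exists>xs. (\<forall>k. xs k \<in> ?W) \<and> cconverges M ?D xs x}"
  note pr = sequential_closure_presents[OF P]
  have W: "stable_set M ?W" "?W \<subseteq> L0 M" using presents_cset[OF P] unfolding presents_def by auto
  have Q: "?Q \<in> cond_subsets M (L0 M)" using pr cond_subsets_iff by blast
  note pQ = presents_cset[OF Q]
  fix xs and x :: "'a \<Rightarrow> 'b" assume x: "x \<in> L0 M" and xs: "\<forall>k. xs k \<in> cset M (L0 M) ?Q"
    and conv: "cconverges M (cdom M (L0 M) ?Q) xs x"
  have "\<forall>k. \<exists>v. v \<in> ?V \<and> (AE \<omega> in M. (\<omega> \<in> cdom M (L0 M) ?Q \<longleftrightarrow> \<omega> \<in> ?D) \<and> (\<omega> \<in> cdom M (L0 M) ?Q \<longrightarrow> xs k \<omega> = v \<omega>))"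
    using presents_cong[OF pQ pr] xs by blast
  from choice[OF this] obtain v where v: "\<And>k. v k \<in> ?V"
    "\<And>k. AE \<omega> in M. (\<omega> \<in> cdom M (L0 M) ?Q \<longleftrightarrow> \<omega> \<in> ?D) \<and> (\<omega> \<in> cdom M (L0 M) ?Q \<longrightarrow> xs k \<omega> = v k \<omega>)" by blast
  have "\<exists>u. u \<in> ?W \<and> (AE \<omega> in M. \<omega> \<in> ?D \<longrightarrow> norm (u \<omega> - v k \<omega>) < 1 / Suc k)" for k
  proof -
    obtain ys where "\<And>j. ys j \<in> ?W" "cconverges M ?D ys (v k)" "v k \<in> L0 M" using v(1)[of k] by blast
    from stable_approx[OF W this(1,3,2), of "1 / Suc k"] show ?thesis by auto
  qed
  then have "\<forall>k. \<exists>u. u \<in> ?W \<and> (AE \<omega> in M. \<omega> \<in> ?D \<longrightarrow> norm (u \<omega> - v k \<omega>) < 1 / Suc k)" by blast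
  from choice[OF this] obtain u where u: "\<And>k. u k \<in> ?W"
    "\<And>k. AE \<omega> in M. \<omega> \<in> ?D \<longrightarrow> norm (u k \<omega> - v k \<omega>) < 1 / Suc k" by blast
  have v2: "AE \<omega> in M. \<forall>k. (\<omega> \<in> cdom M (L0 M) ?Q \<longleftrightarrow> \<omega> \<in> ?D) \<and> (\<omega> \<in> cdom M (L0 M) ?Q \<longrightarrow> xs k \<omega> = v k \<omega>)"
    using v(2) unfolding AE_all_countable by blast
  have u2: "AE \<omega> in M. \<forall>k. \<omega> \<in> ?D \<longrightarrow> norm (u k \<omega> - v k \<omega>) < 1 / Suc k"
    using u(2) unfolding AE_all_countable by blast
  have "cconverges M ?D u x" unfolding cconverges_def
    using v2 u2 conv[unfolded cconverges_def]
  proof eventually_elim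
    case (elim \<omega>)
    show ?case
    proof
      assume "\<omega> \<in> ?D"
      then have eq: "\<And>k. xs k \<omega> = v k \<omega>" and lt: "\<And>k. norm (u k \<omega> - v k \<omega>) < 1 / Suc k"
        and cv: "(\<lambda>k. xs k \<omega>) \<longlonglongrightarrow> x \<omega>" using elim by auto
      have "(\<lambda>k. u k \<omega> - v k \<omega>) \<longlonglongrightarrow> 0"
        by (rule Lim_null_comparison[OF _ LIMSEQ_Suc[OF lim_1_over_n]])
          (use lt in \<open>auto intro!: always_eventually less_imp_le\<close>)
      from tendsto_add[OF this cv[unfolded eq]] show "(\<lambda>k. u k \<omega>) \<longlonglongrightarrow> x \<omega>" by simp
    qed
  qed
  then have xV: "x \<in> ?V" using x u(1) by blast
  have "AE \<omega> in M. \<omega> \<in> cdom M (L0 M) ?Q \<longleftrightarrow> \<omega> \<in> ?D" using v2 by eventually_elim blast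
  then have "rst M x (cdom M (L0 M) ?Q) \<in> restr M ?V ?D"
    unfolding rst_in_restr_iff2 using xV by (intro bexI[of _ x]) auto
  then show "rst M x (cdom M (L0 M) ?Q) \<in> ?Q" using pr unfolding presents_def by metis
qed

section \<open>Conditional supports and a criterion for membership in \<open>C_c\<close>\<close>

lemma cmem_zero:
  fixes x :: "'a \<Rightarrow> 'b::euclidean_space"
  shows "restr M {\<lambda>_. 0 :: 'b} (space M) \<in> cond_subsets M (L0 M)"
    and "x \<in> L0 M \<Longrightarrow> AE \<omega> in M. \<omega> \<in> cmem M (restr M {\<lambda>_. 0} (space M)) x \<longleftrightarrow> x \<omega> = 0"
proof -
  have pr: "presents M (restr M {\<lambda>_. 0 :: 'b} (space M)) {\<lambda>_. 0} (space M)"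
    unfolding presents_def stable_set_def by (auto simp: glue_def)
  then show "restr M {\<lambda>_. 0 :: 'b} (space M) \<in> cond_subsets M (L0 M)" using cond_subsets_iff by blast
  assume x: "x \<in> L0 M"
  have "AE \<omega> in M. \<omega> \<in> cmem M (restr M {\<lambda>_. 0} (space M)) x \<longleftrightarrow> \<omega> \<in> {\<omega>\<in>space M. x \<omega> = 0}"
    by (rule cmem_eqI[OF pr x]) (auto intro!: AE_I2)
  then show "AE \<omega> in M. \<omega> \<in> cmem M (restr M {\<lambda>_. 0} (space M)) x \<longleftrightarrow> x \<omega> = 0"
    using AE_space by eventually_elim simp
qed

lemma cmem_nonzero:
  fixes f :: "('a \<Rightarrow> 'b::euclidean_space) \<Rightarrow> 'a \<Rightarrow> real"
  assumes f: "stable_fun M (L0 M) (L0 M) f"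
  defines "P \<equiv> cpreimage M (L0 M) (L0 M) f (ccompl M (L0 M) (restr M {\<lambda>_. 0} (space M)))"
  shows "P \<in> cond_subsets M (L0 M)"
    and "x \<in> L0 M \<Longrightarrow> AE \<omega> in M. \<omega> \<in> cmem M P x \<longleftrightarrow> f x \<omega> \<noteq> 0"
proof -
  note c = ccompl_cmem[OF cmem_zero(1)]
  show "P \<in> cond_subsets M (L0 M)" unfolding P_def by (rule cpreimage_cmem(1)[OF f c(1)])
  assume x: "x \<in> L0 M"
  show "AE \<omega> in M. \<omega> \<in> cmem M P x \<longleftrightarrow> f x \<omega> \<noteq> 0"
    using cpreimage_cmem(2)[OF f c(1) x] c(2)[OF stable_funD(1)[OF f x]] cmem_zero(2)[OF stable_funD(1)[OF f x]]
    unfolding P_def by eventually_elim blast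
qed

text \<open>Where \<open>f x\<close> is non-zero, \<open>x\<close> agrees with an element of the
  preimage of the non-zero values. That element lies in the sequential closure, so the bound for the
  support applies to \<open>x\<close> there.\<close>

lemma C_c_bounded:
  fixes f :: "('a \<Rightarrow> 'b::euclidean_space) \<Rightarrow> 'a \<Rightarrow> real"
  assumes f: "f \<in> C_c M"
  obtains R where "R \<in> L0_plus M" "\<And>x. x \<in> L0 M \<Longrightarrow> AE \<omega> in M. R \<omega> < norm (x \<omega>) \<longrightarrow> f x \<omega> = 0"
proof -
  define P where "P = cpreimage M (L0 M) (L0 M) f (ccompl M (L0 M) (restr M {\<lambda>_. 0} (space M)))"
  let ?D = "cdom M (L0 M) P" and ?W = "cset M (L0 M) P" and ?S = "cond_support M f"
  have st: "stable_fun M (L0 M) (L0 M) f" and sc: "stably_compact M ?S" using f unfolding C_c_def by auto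
  have P: "P \<in> cond_subsets M (L0 M)" unfolding P_def by (rule cmem_nonzero(1)[OF st])
  note mP = cmem_nonzero(2)[OF st, folded P_def]
  have S: "?S = sequential_closure M P" unfolding cond_support_def P_def ..
  note pr = sequential_closure_presents[OF P, folded S]
  have S_CS: "?S \<in> cond_subsets M (L0 M)" using sc unfolding stably_compact_def by blast
  obtain m where m: "m \<in> L0_plus M" "\<And>x. x \<in> cset M (L0 M) ?S \<Longrightarrow>
      AE \<omega> in M. \<omega> \<in> cdom M (L0 M) ?S \<longrightarrow> norm (x \<omega>) \<le> m \<omega>"
    using sc unfolding stably_compact_def L0_bounded_def by blast
  show thesis
  proof
    show "m \<in> L0_plus M" by fact
    fix x :: "'a \<Rightarrow> 'b" assume x: "x \<in> L0 M"
    obtain v where v: "v \<in> ?W" "AE \<omega> in M. \<omega> \<in> cmem M P x \<longrightarrow> \<omega> \<in> ?D \<and> x \<omega> = v \<omega>"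
      using cmem_char0(2)[OF P x] by blast
    have "v \<in> L0 M" using v(1) presents_cset[OF P] unfolding presents_def by auto
    then have "v \<in> {x \<in> L0 M. \<exists>xs. (\<forall>k. xs k \<in> ?W) \<and> cconverges M ?D xs x}"
      using v(1) by (auto intro!: exI[of _ "\<lambda>_. v"] simp: cconverges_def)
    then obtain w where w: "w \<in> cset M (L0 M) ?S"
      "AE \<omega> in M. (\<omega> \<in> ?D \<longleftrightarrow> \<omega> \<in> cdom M (L0 M) ?S) \<and> (\<omega> \<in> ?D \<longrightarrow> v \<omega> = w \<omega>)"
      using presents_cong[OF pr presents_cset[OF S_CS]] by blast
    show "AE \<omega> in M. m \<omega> < norm (x \<omega>) \<longrightarrow> f x \<omega> = 0"
      using mP[OF x] v(2) w(2) m(2)[OF w(1)] by eventually_elim auto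
  qed
qed

text \<open>Together with \<open>C_c_bounded\<close> this describes \<open>C_c\<close> without
  mentioning supports. Sequential closures are closed anyway, so only the bound is at stake, and it
  survives limits.\<close>

lemma C_cI:
  fixes f :: "('a \<Rightarrow> 'b::euclidean_space) \<Rightarrow> 'a \<Rightarrow> real"
  assumes st: "stable_fun M (L0 M) (L0 M) f" and sc: "sequentially_continuous M f"
    and R: "R \<in> L0_plus M" "\<And>x. x \<in> L0 M \<Longrightarrow> AE \<omega> in M. R \<omega> < norm (x \<omega>) \<longrightarrow> f x \<omega> = 0"
  shows "f \<in> C_c M"
proof -
  define P where "P = cpreimage M (L0 M) (L0 M) f (ccompl M (L0 M) (restr M {\<lambda>_. 0} (space M)))"
  let ?D = "cdom M (L0 M) P" and ?W = "cset M (L0 M) P" and ?S = "cond_support M f"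
  have P: "P \<in> cond_subsets M (L0 M)" unfolding P_def by (rule cmem_nonzero(1)[OF st])
  note mP = cmem_nonzero(2)[OF st, folded P_def]
  have S: "?S = sequential_closure M P" unfolding cond_support_def P_def ..
  note pr = sequential_closure_presents[OF P, folded S]
  have S_CS: "?S \<in> cond_subsets M (L0 M)" using pr cond_subsets_iff by blast
  have WL: "?W \<subseteq> L0 M" using presents_cset[OF P] unfolding presents_def by auto
  have "AE \<omega> in M. \<omega> \<in> cdom M (L0 M) ?S \<longrightarrow> norm (x \<omega>) \<le> R \<omega>" if x: "x \<in> cset M (L0 M) ?S" for x
  proof -
    obtain v where v: "v \<in> {x \<in> L0 M. \<exists>xs. (\<forall>k. xs k \<in> ?W) \<and> cconverges M ?D xs x}"
      "AE \<omega> in M. (\<omega> \<in> cdom M (L0 M) ?S \<longleftrightarrow> \<omega> \<in> ?D) \<and> (\<omega> \<in> cdom M (L0 M) ?S \<longrightarrow> x \<omega> = v \<omega>)"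
      using presents_cong[OF presents_cset[OF S_CS] pr x] by blast
    then obtain xs where xs: "\<And>k. xs k \<in> ?W" "cconverges M ?D xs v" by blast
    have "AE \<omega> in M. \<omega> \<in> ?D \<longrightarrow> norm (xs k \<omega>) \<le> R \<omega>" for k
    proof -
      have xL: "xs k \<in> L0 M" using xs(1) WL by auto
      show ?thesis
        using cmem_presented[OF presents_cset[OF P] xs(1)[of k]] mP[OF xL] R(2)[OF xL] by eventually_elim auto
    qed
    then have "AE \<omega> in M. \<forall>k. \<omega> \<in> ?D \<longrightarrow> norm (xs k \<omega>) \<le> R \<omega>" unfolding AE_all_countable by blast
    then show ?thesis using v(2) xs(2)[unfolded cconverges_def]
    proof eventually_elim
      case (elim \<omega>)
      show ?case
      proof
        assume "\<omega> \<in> cdom M (L0 M) ?S"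
        then have "(\<lambda>k. xs k \<omega>) \<longlonglongrightarrow> x \<omega>" "\<And>k. norm (xs k \<omega>) \<le> R \<omega>" using elim by auto
        from this(1) show "norm (x \<omega>) \<le> R \<omega>"
          by (rule Lim_norm_ubound[OF sequentially_bot]) (use \<open>\<And>k. norm (xs k \<omega>) \<le> R \<omega>\<close> in simp)
      qed
    qed
  qed
  then have "L0_bounded M ?S" unfolding L0_bounded_def using R(1) by blast
  then have "stably_compact M ?S"
    unfolding stably_compact_def using S_CS sequential_closure_closed[OF P] S by simp
  then show ?thesis unfolding C_c_def using st sc by blast
qed

section \<open>Operations on test functions and their representation on the product\<close>

lemma C_cD:
  assumes "f \<in> C_c M"
  shows "stable_fun M (L0 M) (L0 M) f" "sequentially_continuous M f"
  using assms unfolding C_c_def by auto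

text \<open>One lemma for linear combinations with random coefficients and for maxima. That
  \<open>h\<close> vanishes when both arguments do keeps the combination zero outside the larger of
  the two random balls.\<close>

lemma C_c_comb:
  fixes f g :: "('a \<Rightarrow> 'b::euclidean_space) \<Rightarrow> 'a \<Rightarrow> real" and h :: "'a \<Rightarrow> real \<Rightarrow> real \<Rightarrow> real"
  assumes f: "f \<in> C_c M" and g: "g \<in> C_c M"
    and meas: "\<And>a b. a \<in> borel_measurable M \<Longrightarrow> b \<in> borel_measurable M \<Longrightarrow> (\<lambda>\<omega>. h \<omega> (a \<omega>) (b \<omega>)) \<in> borel_measurable M"
    and cont: "\<And>\<omega> a b a' b'. a \<longlonglongrightarrow> a' \<Longrightarrow> b \<longlonglongrightarrow> b' \<Longrightarrow> (\<lambda>k. h \<omega> (a k) (b k)) \<longlonglongrightarrow> h \<omega> a' b'"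
    and zero: "\<And>\<omega>. h \<omega> 0 0 = 0"
  shows "(\<lambda>x \<omega>. h \<omega> (f x \<omega>) (g x \<omega>)) \<in> C_c M"
proof -
  obtain R where R: "R \<in> L0_plus M" "\<And>x. x \<in> L0 M \<Longrightarrow> AE \<omega> in M. R \<omega> < norm (x \<omega>) \<longrightarrow> f x \<omega> = 0"
    using C_c_bounded[OF f] by blast
  obtain S where S: "S \<in> L0_plus M" "\<And>x. x \<in> L0 M \<Longrightarrow> AE \<omega> in M. S \<omega> < norm (x \<omega>) \<longrightarrow> g x \<omega> = 0"
    using C_c_bounded[OF g] by blast
  note f' = C_cD[OF f] and g' = C_cD[OF g]
  show ?thesis
  proof (rule C_cI)
    show "stable_fun M (L0 M) (L0 M) (\<lambda>x \<omega>. h \<omega> (f x \<omega>) (g x \<omega>))"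
      unfolding stable_fun_def
    proof (intro conjI allI ballI impI Pi_I)
      fix x :: "'a \<Rightarrow> 'b" assume x: "x \<in> L0 M"
      show "(\<lambda>\<omega>. h \<omega> (f x \<omega>) (g x \<omega>)) \<in> L0 M"
        using stable_funD(1)[OF f'(1) x] stable_funD(1)[OF g'(1) x] by (rule meas)
      fix y assume y: "y \<in> L0 M" and eq: "AE \<omega> in M. x \<omega> = y \<omega>"
      show "AE \<omega> in M. h \<omega> (f x \<omega>) (g x \<omega>) = h \<omega> (f y \<omega>) (g y \<omega>)"
        using stable_funD(2)[OF f'(1) x y eq] stable_funD(2)[OF g'(1) x y eq] by eventually_elim simp
    next
      fix A and x :: "nat \<Rightarrow> 'a \<Rightarrow> 'b" assume A: "partition_of M A" and x: "\<forall>k. x k \<in> L0 M"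
      have "AE \<omega> in M. f (glue A x) \<omega> = glue A (\<lambda>k. f (x k)) \<omega>" "AE \<omega> in M. g (glue A x) \<omega> = glue A (\<lambda>k. g (x k)) \<omega>"
        using stable_funD(3)[OF f'(1) A] stable_funD(3)[OF g'(1) A] x by blast+
      then show "AE \<omega> in M. h \<omega> (f (glue A x) \<omega>) (g (glue A x) \<omega>) = glue A (\<lambda>k \<omega>. h \<omega> (f (x k) \<omega>) (g (x k) \<omega>)) \<omega>"
        by eventually_elim (simp add: glue_def)
    qed
    show "sequentially_continuous M (\<lambda>x \<omega>. h \<omega> (f x \<omega>) (g x \<omega>))"
    proof (rule sequentially_continuousI)
      fix xs and x :: "'a \<Rightarrow> 'b"
      assume x: "x \<in> L0 M" "\<And>k. xs k \<in> L0 M" "AE \<omega> in M. (\<lambda>k. xs k \<omega>) \<longlonglongrightarrow> x \<omega>"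
      show "AE \<omega> in M. (\<lambda>k. h \<omega> (f (xs k) \<omega>) (g (xs k) \<omega>)) \<longlonglongrightarrow> h \<omega> (f x \<omega>) (g x \<omega>)"
        using sequentially_continuousD[OF f'(2) x] sequentially_continuousD[OF g'(2) x]
        by eventually_elim (rule cont)
    qed
    show "(\<lambda>\<omega>. max (R \<omega>) (S \<omega>)) \<in> L0_plus M"
    proof -
      have [measurable]: "R \<in> L0 M" "S \<in> L0 M" using R(1) S(1) unfolding L0_plus_def by auto
      have "AE \<omega> in M. 0 \<le> R \<omega>" using R(1) unfolding L0_plus_def by auto
      then have "AE \<omega> in M. 0 \<le> max (R \<omega>) (S \<omega>)" by eventually_elim simp
      then show ?thesis unfolding L0_plus_def by simp
    qed
    fix x :: "'a \<Rightarrow> 'b" assume x: "x \<in> L0 M"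
    show "AE \<omega> in M. max (R \<omega>) (S \<omega>) < norm (x \<omega>) \<longrightarrow> h \<omega> (f x \<omega>) (g x \<omega>) = 0"
      using R(2)[OF x] S(2)[OF x] by eventually_elim (auto simp: zero)
  qed
qed

lemma C_c_lin:
  assumes "f \<in> C_c M" "g \<in> C_c M" "r \<in> borel_measurable M"
  shows "(\<lambda>x \<omega>. f x \<omega> + r \<omega> * g x \<omega>) \<in> C_c M"
  by (rule C_c_comb[where h = "\<lambda>\<omega> a b. a + r \<omega> * b", OF assms(1,2)])
    (use assms(3) in \<open>auto intro!: tendsto_intros\<close>)

lemma C_c_max:
  assumes "f \<in> C_c M" "g \<in> C_c M"
  shows "(\<lambda>x \<omega>. max (f x \<omega>) (g x \<omega>)) \<in> C_c M"
  by (rule C_c_comb[where h = "\<lambda>\<omega> a b. max a b", OF assms]) (auto intro!: tendsto_intros)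

text \<open>The source of the concrete test functions, such as cutoffs: joint measurability gives
  stability, and continuity of the sections gives sequential continuity.\<close>

lemma C_c_section:
  fixes F :: "'a \<times> 'b::euclidean_space \<Rightarrow> real"
  assumes F: "F \<in> borel_measurable (M \<Otimes>\<^sub>M borel)"
    and cont: "\<And>\<omega>. \<omega> \<in> space M \<Longrightarrow> continuous_on UNIV (\<lambda>z. F (\<omega>, z))"
    and R: "R \<in> L0_plus M" "\<And>\<omega> z. \<omega> \<in> space M \<Longrightarrow> R \<omega> < norm z \<Longrightarrow> F (\<omega>, z) = 0"
  shows "(\<lambda>x \<omega>. F (\<omega>, x \<omega>)) \<in> C_c M"
proof (rule C_cI[OF _ _ R(1)])
  show "stable_fun M (L0 M) (L0 M) (\<lambda>x \<omega>. F (\<omega>, x \<omega>))"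
    unfolding stable_fun_def
  proof (intro conjI allI ballI impI Pi_I)
    fix x :: "'a \<Rightarrow> 'b" assume x [measurable]: "x \<in> L0 M"
    note F [measurable]
    show "(\<lambda>\<omega>. F (\<omega>, x \<omega>)) \<in> L0 M" by measurable
  qed (auto simp: glue_def)
  show "sequentially_continuous M (\<lambda>x \<omega>. F (\<omega>, x \<omega>))"
  proof (rule sequentially_continuousI)
    fix xs and x :: "'a \<Rightarrow> 'b"
    assume "AE \<omega> in M. (\<lambda>k. xs k \<omega>) \<longlonglongrightarrow> x \<omega>"
    then show "AE \<omega> in M. (\<lambda>k. F (\<omega>, xs k \<omega>)) \<longlonglongrightarrow> F (\<omega>, x \<omega>)"
      using AE_space
    proof eventually_elim
      case (elim \<omega>)
      show ?case
        by (rule continuous_on_tendsto_compose[OF cont[OF elim(2)] elim(1)]) auto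
    qed
  qed
  show "AE \<omega> in M. R \<omega> < norm (x \<omega>) \<longrightarrow> F (\<omega>, x \<omega>) = 0" for x
    using AE_space by eventually_elim (auto simp: R)
qed

text \<open>A function on the product that represents a test function agrees with it only almost
  surely for each \<open>x\<close> and is not known to be continuous, so its section enters
  \<open>C_c\<close> by this route.\<close>

lemma C_c_cong:
  fixes f g :: "('a \<Rightarrow> 'b::euclidean_space) \<Rightarrow> 'a \<Rightarrow> real"
  assumes f: "f \<in> C_c M" and g: "\<And>x. x \<in> L0 M \<Longrightarrow> g x \<in> L0 M"
    and eq: "\<And>x. x \<in> L0 M \<Longrightarrow> AE \<omega> in M. f x \<omega> = g x \<omega>"
  shows "g \<in> C_c M"
proof -
  obtain R where R: "R \<in> L0_plus M" "\<And>x. x \<in> L0 M \<Longrightarrow> AE \<omega> in M. R \<omega> < norm (x \<omega>) \<longrightarrow> f x \<omega> = 0"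
    using C_c_bounded[OF f] by blast
  note f' = C_cD[OF f]
  show ?thesis
  proof (rule C_cI[OF _ _ R(1)])
    show "stable_fun M (L0 M) (L0 M) g"
      unfolding stable_fun_def
    proof (intro conjI allI ballI impI Pi_I g)
      fix x y :: "'a \<Rightarrow> 'b" assume x: "x \<in> L0 M" and y: "y \<in> L0 M" and xy: "AE \<omega> in M. x \<omega> = y \<omega>"
      show "AE \<omega> in M. g x \<omega> = g y \<omega>"
        using stable_funD(2)[OF f'(1) x y xy] eq[OF x] eq[OF y] by eventually_elim simp
    next
      fix A and x :: "nat \<Rightarrow> 'a \<Rightarrow> 'b" assume A: "partition_of M A" and x: "\<forall>k. x k \<in> L0 M"
      have gl: "glue A x \<in> L0 M" using A x by (intro glue_measurable) auto
      have "AE \<omega> in M. f (glue A x) \<omega> = glue A (\<lambda>k. f (x k)) \<omega>"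
        using stable_funD(3)[OF f'(1) A] x by blast
      moreover have "AE \<omega> in M. \<forall>k. f (x k) \<omega> = g (x k) \<omega>" unfolding AE_all_countable using eq x by blast
      ultimately show "AE \<omega> in M. g (glue A x) \<omega> = glue A (\<lambda>k. g (x k)) \<omega>"
        using eq[OF gl] by eventually_elim (simp add: glue_def)
    qed
    show "sequentially_continuous M g"
    proof (rule sequentially_continuousI)
      fix xs and x :: "'a \<Rightarrow> 'b"
      assume x: "x \<in> L0 M" "\<And>k. xs k \<in> L0 M" "AE \<omega> in M. (\<lambda>k. xs k \<omega>) \<longlonglongrightarrow> x \<omega>"
      have "AE \<omega> in M. \<forall>k. f (xs k) \<omega> = g (xs k) \<omega>" unfolding AE_all_countable using eq x(2) by blast
      then show "AE \<omega> in M. (\<lambda>k. g (xs k) \<omega>) \<longlonglongrightarrow> g x \<omega>"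
        using sequentially_continuousD[OF f'(2) x] eq[OF x(1)] by eventually_elim simp
    qed
    fix x :: "'a \<Rightarrow> 'b" assume x: "x \<in> L0 M"
    show "AE \<omega> in M. R \<omega> < norm (x \<omega>) \<longrightarrow> g x \<omega> = 0"
      using R(2)[OF x] eq[OF x] by eventually_elim auto
  qed
qed

text \<open>At a random variable with finitely many values, locality determines \<open>f\<close> by
  its values at constants. Simple functions tending to the identity and sequential continuity extend
  this to every \<open>x\<close>. Nothing is claimed about \<open>F\<close> away from graphs; where
  \<open>G i\<close> fails to converge, \<open>lim\<close> has an arbitrary value.\<close>

lemma C_c_representation:
  fixes f :: "('a \<Rightarrow> 'b::euclidean_space) \<Rightarrow> 'a \<Rightarrow> real"
  assumes f: "f \<in> C_c M"
  obtains F where "F \<in> borel_measurable (M \<Otimes>\<^sub>M borel)"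
    "\<And>x. x \<in> L0 M \<Longrightarrow> AE \<omega> in M. f x \<omega> = F (\<omega>, x \<omega>)"
proof -
  note f' = C_cD[OF f]
  have "(\<lambda>z. z) \<in> borel_measurable (borel :: 'b measure)" by simp
  from borel_measurable_implies_sequence_metric[OF this, of 0]
  obtain s where s: "\<And>i. simple_function borel (s i)" "\<And>z :: 'b. (\<lambda>i. s i z) \<longlonglongrightarrow> z" by auto
  have s_fin: "finite (range (s i))" for i using s(1)[of i] by (simp add: simple_function_def)
  have s_m [measurable]: "s i \<in> borel_measurable borel" for i using s(1) by (rule borel_measurable_simple_function)
  have cL: "(\<lambda>_. q) \<in> (L0 M :: ('a \<Rightarrow> 'b) set)" for q by simp
  define G where "G = (\<lambda>i p. f (\<lambda>_. s i (snd p)) (fst p))"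
  have [measurable]: "G i \<in> borel_measurable (M \<Otimes>\<^sub>M borel)" for i
  proof -
    have [measurable]: "f (\<lambda>_. q) \<in> borel_measurable M" for q using stable_funD(1)[OF f'(1) cL] .
    have eq: "G i p = (\<Sum>q\<in>range (s i). indicator {q} (s i (snd p)) * f (\<lambda>_. q) (fst p))" for p
    proof -
      have "(\<Sum>q\<in>range (s i). indicator {q} (s i (snd p)) * f (\<lambda>_. q) (fst p)) =
          (\<Sum>q\<in>range (s i). if q = s i (snd p) then f (\<lambda>_. q) (fst p) else 0)"
        by (intro sum.cong) (auto simp: indicator_def)
      also have "\<dots> = G i p" using s_fin by (simp add: G_def)
      finally show ?thesis by simp
    qed
    show ?thesis unfolding eq[abs_def] by measurable
  qed
  define F where "F = (\<lambda>p. lim (\<lambda>i. G i p))"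
  show thesis
  proof
    show "F \<in> borel_measurable (M \<Otimes>\<^sub>M borel)" unfolding F_def by measurable
    fix x :: "'a \<Rightarrow> 'b" assume x: "x \<in> L0 M"
    then have sx: "(\<lambda>\<omega>. s i (x \<omega>)) \<in> L0 M" for i by measurable
    have "AE \<omega> in M. f (\<lambda>\<omega>. s i (x \<omega>)) \<omega> = G i (\<omega>, x \<omega>)" for i
    proof -
      have "AE \<omega> in M. \<forall>q\<in>range (s i). s i (x \<omega>) = q \<longrightarrow> f (\<lambda>\<omega>. s i (x \<omega>)) \<omega> = f (\<lambda>_. q) \<omega>"
        unfolding AE_ball_countable[OF countable_finite[OF s_fin[of i]]]
        using stable_fun_local[OF f'(1) sx cL] by blast
      then show ?thesis unfolding G_def by eventually_elim simp
    qed
    then have "AE \<omega> in M. \<forall>i. f (\<lambda>\<omega>. s i (x \<omega>)) \<omega> = G i (\<omega>, x \<omega>)" unfolding AE_all_countable by blast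
    moreover have "AE \<omega> in M. (\<lambda>i. f (\<lambda>\<omega>. s i (x \<omega>)) \<omega>) \<longlonglongrightarrow> f x \<omega>"
      by (rule sequentially_continuousD[OF f'(2) x sx]) (simp add: s(2))
    ultimately show "AE \<omega> in M. f x \<omega> = F (\<omega>, x \<omega>)"
      unfolding F_def by eventually_elim (simp add: limI)
  qed
qed

end

section \<open>Measurable selections and the conditional Dini theorem\<close>

text \<open>The construction of Kuratowski and Ryll-Nardzewski: dense points of least index are
  chosen so that the ball of radius \<open>(1/2)^n\<close> around the \<open>n\<close>-th one meets
  \<open>K \<omega>\<close>. Successive choices form a Cauchy sequence, and closedness puts its
  limit into \<open>K \<omega>\<close>.\<close>

lemma measurable_selection:
  fixes K :: "'w \<Rightarrow> 'b::euclidean_space set"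
  assumes closed: "\<And>\<omega>. \<omega> \<in> space M \<Longrightarrow> closed (K \<omega>)" and ne: "\<And>\<omega>. \<omega> \<in> space M \<Longrightarrow> K \<omega> \<noteq> {}"
    and meas: "\<And>q r. {\<omega>\<in>space M. K \<omega> \<inter> cball q r \<noteq> {}} \<in> sets M"
  obtains x where "x \<in> borel_measurable M" "\<And>\<omega>. \<omega> \<in> space M \<Longrightarrow> x \<omega> \<in> K \<omega>"
proof -
  obtain D :: "'b set" where D: "countable D" "\<And>X. open X \<Longrightarrow> X \<noteq> {} \<Longrightarrow> \<exists>d\<in>D. d \<in> X"
    using countable_dense_exists by blast
  have "D \<noteq> {}" using D(2)[of UNIV] by auto
  define q where "q = from_nat_into D"
  have q: "\<exists>j. dist (q j) z < e" if "0 < e" for z e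
  proof -
    have "ball z e \<noteq> {}" using that by simp
    then obtain d where "d \<in> D" "d \<in> ball z e" using D(2)[OF open_ball] by blast
    moreover obtain j where "q j = d" unfolding q_def using from_nat_into_surj[OF D(1) \<open>d \<in> D\<close>] by blast
    ultimately show ?thesis by (auto simp: dist_commute)
  qed
  define hit where "hit = (\<lambda>\<omega> z (n::nat). K \<omega> \<inter> cball z ((1/2)^n) \<noteq> {})"
  \<comment> \<open>The slack \<open>2 * (1/2)^n\<close> leaves room for a next choice: a point of
    \<open>K \<omega>\<close> within \<open>(1/2)^n\<close> of the current centre is within
    \<open>(1/2)^Suc n\<close> of some dense point.\<close>
  define i where "i = rec_nat (\<lambda>\<omega>. LEAST j. hit \<omega> (q j) 0)
    (\<lambda>n f \<omega>. LEAST j. dist (q j) (q (f \<omega>)) \<le> 2 * (1/2)^n \<and> hit \<omega> (q j) (Suc n))"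
  have i0: "i 0 = (\<lambda>\<omega>. LEAST j. hit \<omega> (q j) 0)"
    and iS: "i (Suc n) = (\<lambda>\<omega>. LEAST j. dist (q j) (q (i n \<omega>)) \<le> 2 * (1/2)^n \<and> hit \<omega> (q j) (Suc n))" for n
    unfolding i_def by simp_all
  have hit_m [measurable]: "Measurable.pred M (\<lambda>\<omega>. hit \<omega> z n)" for z n
    unfolding hit_def pred_def using meas .
  have i_m: "i n \<in> measurable M (count_space UNIV)" for n
  proof (induction n)
    case 0
    show ?case unfolding i0 by (rule measurable_Least) measurable
  next
    case (Suc n)
    note Suc [measurable]
    show ?case unfolding iS
    proof (rule measurable_Least)
      fix j
      have [measurable]: "(\<lambda>\<omega>. dist (q j) (q (i n \<omega>))) \<in> borel_measurable M"
        by (rule measurable_compose[OF Suc]) simp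
      show "Measurable.pred M (\<lambda>\<omega>. dist (q j) (q (i n \<omega>)) \<le> 2 * (1/2)^n \<and> hit \<omega> (q j) (Suc n))"
        by measurable
    qed
  qed
  define a where "a = (\<lambda>n \<omega>. q (i n \<omega>))"
  have a_m: "a n \<in> borel_measurable M" for n
    unfolding a_def by (rule measurable_compose[OF i_m]) simp
  have ex: "\<exists>j. dist (q j) z \<le> 2 * (1/2)^n \<and> hit \<omega> (q j) (Suc n)" if "hit \<omega> z n" for \<omega> z n
  proof -
    obtain k where k: "k \<in> K \<omega>" "dist z k \<le> (1/2)^n" using \<open>hit \<omega> z n\<close> unfolding hit_def by auto
    obtain j where j: "dist (q j) k < (1/2)^Suc n" using q[of "(1/2)^Suc n" k] by auto
    have "dist (q j) z \<le> dist (q j) k + dist z k" by (rule dist_triangle2)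
    also have "\<dots> \<le> (1/2)^n / 2 + (1/2)^n" using j k(2) by simp
    also have "\<dots> \<le> 2 * (1/2)^n" by simp
    finally show ?thesis using k(1) j unfolding hit_def by (auto intro!: exI[of _ j] less_imp_le)
  qed
  have hit_a: "hit \<omega> (a n \<omega>) n" if w: "\<omega> \<in> space M" for n \<omega>
  proof (induction n)
    case 0
    obtain k where "k \<in> K \<omega>" using ne[OF w] by blast
    moreover obtain j where "dist (q j) k < 1" using q[of 1 k] by auto
    ultimately have "hit \<omega> (q j) 0" unfolding hit_def by (auto intro!: less_imp_le)
    then show ?case unfolding a_def i0 by (rule LeastI)
  next
    case (Suc n)
    from LeastI_ex[OF ex[OF this]] show ?case unfolding a_def iS by blast
  qed
  have step: "dist (a (Suc n) \<omega>) (a n \<omega>) \<le> 2 * (1/2)^n" if w: "\<omega> \<in> space M" for n \<omega>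
    using LeastI_ex[OF ex[OF hit_a[OF w, of n]]] unfolding a_def iS by blast
  have conv: "convergent (\<lambda>n. a n \<omega>)" if w: "\<omega> \<in> space M" for \<omega>
  proof -
    have "summable (\<lambda>n. 2 * (1/2 :: real)^n)" by (intro summable_mult summable_geometric) simp
    then have "summable (\<lambda>n. a (Suc n) \<omega> - a n \<omega>)"
      by (rule summable_comparison_test'[where N = 0]) (use step[OF w] in \<open>simp add: dist_norm\<close>)
    then have "convergent (\<lambda>n. \<Sum>k<n. a (Suc k) \<omega> - a k \<omega>)" by (simp add: summable_iff_convergent)
    then have "convergent (\<lambda>n. a n \<omega> - a 0 \<omega>)" by (simp only: sum_lessThan_telescope[of "\<lambda>n. a n \<omega>"])
    then show ?thesis using convergent_add[OF _ convergent_const[of "a 0 \<omega>"]] by fastforce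
  qed
  define x where "x = (\<lambda>\<omega>. lim (\<lambda>n. a n \<omega>))"
  have ax: "(\<lambda>n. a n \<omega>) \<longlonglongrightarrow> x \<omega>" if "\<omega> \<in> space M" for \<omega>
    using conv[OF that] unfolding x_def by (simp add: convergent_LIMSEQ_iff)
  show thesis
  proof
    show "x \<in> borel_measurable M" by (rule borel_measurable_LIMSEQ_metric[OF a_m ax])
    fix \<omega> assume w: "\<omega> \<in> space M"
    have "\<forall>n. \<exists>k. k \<in> K \<omega> \<and> dist (a n \<omega>) k \<le> (1/2)^n"
    proof
      fix n
      obtain k where "k \<in> K \<omega>" "k \<in> cball (a n \<omega>) ((1/2)^n)" using hit_a[OF w, of n] unfolding hit_def by blast
      then show "\<exists>k. k \<in> K \<omega> \<and> dist (a n \<omega>) k \<le> (1/2)^n" by auto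
    qed
    from choice[OF this] obtain k where k: "\<And>n. k n \<in> K \<omega>" "\<And>n. dist (a n \<omega>) (k n) \<le> (1/2)^n" by blast
    have "(\<lambda>n. k n - a n \<omega>) \<longlonglongrightarrow> 0"
      by (rule Lim_null_comparison[of _ "\<lambda>n. (1/2)^n"])
        (use k(2) in \<open>auto simp: dist_norm norm_minus_commute LIMSEQ_realpow_zero\<close>)
    from tendsto_add[OF this ax[OF w]] have "k \<longlonglongrightarrow> x \<omega>" by simp
    with closed[OF w] k(1) show "x \<omega> \<in> K \<omega>" by (rule closed_sequentially)
  qed
qed

text \<open>Boundedness yields a convergent subsequence of almost hitting terms. The right-hand side
  has only countable quantifiers, which makes the hitting events of the set of cluster points
  measurable.\<close>

lemma cluster_hits_cball:
  fixes x :: "nat \<Rightarrow> 'b::euclidean_space"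
  assumes b: "\<And>n. norm (x n) \<le> R"
  shows "(\<Inter>N. closure (x ` {N..})) \<inter> cball q r \<noteq> {} \<longleftrightarrow> (\<forall>m N. \<exists>n\<ge>N. dist (x n) q \<le> r + 1 / Suc m)"
proof
  assume "(\<Inter>N. closure (x ` {N..})) \<inter> cball q r \<noteq> {}"
  then obtain z where "z \<in> (\<Inter>N. closure (x ` {N..}))" "z \<in> cball q r" by blast
  then have z: "\<And>N. z \<in> closure (x ` {N..})" "dist q z \<le> r" by auto
  show "\<forall>m N. \<exists>n\<ge>N. dist (x n) q \<le> r + 1 / Suc m"
  proof (intro allI)
    fix m N :: nat
    have "0 < 1 / real (Suc m)" by simp
    then obtain n where n: "n \<ge> N" "dist (x n) z < 1 / Suc m"
      using z(1)[of N] unfolding closure_approachable by (metis atLeast_iff imageE)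
    then have "dist (x n) q \<le> r + 1 / Suc m" using dist_triangle2[of "x n" q z] z(2) by linarith
    then show "\<exists>n\<ge>N. dist (x n) q \<le> r + 1 / Suc m" using n by blast
  qed
next
  assume H: "\<forall>m N. \<exists>n\<ge>N. dist (x n) q \<le> r + 1 / Suc m"
  then have "\<forall>m. \<exists>n\<ge>m. dist (x n) q \<le> r + 1 / Suc m" by blast
  from choice[OF this] obtain n where n: "\<And>m. n m \<ge> m" "\<And>m. dist (x (n m)) q \<le> r + 1 / Suc m" by blast
  have "\<exists>l\<in>cball 0 R. \<exists>s. strict_mono s \<and> ((\<lambda>m. x (n m)) \<circ> s) \<longlonglongrightarrow> l"
    by (rule compact_cball[of "0::'b" R, unfolded compact_def, rule_format]) (use b in simp)
  then obtain z s where s: "strict_mono s" "((\<lambda>m. x (n m)) \<circ> s) \<longlonglongrightarrow> z" by blast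
  have "z \<in> closure (x ` {N..})" for N
    unfolding closure_sequential
  proof (intro exI conjI allI)
    show "(x (n (s (m + N)))) \<in> x ` {N..}" for m
      using n(1)[of "s (m + N)"] seq_suble[OF s(1), of "m + N"] by auto
    show "(\<lambda>m. x (n (s (m + N)))) \<longlonglongrightarrow> z" using LIMSEQ_ignore_initial_segment[OF s(2), of N] by (simp add: o_def)
  qed
  moreover have "dist z q \<le> r"
  proof (rule LIMSEQ_le)
    show "(\<lambda>m. dist (x (n (s m))) q) \<longlonglongrightarrow> dist z q"
      using s(2) by (intro tendsto_dist tendsto_const) (simp add: o_def)
    have "(\<lambda>m. r + 1 / real (Suc m)) \<longlonglongrightarrow> r + 0" by (intro tendsto_intros LIMSEQ_Suc[OF lim_1_over_n])
    from LIMSEQ_subseq_LIMSEQ[OF this s(1)] show "(\<lambda>m. r + 1 / real (Suc (s m))) \<longlonglongrightarrow> r" by (simp add: o_def)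
    show "\<exists>N. \<forall>m\<ge>N. dist (x (n (s m))) q \<le> r + 1 / real (Suc (s m))" using n(2) by blast
  qed
  ultimately have "z \<in> (\<Inter>N. closure (x ` {N..})) \<inter> cball q r" by (simp add: dist_commute)
  then show "(\<Inter>N. closure (x ` {N..})) \<inter> cball q r \<noteq> {}" by blast
qed

text \<open>A selection from the closed set of cluster points, non-empty by boundedness. A
  convergent subsequence depends on \<omega>, so only the limit is selected here; random indices are
  chosen where the lemma is applied.\<close>

lemma measurable_cluster_point:
  fixes x :: "nat \<Rightarrow> 'w \<Rightarrow> 'b::euclidean_space"
  assumes x [measurable]: "\<And>n. x n \<in> borel_measurable M"
    and b: "\<And>n \<omega>. \<omega> \<in> space M \<Longrightarrow> norm (x n \<omega>) \<le> R \<omega>"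
  obtains z where "z \<in> borel_measurable M"
    "\<And>\<omega> e N. \<omega> \<in> space M \<Longrightarrow> 0 < e \<Longrightarrow> \<exists>n\<ge>N. dist (x n \<omega>) (z \<omega>) < e"
proof -
  define K where "K = (\<lambda>\<omega>. \<Inter>N. closure ((\<lambda>n. x n \<omega>) ` {N..}))"
  have hit: "K \<omega> \<inter> cball q r \<noteq> {} \<longleftrightarrow> (\<forall>m N. \<exists>n\<ge>N. dist (x n \<omega>) q \<le> r + 1 / Suc m)" if "\<omega> \<in> space M" for \<omega> q r
    unfolding K_def by (rule cluster_hits_cball) (rule b[OF that])
  obtain z where z: "z \<in> borel_measurable M" "\<And>\<omega>. \<omega> \<in> space M \<Longrightarrow> z \<omega> \<in> K \<omega>"
  proof (rule measurable_selection[of M K])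
    fix \<omega> assume w: "\<omega> \<in> space M"
    show "closed (K \<omega>)" unfolding K_def by (intro closed_INT) auto
    have "dist (x n \<omega>) 0 \<le> R \<omega> + 1 / Suc m" for n m
      using b[OF w, of n] by (simp add: add_increasing2)
    then have "K \<omega> \<inter> cball 0 (R \<omega>) \<noteq> {}" unfolding hit[OF w] by blast
    then show "K \<omega> \<noteq> {}" by blast
  next
    fix q r
    have "{\<omega>\<in>space M. K \<omega> \<inter> cball q r \<noteq> {}} = {\<omega>\<in>space M. \<forall>m N. \<exists>n\<in>{N..}. dist (x n \<omega>) q \<le> r + 1 / Suc m}"
      by (intro Collect_cong conj_cong refl) (simp only: hit Bex_def atLeast_iff)
    also have "\<dots> \<in> sets M" by measurable
    finally show "{\<omega>\<in>space M. K \<omega> \<inter> cball q r \<noteq> {}} \<in> sets M" .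
  qed blast
  show thesis
  proof (rule that[OF z(1)])
    fix \<omega> e N assume w: "\<omega> \<in> space M" and e: "0 < (e::real)"
    have "z \<omega> \<in> closure ((\<lambda>n. x n \<omega>) ` {N..})" using z(2)[OF w] unfolding K_def by blast
    then show "\<exists>n\<ge>N. dist (x n \<omega>) (z \<omega>) < e" using e unfolding closure_approachable by (metis atLeast_iff imageE)
  qed
qed

context prob_space
begin

text \<open>
  The event \<open>A n\<close> is the largest one on which \<open>f n x\<close> exceeds \<open>e\<close> for some \<open>x\<close>. If these decreasing
  events did not shrink to a null set, a measurable cluster point of maximisers would contradict \<open>lim\<close>.
\<close>

lemma conditional_dini:
  fixes f :: "nat \<Rightarrow> ('a \<Rightarrow> 'b::euclidean_space) \<Rightarrow> 'a \<Rightarrow> real"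
  assumes f: "\<And>n. f n \<in> C_c M"
    and dec: "\<And>x n. x \<in> L0 M \<Longrightarrow> AE \<omega> in M. f (Suc n) x \<omega> \<le> f n x \<omega>"
    and lim: "\<And>x. x \<in> L0 M \<Longrightarrow> AE \<omega> in M. (\<lambda>n. f n x \<omega>) \<longlonglongrightarrow> 0"
    and R: "R \<in> borel_measurable M" "\<And>x. x \<in> L0 M \<Longrightarrow> AE \<omega> in M. R \<omega> < norm (x \<omega>) \<longrightarrow> f 0 x \<omega> = 0"
    and e: "0 < e"
  obtains A where "\<And>n :: nat. A n \<in> sets M"
    "\<And>n x. x \<in> L0 M \<Longrightarrow> AE \<omega> in M. \<omega> \<notin> A n \<longrightarrow> f n x \<omega> \<le> e * indicator {..R \<omega>} (norm (x \<omega>))"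
    "AE \<omega> in M. \<exists>N. \<forall>n\<ge>N. \<omega> \<notin> A n"
proof -
  have st: "stable_fun M (L0 M) (L0 M) (f n)" for n using C_cD(1)[OF f] .
  have fL [measurable]: "x \<in> L0 M \<Longrightarrow> f n x \<in> L0 M" for n x using stable_funD(1)[OF st] .
  have dec2: "AE \<omega> in M. decseq (\<lambda>n. f n x \<omega>)" if "x \<in> L0 M" for x
  proof -
    have "AE \<omega> in M. \<forall>n. f (Suc n) x \<omega> \<le> f n x \<omega>" unfolding AE_all_countable using dec[OF that] by blast
    then show ?thesis by eventually_elim (simp add: decseq_Suc_iff)
  qed
  define \<phi> where "\<phi> = (\<lambda>n x. {\<omega>\<in>space M. e < f n x \<omega>})"
  have loc: "local_events M (\<phi> n)" for n
    unfolding local_events_def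
  proof (intro conjI ballI)
    fix x y :: "'a \<Rightarrow> 'b" assume x [measurable]: "x \<in> L0 M" and y: "y \<in> L0 M"
    show "\<phi> n x \<in> sets M" unfolding \<phi>_def by measurable
    show "AE \<omega> in M. x \<omega> = y \<omega> \<longrightarrow> (\<omega> \<in> \<phi> n x \<longleftrightarrow> \<omega> \<in> \<phi> n y)"
      using stable_fun_local[OF st x y, of n] by eventually_elim (simp add: \<phi>_def)
  qed
  have "\<exists>A x0. A \<in> sets M \<and> x0 \<in> L0 M \<and> (AE \<omega> in M. \<omega> \<in> A \<longleftrightarrow> \<omega> \<in> \<phi> n x0) \<and>
      (\<forall>x\<in>L0 M. AE \<omega> in M. \<omega> \<in> \<phi> n x \<longrightarrow> \<omega> \<in> A)" for n
    by (rule local_events_max[OF loc[of n]]) blast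
  then have "\<forall>n. \<exists>p. fst p \<in> sets M \<and> snd p \<in> L0 M \<and> (AE \<omega> in M. \<omega> \<in> fst p \<longleftrightarrow> \<omega> \<in> \<phi> n (snd p)) \<and>
      (\<forall>x\<in>L0 M. AE \<omega> in M. \<omega> \<in> \<phi> n x \<longrightarrow> \<omega> \<in> fst p)" by simp
  from choice[OF this] obtain p where p: "\<And>n. fst (p n) \<in> sets M" "\<And>n. snd (p n) \<in> L0 M"
    "\<And>n. AE \<omega> in M. \<omega> \<in> fst (p n) \<longleftrightarrow> \<omega> \<in> \<phi> n (snd (p n))"
    "\<And>n x. x \<in> L0 M \<Longrightarrow> AE \<omega> in M. \<omega> \<in> \<phi> n x \<longrightarrow> \<omega> \<in> fst (p n)" by blast
  define A where "A = (\<lambda>n. fst (p n))"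
  define X where "X = (\<lambda>n. snd (p n))"
  have A: "\<And>n. A n \<in> sets M" and X: "\<And>n. X n \<in> L0 M"
    and AX: "\<And>n. AE \<omega> in M. \<omega> \<in> A n \<longleftrightarrow> \<omega> \<in> \<phi> n (X n)"
    and Amax: "\<And>n x. x \<in> L0 M \<Longrightarrow> AE \<omega> in M. \<omega> \<in> \<phi> n x \<longrightarrow> \<omega> \<in> A n"
    unfolding A_def X_def by (rule p; assumption?)+
  note A [measurable] X [measurable] R(1) [measurable]
  have A_dec: "AE \<omega> in M. decseq (\<lambda>n. (indicator (A n) \<omega> :: nat))"
  proof -
    have "AE \<omega> in M. \<omega> \<in> A (Suc n) \<longrightarrow> \<omega> \<in> A n" for n
      using AX[of "Suc n"] Amax[OF X[of "Suc n"], of n] dec[OF X[of "Suc n"], of n]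
      by eventually_elim (auto simp: \<phi>_def)
    then have "AE \<omega> in M. \<forall>n. \<omega> \<in> A (Suc n) \<longrightarrow> \<omega> \<in> A n" unfolding AE_all_countable by blast
    then show ?thesis by eventually_elim (simp add: decseq_Suc_iff indicator_def)
  qed
  \<comment> \<open>On \<open>A n\<close> the witness \<open>X n\<close> already lies in the ball of
    radius \<open>R\<close>, because \<open>f 0\<close> vanishes outside that ball and dominates
    \<open>f n\<close>. The truncation changes nothing there and makes the sequence bounded
    everywhere.\<close>
  define X' where "X' = (\<lambda>n \<omega>. if norm (X n \<omega>) \<le> R \<omega> then X n \<omega> else 0)"
  have X' [measurable]: "X' n \<in> borel_measurable M" for n unfolding X'_def by measurable
  have X'b: "norm (X' n \<omega>) \<le> max (R \<omega>) 0" for n \<omega> unfolding X'_def by auto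
  obtain x where x: "x \<in> L0 M"
    "\<And>\<omega> e N. \<omega> \<in> space M \<Longrightarrow> 0 < e \<Longrightarrow> \<exists>n\<ge>N. dist (X' n \<omega>) (x \<omega>) < e"
    using measurable_cluster_point[of X' M "\<lambda>\<omega>. max (R \<omega>) 0", OF X' X'b] by metis
  note x(1) [measurable]
  \<comment> \<open>A random subsequence: \<open>m \<le> j\<close> forces the indices to grow, and
    taking the least index makes the choice measurable.\<close>
  define J where "J = (\<lambda>m \<omega>. LEAST j. m \<le> j \<and> dist (X' j \<omega>) (x \<omega>) < 1 / real (Suc m))"
  have J: "m \<le> J m \<omega> \<and> dist (X' (J m \<omega>) \<omega>) (x \<omega>) < 1 / real (Suc m)" if "\<omega> \<in> space M" for m \<omega>
    unfolding J_def by (rule LeastI_ex) (use x(2)[OF that, of "1 / real (Suc m)" m] in auto)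
  have [measurable]: "J m \<in> measurable M (count_space UNIV)" for m
    unfolding J_def by (rule measurable_Least) measurable
  define Y where "Y = (\<lambda>m \<omega>. X' (J m \<omega>) \<omega>)"
  have Y [measurable]: "Y m \<in> borel_measurable M" for m
    unfolding Y_def by (rule measurable_compose_countable[where f = X']) measurable
  have Yx: "AE \<omega> in M. (\<lambda>m. Y m \<omega>) \<longlonglongrightarrow> x \<omega>"
    using AE_space
  proof eventually_elim
    case (elim \<omega>)
    have "(\<lambda>m. Y m \<omega> - x \<omega>) \<longlonglongrightarrow> 0"
      by (rule Lim_null_comparison[OF _ LIMSEQ_Suc[OF lim_1_over_n]])
        (use J[OF elim] in \<open>auto simp: Y_def dist_norm intro!: always_eventually less_imp_le\<close>)
    then show ?case by (simp add: LIM_zero_iff)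
  qed
  have fY: "AE \<omega> in M. (\<lambda>m. f k (Y m) \<omega>) \<longlonglongrightarrow> f k x \<omega>" for k
    by (rule sequentially_continuousD[OF C_cD(2)[OF f] x(1) Y Yx])
  have fYJ: "AE \<omega> in M. f k (Y m) \<omega> = f k (X' (J m \<omega>)) \<omega>" for k m
  proof -
    have "AE \<omega> in M. \<forall>j. Y m \<omega> = X' j \<omega> \<longrightarrow> f k (Y m) \<omega> = f k (X' j) \<omega>"
      unfolding AE_all_countable using stable_fun_local[OF st Y X'] by blast
    then show ?thesis by eventually_elim (simp add: Y_def)
  qed
  have fX': "AE \<omega> in M. norm (X j \<omega>) \<le> R \<omega> \<longrightarrow> f k (X' j) \<omega> = f k (X j) \<omega>" for k j
    using stable_fun_local[OF st[of k] X'[of j] X[of j]] by eventually_elim (simp add: X'_def)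
  have "AE \<omega> in M. \<exists>n. \<omega> \<notin> A n"
  proof -
    have 1: "AE \<omega> in M. \<forall>n. \<omega> \<in> A n \<longleftrightarrow> \<omega> \<in> \<phi> n (X n)" unfolding AE_all_countable using AX by blast
    have 2: "AE \<omega> in M. \<forall>n. R \<omega> < norm (X n \<omega>) \<longrightarrow> f 0 (X n) \<omega> = 0" unfolding AE_all_countable using R(2)[OF X] by blast
    have 3: "AE \<omega> in M. \<forall>k. (\<lambda>m. f k (Y m) \<omega>) \<longlonglongrightarrow> f k x \<omega>" unfolding AE_all_countable using fY by blast
    have 4: "AE \<omega> in M. \<forall>k m. f k (Y m) \<omega> = f k (X' (J m \<omega>)) \<omega>" unfolding AE_all_countable using fYJ by blast
    have 5: "AE \<omega> in M. \<forall>k j. norm (X j \<omega>) \<le> R \<omega> \<longrightarrow> f k (X' j) \<omega> = f k (X j) \<omega>" unfolding AE_all_countable using fX' by blast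
    have 6: "AE \<omega> in M. \<forall>j. decseq (\<lambda>n. f n (X j) \<omega>)" unfolding AE_all_countable using dec2[OF X] by blast
    show ?thesis using 1 2 3 4 5 6 lim[OF x(1)] AE_space
    proof eventually_elim
      case (elim \<omega>)
      show ?case
      proof (rule ccontr)
        assume "\<not> (\<exists>n. \<omega> \<notin> A n)"
        then have big: "e < f n (X n) \<omega>" for n using elim(1) unfolding \<phi>_def by blast
        have bd: "norm (X n \<omega>) \<le> R \<omega>" for n
        proof (rule ccontr)
          assume "\<not> norm (X n \<omega>) \<le> R \<omega>"
          then have "f 0 (X n) \<omega> = 0" using elim(2) by simp
          moreover have "f n (X n) \<omega> \<le> f 0 (X n) \<omega>" using decseqD[OF elim(6)[rule_format, of n], of 0 n] by simp
          ultimately show False using big[of n] e by simp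
        qed
        have "e \<le> f k x \<omega>" for k
        proof (rule LIMSEQ_le_const)
          show "(\<lambda>m. f k (Y m) \<omega>) \<longlonglongrightarrow> f k x \<omega>" using elim(3) by blast
          \<comment> \<open>By locality \<open>Y m\<close> may be replaced by the witness with index
            \<open>J m \<omega>\<close>, which is at least \<open>k\<close>; monotonicity carries
            the bound from that index down to \<open>k\<close>. Letting \<open>m\<close> tend to
            infinity then uses continuity of \<open>f k\<close> alone.\<close>
          have "e \<le> f k (Y m) \<omega>" if "m \<ge> k" for m
          proof -
            let ?j = "J m \<omega>"
            have "k \<le> ?j" using J[OF elim(8), of m] that by linarith
            then have "f ?j (X ?j) \<omega> \<le> f k (X ?j) \<omega>"
              using decseqD[OF elim(6)[rule_format, of ?j], of k ?j] by simp
            moreover have "f k (Y m) \<omega> = f k (X ?j) \<omega>" using elim(4,5) bd by simp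
            ultimately show ?thesis using big[of ?j] by simp
          qed
          then show "\<exists>N. \<forall>m\<ge>N. e \<le> f k (Y m) \<omega>" by blast
        qed
        then have "e \<le> 0" using LIMSEQ_le_const[OF elim(7)] by blast
        then show False using e by simp
      qed
    qed
  qed
  then have ev: "AE \<omega> in M. \<exists>N. \<forall>n\<ge>N. \<omega> \<notin> A n" using A_dec
  proof eventually_elim
    case (elim \<omega>)
    then obtain N where N: "\<omega> \<notin> A N" by blast
    have "\<omega> \<notin> A n" if "n \<ge> N" for n
      using decseqD[OF elim(2) that] N by (auto simp: indicator_def split: if_splits)
    then show ?case by blast
  qed
  show thesis
  proof (rule that[OF A _ ev])
    fix n and y :: "'a \<Rightarrow> 'b" assume y: "y \<in> L0 M"
    show "AE \<omega> in M. \<omega> \<notin> A n \<longrightarrow> f n y \<omega> \<le> e * indicator {..R \<omega>} (norm (y \<omega>))"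
      using Amax[OF y, of n] dec2[OF y] R(2)[OF y] AE_space
    proof eventually_elim
      case (elim \<omega>)
      have "f n y \<omega> \<le> f 0 y \<omega>" using decseqD[OF elim(2), of 0 n] by simp
      then show ?case using elim by (auto simp: \<phi>_def indicator_def)
    qed
  qed
qed

end

section \<open>The measure on the product space\<close>

definition section_fun :: "('w \<times> 'b \<Rightarrow> real) \<Rightarrow> ('w \<Rightarrow> 'b) \<Rightarrow> 'w \<Rightarrow> real"
  where "section_fun F = (\<lambda>x \<omega>. F (\<omega>, x \<omega>))"

text \<open>A test function dominating the indicator of a random ball; the linear drop over a shell
  of width 1 makes its sections continuous.\<close>

definition cutoff :: "('w \<Rightarrow> real) \<Rightarrow> 'w \<times> 'b::euclidean_space \<Rightarrow> real"
  where "cutoff R = (\<lambda>p. max 0 (min 1 (R (fst p) + 1 - norm (snd p))))"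

lemma cutoff_nonneg: "0 \<le> cutoff R p" and cutoff_one: "norm (snd p) \<le> R (fst p) \<Longrightarrow> cutoff R p = 1"
  unfolding cutoff_def by auto

lemma cutoff_measurable [measurable]:
  assumes [measurable]: "R \<in> borel_measurable M"
  shows "cutoff R \<in> borel_measurable (M \<Otimes>\<^sub>M borel)"
  unfolding cutoff_def by measurable

context prob_space
begin

lemma C_c_cutoff:
  assumes R: "R \<in> borel_measurable M"
  shows "section_fun (cutoff R :: 'a \<times> 'b::euclidean_space \<Rightarrow> real) \<in> C_c M"
  unfolding section_fun_def
proof (rule C_c_section[where R = "\<lambda>\<omega>. max 0 (R \<omega> + 1)"])
  show "cutoff R \<in> borel_measurable (M \<Otimes>\<^sub>M borel)" using R by measurable
  show "continuous_on UNIV (\<lambda>z. cutoff R (\<omega>, z))" for \<omega>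
    unfolding cutoff_def fst_conv snd_conv by (intro continuous_intros)
  show "(\<lambda>\<omega>. max 0 (R \<omega> + 1)) \<in> L0_plus M" unfolding L0_plus_def using R by simp
qed (auto simp: cutoff_def)

end

text \<open>\<open>L_linear\<close> admits random coefficients, in particular indicators. This is
  the form in which locality of \<open>L\<close> is used throughout.\<close>

locale positive_functional = prob_space M for M :: "'a measure" +
  fixes L :: "(('a \<Rightarrow> 'b::euclidean_space) \<Rightarrow> 'a \<Rightarrow> real) \<Rightarrow> 'a \<Rightarrow> real"
  assumes L_maps: "f \<in> C_c M \<Longrightarrow> L f \<in> L0 M"
    and L_well_defined: "f \<in> C_c M \<Longrightarrow> g \<in> C_c M \<Longrightarrow>
          (\<And>x. x \<in> L0 M \<Longrightarrow> AE \<omega> in M. f x \<omega> = g x \<omega>) \<Longrightarrow> AE \<omega> in M. L f \<omega> = L g \<omega>"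
    and L_linear: "f \<in> C_c M \<Longrightarrow> g \<in> C_c M \<Longrightarrow> r \<in> L0 M \<Longrightarrow>
          AE \<omega> in M. L (\<lambda>x \<omega>. f x \<omega> + r \<omega> * g x \<omega>) \<omega> = L f \<omega> + r \<omega> * L g \<omega>"
    and L_positive: "f \<in> C_c M \<Longrightarrow> (\<And>x. x \<in> L0 M \<Longrightarrow> AE \<omega> in M. 0 \<le> f x \<omega>) \<Longrightarrow>
          AE \<omega> in M. 0 \<le> L f \<omega>"
begin

section \<open>Rules for \<open>L\<close> and the vector lattice \<open>H\<close> on the
  product\<close>

abbreviation N :: "('a \<times> 'b) measure" where "N \<equiv> M \<Otimes>\<^sub>M borel"

lemma L_meas [measurable]: "f \<in> C_c M \<Longrightarrow> L f \<in> borel_measurable M"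
  by (rule L_maps)

lemma C_c_zero: "(\<lambda>x \<omega>. 0 :: real) \<in> (C_c M :: (('a \<Rightarrow> 'b) \<Rightarrow> _) set)"
  using C_c_section[of "\<lambda>_. 0" "\<lambda>_. 0"] by (simp add: L0_plus_def)

lemma C_c_mult: "f \<in> C_c M \<Longrightarrow> r \<in> L0 M \<Longrightarrow> (\<lambda>x \<omega>. r \<omega> * f x \<omega>) \<in> (C_c M :: (('a \<Rightarrow> 'b) \<Rightarrow> _) set)"
  using C_c_lin[OF C_c_zero, of f r] by simp

lemma C_c_add: "f \<in> C_c M \<Longrightarrow> g \<in> C_c M \<Longrightarrow> (\<lambda>x \<omega>. f x \<omega> + g x \<omega>) \<in> (C_c M :: (('a \<Rightarrow> 'b) \<Rightarrow> _) set)"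
  using C_c_lin[of f g "\<lambda>_. 1"] by simp

lemma C_c_diff: "f \<in> C_c M \<Longrightarrow> g \<in> C_c M \<Longrightarrow> (\<lambda>x \<omega>. f x \<omega> - g x \<omega>) \<in> (C_c M :: (('a \<Rightarrow> 'b) \<Rightarrow> _) set)"
  using C_c_lin[of f g "\<lambda>_. - 1"] by simp

lemma C_c_abs: "f \<in> C_c M \<Longrightarrow> (\<lambda>x \<omega>. \<bar>f x \<omega>\<bar>) \<in> (C_c M :: (('a \<Rightarrow> 'b) \<Rightarrow> _) set)"
proof -
  assume f: "f \<in> C_c M"
  then have "(\<lambda>x \<omega>. max (f x \<omega>) (- 1 * f x \<omega>)) \<in> C_c M" by (intro C_c_max C_c_mult) auto
  moreover have "max a (- 1 * a) = \<bar>a\<bar>" for a :: real by auto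
  ultimately show ?thesis by simp
qed

lemma L_add: "f \<in> C_c M \<Longrightarrow> g \<in> C_c M \<Longrightarrow> AE \<omega> in M. L (\<lambda>x \<omega>. f x \<omega> + g x \<omega>) \<omega> = L f \<omega> + L g \<omega>"
  using L_linear[of f g "\<lambda>_. 1"] by simp

lemma L_zero: "AE \<omega> in M. L (\<lambda>x \<omega>. 0) \<omega> = 0"
  using L_add[OF C_c_zero C_c_zero] by simp

lemma L_mult: "f \<in> C_c M \<Longrightarrow> r \<in> L0 M \<Longrightarrow> AE \<omega> in M. L (\<lambda>x \<omega>. r \<omega> * f x \<omega>) \<omega> = r \<omega> * L f \<omega>"
  using L_linear[OF C_c_zero, of f r] L_zero by auto

lemma L_diff: "f \<in> C_c M \<Longrightarrow> g \<in> C_c M \<Longrightarrow> AE \<omega> in M. L (\<lambda>x \<omega>. f x \<omega> - g x \<omega>) \<omega> = L f \<omega> - L g \<omega>"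
  using L_linear[of f g "\<lambda>_. - 1"] by simp

lemma L_mono:
  assumes f: "f \<in> C_c M" and g: "g \<in> C_c M" and le: "\<And>x. x \<in> L0 M \<Longrightarrow> AE \<omega> in M. f x \<omega> \<le> g x \<omega>"
  shows "AE \<omega> in M. L f \<omega> \<le> L g \<omega>"
proof -
  have "AE \<omega> in M. 0 \<le> L (\<lambda>x \<omega>. g x \<omega> - f x \<omega>) \<omega>"
    by (rule L_positive[OF C_c_diff[OF g f]]) (use le in simp)
  then show ?thesis using L_diff[OF g f] by eventually_elim simp
qed

lemma L_abs_le:
  assumes f: "f \<in> C_c M"
  shows "AE \<omega> in M. \<bar>L f \<omega>\<bar> \<le> L (\<lambda>x \<omega>. \<bar>f x \<omega>\<bar>) \<omega>"
proof -
  have "(\<lambda>x \<omega>. - 1 * f x \<omega>) \<in> C_c M" using f by (intro C_c_mult) auto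
  from L_mono[OF this C_c_abs[OF f]] L_mono[OF f C_c_abs[OF f]] L_mult[OF f, of "\<lambda>_. - 1"]
  have "AE \<omega> in M. L (\<lambda>x \<omega>. - 1 * f x \<omega>) \<omega> \<le> L (\<lambda>x \<omega>. \<bar>f x \<omega>\<bar>) \<omega>"
    "AE \<omega> in M. L f \<omega> \<le> L (\<lambda>x \<omega>. \<bar>f x \<omega>\<bar>) \<omega>" "AE \<omega> in M. L (\<lambda>x \<omega>. - 1 * f x \<omega>) \<omega> = - 1 * L f \<omega>"
    by auto
  then show ?thesis by eventually_elim auto
qed

text \<open>Integrability is required of \<open>L\<close> at the absolute value, so that
  \<open>H\<close> is closed under sums and maxima by domination.\<close>

definition H :: "('a \<times> 'b \<Rightarrow> real) set"
  where "H = {F \<in> borel_measurable N. section_fun F \<in> C_c M \<and>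
           integrable M (L (section_fun (\<lambda>p. \<bar>F p\<bar>)))}"

definition I :: "('a \<times> 'b \<Rightarrow> real) \<Rightarrow> real"
  where "I F = (\<integral>\<omega>. L (section_fun F) \<omega> \<partial>M)"

lemma HD:
  assumes "F \<in> H"
  shows "F \<in> borel_measurable N" "section_fun F \<in> C_c M" "section_fun (\<lambda>p. \<bar>F p\<bar>) \<in> C_c M"
    "integrable M (L (section_fun (\<lambda>p. \<bar>F p\<bar>)))" "integrable M (L (section_fun F))"
proof -
  show 1: "F \<in> borel_measurable N" "section_fun F \<in> C_c M" and 2: "integrable M (L (section_fun (\<lambda>p. \<bar>F p\<bar>)))"
    using assms unfolding H_def by auto
  show 3: "section_fun (\<lambda>p. \<bar>F p\<bar>) \<in> C_c M" using C_c_abs[OF 1(2)] unfolding section_fun_def .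
  show "integrable M (L (section_fun F))"
  proof (rule Bochner_Integration.integrable_bound[OF 2 L_maps[OF 1(2)]])
    show "AE \<omega> in M. norm (L (section_fun F) \<omega>) \<le> norm (L (section_fun (\<lambda>p. \<bar>F p\<bar>)) \<omega>)"
      using L_abs_le[OF 1(2)] unfolding section_fun_def by eventually_elim auto
  qed
qed

text \<open>The majorant is any test function with integrable \<open>L G\<close>, not necessarily
  the section of a function on the product; this is the form available in
  \<open>cE_eq_L\<close>.\<close>

lemma HI:
  assumes "F \<in> borel_measurable N" "section_fun F \<in> C_c M" "G \<in> C_c M" "integrable M (L G)"
    and le: "\<And>x. x \<in> L0 M \<Longrightarrow> AE \<omega> in M. \<bar>F (\<omega>, x \<omega>)\<bar> \<le> G x \<omega>"
  shows "F \<in> H"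
proof -
  have 3: "section_fun (\<lambda>p. \<bar>F p\<bar>) \<in> C_c M" using C_c_abs[OF assms(2)] unfolding section_fun_def .
  have "integrable M (L (section_fun (\<lambda>p. \<bar>F p\<bar>)))"
  proof (rule Bochner_Integration.integrable_bound[OF assms(4) L_maps[OF 3]])
    have "AE \<omega> in M. 0 \<le> L (section_fun (\<lambda>p. \<bar>F p\<bar>)) \<omega>"
      by (rule L_positive[OF 3]) (simp add: section_fun_def)
    moreover have "AE \<omega> in M. L (section_fun (\<lambda>p. \<bar>F p\<bar>)) \<omega> \<le> L G \<omega>"
      by (rule L_mono[OF 3 assms(3)]) (use le in \<open>simp add: section_fun_def\<close>)
    ultimately show "AE \<omega> in M. norm (L (section_fun (\<lambda>p. \<bar>F p\<bar>)) \<omega>) \<le> norm (L G \<omega>)"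
      by eventually_elim auto
  qed
  with assms show ?thesis unfolding H_def by auto
qed

lemma H_zero: "(\<lambda>_. 0) \<in> H"
proof (rule HI[OF _ _ C_c_zero])
  show "section_fun (\<lambda>_ :: 'a \<times> 'b. 0) \<in> C_c M" unfolding section_fun_def by (rule C_c_zero)
  have "integrable M (L (\<lambda>x \<omega>. 0)) \<longleftrightarrow> integrable M (\<lambda>_. 0 :: real)"
    using L_zero C_c_zero by (intro integrable_cong_AE) auto
  then show "integrable M (L (\<lambda>x \<omega>. 0))" by simp
qed auto

lemma integrable_L_add:
  assumes "f \<in> C_c M" "g \<in> C_c M" "integrable M (L f)" "integrable M (L g)"
  shows "integrable M (L (\<lambda>x \<omega>. f x \<omega> + g x \<omega>))"
proof -
  have "integrable M (L (\<lambda>x \<omega>. f x \<omega> + g x \<omega>)) \<longleftrightarrow> integrable M (\<lambda>\<omega>. L f \<omega> + L g \<omega>)"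
    using L_add[OF assms(1,2)] L_maps C_c_add assms by (intro integrable_cong_AE) auto
  then show ?thesis using assms by simp
qed

lemma H_add: "F \<in> H \<Longrightarrow> G \<in> H \<Longrightarrow> (\<lambda>p. F p + G p) \<in> H"
proof -
  assume F: "F \<in> H" and G: "G \<in> H"
  show ?thesis
  proof (rule HI[OF _ _ C_c_add[OF HD(3)[OF F] HD(3)[OF G]] integrable_L_add[OF HD(3)[OF F] HD(3)[OF G] HD(4)[OF F] HD(4)[OF G]]])
    show "(\<lambda>p. F p + G p) \<in> borel_measurable N" using HD(1)[OF F] HD(1)[OF G] by measurable
    show "section_fun (\<lambda>p. F p + G p) \<in> C_c M"
      using C_c_add[OF HD(2)[OF F] HD(2)[OF G]] unfolding section_fun_def .
  qed (simp add: section_fun_def abs_triangle_ineq)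
qed

lemma H_scale: "F \<in> H \<Longrightarrow> (\<lambda>p. c * F p) \<in> H"
proof -
  assume F: "F \<in> H"
  have c: "(\<lambda>x \<omega>. \<bar>c\<bar> * section_fun (\<lambda>p. \<bar>F p\<bar>) x \<omega>) \<in> C_c M" using HD(3)[OF F] by (intro C_c_mult) auto
  have "integrable M (L (\<lambda>x \<omega>. \<bar>c\<bar> * section_fun (\<lambda>p. \<bar>F p\<bar>) x \<omega>)) \<longleftrightarrow> integrable M (\<lambda>\<omega>. \<bar>c\<bar> * L (section_fun (\<lambda>p. \<bar>F p\<bar>)) \<omega>)"
    using L_mult[OF HD(3)[OF F], of "\<lambda>_. \<bar>c\<bar>"] L_maps[OF c] L_maps[OF HD(3)[OF F]] by (intro integrable_cong_AE) auto
  then have i: "integrable M (L (\<lambda>x \<omega>. \<bar>c\<bar> * section_fun (\<lambda>p. \<bar>F p\<bar>) x \<omega>))" using HD(4)[OF F] by simp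
  show ?thesis
  proof (rule HI[OF _ _ c i])
    show "(\<lambda>p. c * F p) \<in> borel_measurable N" using HD(1)[OF F] by measurable
    show "section_fun (\<lambda>p. c * F p) \<in> C_c M"
      using C_c_mult[OF HD(2)[OF F], of "\<lambda>_. c"] unfolding section_fun_def by simp
  qed (simp add: section_fun_def abs_mult)
qed

lemma H_max: "F \<in> H \<Longrightarrow> G \<in> H \<Longrightarrow> (\<lambda>p. max (F p) (G p)) \<in> H"
proof -
  assume F: "F \<in> H" and G: "G \<in> H"
  show ?thesis
  proof (rule HI[OF _ _ C_c_add[OF HD(3)[OF F] HD(3)[OF G]] integrable_L_add[OF HD(3)[OF F] HD(3)[OF G] HD(4)[OF F] HD(4)[OF G]]])
    show "(\<lambda>p. max (F p) (G p)) \<in> borel_measurable N" using HD(1)[OF F] HD(1)[OF G] by measurable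
    show "section_fun (\<lambda>p. max (F p) (G p)) \<in> C_c M"
      using C_c_max[OF HD(2)[OF F] HD(2)[OF G]] unfolding section_fun_def .
  qed (auto simp: section_fun_def)
qed

text \<open>Off the event \<open>A n\<close> of \<open>conditional_dini\<close>, \<open>f n\<close>
  is at most \<open>e\<close> times a fixed cutoff, and almost every \<omega> eventually leaves
  these events. So \<open>L (f n)\<close> is eventually at most \<open>e\<close> times a fixed
  random variable.\<close>

lemma L_continuous:
  fixes f :: "nat \<Rightarrow> ('a \<Rightarrow> 'b) \<Rightarrow> 'a \<Rightarrow> real"
  assumes f: "\<And>n. f n \<in> C_c M"
    and dec: "\<And>x n. x \<in> L0 M \<Longrightarrow> AE \<omega> in M. f (Suc n) x \<omega> \<le> f n x \<omega>"
    and lim: "\<And>x. x \<in> L0 M \<Longrightarrow> AE \<omega> in M. (\<lambda>n. f n x \<omega>) \<longlonglongrightarrow> 0"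
    and nonneg: "\<And>x n. x \<in> L0 M \<Longrightarrow> AE \<omega> in M. 0 \<le> f n x \<omega>"
  shows "AE \<omega> in M. (\<lambda>n. L (f n) \<omega>) \<longlonglongrightarrow> 0"
proof -
  obtain R where R: "R \<in> L0_plus M" "\<And>x. x \<in> L0 M \<Longrightarrow> AE \<omega> in M. R \<omega> < norm (x \<omega>) \<longrightarrow> f 0 x \<omega> = 0"
    using C_c_bounded[OF f] by blast
  have Rm: "R \<in> borel_measurable M" using R(1) unfolding L0_plus_def by auto
  let ?\<psi> = "section_fun (cutoff R) :: ('a \<Rightarrow> 'b) \<Rightarrow> 'a \<Rightarrow> real"
  have \<psi>: "?\<psi> \<in> C_c M" by (rule C_c_cutoff[OF Rm])
  have \<psi>1: "indicator {..R \<omega>} (norm (x \<omega>)) \<le> ?\<psi> x \<omega>" for x \<omega>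
    unfolding section_fun_def using cutoff_one[of "(\<omega>, x \<omega>)" R] cutoff_nonneg[of R "(\<omega>, x \<omega>)"]
    by (auto simp: indicator_def)
  have small: "AE \<omega> in M. \<exists>N. \<forall>n\<ge>N. L (f n) \<omega> \<le> e * L ?\<psi> \<omega>" if e: "0 < e" for e
  proof -
    obtain A where A: "\<And>n :: nat. A n \<in> sets M"
      "\<And>n x. x \<in> L0 M \<Longrightarrow> AE \<omega> in M. \<omega> \<notin> A n \<longrightarrow> f n x \<omega> \<le> e * indicator {..R \<omega>} (norm (x \<omega>))"
      "AE \<omega> in M. \<exists>N. \<forall>n\<ge>N. \<omega> \<notin> A n"
      by (rule conditional_dini[of f R e, OF f dec lim Rm R(2) e]) (assumption | blast)+
    have "AE \<omega> in M. \<omega> \<notin> A n \<longrightarrow> L (f n) \<omega> \<le> e * L ?\<psi> \<omega>" for n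
    proof -
      \<comment> \<open>Positivity compares whole test functions only. Multiplying by the indicator
        of the complement of \<open>A n\<close> localises the estimate, and linearity moves the
        indicator out of \<open>L\<close> again.\<close>
      let ?r = "indicator (space M - A n) :: 'a \<Rightarrow> real"
      have r: "?r \<in> L0 M" using A(1)[of n] by simp
      have c: "(\<lambda>x \<omega>. ?r \<omega> * f n x \<omega>) \<in> C_c M" "(\<lambda>x \<omega>. e * ?\<psi> x \<omega>) \<in> C_c M"
        using r f \<psi> by (intro C_c_mult; simp)+
      have "AE \<omega> in M. L (\<lambda>x \<omega>. ?r \<omega> * f n x \<omega>) \<omega> \<le> L (\<lambda>x \<omega>. e * ?\<psi> x \<omega>) \<omega>"
      proof (rule L_mono[OF c])
        fix x :: "'a \<Rightarrow> 'b" assume x: "x \<in> L0 M"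
        show "AE \<omega> in M. ?r \<omega> * f n x \<omega> \<le> e * ?\<psi> x \<omega>"
          using A(2)[OF x, of n]
        proof eventually_elim
          case (elim \<omega>)
          have *: "e * indicator {..R \<omega>} (norm (x \<omega>)) \<le> e * ?\<psi> x \<omega>" using e \<psi>1 by (intro mult_left_mono) auto
          moreover have "0 \<le> e * ?\<psi> x \<omega>" unfolding section_fun_def using e by (intro mult_nonneg_nonneg cutoff_nonneg) simp
          ultimately show ?case using elim by (auto simp: indicator_def[of "space M - A n"])
        qed
      qed
      moreover have "AE \<omega> in M. L (\<lambda>x \<omega>. e * ?\<psi> x \<omega>) \<omega> = e * L ?\<psi> \<omega>" by (rule L_mult[OF \<psi>]) simp
      ultimately show ?thesis using L_mult[OF f[of n] r] AE_space
        by eventually_elim (auto simp: indicator_def)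
    qed
    then have "AE \<omega> in M. \<forall>n. \<omega> \<notin> A n \<longrightarrow> L (f n) \<omega> \<le> e * L ?\<psi> \<omega>" unfolding AE_all_countable by blast
    with A(3) show ?thesis by eventually_elim blast
  qed
  have pos: "AE \<omega> in M. \<forall>n. 0 \<le> L (f n) \<omega>"
    unfolding AE_all_countable using L_positive[OF f nonneg] by blast
  have "AE \<omega> in M. \<forall>k. \<exists>N. \<forall>n\<ge>N. L (f n) \<omega> \<le> (1 / real (Suc k)) * L ?\<psi> \<omega>"
    unfolding AE_all_countable by (intro allI small) simp
  then show ?thesis using pos
  proof eventually_elim
    case (elim \<omega>)
    show ?case
    proof (rule LIMSEQ_I)
      fix d :: real assume d: "0 < d"
      obtain k where k: "\<bar>L ?\<psi> \<omega>\<bar> / d < real k" using reals_Archimedean2 by blast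
      obtain N where N: "\<And>n. n \<ge> N \<Longrightarrow> L (f n) \<omega> \<le> (1 / real (Suc k)) * L ?\<psi> \<omega>" using elim(1) by blast
      have "(1 / real (Suc k)) * L ?\<psi> \<omega> < d"
      proof -
        have "L ?\<psi> \<omega> < d * real k" using k d by (simp add: divide_less_eq mult.commute)
        also have "\<dots> \<le> d * real (Suc k)" using d by simp
        finally show ?thesis by (simp add: divide_less_eq)
      qed
      then have "norm (L (f n) \<omega> - 0) < d" if "n \<ge> N" for n using N[OF that] elim(2) by simp
      then show "\<exists>N. \<forall>n\<ge>N. norm (L (f n) \<omega> - 0) < d" by blast
    qed
  qed
qed

lemma space_N: "p \<in> space N \<longleftrightarrow> fst p \<in> space M"
  by (cases p) (simp add: space_pair_measure)

lemma section_AE: "(\<And>p. p \<in> space N \<Longrightarrow> P p) \<Longrightarrow> AE \<omega> in M. P (\<omega>, x \<omega>)"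
  by (rule AE_I2) (simp add: space_N)

text \<open>The substantial axiom is continuity: \<open>L_continuous\<close> gives almost sure
  convergence, and \<open>L\<close> of the first function of the sequence is an integrable
  majorant.\<close>

lemma daniell_I: "daniell (space N) H I"
proof
  show "(\<lambda>_. 0) \<in> H" by (rule H_zero)
  fix F G and c :: real assume F: "F \<in> H"
  show "(\<lambda>p. c * F p) \<in> H" by (rule H_scale[OF F])
  show "I (\<lambda>p. c * F p) = c * I F"
  proof -
    have "I (\<lambda>p. c * F p) = (\<integral>\<omega>. c * L (section_fun F) \<omega> \<partial>M)"
      unfolding I_def using L_mult[OF HD(2)[OF F], of "\<lambda>_. c"] L_maps[OF HD(2)[OF F]] L_maps[OF HD(2)[OF H_scale[OF F]]]
      by (intro integral_cong_AE) (auto simp: section_fun_def)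
    then show ?thesis unfolding I_def by simp
  qed
  show "0 \<le> I F" if "\<And>p. p \<in> space N \<Longrightarrow> 0 \<le> F p"
    unfolding I_def using section_AE[of "\<lambda>p. 0 \<le> F p"] that
    by (intro integral_nonneg_AE L_positive[OF HD(2)[OF F]]) (auto simp: section_fun_def)
  assume G: "G \<in> H"
  show "(\<lambda>p. F p + G p) \<in> H" by (rule H_add[OF F G])
  show "(\<lambda>p. max (F p) (G p)) \<in> H" by (rule H_max[OF F G])
  show "I (\<lambda>p. F p + G p) = I F + I G"
  proof -
    have "I (\<lambda>p. F p + G p) = (\<integral>\<omega>. L (section_fun F) \<omega> + L (section_fun G) \<omega> \<partial>M)"
      unfolding I_def using L_add[OF HD(2)[OF F] HD(2)[OF G]] L_maps[OF HD(2)[OF F]] L_maps[OF HD(2)[OF G]] L_maps[OF HD(2)[OF H_add[OF F G]]]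
      by (intro integral_cong_AE) (auto simp: section_fun_def)
    then show ?thesis unfolding I_def using HD(5)[OF F] HD(5)[OF G] by simp
  qed
next
  fix F :: "nat \<Rightarrow> 'a \<times> 'b \<Rightarrow> real"
  assume F: "\<And>n. F n \<in> H" and dec: "\<And>p. p \<in> space N \<Longrightarrow> decseq (\<lambda>n. F n p)"
    and lim: "\<And>p. p \<in> space N \<Longrightarrow> (\<lambda>n. F n p) \<longlonglongrightarrow> 0"
  have nonneg: "0 \<le> F n p" if "p \<in> space N" for n p by (rule decseq_ge[OF dec[OF that] lim[OF that]])
  have le: "F (Suc n) p \<le> F n p" "F n p \<le> F 0 p" if "p \<in> space N" for n p
    using decseqD[OF dec[OF that]] by auto
  have s_nn: "AE \<omega> in M. 0 \<le> section_fun (F n) x \<omega>" for n x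
    unfolding section_fun_def by (intro section_AE nonneg)
  have tends: "AE \<omega> in M. (\<lambda>n. L (section_fun (F n)) \<omega>) \<longlonglongrightarrow> 0"
  proof (rule L_continuous[OF HD(2)[OF F] _ _ s_nn])
    show "AE \<omega> in M. section_fun (F (Suc n)) x \<omega> \<le> section_fun (F n) x \<omega>" for x n
      unfolding section_fun_def by (intro section_AE le)
    show "AE \<omega> in M. (\<lambda>n. section_fun (F n) x \<omega>) \<longlonglongrightarrow> 0" for x
      unfolding section_fun_def by (intro section_AE lim)
  qed
  have "(\<lambda>n. \<integral>\<omega>. L (section_fun (F n)) \<omega> \<partial>M) \<longlonglongrightarrow> (\<integral>\<omega>. 0 \<partial>M)"
  proof (rule integral_dominated_convergence[OF _ L_maps[OF HD(2)[OF F]] HD(5)[OF F[of 0]] tends])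
    fix n
    have "AE \<omega> in M. L (section_fun (F n)) \<omega> \<le> L (section_fun (F 0)) \<omega>"
      by (rule L_mono[OF HD(2)[OF F] HD(2)[OF F]]) (unfold section_fun_def, intro section_AE le)
    with L_positive[OF HD(2)[OF F] s_nn, of n]
    show "AE \<omega> in M. norm (L (section_fun (F n)) \<omega>) \<le> L (section_fun (F 0)) \<omega>"
      by eventually_elim auto
  qed simp
  then show "(\<lambda>n. I (F n)) \<longlonglongrightarrow> 0" unfolding I_def by simp
qed

section \<open>Localisation to small rectangles and existence of the product measure\<close>

definition ell :: "nat \<Rightarrow> 'a \<Rightarrow> real"
  where "ell k = L (section_fun (cutoff (\<lambda>_. real k)))"

lemma ell_meas [measurable]: "ell k \<in> borel_measurable M"
  unfolding ell_def by (intro L_maps C_c_cutoff) simp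

text \<open>\<open>ell k\<close> is real-valued but need not be integrable. On these events it is
  bounded, and for fixed \<open>k\<close> they exhaust the space as \<open>j\<close> grows.\<close>

definition small_event :: "nat \<Rightarrow> nat \<Rightarrow> 'a set"
  where "small_event k j = {\<omega>\<in>space M. ell k \<omega> \<le> real j}"

lemma small_event_meas [measurable]: "small_event k j \<in> sets M"
  unfolding small_event_def by measurable

text \<open>Over \<open>A\<close> the functional is controlled by \<open>ell k \<le> j\<close>,
  which gives integrability. A cutoff with constant radius ignores its first coordinate, hence the
  placeholder \<open>undefined\<close>.\<close>

lemma H_small:
  fixes \<phi> :: "'b \<Rightarrow> real"
  assumes A: "A \<in> sets M" "A \<subseteq> small_event k j" and cont: "continuous_on UNIV \<phi>"
    and b: "\<And>z. \<bar>\<phi> z\<bar> \<le> cutoff (\<lambda>_ :: 'a. real k) (undefined, z)"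
  shows "(\<lambda>p. indicator A (fst p) * \<phi> (snd p)) \<in> H"
proof -
  let ?G = "\<lambda>(x :: 'a \<Rightarrow> 'b) \<omega>. indicator A \<omega> * section_fun (cutoff (\<lambda>_. real k)) x \<omega>"
  have cut: "section_fun (cutoff (\<lambda>_. real k)) \<in> (C_c M :: (('a \<Rightarrow> 'b) \<Rightarrow> _) set)" by (rule C_c_cutoff) simp
  have G: "?G \<in> C_c M" by (intro C_c_mult cut) (use A in auto)
  have ub: "\<bar>\<phi> z\<bar> \<le> cutoff (\<lambda>_ :: 'a. real k) (\<omega>, z)" for z \<omega> using b[of z] unfolding cutoff_def by simp
  have [measurable]: "\<phi> \<in> borel_measurable borel" using cont by (rule borel_measurable_continuous_onI)
  note A(1) [measurable]
  show ?thesis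
  proof (rule HI[OF _ _ G])
    show m: "(\<lambda>p. indicator A (fst p) * \<phi> (snd p)) \<in> borel_measurable N" by measurable
    show "section_fun (\<lambda>p. indicator A (fst p) * \<phi> (snd p)) \<in> C_c M"
      unfolding section_fun_def
    proof (rule C_c_section[OF m, where R = "\<lambda>_. real k + 1"])
      show "continuous_on UNIV (\<lambda>z. indicator A (fst (\<omega>, z)) * \<phi> (snd (\<omega>, z)))" for \<omega>
        unfolding fst_conv snd_conv by (intro continuous_intros cont)
      show "(\<lambda>_. real k + 1) \<in> L0_plus M" unfolding L0_plus_def by simp
      show "indicator A (fst (\<omega>, z)) * \<phi> (snd (\<omega>, z)) = 0" if "real k + 1 < norm z" for \<omega> z
        using b[of z] that by (simp add: cutoff_def)
    qed
    have eq: "AE \<omega> in M. L ?G \<omega> = indicator A \<omega> * ell k \<omega>"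
      unfolding ell_def using A by (intro L_mult cut) auto
    have nn: "AE \<omega> in M. 0 \<le> ell k \<omega>" unfolding ell_def
      by (rule L_positive[OF cut]) (simp add: section_fun_def cutoff_nonneg)
    have "integrable M (\<lambda>\<omega>. indicator A \<omega> * ell k \<omega>)"
    proof (rule integrable_const_bound[where B = "real j"])
      show "AE \<omega> in M. norm (indicator A \<omega> * ell k \<omega>) \<le> real j"
        using nn by eventually_elim (use A(2) in \<open>auto simp: indicator_def small_event_def\<close>)
    qed measurable
    moreover have "integrable M (L ?G) \<longleftrightarrow> integrable M (\<lambda>\<omega>. indicator A \<omega> * ell k \<omega>)"
      using eq L_maps[OF G] by (intro integrable_cong_AE) auto
    ultimately show "integrable M (L ?G)" by simp
    show "AE \<omega> in M. \<bar>indicator A (fst (\<omega>, x \<omega>)) * \<phi> (snd (\<omega>, x \<omega>))\<bar> \<le> ?G x \<omega>" for x :: "'a \<Rightarrow> 'b"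
      using ub by (auto simp: section_fun_def abs_mult indicator_def)
  qed
qed

text \<open>Rectangles small in both factors: over the base \<open>ell k\<close> is bounded and the
  other side lies in a ball, so that their indicators are increasing limits of functions in
  \<open>H\<close>.\<close>

definition gen :: "('a \<times> 'b) set set"
  where "gen = {A \<times> U | A U. A \<in> sets M \<and> open U \<and> (\<exists>k j. A \<subseteq> small_event k j \<and> U \<subseteq> ball 0 (real k))}"

lemma gen_exhaust: "(\<Union>k j. (A \<inter> small_event k j) \<times> (U \<inter> ball 0 (real k))) = A \<times> U"
  if "A \<subseteq> space M" for U :: "'b set"
proof (intro equalityI subsetI)
  fix p assume "p \<in> A \<times> U"
  then obtain \<omega> z where p: "p = (\<omega>, z)" "\<omega> \<in> A" "z \<in> U" by auto
  obtain k where "norm z < real k" using reals_Archimedean2 by blast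
  moreover obtain j where "ell k \<omega> \<le> real j" using real_arch_simple by blast
  ultimately show "p \<in> (\<Union>k j. (A \<inter> small_event k j) \<times> (U \<inter> ball 0 (real k)))"
    using p that unfolding small_event_def by auto
qed auto

lemma gen_mem: "A \<in> sets M \<Longrightarrow> open U \<Longrightarrow> (A \<inter> small_event k j) \<times> (U \<inter> ball 0 (real k)) \<in> gen"
  unfolding gen_def by (auto intro!: exI[of _ "A \<inter> small_event k j"] exI[of _ "U \<inter> ball 0 (real k)"])

lemma sets_N_gen: "sets N = sigma_sets (space N) gen"
proof
  have gN: "gen \<subseteq> sets N" unfolding gen_def by (auto intro!: pair_measureI)
  then show "sigma_sets (space N) gen \<subseteq> sets N" by (rule sets.sigma_sets_subset)
  let ?S = "sigma (space N) gen"
  have gP: "gen \<subseteq> Pow (space N)" using gN sets.sets_into_space by blast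
  have sS: "sets ?S = sigma_sets (space N) gen" "space ?S = space N"
    using gP by (simp_all add: sets_measure_of space_measure_of)
  have rect: "A \<times> U \<in> sets ?S" if A: "A \<in> sets M" and U: "open U" for A and U :: "'b set"
  proof -
    have "(A \<inter> small_event k j) \<times> (U \<inter> ball 0 (real k)) \<in> sets ?S" for k j
      unfolding sS using gen_mem[OF A U] by blast
    then have "(\<Union>k j. (A \<inter> small_event k j) \<times> (U \<inter> ball 0 (real k))) \<in> sets ?S" by blast
    then show ?thesis unfolding gen_exhaust[OF sets.sets_into_space[OF A]] .
  qed
  have "sigma_algebra (space N) (sets ?S)" using sets.sigma_algebra_axioms[of ?S] sS(2) by simp
  then have "sets N \<subseteq> sets ?S" by (rule pair_borel_subset) (use rect in auto)
  then show "sets N \<subseteq> sigma_sets (space N) gen" unfolding sS .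
qed

text \<open>\<open>prod_decode\<close> turns the double family into the single sequence of
  generators that \<open>daniell_extension\<close> asks for.\<close>

lemma small_rect_exhaust:
  "(\<Union>i. small_event (fst (prod_decode i)) (snd (prod_decode i)) \<times> ball (0 :: 'b) (real (fst (prod_decode i)))) = space N"
  (is "(\<Union>i. ?A i) = _")
proof -
  have "(\<Union>i. ?A i) = (\<Union>k j. small_event k j \<times> ball 0 (real k))"
  proof (intro equalityI subsetI)
    fix p assume "p \<in> (\<Union>k j. small_event k j \<times> ball (0 :: 'b) (real k))"
    then obtain k j where "p \<in> small_event k j \<times> ball (0 :: 'b) (real k)" by blast
    then have "p \<in> ?A (prod_encode (k, j))" by simp
    then show "p \<in> (\<Union>i. ?A i)" by blast
  qed auto
  moreover have "space M \<inter> small_event k j = small_event k j" for k j unfolding small_event_def by auto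
  ultimately show ?thesis using gen_exhaust[of "space M" UNIV] by (simp add: space_pair_measure)
qed

lemma product_measure_exists:
  obtains m where "sets m = sets N"
    "\<And>F. F \<in> H \<Longrightarrow> (\<And>p. p \<in> space N \<Longrightarrow> 0 \<le> F p) \<Longrightarrow> (\<integral>\<^sup>+p. ennreal (F p) \<partial>m) = ennreal (I F)"
proof -
  note ex = daniell.daniell_extension[OF daniell_I refl sets_N_gen]
  note m = that
  show thesis
  proof (rule ex)
  show "gen \<subseteq> Pow (space N)" using sets.sets_into_space[where M = N] sets_N_gen by blast
  show "Int_stable gen"
  proof (rule Int_stableI)
    fix a b assume "a \<in> gen" "b \<in> gen"
    then obtain A U k j A' U' where "a = A \<times> U" "A \<in> sets M" "open U" "A \<subseteq> small_event k j" "U \<subseteq> ball 0 (real k)"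
      "b = A' \<times> U'" "A' \<in> sets M" "open U'" unfolding gen_def by blast
    moreover from this have "a \<inter> b = (A \<inter> A') \<times> (U \<inter> U')" by auto
    ultimately show "a \<inter> b \<in> gen" unfolding gen_def
      by (intro CollectI exI[of _ "A \<inter> A'"] exI[of _ "U \<inter> U'"] conjI exI[of _ k] exI[of _ j]) auto
  qed
  show "H \<subseteq> borel_measurable N" using HD(1) by blast
  show "\<exists>F. (\<forall>n. F n \<in> H) \<and> (\<forall>p\<in>space N. (\<forall>n. 0 \<le> F n p) \<and> incseq (\<lambda>n. F n p) \<and>
      (\<lambda>n. F n p) \<longlonglongrightarrow> indicator g p)" if g0: "g \<in> gen" for g
  proof -
    obtain A U k j where g: "g = A \<times> U" "A \<in> sets M" "open U" "A \<subseteq> small_event k j" "U \<subseteq> ball 0 (real k)"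
      using g0 unfolding gen_def by blast
    \<comment> \<open>\<open>infdist\<close> from the empty set is 0 and would not detect
      \<open>U\<close>; boundedness of \<open>U\<close> makes its complement non-empty.\<close>
    have "U \<noteq> UNIV" using g(5) not_bounded_UNIV bounded_ball bounded_subset by metis
    then have ne: "- U \<noteq> {}" by auto
    \<comment> \<open>Truncated multiples of the distance from the complement increase to the
      indicator of an open set.\<close>
    let ?\<phi> = "\<lambda>n z. min 1 (real n * infdist z (- U))"
    have out: "?\<phi> n z = 0" if "z \<notin> U" for n z using that by (simp add: infdist_zero)
    let ?F = "\<lambda>n p. indicator A (fst p) * ?\<phi> n (snd p)"
    have "?F n \<in> H" for n
    proof (rule H_small[OF g(2,4)])
      show "continuous_on UNIV (?\<phi> n)" by (intro continuous_intros)
      show "\<bar>?\<phi> n z\<bar> \<le> cutoff (\<lambda>_ :: 'a. real k) (undefined, z)" for z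
      proof (cases "z \<in> U")
        case True
        then have "cutoff (\<lambda>_ :: 'a. real k) (undefined :: 'a, z) = 1" using g(5) by (intro cutoff_one) auto
        then show ?thesis by (simp only:) (simp add: infdist_nonneg)
      next
        case False
        then show ?thesis using out[OF False, of n] cutoff_nonneg[of "\<lambda>_ :: 'a. real k" "(undefined, z)"] by simp
      qed
    qed
    moreover have "0 \<le> ?F n p" for n p by (simp add: infdist_nonneg)
    moreover have "incseq (\<lambda>n. ?F n p)" for p
      unfolding incseq_def by (intro allI impI mult_left_mono min.mono mult_right_mono) (auto simp: infdist_nonneg)
    moreover have "(\<lambda>n. ?F n p) \<longlonglongrightarrow> indicator g p" for p
    proof -
      have "(\<lambda>n. ?\<phi> n z) \<longlonglongrightarrow> indicator U z" for z
      proof (cases "z \<in> U")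
        case True
        then have "infdist z (- U) \<noteq> 0"
          using in_closed_iff_infdist_zero[OF _ ne, of z] g(3) by (auto simp: closed_Compl)
        then have pos: "0 < infdist z (- U)" using infdist_nonneg[of z "- U"] by linarith
        obtain n0 where n0: "1 / infdist z (- U) \<le> real n0" using real_arch_simple by blast
        have "?\<phi> n z = 1" if "n \<ge> n0" for n
        proof -
          have "1 / infdist z (- U) \<le> real n" using n0 that by linarith
          then have "1 \<le> real n * infdist z (- U)" using pos by (simp add: divide_le_eq)
          then show ?thesis by simp
        qed
        then have "eventually (\<lambda>n. ?\<phi> n z = 1) sequentially" unfolding eventually_sequentially by blast
        then show ?thesis using True by (auto intro: tendsto_eventually)
      next
        case False
        then show ?thesis using out[OF False] by simp
      qed
      then have "(\<lambda>n. ?F n p) \<longlonglongrightarrow> indicator A (fst p) * indicator U (snd p)" by (intro tendsto_intros)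
      moreover have "indicator g p = (indicator A (fst p) * indicator U (snd p) :: real)"
        unfolding g(1) by (cases p) (auto simp: indicator_def)
      ultimately show ?thesis by simp
    qed
    ultimately show ?thesis by (intro exI[of _ ?F] conjI ballI allI)
  qed
  show "\<exists>F\<in>H. \<forall>p\<in>space N. indicator g p \<le> F p" if g0: "g \<in> gen" for g
  proof -
    obtain A U k j where g: "g = A \<times> U" "A \<in> sets M" "open U" "A \<subseteq> small_event k j" "U \<subseteq> ball 0 (real k)"
      using g0 unfolding gen_def by blast
    let ?F = "\<lambda>p. indicator A (fst p) * cutoff (\<lambda>_ :: 'a. real k) (undefined, snd p)"
    have "?F \<in> H"
    proof (rule H_small[OF g(2,4)])
      show "continuous_on UNIV (\<lambda>z. cutoff (\<lambda>_ :: 'a. real k) (undefined, z))"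
        unfolding cutoff_def fst_conv snd_conv by (intro continuous_intros)
    qed (simp add: cutoff_nonneg)
    moreover have "indicator g p \<le> ?F p" for p
    proof (cases "p \<in> g")
      case True
      then have "cutoff (\<lambda>_ :: 'a. real k) (undefined, snd p) = 1" "fst p \<in> A"
        using g by (auto intro!: cutoff_one)
      then show ?thesis using True by simp
    qed (simp add: cutoff_nonneg)
    ultimately show ?thesis by (intro bexI[of _ ?F] ballI)
  qed
  let ?A = "\<lambda>i. small_event (fst (prod_decode i)) (snd (prod_decode i)) \<times> ball (0 :: 'b) (real (fst (prod_decode i)))"
  have sp: "space M \<inter> small_event k j = small_event k j" for k j unfolding small_event_def by auto
  have "?A i \<in> gen" for i
    using gen_mem[OF sets.top open_UNIV, of "fst (prod_decode i)" "snd (prod_decode i)"] unfolding sp by simp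
  then show "range ?A \<subseteq> gen" by auto
  show "(\<Union>i. ?A i) = space N" by (rule small_rect_exhaust)
  show thesis if "sets m = sets N" "\<And>F. F \<in> H \<Longrightarrow> (\<And>p. p \<in> space N \<Longrightarrow> 0 \<le> F p) \<Longrightarrow>
    (\<integral>\<^sup>+p. ennreal (F p) \<partial>m) = ennreal (I F)" for m
    using m that by blast
  qed
qed

end

section \<open>Sets with closed sections and inner regularity\<close>

text \<open>Measurability of the hitting events is built in because it is the input of
  \<open>measurable_selection\<close>.\<close>

definition closed_random_sets :: "'w measure \<Rightarrow> ('w \<times> 'b::euclidean_space) set set"
  where "closed_random_sets M = {K \<in> sets (M \<Otimes>\<^sub>M borel).
           (\<forall>\<omega>. closed (Pair \<omega> -` K)) \<and> (\<forall>q r. {\<omega>\<in>space M. Pair \<omega> -` K \<inter> cball q r \<noteq> {}} \<in> sets M)}"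

lemma closed_random_setsD:
  assumes "K \<in> closed_random_sets M"
  shows "K \<in> sets (M \<Otimes>\<^sub>M borel)" "closed (Pair \<omega> -` K)"
    "{\<omega>\<in>space M. Pair \<omega> -` K \<inter> cball q r \<noteq> {}} \<in> sets M"
  using assms unfolding closed_random_sets_def by auto

lemma closed_random_sets_Times:
  assumes "A \<in> sets M" "closed C"
  shows "A \<times> C \<in> closed_random_sets M"
proof -
  have s: "Pair \<omega> -` (A \<times> C) = (if \<omega> \<in> A then C else {})" for \<omega> by auto
  have "{\<omega>\<in>space M. (if \<omega> \<in> A then C else {}) \<inter> cball q r \<noteq> {}} = (if C \<inter> cball q r \<noteq> {} then A else {})" for q r
    using sets.sets_into_space[OF assms(1)] by auto
  then show ?thesis
    unfolding closed_random_sets_def s using assms by (auto intro!: pair_measureI)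
qed

lemma closed_random_sets_empty: "{} \<in> closed_random_sets M"
  using closed_random_sets_Times[of "{}" M "{}"] by simp

lemma closed_random_sets_Un:
  assumes K: "K \<in> closed_random_sets M" and L: "L \<in> closed_random_sets M"
  shows "K \<union> L \<in> closed_random_sets M"
proof -
  have "{\<omega>\<in>space M. Pair \<omega> -` (K \<union> L) \<inter> cball q r \<noteq> {}} =
      {\<omega>\<in>space M. Pair \<omega> -` K \<inter> cball q r \<noteq> {}} \<union> {\<omega>\<in>space M. Pair \<omega> -` L \<inter> cball q r \<noteq> {}}" for q r
    by auto
  then show ?thesis
    unfolding closed_random_sets_def using closed_random_setsD[OF K] closed_random_setsD[OF L] by auto
qed

lemma closed_random_sets_UN:
  "finite J \<Longrightarrow> (\<And>i. i \<in> J \<Longrightarrow> K i \<in> closed_random_sets M) \<Longrightarrow> (\<Union>i\<in>J. K i) \<in> closed_random_sets M"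
  by (induction J rule: finite_induct) (auto intro: closed_random_sets_Un closed_random_sets_empty)

text \<open>Hitting an intersection is more than hitting each set. By compactness it is still
  detected at finite stages: a dense point near the ball has a small neighbourhood meeting the sets
  with index up to \<open>n\<close>, and limits of such points lie in every \<open>K i\<close>. With
  \<open>D\<close> countable the criterion is measurable in applications.\<close>

lemma Inter_hits_cball:
  fixes K :: "nat \<Rightarrow> 'b::euclidean_space set"
  assumes cl: "\<And>i. closed (K i)" and D: "\<And>z e. 0 < e \<Longrightarrow> \<exists>d\<in>D. dist d z < e"
  shows "(\<Inter>i. K i) \<inter> cball q r \<noteq> {} \<longleftrightarrow>
    (\<forall>n. \<exists>d\<in>D. dist d q \<le> r + 1 / Suc n \<and> (\<forall>i\<le>n. K i \<inter> cball d (1 / Suc n) \<noteq> {}))"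
proof
  assume "(\<Inter>i. K i) \<inter> cball q r \<noteq> {}"
  then obtain z where "z \<in> (\<Inter>i. K i)" "z \<in> cball q r" by blast
  then have z: "\<And>i. z \<in> K i" "dist q z \<le> r" by auto
  show "\<forall>n. \<exists>d\<in>D. dist d q \<le> r + 1 / Suc n \<and> (\<forall>i\<le>n. K i \<inter> cball d (1 / Suc n) \<noteq> {})"
  proof
    fix n
    obtain d where d: "d \<in> D" "dist d z < 1 / Suc n" using D[of "1 / Suc n" z] by auto
    have "dist d q \<le> r + 1 / Suc n" using dist_triangle2[of d q z] d z(2) by linarith
    moreover have "z \<in> K i \<inter> cball d (1 / Suc n)" for i using z(1) d by simp
    ultimately show "\<exists>d\<in>D. dist d q \<le> r + 1 / Suc n \<and> (\<forall>i\<le>n. K i \<inter> cball d (1 / Suc n) \<noteq> {})"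
      using d(1) by blast
  qed
next
  assume H: "\<forall>n. \<exists>d\<in>D. dist d q \<le> r + 1 / Suc n \<and> (\<forall>i\<le>n. K i \<inter> cball d (1 / Suc n) \<noteq> {})"
  then have "\<forall>n. \<exists>d. dist d q \<le> r + 1 / Suc n \<and> (\<forall>i\<le>n. K i \<inter> cball d (1 / Suc n) \<noteq> {})" by blast
  from choice[OF this] obtain d where d: "\<And>n. dist (d n) q \<le> r + 1 / Suc n"
    "\<And>n i. i \<le> n \<Longrightarrow> K i \<inter> cball (d n) (1 / Suc n) \<noteq> {}" by blast
  have "dist q (d n) \<le> r + 1" for n
  proof -
    have "1 / real (Suc n) \<le> 1" by simp
    then show ?thesis using d(1)[of n] dist_commute[of q "d n"] by linarith
  qed
  then have "\<exists>l\<in>cball q (r + 1). \<exists>s. strict_mono s \<and> (d \<circ> s) \<longlonglongrightarrow> l"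
    by (intro compact_cball[of q "r + 1", unfolded compact_def, rule_format]) simp
  then obtain z s where s: "strict_mono s" "(d \<circ> s) \<longlonglongrightarrow> z" by blast
  have inv: "(\<lambda>m. 1 / real (Suc (s m))) \<longlonglongrightarrow> 0"
    using LIMSEQ_subseq_LIMSEQ[OF LIMSEQ_Suc[OF lim_1_over_n] s(1)] by (simp add: o_def)
  have "dist z q \<le> r"
  proof (rule LIMSEQ_le)
    show "(\<lambda>m. dist (d (s m)) q) \<longlonglongrightarrow> dist z q"
      using s(2) by (intro tendsto_dist tendsto_const) (simp add: o_def)
    show "(\<lambda>m. r + 1 / real (Suc (s m))) \<longlonglongrightarrow> r" using tendsto_add[OF tendsto_const[of r] inv] by simp
    show "\<exists>N. \<forall>m\<ge>N. dist (d (s m)) q \<le> r + 1 / real (Suc (s m))" using d(1) by blast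
  qed
  moreover have "z \<in> K i" for i
  proof -
    have "\<exists>k. k \<in> K i \<and> dist (d (s (m + i))) k \<le> 1 / Suc (s (m + i))" for m
    proof -
      have "i \<le> s (m + i)" using seq_suble[OF s(1), of "m + i"] by linarith
      from d(2)[OF this] show ?thesis by fastforce
    qed
    then obtain k where k: "\<And>m. k m \<in> K i" "\<And>m. dist (d (s (m + i))) (k m) \<le> 1 / Suc (s (m + i))" by metis
    have "(\<lambda>m. k m - d (s (m + i))) \<longlonglongrightarrow> 0"
      by (rule Lim_null_comparison[OF _ LIMSEQ_ignore_initial_segment[OF inv, of i]])
        (use k(2) in \<open>auto simp: dist_norm norm_minus_commute\<close>)
    moreover have "(\<lambda>m. d (s (m + i))) \<longlonglongrightarrow> z"
      using LIMSEQ_ignore_initial_segment[OF s(2), of i] by (simp add: o_def)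
    ultimately have "k \<longlonglongrightarrow> z" using tendsto_add by fastforce
    with cl k(1) show ?thesis by (rule closed_sequentially)
  qed
  ultimately have "z \<in> (\<Inter>i. K i) \<inter> cball q r" by (simp add: dist_commute)
  then show "(\<Inter>i. K i) \<inter> cball q r \<noteq> {}" by blast
qed

lemma closed_random_sets_Inter:
  fixes K :: "nat \<Rightarrow> ('w \<times> 'b::euclidean_space) set"
  assumes K: "\<And>i. K i \<in> closed_random_sets M"
  shows "(\<Inter>i. K i) \<in> closed_random_sets M"
proof -
  obtain D :: "'b set" where D: "countable D" "\<And>X. open X \<Longrightarrow> X \<noteq> {} \<Longrightarrow> \<exists>d\<in>D. d \<in> X"
    using countable_dense_exists by blast
  have D2: "\<exists>d\<in>D. dist d z < e" if "0 < e" for z e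
    using D(2)[of "ball z e"] that by (auto simp: dist_commute)
  note cl = closed_random_setsD(2)[OF K]
  have eq: "Pair \<omega> -` (\<Inter>i. K i) = (\<Inter>i. Pair \<omega> -` K i)" for \<omega> by auto
  have "{\<omega>\<in>space M. Pair \<omega> -` (\<Inter>i. K i) \<inter> cball q r \<noteq> {}} \<in> sets M" for q r
  proof -
    have hm [measurable]: "Measurable.pred M (\<lambda>\<omega>. Pair \<omega> -` K i \<inter> cball d e \<noteq> {})" for i d e
      using closed_random_setsD(3)[OF K] by (simp add: pred_def)
    have "{\<omega>\<in>space M. \<forall>n. \<exists>d\<in>D. dist d q \<le> r + 1 / Suc n \<and> (\<forall>i\<in>{..n}. Pair \<omega> -` K i \<inter> cball d (1 / Suc n) \<noteq> {})} \<in> sets M"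
      using D(1) by measurable
    also have "{\<omega>\<in>space M. \<forall>n. \<exists>d\<in>D. dist d q \<le> r + 1 / Suc n \<and> (\<forall>i\<in>{..n}. Pair \<omega> -` K i \<inter> cball d (1 / Suc n) \<noteq> {})} =
      {\<omega>\<in>space M. Pair \<omega> -` (\<Inter>i. K i) \<inter> cball q r \<noteq> {}}"
      unfolding eq by (intro Collect_cong conj_cong refl, subst Inter_hits_cball[of "\<lambda>i. Pair _ -` K i", OF cl D2])
        (simp_all add: Ball_def)
    finally show ?thesis .
  qed
  then show ?thesis unfolding closed_random_sets_def
    using closed_random_setsD(1)[OF K] cl by (auto simp: eq intro!: sets.countable_INT)
qed

text \<open>Sets approximable from inside are closed under countable unions and intersections, but
  not evidently under complements. \<open>T\<close> asks for approximation of a set and of its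
  complement, which makes it a sigma-algebra; it contains the cylinders over both factors.\<close>

lemma inner_regular_closed_random:
  fixes \<nu> :: "('w \<times> 'b::euclidean_space) measure"
  assumes fin: "finite_measure \<nu>" and sets: "sets \<nu> = sets (M \<Otimes>\<^sub>M borel)"
    and B: "B \<in> sets \<nu>" and e: "0 < e"
  obtains K where "K \<in> closed_random_sets M" "K \<subseteq> B" "measure \<nu> (B - K) < e"
proof -
  interpret finite_measure \<nu> by fact
  define Q where "Q = (\<lambda>B. \<forall>e>0. \<exists>K\<in>closed_random_sets M. K \<subseteq> B \<and> measure \<nu> (B - K) < e)"
  have K_sets: "K \<in> sets \<nu>" if "K \<in> closed_random_sets M" for K
    using closed_random_setsD(1)[OF that] sets by simp
  have Q_closed: "Q K" if "K \<in> closed_random_sets M" for K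
    unfolding Q_def using that by (auto intro!: bexI[of _ K])
  \<comment> \<open>The errors add up to \<open>e / 2\<close>; for unions the other half pays for
    the passage to a finite union.\<close>
  have pick: "\<exists>K. \<forall>n. K n \<in> closed_random_sets M \<and> K n \<subseteq> B n \<and> measure \<nu> (B n - K n) < e * (1/2)^Suc (Suc n)"
    if "\<And>n. Q (B n)" "0 < e" for B :: "nat \<Rightarrow> _" and e
  proof -
    have "\<forall>n. \<exists>K. K \<in> closed_random_sets M \<and> K \<subseteq> B n \<and> measure \<nu> (B n - K) < e * (1/2)^Suc (Suc n)"
      using that unfolding Q_def by (metis mult_pos_pos zero_less_divide_1_iff zero_less_numeral zero_less_power)
    from choice[OF this] show ?thesis .
  qed
  have geo: "measure \<nu> (\<Union>n. B n - K n) \<le> e / 2"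
    if "\<And>n. B n \<in> sets \<nu>" "\<And>n. K n \<in> closed_random_sets M" "\<And>n. measure \<nu> (B n - K n) < e * (1/2)^Suc (Suc n)"
    for B K :: "nat \<Rightarrow> _" and e
  proof -
    have sums: "(\<lambda>n. e * (1/2 :: real)^Suc (Suc n)) sums (e / 2)"
    proof -
      have "(\<lambda>n. (e/4) * (1/2 :: real)^n) sums ((e/4) * (1 / (1 - 1/2)))"
        by (intro sums_mult geometric_sums) simp
      then show ?thesis by (simp add: mult.assoc field_simps)
    qed
    have summ: "summable (\<lambda>n. measure \<nu> (B n - K n))"
      by (rule summable_comparison_test'[OF sums_summable[OF sums], where N = 0]) (use that(3) in \<open>simp add: less_imp_le\<close>)
    have "measure \<nu> (\<Union>n. B n - K n) \<le> (\<Sum>n. measure \<nu> (B n - K n))"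
      using that K_sets by (intro finite_measure_subadditive_countably summ) auto
    also have "\<dots> \<le> (\<Sum>n. e * (1/2)^Suc (Suc n))"
      using that(3) by (intro suminf_le summ sums_summable[OF sums] less_imp_le)
    finally show ?thesis using sums_unique[OF sums] by simp
  qed
  have Q_UN: "Q (\<Union>n. B n)" if B: "\<And>n. B n \<in> sets \<nu>" "\<And>n. Q (B n)" for B :: "nat \<Rightarrow> _"
    unfolding Q_def
  proof (intro allI impI)
    fix e :: real assume e: "0 < e"
    obtain K where K: "\<And>n. K n \<in> closed_random_sets M" "\<And>n. K n \<subseteq> B n"
      "\<And>n. measure \<nu> (B n - K n) < e * (1/2)^Suc (Suc n)" using pick[of B e, OF B(2) e] by blast
    define L where "L = (\<lambda>n. \<Union>i\<le>n. K i)"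
    have L: "L n \<in> closed_random_sets M" for n unfolding L_def using K(1) by (intro closed_random_sets_UN) auto
    have "incseq L" unfolding L_def incseq_def by force
    then have "(\<lambda>n. measure \<nu> (L n)) \<longlonglongrightarrow> measure \<nu> (\<Union>n. L n)"
      using L K_sets by (intro finite_Lim_measure_incseq) auto
    then have "eventually (\<lambda>n. measure \<nu> (\<Union>n. L n) - e / 2 < measure \<nu> (L n)) sequentially"
      using e by (intro order_tendstoD(1)) auto
    then obtain n where n: "measure \<nu> (\<Union>n. L n) - e / 2 < measure \<nu> (L n)"
      by (auto simp: eventually_sequentially)
    have UL: "(\<Union>n. L n) = (\<Union>n. K n)" unfolding L_def by auto
    have KS: "\<And>n. K n \<in> sets \<nu>" "L n \<in> sets \<nu>" using K(1) L K_sets by auto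
    have "measure \<nu> ((\<Union>n. B n) - L n) \<le> measure \<nu> ((\<Union>n. B n - K n) \<union> ((\<Union>n. K n) - L n))"
      using B(1) KS by (intro finite_measure_mono) auto
    also have "\<dots> \<le> measure \<nu> (\<Union>n. B n - K n) + measure \<nu> ((\<Union>n. K n) - L n)"
      using B(1) KS by (intro measure_Un_le) auto
    also have "measure \<nu> ((\<Union>n. K n) - L n) = measure \<nu> (\<Union>n. K n) - measure \<nu> (L n)"
      using KS by (intro finite_measure_Diff) (auto simp: L_def)
    finally have "measure \<nu> ((\<Union>n. B n) - L n) < e" using n geo[of B K e, OF B(1) K(1,3)] unfolding UL by linarith
    moreover have "L n \<subseteq> (\<Union>n. B n)" unfolding L_def using K(2) by blast
    ultimately show "\<exists>K\<in>closed_random_sets M. K \<subseteq> (\<Union>n. B n) \<and> measure \<nu> ((\<Union>n. B n) - K) < e"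
      using L by blast
  qed
  have Q_INT: "Q (\<Inter>n. B n)" if B: "\<And>n. B n \<in> sets \<nu>" "\<And>n. Q (B n)" for B :: "nat \<Rightarrow> _"
    unfolding Q_def
  proof (intro allI impI)
    fix e :: real assume e: "0 < e"
    obtain K where K: "\<And>n. K n \<in> closed_random_sets M" "\<And>n. K n \<subseteq> B n"
      "\<And>n. measure \<nu> (B n - K n) < e * (1/2)^Suc (Suc n)" using pick[of B e, OF B(2) e] by blast
    have KS: "\<And>n. K n \<in> sets \<nu>" using K(1) K_sets by auto
    have "measure \<nu> ((\<Inter>n. B n) - (\<Inter>n. K n)) \<le> measure \<nu> (\<Union>n. B n - K n)"
      using B(1) KS by (intro finite_measure_mono) auto
    then have "measure \<nu> ((\<Inter>n. B n) - (\<Inter>n. K n)) < e" using geo[of B K e, OF B(1) K(1,3)] e by linarith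
    moreover have "(\<Inter>n. K n) \<subseteq> (\<Inter>n. B n)" by (intro INF_mono' K(2))
    ultimately show "\<exists>K\<in>closed_random_sets M. K \<subseteq> (\<Inter>n. B n) \<and> measure \<nu> ((\<Inter>n. B n) - K) < e"
      using closed_random_sets_Inter[of K, OF K(1)] by blast
  qed
  let ?\<Omega> = "space \<nu>"
  have sp: "?\<Omega> = space M \<times> UNIV" using sets_eq_imp_space_eq[OF sets] by (simp add: space_pair_measure)
  define T where "T = {B \<in> sets \<nu>. Q B \<and> Q (?\<Omega> - B)}"
  have T_closed: "K \<in> T" if "K \<in> closed_random_sets M" "Q (?\<Omega> - K)" for K
    unfolding T_def using that K_sets Q_closed by auto
  have T_compl: "?\<Omega> - B \<in> T" if "B \<in> T" for B
  proof -
    have "B \<subseteq> ?\<Omega>" using that sets.sets_into_space[of B \<nu>] unfolding T_def by simp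
    then have "?\<Omega> - (?\<Omega> - B) = B" by (rule double_diff) simp
    then show ?thesis using that unfolding T_def by auto
  qed
  have T_UN: "(\<Union>n. B n) \<in> T" if "range B \<subseteq> T" for B :: "nat \<Rightarrow> _"
  proof -
    have B: "\<And>n. B n \<in> sets \<nu>" "\<And>n. Q (B n)" "\<And>n. Q (?\<Omega> - B n)" using that unfolding T_def by auto
    have "Q (\<Inter>n. ?\<Omega> - B n)" using B by (intro Q_INT) auto
    moreover have "?\<Omega> - (\<Union>n. B n) = (\<Inter>n. ?\<Omega> - B n)" by auto
    moreover have "Q (\<Union>n. B n)" using B(1,2) by (rule Q_UN)
    moreover have "(\<Union>n. B n) \<in> sets \<nu>" using B(1) by (intro sets.countable_UN) auto
    ultimately show ?thesis unfolding T_def by (simp only: mem_Collect_eq simp_thms)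
  qed
  have rect: "A \<times> UNIV \<in> T" if A: "A \<in> sets M" for A
  proof (rule T_closed)
    have "?\<Omega> - A \<times> UNIV = (space M - A) \<times> UNIV" unfolding sp by auto
    then show "Q (?\<Omega> - A \<times> UNIV)" using A by (auto intro!: Q_closed closed_random_sets_Times)
  qed (use A in \<open>auto intro!: closed_random_sets_Times\<close>)
  have cyl: "space M \<times> U \<in> T" if U: "open U" for U :: "'b set"
  proof (cases "U = UNIV")
    case True
    then show ?thesis using rect[OF sets.top] by simp
  next
    case False
    \<comment> \<open>An open set is a countable union of closed sets, here the points at distance
      at least \<open>1 / Suc n\<close> from the complement; the complement itself is
      closed.\<close>
    define C where "C = (\<lambda>n::nat. {z. 1 / real (Suc n) \<le> infdist z (- U)})"
    have C: "closed (C n)" for n unfolding C_def by (intro closed_Collect_le continuous_intros)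
    have ne: "- U \<noteq> {}" using False by auto
    have UC: "(\<Union>n. C n) = U"
    proof (intro equalityI subsetI)
      fix z assume "z \<in> (\<Union>n. C n)"
      then obtain n where "1 / real (Suc n) \<le> infdist z (- U)" unfolding C_def by blast
      moreover have "0 < 1 / real (Suc n)" by simp
      ultimately have "infdist z (- U) \<noteq> 0" by linarith
      then show "z \<in> U" by (metis Compl_iff infdist_zero)
    next
      fix z assume "z \<in> U"
      then have "infdist z (- U) \<noteq> 0"
        using in_closed_iff_infdist_zero[OF _ ne, of z] U by (auto simp: closed_Compl)
      then have "0 < infdist z (- U)" using infdist_nonneg[of z "- U"] by linarith
      then obtain n where "1 / real (Suc n) < infdist z (- U)" by (metis nat_approx_posE)
      then show "z \<in> (\<Union>n. C n)" unfolding C_def by (auto intro: less_imp_le)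
    qed
    have c: "space M \<times> C n \<in> closed_random_sets M" for n using C by (intro closed_random_sets_Times) auto
    have "Q (\<Union>n. space M \<times> C n)" using c by (intro Q_UN K_sets Q_closed)
    moreover have "(\<Union>n. space M \<times> C n) = space M \<times> U" using UC by blast
    moreover have "Q (?\<Omega> - space M \<times> U)"
    proof -
      have "?\<Omega> - space M \<times> U = space M \<times> (- U)" unfolding sp by auto
      then show ?thesis using U by (auto intro!: Q_closed closed_random_sets_Times)
    qed
    moreover have "space M \<times> U \<in> sets \<nu>" unfolding sets using U by (intro pair_measureI) auto
    ultimately show ?thesis unfolding T_def by simp
  qed
  have empty: "{} \<in> T"
    using rect[of "{}"] by simp
  have sig: "sigma_algebra ?\<Omega> T"
    unfolding sigma_algebra_iff2
  proof (intro conjI ballI allI impI)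
    show "T \<subseteq> Pow ?\<Omega>" unfolding T_def using sets.sets_into_space by auto
  qed (use T_compl T_UN empty in auto)
  have "sets (M \<Otimes>\<^sub>M (borel :: 'b measure)) \<subseteq> T"
    using sig unfolding sets_eq_imp_space_eq[OF sets] by (rule pair_borel_subset) (use rect cyl in auto)
  then have "B \<in> T" using B sets by blast
  then show thesis using that e unfolding T_def Q_def by blast
qed

section \<open>Conditional integrals\<close>

text \<open>The first marginal of \<open>m\<close> is neither \<open>M\<close> nor finite in
  general. \<open>null_cylinder\<close> provides densities with respect to \<open>M\<close>;
  \<open>finite_cover\<close> reduces inner approximation to finite measures and supplies bounded
  sets.\<close>

locale conditional_measure = prob_space M for M :: "'a measure" +
  fixes m :: "('a \<times> 'b::euclidean_space) measure"
  assumes sets_m [measurable_cong]: "sets m = sets (M \<Otimes>\<^sub>M borel)"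
    and null_cylinder: "A \<in> null_sets M \<Longrightarrow> emeasure m (A \<times> UNIV) = 0"
    and finite_cover: "\<exists>E :: nat \<Rightarrow> _. (\<forall>i. E i \<in> sets m \<and> emeasure m (E i) < \<infinity> \<and> (\<exists>r. E i \<subseteq> UNIV \<times> cball 0 r)) \<and>
      (\<Union>i. E i) = space m"
begin

lemma space_m: "space m = space M \<times> UNIV"
  using sets_eq_imp_space_eq[OF sets_m] by (simp add: space_pair_measure)

lemma fst_m [measurable]: "fst \<in> measurable m M"
  by (subst measurable_cong_sets[OF sets_m refl]) measurable

lemma cylinder_sets: "A \<in> sets M \<Longrightarrow> A \<times> UNIV \<in> sets m"
  unfolding sets_m by (intro pair_measureI) auto

text \<open>The integral of \<open>G\<close> over the fibre, as the density of the first marginal of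
  \<open>density m G\<close>. This marginal need not be sigma-finite; the Radon-Nikodym theorem asks
  that of \<open>M\<close> only and lets the density be infinite.\<close>

definition cE :: "('a \<times> 'b \<Rightarrow> ennreal) \<Rightarrow> 'a \<Rightarrow> ennreal"
  where "cE G = (SOME h. h \<in> borel_measurable M \<and> density M h = distr (density m G) M fst)"

lemma cE_props:
  assumes G: "G \<in> borel_measurable m"
  shows "cE G \<in> borel_measurable M" "density M (cE G) = distr (density m G) M fst"
proof -
  have f: "fst \<in> measurable (density m G) M" by simp
  have "absolutely_continuous M (distr (density m G) M fst)"
    unfolding absolutely_continuous_def
  proof
    fix A assume A: "A \<in> null_sets M"
    then have AM: "A \<in> sets M" by auto
    have pre: "fst -` A \<inter> space m = A \<times> UNIV" using sets.sets_into_space[OF AM] by (auto simp: space_m)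
    have "A \<times> UNIV \<in> null_sets m" using null_cylinder[OF A] cylinder_sets[OF AM] by auto
    then have "A \<times> UNIV \<in> null_sets (density m G)"
      using absolutely_continuousI_density[OF G] unfolding absolutely_continuous_def by blast
    then have "emeasure (distr (density m G) M fst) A = 0"
      using AM f pre by (simp add: emeasure_distr null_setsD1)
    then show "A \<in> null_sets (distr (density m G) M fst)" using AM by auto
  qed
  from Radon_Nikodym[OF this] have "\<exists>h. h \<in> borel_measurable M \<and> density M h = distr (density m G) M fst"
    by auto
  from someI_ex[OF this] show "cE G \<in> borel_measurable M" "density M (cE G) = distr (density m G) M fst"
    unfolding cE_def by auto
qed

lemmas cE_measurable [measurable] = cE_props(1)

text \<open>The characteristic identity of a conditional expectation. Combined with
  \<open>cE_unique\<close> it reduces the rules for \<open>cE\<close> to rules for integrals against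
  \<open>m\<close>.\<close>

lemma nn_integral_cE:
  assumes G: "G \<in> borel_measurable m" and r: "r \<in> borel_measurable M"
  shows "(\<integral>\<^sup>+\<omega>. r \<omega> * cE G \<omega> \<partial>M) = (\<integral>\<^sup>+p. r (fst p) * G p \<partial>m)"
proof -
  note G [measurable] and r [measurable]
  have "(\<integral>\<^sup>+\<omega>. r \<omega> * cE G \<omega> \<partial>M) = (\<integral>\<^sup>+\<omega>. r \<omega> \<partial>(density M (cE G)))"
    by (subst nn_integral_density) (auto simp: mult.commute G)
  also have "\<dots> = (\<integral>\<^sup>+\<omega>. r \<omega> \<partial>(distr (density m G) M fst))" unfolding cE_props(2)[OF G] ..
  also have "\<dots> = (\<integral>\<^sup>+p. r (fst p) \<partial>(density m G))" by (rule nn_integral_distr) simp_all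
  also have "\<dots> = (\<integral>\<^sup>+p. r (fst p) * G p \<partial>m)" by (subst nn_integral_density) (auto simp: mult.commute)
  finally show ?thesis .
qed

text \<open>With respect to a finite measure a density is determined by its integrals over events,
  even where it is infinite.\<close>

lemma cE_unique:
  assumes G: "G \<in> borel_measurable m" and h: "h \<in> borel_measurable M"
    and eq: "\<And>A. A \<in> sets M \<Longrightarrow> (\<integral>\<^sup>+\<omega>. indicator A \<omega> * h \<omega> \<partial>M) = (\<integral>\<^sup>+p. indicator A (fst p) * G p \<partial>m)"
  shows "AE \<omega> in M. h \<omega> = cE G \<omega>"
proof (rule density_unique_finite_measure[OF h cE_measurable[OF G]])
  fix A assume A: "A \<in> sets M"
  show "(\<integral>\<^sup>+\<omega>. h \<omega> * indicator A \<omega> \<partial>M) = (\<integral>\<^sup>+\<omega>. cE G \<omega> * indicator A \<omega> \<partial>M)"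
    using eq[OF A] nn_integral_cE[OF G, of "indicator A"] A by (simp add: mult.commute)
qed auto

lemma cE_cong:
  assumes G: "G \<in> borel_measurable m" and G': "G' \<in> borel_measurable m" and eq: "AE p in m. G p = G' p"
  shows "AE \<omega> in M. cE G \<omega> = cE G' \<omega>"
proof (rule cE_unique[OF G' cE_measurable[OF G]])
  fix A assume A: "A \<in> sets M"
  have "(\<integral>\<^sup>+\<omega>. indicator A \<omega> * cE G \<omega> \<partial>M) = (\<integral>\<^sup>+p. indicator A (fst p) * G p \<partial>m)"
    using A by (intro nn_integral_cE G) auto
  also have "\<dots> = (\<integral>\<^sup>+p. indicator A (fst p) * G' p \<partial>m)"
    using eq by (intro nn_integral_cong_AE) (auto elim!: eventually_mono)
  finally show "(\<integral>\<^sup>+\<omega>. indicator A \<omega> * cE G \<omega> \<partial>M) = (\<integral>\<^sup>+p. indicator A (fst p) * G' p \<partial>m)" .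
qed

lemma cE_mult:
  assumes G: "G \<in> borel_measurable m" and r: "r \<in> borel_measurable M"
  shows "AE \<omega> in M. r \<omega> * cE G \<omega> = cE (\<lambda>p. r (fst p) * G p) \<omega>"
proof (rule cE_unique)
  note G [measurable] and r [measurable]
  show "(\<lambda>p. r (fst p) * G p) \<in> borel_measurable m" by measurable
  show "(\<lambda>\<omega>. r \<omega> * cE G \<omega>) \<in> borel_measurable M" by measurable
  fix A assume A [measurable]: "A \<in> sets M"
  have "(\<integral>\<^sup>+\<omega>. indicator A \<omega> * (r \<omega> * cE G \<omega>) \<partial>M) = (\<integral>\<^sup>+\<omega>. (indicator A \<omega> * r \<omega>) * cE G \<omega> \<partial>M)"
    by (simp add: mult.assoc)
  also have "\<dots> = (\<integral>\<^sup>+p. (indicator A (fst p) * r (fst p)) * G p \<partial>m)"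
    by (rule nn_integral_cE[OF G]) measurable
  finally show "(\<integral>\<^sup>+\<omega>. indicator A \<omega> * (r \<omega> * cE G \<omega>) \<partial>M) = (\<integral>\<^sup>+p. indicator A (fst p) * (r (fst p) * G p) \<partial>m)"
    by (simp add: mult.assoc)
qed

lemma cE_suminf:
  fixes G :: "nat \<Rightarrow> 'a \<times> 'b \<Rightarrow> ennreal"
  assumes G: "\<And>n. G n \<in> borel_measurable m"
  shows "AE \<omega> in M. (\<Sum>n. cE (G n) \<omega>) = cE (\<lambda>p. \<Sum>n. G n p) \<omega>"
proof (rule cE_unique)
  note G [measurable]
  show "(\<lambda>p. \<Sum>n. G n p) \<in> borel_measurable m" by measurable
  show "(\<lambda>\<omega>. \<Sum>n. cE (G n) \<omega>) \<in> borel_measurable M" by measurable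
  fix A assume A [measurable]: "A \<in> sets M"
  have "(\<integral>\<^sup>+\<omega>. indicator A \<omega> * (\<Sum>n. cE (G n) \<omega>) \<partial>M) = (\<Sum>n. \<integral>\<^sup>+\<omega>. indicator A \<omega> * cE (G n) \<omega> \<partial>M)"
    by (subst nn_integral_suminf[symmetric]) (auto simp: ennreal_suminf_cmult)
  also have "\<dots> = (\<Sum>n. \<integral>\<^sup>+p. indicator A (fst p) * G n p \<partial>m)"
    by (intro suminf_cong nn_integral_cE G) measurable
  also have "\<dots> = (\<integral>\<^sup>+p. indicator A (fst p) * (\<Sum>n. G n p) \<partial>m)"
    by (subst nn_integral_suminf[symmetric]) (auto simp: ennreal_suminf_cmult)
  finally show "(\<integral>\<^sup>+\<omega>. indicator A \<omega> * (\<Sum>n. cE (G n) \<omega>) \<partial>M) = (\<integral>\<^sup>+p. indicator A (fst p) * (\<Sum>n. G n p) \<partial>m)" .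
qed

lemma cE_sum:
  fixes G :: "nat \<Rightarrow> 'a \<times> 'b \<Rightarrow> ennreal"
  assumes G: "\<And>k. k \<le> n \<Longrightarrow> G k \<in> borel_measurable m"
  shows "AE \<omega> in M. (\<Sum>k\<le>n. cE (G k) \<omega>) = cE (\<lambda>p. \<Sum>k\<le>n. G k p) \<omega>"
proof (rule cE_unique)
  show "(\<lambda>p. \<Sum>k\<le>n. G k p) \<in> borel_measurable m" using G by (intro borel_measurable_sum) auto
  show "(\<lambda>\<omega>. \<Sum>k\<le>n. cE (G k) \<omega>) \<in> borel_measurable M" using G by (intro borel_measurable_sum cE_measurable) auto
  fix A assume A [measurable]: "A \<in> sets M"
  have "(\<integral>\<^sup>+\<omega>. indicator A \<omega> * (\<Sum>k\<le>n. cE (G k) \<omega>) \<partial>M) = (\<Sum>k\<le>n. \<integral>\<^sup>+\<omega>. indicator A \<omega> * cE (G k) \<omega> \<partial>M)"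
    unfolding sum_distrib_left using G A by (intro nn_integral_sum borel_measurable_times cE_measurable) auto
  also have "\<dots> = (\<Sum>k\<le>n. \<integral>\<^sup>+p. indicator A (fst p) * G k p \<partial>m)"
    using G A by (intro sum.cong refl nn_integral_cE) auto
  also have "\<dots> = (\<integral>\<^sup>+p. indicator A (fst p) * (\<Sum>k\<le>n. G k p) \<partial>m)"
    unfolding sum_distrib_left using G A by (intro nn_integral_sum[symmetric] borel_measurable_times) auto
  finally show "(\<integral>\<^sup>+\<omega>. indicator A \<omega> * (\<Sum>k\<le>n. cE (G k) \<omega>) \<partial>M) = (\<integral>\<^sup>+p. indicator A (fst p) * (\<Sum>k\<le>n. G k p) \<partial>m)" .
qed

text \<open>Derived from additivity: almost everywhere \<open>G'\<close> is the sum of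
  \<open>G\<close> and \<open>G' - G\<close>, written as a sum over two indices so that
  \<open>cE_sum\<close> applies.\<close>

lemma cE_mono:
  assumes G: "G \<in> borel_measurable m" and G': "G' \<in> borel_measurable m" and le: "AE p in m. G p \<le> G' p"
  shows "AE \<omega> in M. cE G \<omega> \<le> cE G' \<omega>"
proof -
  note G [measurable] and G' [measurable]
  let ?D = "\<lambda>p. G' p - G p"
  have D: "?D \<in> borel_measurable m" by measurable
  let ?S = "\<lambda>k::nat. if k = 0 then G else ?D"
  have s: "AE \<omega> in M. (\<Sum>k\<le>1. cE (?S k) \<omega>) = cE (\<lambda>p. \<Sum>k\<le>1. ?S k p) \<omega>"
    by (rule cE_sum) auto
  have "AE \<omega> in M. cE (\<lambda>p. \<Sum>k\<le>1. ?S k p) \<omega> = cE G' \<omega>"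
  proof (rule cE_cong)
    show "(\<lambda>p. \<Sum>k\<le>1. ?S k p) \<in> borel_measurable m" by simp
    show "AE p in m. (\<Sum>k\<le>1. ?S k p) = G' p" using le by eventually_elim simp
  qed measurable
  with s show ?thesis
  proof eventually_elim
    case (elim \<omega>)
    then have "cE G' \<omega> = cE G \<omega> + cE ?D \<omega>" by simp
    then show ?case by simp
  qed
qed

lemma cE_SUP:
  fixes G :: "nat \<Rightarrow> 'a \<times> 'b \<Rightarrow> ennreal"
  assumes G: "\<And>n. G n \<in> borel_measurable m" and inc: "\<And>n. AE p in m. G n p \<le> G (Suc n) p"
  shows "AE \<omega> in M. (SUP n. cE (G n) \<omega>) = cE (\<lambda>p. SUP n. G n p) \<omega>"
proof (rule cE_unique)
  note G [measurable]
  show "(\<lambda>p. SUP n. G n p) \<in> borel_measurable m" by measurable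
  show "(\<lambda>\<omega>. SUP n. cE (G n) \<omega>) \<in> borel_measurable M" by measurable
  fix A assume A [measurable]: "A \<in> sets M"
  have "(\<integral>\<^sup>+\<omega>. indicator A \<omega> * (SUP n. cE (G n) \<omega>) \<partial>M) = (\<integral>\<^sup>+\<omega>. (SUP n. indicator A \<omega> * cE (G n) \<omega>) \<partial>M)"
    by (simp add: SUP_mult_left_ennreal)
  also have "\<dots> = (SUP n. \<integral>\<^sup>+\<omega>. indicator A \<omega> * cE (G n) \<omega> \<partial>M)"
  proof (rule nn_integral_monotone_convergence_SUP_AE)
    show "AE \<omega> in M. indicator A \<omega> * cE (G n) \<omega> \<le> indicator A \<omega> * cE (G (Suc n)) \<omega>" for n
      using cE_mono[OF G G inc] by eventually_elim (auto intro: mult_left_mono)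
  qed measurable
  also have "\<dots> = (SUP n. \<integral>\<^sup>+p. indicator A (fst p) * G n p \<partial>m)"
    by (intro SUP_cong refl nn_integral_cE G) measurable
  also have "\<dots> = (\<integral>\<^sup>+p. (SUP n. indicator A (fst p) * G n p) \<partial>m)"
  proof (rule nn_integral_monotone_convergence_SUP_AE[symmetric])
    show "AE p in m. indicator A (fst p) * G n p \<le> indicator A (fst p) * G (Suc n) p" for n
      using inc by eventually_elim (auto intro: mult_left_mono)
  qed measurable
  also have "\<dots> = (\<integral>\<^sup>+p. indicator A (fst p) * (SUP n. G n p) \<partial>m)"
    by (simp add: SUP_mult_left_ennreal)
  finally show "(\<integral>\<^sup>+\<omega>. indicator A \<omega> * (SUP n. cE (G n) \<omega>) \<partial>M) = (\<integral>\<^sup>+p. indicator A (fst p) * (SUP n. G n p) \<partial>m)" .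
qed

text \<open>Approximation with error \<open>1 / Suc j\<close> on each finite piece
  \<open>E i\<close>, followed by finite unions over \<open>i, j \<le> n\<close>. Boundedness comes
  from the pieces, and \<open>B\<close> itself may have infinite measure because only an
  \<open>m\<close>-null remainder is claimed.\<close>

lemma inner_regular:
  assumes B: "B \<in> sets m"
  obtains K where "incseq K" "\<And>n :: nat. K n \<in> closed_random_sets M" "\<And>n. K n \<subseteq> B"
    "\<And>n. \<exists>r. K n \<subseteq> UNIV \<times> cball 0 r" "emeasure m (B - (\<Union>n. K n)) = 0"
proof -
  obtain E where E: "\<And>i :: nat. E i \<in> sets m" "\<And>i. emeasure m (E i) < \<infinity>" "\<And>i. \<exists>r. E i \<subseteq> UNIV \<times> cball 0 r"
    "(\<Union>i. E i) = space m" using finite_cover by blast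
  note E(1) [measurable] and B [measurable]
  have "\<exists>K. K \<in> closed_random_sets M \<and> K \<subseteq> B \<inter> E i \<and> emeasure m ((B \<inter> E i) - K) \<le> ennreal (1 / Suc j)" for i j
  proof -
    \<comment> \<open>The part of \<open>m\<close> on \<open>E i\<close>, kept as a measure on the
      whole product so that the finite case applies unchanged.\<close>
    let ?\<nu> = "density m (indicator (E i))"
    have em: "emeasure ?\<nu> X = emeasure m (X \<inter> E i)" if "X \<in> sets m" for X
      using that by (subst emeasure_density) (auto simp: nn_integral_indicator[symmetric] indicator_inter_arith mult.commute simp del: nn_integral_indicator)
    have fin: "finite_measure ?\<nu>"
    proof
      show "emeasure ?\<nu> (space ?\<nu>) \<noteq> \<infinity>" using em[of "space m"] E(2)[of i] sets.sets_into_space[OF E(1)[of i]]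
        by (simp add: Int_absorb1)
    qed
    have s: "sets ?\<nu> = sets (M \<Otimes>\<^sub>M borel)" by (simp add: sets_m)
    have "B \<inter> E i \<in> sets ?\<nu>" by simp
    then obtain K where K: "K \<in> closed_random_sets M" "K \<subseteq> B \<inter> E i" "measure ?\<nu> ((B \<inter> E i) - K) < 1 / Suc j"
      using inner_regular_closed_random[OF fin s, of "B \<inter> E i" "1 / Suc j"] by auto
    have Km: "K \<in> sets m" using closed_random_setsD(1)[OF K(1)] sets_m by simp
    have "((B \<inter> E i) - K) \<inter> E i = (B \<inter> E i) - K" by auto
    then have "emeasure m ((B \<inter> E i) - K) = emeasure ?\<nu> ((B \<inter> E i) - K)"
      using em[of "(B \<inter> E i) - K"] Km by (simp only:) simp
    also have "\<dots> = ennreal (measure ?\<nu> ((B \<inter> E i) - K))"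
      using fin by (simp add: finite_measure.emeasure_eq_measure)
    finally show ?thesis using K by (auto intro!: exI[of _ K] ennreal_leI)
  qed
  then have "\<forall>i. \<exists>K. \<forall>j. K j \<in> closed_random_sets M \<and> K j \<subseteq> B \<inter> E i \<and> emeasure m ((B \<inter> E i) - K j) \<le> ennreal (1 / Suc j)"
    by (intro allI choice) blast
  from choice[OF this] obtain K where K: "\<And>i j. K i j \<in> closed_random_sets M" "\<And>i j. K i j \<subseteq> B \<inter> E i"
    "\<And>i j. emeasure m ((B \<inter> E i) - K i j) \<le> ennreal (1 / Suc j)" by blast
  have Km [measurable]: "K i j \<in> sets m" for i j using closed_random_setsD(1)[OF K(1)] sets_m by simp
  define L where "L = (\<lambda>n. \<Union>i\<le>n. \<Union>j\<le>n. K i j)"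
  have Lm: "L n \<in> sets m" for n unfolding L_def by measurable
  show thesis
  proof
    show "incseq L" unfolding incseq_def L_def by (intro allI impI UN_mono) auto
    show "L n \<in> closed_random_sets M" for n unfolding L_def using K(1) by (intro closed_random_sets_UN) auto
    show "L n \<subseteq> B" for n unfolding L_def using K(2) by blast
    show "\<exists>r. L n \<subseteq> UNIV \<times> cball 0 r" for n
    proof -
      obtain r where r: "\<And>i. E i \<subseteq> UNIV \<times> cball 0 (r i)" using E(3) by metis
      have "K i j \<subseteq> UNIV \<times> cball 0 (Max (r ` {..n}))" if "i \<le> n" for i j
      proof -
        have "r i \<le> Max (r ` {..n})" using that by (intro Max_ge) auto
        then have "UNIV \<times> cball (0 :: 'b) (r i) \<subseteq> (UNIV :: 'a set) \<times> cball 0 (Max (r ` {..n}))" by auto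
        then show ?thesis using K(2)[of i j] r[of i] by blast
      qed
      then have "L n \<subseteq> UNIV \<times> cball 0 (Max (r ` {..n}))" unfolding L_def by (intro UN_least) auto
      then show ?thesis by blast
    qed
    have z: "emeasure m ((B \<inter> E i) - (\<Union>n. L n)) = 0" for i
    proof -
      have "emeasure m ((B \<inter> E i) - (\<Union>n. L n)) \<le> ennreal (1 / Suc j)" for j
      proof -
        have "K i j \<subseteq> L (max i j)"
        proof
          fix p assume "p \<in> K i j"
          then show "p \<in> L (max i j)" unfolding L_def by (intro UN_I[of i] UN_I[of j]) auto
        qed
        then have "(B \<inter> E i) - (\<Union>n. L n) \<subseteq> (B \<inter> E i) - K i j" by blast
        then have "emeasure m ((B \<inter> E i) - (\<Union>n. L n)) \<le> emeasure m ((B \<inter> E i) - K i j)"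
          by (intro emeasure_mono) measurable
        also note K(3)
        finally show ?thesis .
      qed
      moreover have "(\<lambda>j. ennreal (1 / Suc j)) \<longlonglongrightarrow> ennreal 0"
        by (intro tendsto_ennrealI LIMSEQ_Suc[OF lim_1_over_n])
      ultimately show ?thesis using LIMSEQ_le_const[of "\<lambda>j. ennreal (1 / Suc j)" "ennreal 0"] by auto
    qed
    have "(\<Union>i. (B \<inter> E i) - (\<Union>n. L n)) \<in> null_sets m"
      using z Lm by (intro null_sets_UN) auto
    moreover have "(\<Union>i. (B \<inter> E i) - (\<Union>n. L n)) = B - (\<Union>n. L n)"
      using E(4) sets.sets_into_space[OF B] by auto
    ultimately show "emeasure m (B - (\<Union>n. L n)) = 0" by auto
  qed
qed

text \<open>\<open>S\<close> is the projection of \<open>K\<close>, measurable as a union of hitting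
  events of balls around 0. Off \<open>S\<close> the empty section is replaced by
  \<open>{0}\<close>, so that a selection exists on the whole space.\<close>

lemma closed_random_set_selection:
  fixes K :: "('a \<times> 'b) set"
  assumes K: "K \<in> closed_random_sets M"
  obtains S x where "S \<in> sets M" "x \<in> L0 M" "K \<subseteq> S \<times> UNIV" "\<And>\<omega>. \<omega> \<in> S \<Longrightarrow> (\<omega>, x \<omega>) \<in> K"
proof -
  note KD = closed_random_setsD[OF K]
  define S where "S = (\<Union>n::nat. {\<omega>\<in>space M. Pair \<omega> -` K \<inter> cball 0 (real n) \<noteq> {}})"
  have S [measurable]: "S \<in> sets M" unfolding S_def using KD(3) by auto
  have S_iff: "\<omega> \<in> S \<longleftrightarrow> \<omega> \<in> space M \<and> Pair \<omega> -` K \<noteq> {}" for \<omega>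
  proof
    assume "\<omega> \<in> space M \<and> Pair \<omega> -` K \<noteq> {}"
    then obtain z where "\<omega> \<in> space M" "z \<in> Pair \<omega> -` K" by blast
    moreover obtain n where "norm z \<le> real n" using real_arch_simple by blast
    ultimately have "\<omega> \<in> {\<omega>\<in>space M. Pair \<omega> -` K \<inter> cball 0 (real n) \<noteq> {}}" by auto
    then show "\<omega> \<in> S" unfolding S_def by blast
  qed (auto simp: S_def)
  let ?K = "\<lambda>\<omega>. if \<omega> \<in> S then Pair \<omega> -` K else {0}"
  obtain x where x: "x \<in> L0 M" "\<And>\<omega>. \<omega> \<in> space M \<Longrightarrow> x \<omega> \<in> ?K \<omega>"
  proof (rule measurable_selection[of M ?K])
    show "closed (?K \<omega>)" for \<omega> using KD(2) by auto
    show "?K \<omega> \<noteq> {}" for \<omega> using S_iff by auto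
    fix q r
    have "{\<omega>\<in>space M. ?K \<omega> \<inter> cball q r \<noteq> {}} =
      {\<omega>\<in>space M. Pair \<omega> -` K \<inter> cball q r \<noteq> {}} \<union> (if 0 \<in> cball q r then space M - S else {})"
      using S_iff by auto
    then show "{\<omega>\<in>space M. ?K \<omega> \<inter> cball q r \<noteq> {}} \<in> sets M" using KD(3)[of q r] by auto
  qed blast
  show thesis
  proof (rule that[OF S x(1)])
    show "K \<subseteq> S \<times> UNIV"
    proof
      fix p assume p: "p \<in> K"
      then have "fst p \<in> space M" using sets.sets_into_space[OF KD(1)] by (auto simp: space_pair_measure)
      moreover have "snd p \<in> Pair (fst p) -` K" using p by simp
      ultimately have "fst p \<in> S" unfolding S_iff by blast
      then show "p \<in> S \<times> UNIV" by (cases p) auto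
    qed
    fix \<omega> assume "\<omega> \<in> S"
    then show "(\<omega>, x \<omega>) \<in> K" using x(2)[of \<omega>] S_iff by auto
  qed
qed

text \<open>A set with closed sections inside \<open>N\<close> contains the graph of a random
  variable over its projection. As \<open>N\<close> is polar, the projection is null, and the set
  lies in an \<open>m\<close>-null cylinder. Inner approximation passes this on to
  \<open>N\<close>.\<close>

lemma polar_null:
  assumes N: "polar N"
  shows "N \<in> null_sets m"
proof -
  have Nm: "N \<in> sets m" using N sets_m unfolding polar_def by simp
  obtain K where K: "\<And>n :: nat. K n \<in> closed_random_sets M" "\<And>n. K n \<subseteq> N" "emeasure m (N - (\<Union>n. K n)) = 0"
    by (rule inner_regular[OF Nm]) blast
  have Kn: "K n \<in> null_sets m" for n
  proof -
    obtain S x where S: "S \<in> sets M" "x \<in> L0 M" "K n \<subseteq> S \<times> UNIV" "\<And>\<omega>. \<omega> \<in> S \<Longrightarrow> (\<omega>, x \<omega>) \<in> K n"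
      by (rule closed_random_set_selection[OF K(1)[of n]]) blast
    have "AE \<omega> in M. (\<omega>, x \<omega>) \<notin> N" using N S(2) unfolding polar_def by blast
    then have "AE \<omega> in M. \<omega> \<notin> S" by eventually_elim (use S(4) K(2) in blast)
    then have "S \<in> null_sets M" using S(1) by (simp add: AE_iff_null_sets)
    from null_cylinder[OF this] have "S \<times> UNIV \<in> null_sets m" using cylinder_sets[OF S(1)] by auto
    then show ?thesis
      using S(3) closed_random_setsD(1)[OF K(1)] sets_m by (auto intro: null_sets_subset)
  qed
  then have U: "(\<Union>n. K n) \<in> null_sets m" by auto
  have "N - (\<Union>n. K n) \<in> null_sets m" using K(3) Nm U by auto
  from null_sets.Un[OF this U] have "N \<union> (\<Union>n. K n) \<in> null_sets m" by simp
  then show ?thesis using Nm by (rule null_sets_subset) auto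
qed

end

section \<open>The stable measure\<close>

locale represented_functional = positive_functional M L
  for M :: "'a measure" and L :: "(('a \<Rightarrow> 'b::euclidean_space) \<Rightarrow> 'a \<Rightarrow> real) \<Rightarrow> 'a \<Rightarrow> real" +
  fixes m :: "('a \<times> 'b) measure"
  assumes sets_m': "sets m = sets N"
    and nn_integral_H: "F \<in> H \<Longrightarrow> (\<And>p. p \<in> space N \<Longrightarrow> 0 \<le> F p) \<Longrightarrow>
          (\<integral>\<^sup>+p. ennreal (F p) \<partial>m) = ennreal (I F)"
begin

definition bump :: "'a set \<Rightarrow> nat \<Rightarrow> 'a \<times> 'b \<Rightarrow> real"
  where "bump A k = (\<lambda>p. indicator A (fst p) * cutoff (\<lambda>_ :: 'a. real k) (undefined, snd p))"

lemma bump: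
  assumes A: "A \<in> sets M" "A \<subseteq> small_event k j"
  shows "bump A k \<in> H" "I (bump A k) = (\<integral>\<omega>. indicator A \<omega> * ell k \<omega> \<partial>M)"
    "emeasure m (A \<times> ball 0 (real k)) \<le> ennreal (I (bump A k))"
proof -
  show b: "bump A k \<in> H"
    unfolding bump_def
  proof (rule H_small[OF A])
    show "continuous_on UNIV (\<lambda>z. cutoff (\<lambda>_ :: 'a. real k) (undefined, z))"
      unfolding cutoff_def fst_conv snd_conv by (intro continuous_intros)
  qed (simp add: cutoff_nonneg)
  have cut: "section_fun (cutoff (\<lambda>_. real k)) \<in> (C_c M :: (('a \<Rightarrow> 'b) \<Rightarrow> _) set)" by (rule C_c_cutoff) simp
  have eq: "section_fun (bump A k) = (\<lambda>x \<omega>. indicator A \<omega> * section_fun (cutoff (\<lambda>_. real k)) x \<omega>)"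
    unfolding section_fun_def bump_def cutoff_def by simp
  have "AE \<omega> in M. L (section_fun (bump A k)) \<omega> = indicator A \<omega> * ell k \<omega>"
    unfolding eq ell_def using A by (intro L_mult cut) auto
  then show "I (bump A k) = (\<integral>\<omega>. indicator A \<omega> * ell k \<omega> \<partial>M)"
    unfolding I_def using L_maps[OF HD(2)[OF b]] A(1) by (intro integral_cong_AE) auto
  have "emeasure m (A \<times> ball 0 (real k)) = (\<integral>\<^sup>+p. indicator (A \<times> ball 0 (real k)) p \<partial>m)"
  proof (rule nn_integral_indicator[symmetric])
    show "A \<times> ball 0 (real k) \<in> sets m" unfolding sets_m' using A(1) by (intro pair_measureI) auto
  qed
  also have "\<dots> \<le> (\<integral>\<^sup>+p. ennreal (bump A k p) \<partial>m)"
  proof (intro nn_integral_mono)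
    fix p :: "'a \<times> 'b"
    show "indicator (A \<times> ball 0 (real k)) p \<le> ennreal (bump A k p)"
    proof (cases "p \<in> A \<times> ball 0 (real k)")
      case True
      then have "fst p \<in> A" "cutoff (\<lambda>_ :: 'a. real k) (undefined :: 'a, snd p) = 1" by (auto intro!: cutoff_one)
      then show ?thesis using True unfolding bump_def by simp
    qed simp
  qed
  also have "\<dots> = ennreal (I (bump A k))"
    by (rule nn_integral_H[OF b]) (simp add: bump_def cutoff_nonneg)
  finally show "emeasure m (A \<times> ball 0 (real k)) \<le> ennreal (I (bump A k))" .
qed

text \<open>The bound by \<open>bump\<close> serves both conditions: the integral of
  \<open>ell k\<close> over a null event vanishes, and over a small event it is finite. Countably
  many rectangles cover a cylinder or the whole space.\<close>

lemma conditional_measure_m: "conditional_measure M m"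
proof
  show "sets m = sets N" by (rule sets_m')
  fix A assume A: "A \<in> null_sets M"
  then have AM: "A \<in> sets M" by auto
  have "(A \<inter> small_event k j) \<times> ball 0 (real k) \<in> null_sets m" for k j
  proof -
    have "AE \<omega> in M. \<omega> \<notin> A" using A by (rule AE_not_in)
    then have "AE \<omega> in M. indicator (A \<inter> small_event k j) \<omega> * ell k \<omega> = 0" by eventually_elim simp
    then have "(\<integral>\<omega>. indicator (A \<inter> small_event k j) \<omega> * ell k \<omega> \<partial>M) = (\<integral>\<omega>. 0 \<partial>M)"
      using AM by (intro integral_cong_AE) auto
    then have "emeasure m ((A \<inter> small_event k j) \<times> ball 0 (real k)) = 0"
      using bump(2,3)[of "A \<inter> small_event k j" k j] AM by simp
    moreover have "(A \<inter> small_event k j) \<times> ball 0 (real k) \<in> sets m"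
      unfolding sets_m' using AM by (intro pair_measureI) auto
    ultimately show ?thesis by auto
  qed
  then have "(\<Union>k j. (A \<inter> small_event k j) \<times> (UNIV \<inter> ball 0 (real k))) \<in> null_sets m" by auto
  then show "emeasure m (A \<times> UNIV) = 0"
    unfolding gen_exhaust[OF sets.sets_into_space[OF AM]] by (rule null_setsD1)
next
  let ?E = "\<lambda>i. small_event (fst (prod_decode i)) (snd (prod_decode i)) \<times> ball (0 :: 'b) (real (fst (prod_decode i)))"
  have "?E i \<in> sets m \<and> emeasure m (?E i) < \<infinity> \<and> (\<exists>r. ?E i \<subseteq> UNIV \<times> cball 0 r)" for i
  proof (intro conjI)
    show "?E i \<in> sets m" unfolding sets_m' by (intro pair_measureI) auto
    have "emeasure m (?E i) \<le> ennreal (I (bump (small_event (fst (prod_decode i)) (snd (prod_decode i))) (fst (prod_decode i))))"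
      by (rule bump(3)) auto
    then show "emeasure m (?E i) < \<infinity>" by (simp add: le_less_trans)
    show "\<exists>r. ?E i \<subseteq> UNIV \<times> cball 0 r"
      by (intro exI[of _ "real (fst (prod_decode i))"] Sigma_mono ball_subset_cball subset_UNIV)
  qed
  moreover have "(\<Union>i. ?E i) = space m"
    using small_rect_exhaust sets_eq_imp_space_eq[OF sets_m'] by simp
  ultimately show "\<exists>E :: nat \<Rightarrow> _. (\<forall>i. E i \<in> sets m \<and> emeasure m (E i) < \<infinity> \<and> (\<exists>r. E i \<subseteq> UNIV \<times> cball 0 r)) \<and>
      (\<Union>i. E i) = space m" by (intro exI[of _ ?E]) blast
qed

sublocale conditional_measure M m
  by (rule conditional_measure_m)

lemma space_m_N: "space m = space N"
  by (rule sets_eq_imp_space_eq[OF sets_m'])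

lemma borel_m: "borel_measurable m = borel_measurable N"
  by (rule measurable_cong_sets[OF sets_m' refl])

text \<open>Where functional and measure meet. As \<open>L f\<close> need not be integrable, the
  identity is tested on events \<open>A\<close> cut down to \<open>L f \<le> j\<close>; there the
  product function lies in \<open>H\<close> and both sides equal its value under \<open>I\<close>.
  Monotone convergence removes the cut.\<close>

lemma cE_eq_L:
  fixes f :: "('a \<Rightarrow> 'b) \<Rightarrow> 'a \<Rightarrow> real"
  assumes f: "f \<in> C_c M" and F [measurable]: "F \<in> borel_measurable N"
    and fF: "\<And>x. x \<in> L0 M \<Longrightarrow> AE \<omega> in M. f x \<omega> = F (\<omega>, x \<omega>)"
    and F0: "\<And>p. p \<in> space N \<Longrightarrow> 0 \<le> F p"
  shows "AE \<omega> in M. ennreal (L f \<omega>) = cE (\<lambda>p. ennreal (F p)) \<omega>"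
proof (rule cE_unique)
  have Lf [measurable]: "L f \<in> borel_measurable M" by (rule L_maps[OF f])
  have Lpos: "AE \<omega> in M. 0 \<le> L f \<omega>"
  proof (rule L_positive[OF f])
    fix x :: "'a \<Rightarrow> 'b" assume x: "x \<in> L0 M"
    show "AE \<omega> in M. 0 \<le> f x \<omega>" using fF[OF x] AE_space
      by eventually_elim (use F0 in \<open>simp add: space_N\<close>)
  qed
  show Fm: "(\<lambda>p. ennreal (F p)) \<in> borel_measurable m" unfolding borel_m by measurable
  show "(\<lambda>\<omega>. ennreal (L f \<omega>)) \<in> borel_measurable M" by measurable
  fix A assume A [measurable]: "A \<in> sets M"
  define D where "D = (\<lambda>j::nat. A \<inter> {\<omega>\<in>space M. L f \<omega> \<le> real j})"
  have D [measurable]: "D j \<in> sets M" for j unfolding D_def by measurable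
  have incD: "D j \<subseteq> D (Suc j)" for j unfolding D_def by auto
  have SUP_D: "(SUP j. indicator (D j) \<omega> * c) = (indicator A \<omega> * c :: ennreal)" if "\<omega> \<in> space M" for \<omega> c
  proof -
    obtain j where j: "L f \<omega> \<le> real j" using real_arch_simple by blast
    have "indicator (D i) \<omega> * c \<le> indicator A \<omega> * c" for i unfolding D_def by (auto simp: indicator_def)
    moreover have "indicator (D j) \<omega> * c = indicator A \<omega> * c" unfolding D_def using j that by (auto simp: indicator_def)
    ultimately show ?thesis by (intro antisym SUP_least SUP_upper2[of j]) auto
  qed
  have eq: "(\<integral>\<^sup>+\<omega>. indicator (D j) \<omega> * ennreal (L f \<omega>) \<partial>M) = (\<integral>\<^sup>+p. indicator (D j) (fst p) * ennreal (F p) \<partial>m)" for j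
  proof -
    let ?F = "\<lambda>p. indicator (D j) (fst p) * F p"
    have c1: "(\<lambda>x \<omega>. indicator (D j) \<omega> * f x \<omega>) \<in> C_c M" using f by (intro C_c_mult) auto
    \<comment> \<open>\<open>F\<close> need not be continuous in the second variable; membership
      comes from almost sure agreement with an indicator times \<open>f\<close>.\<close>
    have c2: "section_fun ?F \<in> C_c M"
    proof (rule C_c_cong[OF c1])
      show "section_fun ?F x \<in> L0 M" if [measurable]: "x \<in> L0 M" for x
        unfolding section_fun_def fst_conv by measurable
      show "AE \<omega> in M. indicator (D j) \<omega> * f x \<omega> = section_fun ?F x \<omega>" if "x \<in> L0 M" for x
        using fF[OF that] unfolding section_fun_def by eventually_elim simp
    qed
    have L1: "AE \<omega> in M. L (\<lambda>x \<omega>. indicator (D j) \<omega> * f x \<omega>) \<omega> = indicator (D j) \<omega> * L f \<omega>"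
      using f by (intro L_mult) auto
    have L2: "AE \<omega> in M. L (section_fun ?F) \<omega> = L (\<lambda>x \<omega>. indicator (D j) \<omega> * f x \<omega>) \<omega>"
    proof (rule L_well_defined[OF c2 c1])
      show "AE \<omega> in M. section_fun ?F x \<omega> = indicator (D j) \<omega> * f x \<omega>" if "x \<in> L0 M" for x
        using fF[OF that] unfolding section_fun_def by eventually_elim simp
    qed
    have int: "integrable M (\<lambda>\<omega>. indicator (D j) \<omega> * L f \<omega>)"
    proof (rule integrable_const_bound[where B = "real j"])
      show "AE \<omega> in M. norm (indicator (D j) \<omega> * L f \<omega>) \<le> real j"
        using Lpos by eventually_elim (auto simp: indicator_def D_def)
    qed measurable
    have "integrable M (L (\<lambda>x \<omega>. indicator (D j) \<omega> * f x \<omega>)) \<longleftrightarrow> integrable M (\<lambda>\<omega>. indicator (D j) \<omega> * L f \<omega>)"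
      using L1 L_maps[OF c1] by (intro integrable_cong_AE) auto
    then have int2: "integrable M (L (\<lambda>x \<omega>. indicator (D j) \<omega> * f x \<omega>))" using int by simp
    have FH: "?F \<in> H"
    proof (rule HI[OF _ c2 c1 int2])
      show "?F \<in> borel_measurable N" by measurable
      show "AE \<omega> in M. \<bar>indicator (D j) (fst (\<omega>, x \<omega>)) * F (\<omega>, x \<omega>)\<bar> \<le> indicator (D j) \<omega> * f x \<omega>" if "x \<in> L0 M" for x
        using fF[OF that] AE_space by eventually_elim (use F0 in \<open>simp add: abs_mult space_N\<close>)
    qed
    have F1: "0 \<le> ?F p" if "p \<in> space N" for p using F0[OF that] by simp
    have "I ?F = (\<integral>\<omega>. indicator (D j) \<omega> * L f \<omega> \<partial>M)"
    proof -
      have "AE \<omega> in M. L (section_fun ?F) \<omega> = indicator (D j) \<omega> * L f \<omega>"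
        using L1 L2 by eventually_elim simp
      then show ?thesis unfolding I_def using L_maps[OF c2] by (intro integral_cong_AE) auto
    qed
    then have "(\<integral>\<^sup>+p. ennreal (?F p) \<partial>m) = ennreal (\<integral>\<omega>. indicator (D j) \<omega> * L f \<omega> \<partial>M)"
      using nn_integral_H[OF FH F1] by simp
    also have "\<dots> = (\<integral>\<^sup>+\<omega>. ennreal (indicator (D j) \<omega> * L f \<omega>) \<partial>M)"
      using Lpos by (intro nn_integral_eq_integral[symmetric] int) (auto elim!: eventually_mono)
    finally have "(\<integral>\<^sup>+p. ennreal (?F p) \<partial>m) = (\<integral>\<^sup>+\<omega>. ennreal (indicator (D j) \<omega> * L f \<omega>) \<partial>M)" .
    moreover have "ennreal (indicator (D j) \<omega> * c) = indicator (D j) \<omega> * ennreal c" for \<omega> c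
      by (simp add: indicator_def)
    ultimately show ?thesis by simp
  qed
  have "(\<integral>\<^sup>+\<omega>. indicator A \<omega> * ennreal (L f \<omega>) \<partial>M) = (\<integral>\<^sup>+\<omega>. (SUP j. indicator (D j) \<omega> * ennreal (L f \<omega>)) \<partial>M)"
    by (intro nn_integral_cong) (simp add: SUP_D)
  also have "\<dots> = (SUP j. \<integral>\<^sup>+\<omega>. indicator (D j) \<omega> * ennreal (L f \<omega>) \<partial>M)"
  proof (rule nn_integral_monotone_convergence_SUP_AE)
    show "AE \<omega> in M. indicator (D j) \<omega> * ennreal (L f \<omega>) \<le> indicator (D (Suc j)) \<omega> * ennreal (L f \<omega>)" for j
      using incD[of j] by (auto simp: indicator_def)
  qed measurable
  also have "\<dots> = (SUP j. \<integral>\<^sup>+p. indicator (D j) (fst p) * ennreal (F p) \<partial>m)" unfolding eq ..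
  also have "\<dots> = (\<integral>\<^sup>+p. (SUP j. indicator (D j) (fst p) * ennreal (F p)) \<partial>m)"
  proof (rule nn_integral_monotone_convergence_SUP_AE[symmetric])
    show "AE p in m. indicator (D j) (fst p) * ennreal (F p) \<le> indicator (D (Suc j)) (fst p) * ennreal (F p)" for j
      using incD[of j] by (auto simp: indicator_def)
    show "(\<lambda>p. indicator (D j) (fst p) * ennreal (F p)) \<in> borel_measurable m" for j
      using Fm by measurable
  qed
  also have "\<dots> = (\<integral>\<^sup>+p. indicator A (fst p) * ennreal (F p) \<partial>m)"
    by (intro nn_integral_cong) (simp add: SUP_D space_m_N space_N)
  finally show "(\<integral>\<^sup>+\<omega>. indicator A \<omega> * ennreal (L f \<omega>) \<partial>M) = (\<integral>\<^sup>+p. indicator A (fst p) * ennreal (F p) \<partial>m)" .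
qed

text \<open>The exceptional set is polar, hence null. Comparisons known along random variables only
  are carried over to \<open>m\<close> by this lemma.\<close>

lemma polar_AE:
  fixes Q :: "'a \<times> 'b \<Rightarrow> bool"
  assumes Q: "{p\<in>space N. Q p} \<in> sets N" and ae: "\<And>x. x \<in> L0 M \<Longrightarrow> AE \<omega> in M. Q (\<omega>, x \<omega>)"
  shows "AE p in m. Q p"
proof -
  have eq: "{p\<in>space N. \<not> Q p} = space N - {p\<in>space N. Q p}" by auto
  have "polar {p\<in>space N. \<not> Q p}" unfolding polar_def
  proof (intro conjI ballI)
    show "{p\<in>space N. \<not> Q p} \<in> sets N" unfolding eq using Q by auto
    fix x :: "'a \<Rightarrow> 'b" assume "x \<in> L0 M"
    from ae[OF this] show "AE \<omega> in M. (\<omega>, x \<omega>) \<notin> {p\<in>space N. \<not> Q p}" by eventually_elim simp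
  qed
  from polar_null[OF this] show ?thesis by (rule AE_I') (simp add: space_m_N)
qed

text \<open>Versions are chosen for each \<open>B\<close> separately, so the rules for
  \<open>\<kappa>\<close> hold almost surely and not for every \<omega>.\<close>

definition \<kappa> :: "('a \<times> 'b) set \<Rightarrow> 'a \<Rightarrow> ennreal"
  where "\<kappa> B = cE (indicator B)"

text \<open>
  The value \<open>0\<close> off \<open>stable_borel M\<close> keeps arbitrary stably compact sets from affecting the supremum
  in the inner regularity of \<open>\<mu>\<close>.
\<close>

definition \<mu> :: "('a, 'b) condset \<Rightarrow> 'a \<Rightarrow> ennreal"
  where "\<mu> P = (if P \<in> stable_borel M then \<kappa> (SOME B. B \<in> sets N \<and> P = cgraph M B) else (\<lambda>_. 0))"

lemma ind_m: "B \<in> sets N \<Longrightarrow> indicator B \<in> borel_measurable m"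
  by (rule borel_measurable_indicator) (simp add: sets_m')

lemma stable_borelE:
  assumes "P \<in> stable_borel M"
  obtains B where "B \<in> sets N" "P = cgraph M B"
  using assms unfolding stable_borel_eq by blast

lemma \<kappa>_measurable [measurable]: "B \<in> sets N \<Longrightarrow> \<kappa> B \<in> borel_measurable M"
  unfolding \<kappa>_def by (intro cE_measurable ind_m)

lemma \<mu>_measurable: "\<mu> P \<in> borel_measurable M"
proof (cases "P \<in> stable_borel M")
  case True
  then obtain B where B: "B \<in> sets N \<and> P = cgraph M B" by (auto elim: stable_borelE)
  from someI[of "\<lambda>B. B \<in> sets N \<and> P = cgraph M B", OF B] True show ?thesis
    unfolding \<mu>_def by (auto intro: \<kappa>_measurable)
qed (simp add: \<mu>_def)

text \<open>The hypothesis speaks of random variables instead of inclusion of sets, so it depends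
  only on the induced conditional sets.\<close>

lemma \<kappa>_mono:
  assumes B: "B \<in> sets N" and C: "C \<in> sets N"
    and sub: "\<And>x. x \<in> L0 M \<Longrightarrow> AE \<omega> in M. (\<omega>, x \<omega>) \<in> B \<longrightarrow> (\<omega>, x \<omega>) \<in> C"
  shows "AE \<omega> in M. \<kappa> B \<omega> \<le> \<kappa> C \<omega>"
  unfolding \<kappa>_def
proof (rule cE_mono[OF ind_m[OF B] ind_m[OF C]])
  have "{p\<in>space N. p \<in> B \<longrightarrow> p \<in> C} = space N - (B - C)" by auto
  then have "{p\<in>space N. p \<in> B \<longrightarrow> p \<in> C} \<in> sets N" using B C by auto
  then have "AE p in m. p \<in> B \<longrightarrow> p \<in> C" by (rule polar_AE) (rule sub)
  then show "AE p in m. indicator B p \<le> (indicator C p :: ennreal)"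
    by eventually_elim (auto simp: indicator_def)
qed

text \<open>Independence of the inducing set picked by choice: two candidates induce the same
  conditional set, so each is contained in the other along every random variable, and
  \<open>\<kappa>_mono\<close> applies both ways.\<close>

lemma \<mu>_cgraph:
  assumes B: "B \<in> sets N"
  shows "AE \<omega> in M. \<mu> (cgraph M B) \<omega> = \<kappa> B \<omega>"
proof -
  define C where "C = (SOME C. C \<in> sets N \<and> cgraph M B = cgraph M C)"
  have C: "C \<in> sets N" "cgraph M B = cgraph M C"
    using someI[of "\<lambda>C. C \<in> sets N \<and> cgraph M B = cgraph M C" B] B unfolding C_def by auto
  have 1: "\<mu> (cgraph M B) = \<kappa> C" unfolding \<mu>_def C_def stable_borel_eq using B by auto
  have eq: "AE \<omega> in M. (\<omega>, x \<omega>) \<in> B \<longleftrightarrow> (\<omega>, x \<omega>) \<in> C" if x: "x \<in> L0 M" for x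
    using cmem_cgraph[OF B x] cmem_cgraph[OF C(1) x] unfolding C(2) by eventually_elim blast
  have "AE \<omega> in M. \<kappa> B \<omega> \<le> \<kappa> C \<omega>"
    by (rule \<kappa>_mono[OF B C(1)], drule eq, erule eventually_mono) blast
  moreover have "AE \<omega> in M. \<kappa> C \<omega> \<le> \<kappa> B \<omega>"
    by (rule \<kappa>_mono[OF C(1) B], drule eq, erule eventually_mono) blast
  ultimately show ?thesis unfolding 1 by eventually_elim simp
qed

text \<open>Sets inducing disjoint conditional sets may overlap, but the overlap is polar and thus
  invisible to \<open>m\<close>.\<close>

lemma \<kappa>_UN:
  fixes B :: "nat \<Rightarrow> ('a \<times> 'b) set"
  assumes B: "\<And>k. B k \<in> sets N"
    and disj: "\<And>x i j. x \<in> L0 M \<Longrightarrow> i \<noteq> j \<Longrightarrow> AE \<omega> in M. \<not> ((\<omega>, x \<omega>) \<in> B i \<and> (\<omega>, x \<omega>) \<in> B j)"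
  shows "AE \<omega> in M. \<kappa> (\<Union>k. B k) \<omega> = (\<Sum>k. \<kappa> (B k) \<omega>)"
proof -
  have U: "(\<Union>k. B k) \<in> sets N" using B by auto
  have "AE p in m. \<forall>i j. i \<noteq> j \<longrightarrow> \<not> (p \<in> B i \<and> p \<in> B j)"
    unfolding AE_all_countable
  proof (intro allI)
    fix i j
    show "AE p in m. i \<noteq> j \<longrightarrow> \<not> (p \<in> B i \<and> p \<in> B j)"
    proof (rule polar_AE)
      have "{p\<in>space N. i \<noteq> j \<longrightarrow> \<not> (p \<in> B i \<and> p \<in> B j)} = (if i = j then space N else space N - (B i \<inter> B j))" by auto
      then show "{p\<in>space N. i \<noteq> j \<longrightarrow> \<not> (p \<in> B i \<and> p \<in> B j)} \<in> sets N" using B by auto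
    qed (use disj in auto)
  qed
  then have ae: "AE p in m. (\<Sum>k. indicator (B k) p) = (indicator (\<Union>k. B k) p :: ennreal)"
  proof eventually_elim
    case (elim p)
    show ?case
    proof (cases "p \<in> (\<Union>k. B k)")
      case True
      then obtain k where k: "p \<in> B k" by blast
      have "(\<Sum>i. indicator (B i) p) = (\<Sum>i\<in>{k}. indicator (B i) p :: ennreal)"
        by (rule suminf_finite) (use elim k in \<open>auto simp: indicator_def\<close>)
      then show ?thesis using k True by simp
    qed auto
  qed
  have s: "AE \<omega> in M. (\<Sum>k. cE (indicator (B k)) \<omega>) = cE (\<lambda>p. \<Sum>k. indicator (B k) p) \<omega>"
    by (rule cE_suminf) (rule ind_m[OF B])
  have "(\<lambda>p. \<Sum>k. indicator (B k) p :: ennreal) \<in> borel_measurable m"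
    using ind_m[OF B] by measurable
  from cE_cong[OF this ind_m[OF U] ae] s show ?thesis unfolding \<kappa>_def by eventually_elim simp
qed

lemma \<kappa>_cylinder:
  assumes A: "A \<in> sets M" and B: "B \<in> sets N"
  shows "AE \<omega> in M. \<kappa> ((A \<times> UNIV) \<inter> B) \<omega> = indicator A \<omega> * \<kappa> B \<omega>"
proof -
  have "(\<lambda>p. indicator A (fst p) * indicator B p) = (indicator ((A \<times> UNIV) \<inter> B) :: _ \<Rightarrow> ennreal)"
    by (auto simp: indicator_def fun_eq_iff)
  then show ?thesis using cE_mult[OF ind_m[OF B], of "indicator A"] A unfolding \<kappa>_def
    by (auto elim!: eventually_mono)
qed

lemma cylinder_N: "A \<in> sets M \<Longrightarrow> A \<times> UNIV \<in> sets N"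
  by (intro pair_measureI) auto

lemma stable_measure_\<mu>: "stable_measure M (L0 M) (stable_borel M) \<mu>"
  unfolding stable_measure_def
proof (intro conjI ballI allI impI)
  show "\<mu> P \<in> borel_measurable M" for P by (rule \<mu>_measurable)
next
  fix A and P :: "nat \<Rightarrow> ('a, 'b) condset"
  assume A: "partition_of M A" and P: "\<forall>k. P k \<in> stable_borel M"
  have "\<forall>k. \<exists>B. B \<in> sets N \<and> P k = cgraph M B" 
    using P stable_borelE by metis
  from choice[OF this] obtain B where B: "\<And>k. B k \<in> sets N" "\<And>k. P k = cgraph M (B k)" by blast
  have PB: "P = (\<lambda>k. cgraph M (B k))" using B(2) by auto
  have Am: "A k \<in> sets M" for k using A unfolding partition_of_def by auto
  let ?C = "\<lambda>k. (A k \<times> UNIV) \<inter> B k"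
  have C: "?C k \<in> sets N" for k using cylinder_N[OF Am] B(1) by auto
  have U: "(\<Union>k. ?C k) \<in> sets N" using C by auto
  have 1: "AE \<omega> in M. \<kappa> (\<Union>k. ?C k) \<omega> = (\<Sum>k. \<kappa> (?C k) \<omega>)"
  proof (rule \<kappa>_UN[OF C])
    fix x :: "'a \<Rightarrow> 'b" and i j :: nat assume "i \<noteq> j"
    then have "A i \<inter> A j = {}" using A unfolding partition_of_def disjoint_family_on_def by auto
    then show "AE \<omega> in M. \<not> ((\<omega>, x \<omega>) \<in> ?C i \<and> (\<omega>, x \<omega>) \<in> ?C j)" by auto
  qed
  have 2: "AE \<omega> in M. \<forall>k. \<kappa> (?C k) \<omega> = indicator (A k) \<omega> * \<kappa> (B k) \<omega>"
    unfolding AE_all_countable using \<kappa>_cylinder[OF Am B(1)] by blast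
  have 3: "AE \<omega> in M. \<forall>k. \<mu> (P k) \<omega> = \<kappa> (B k) \<omega>"
    unfolding AE_all_countable B(2) using \<mu>_cgraph[OF B(1)] by blast
  have 4: "AE \<omega> in M. \<mu> (cglue M (L0 M) A P) \<omega> = \<kappa> (\<Union>k. ?C k) \<omega>"
    unfolding PB cgraph_glue[OF A B(1)] by (rule \<mu>_cgraph[OF U])
  show "AE \<omega> in M. \<mu> (cglue M (L0 M) A P) \<omega> = glue A (\<lambda>k. \<mu> (P k)) \<omega>"
    using 1 2 3 4 AE_space
  proof eventually_elim
    case (elim \<omega>)
    obtain k where k: "\<omega> \<in> A k" using partition_ofE[OF A elim(5)] .
    have other: "\<omega> \<notin> A i" if "i \<noteq> k" for i
      using A k that unfolding partition_of_def disjoint_family_on_def by blast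
    have "(\<Sum>i. indicator (A i) \<omega> * \<kappa> (B i) \<omega>) = (\<Sum>i\<in>{k}. indicator (A i) \<omega> * \<kappa> (B i) \<omega>)"
      by (rule suminf_finite) (use other in auto)
    then show ?case using elim k glue_eq[OF A k, of "\<lambda>k. \<mu> (P k)"] by simp
  qed
next
  fix P :: "('a, 'b) condset" assume P: "P \<in> stable_borel M"
  then obtain B where B: "B \<in> sets N" "P = cgraph M B" by (rule stable_borelE)
  have CS: "P \<in> cond_subsets M (L0 M)" unfolding B(2) using B(1) by simp
  let ?D = "cdom M (L0 M) P"
  note pP = presents_cset[OF CS]
  have D: "?D \<in> sets M" using pP unfolding presents_def by auto
  \<comment> \<open>For (M1): along random variables \<open>B\<close> lies over the domain of
    \<open>P\<close>, so cutting it down to the cylinder over that domain loses nothing.\<close>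
  have "AE \<omega> in M. \<kappa> B \<omega> \<le> \<kappa> ((?D \<times> UNIV) \<inter> B) \<omega>"
  proof (rule \<kappa>_mono[OF B(1)])
    show "(?D \<times> UNIV) \<inter> B \<in> sets N" using cylinder_N[OF D] B(1) by auto
    fix x :: "'a \<Rightarrow> 'b" assume x: "x \<in> L0 M"
    show "AE \<omega> in M. (\<omega>, x \<omega>) \<in> B \<longrightarrow> (\<omega>, x \<omega>) \<in> (?D \<times> UNIV) \<inter> B"
      using cmem_subset_dom[OF pP x] cmem_cgraph[OF B(1) x, folded B(2)] by eventually_elim auto
  qed
  then show "AE \<omega> in M. \<mu> P \<omega> = (if \<omega> \<in> ?D then \<mu> P \<omega> else 0)"
    using \<kappa>_cylinder[OF D B(1)] \<mu>_cgraph[OF B(1), folded B(2)] by eventually_elim auto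
next
  fix P :: "nat \<Rightarrow> ('a, 'b) condset"
  assume P: "\<forall>k. P k \<in> stable_borel M" and disj: "\<forall>i j. i \<noteq> j \<longrightarrow> cdisjoint M (L0 M) (P i) (P j)"
  have "\<forall>k. \<exists>B. B \<in> sets N \<and> P k = cgraph M B" 
    using P stable_borelE by metis
  from choice[OF this] obtain B where B: "\<And>k. B k \<in> sets N" "\<And>k. P k = cgraph M (B k)" by blast
  have PB: "P = (\<lambda>k. cgraph M (B k))" using B(2) by auto
  have U: "(\<Union>k. B k) \<in> sets N" using B by auto
  have CS: "P k \<in> cond_subsets M (L0 M)" for k unfolding B(2) using B(1) by simp
  have 1: "AE \<omega> in M. \<kappa> (\<Union>k. B k) \<omega> = (\<Sum>k. \<kappa> (B k) \<omega>)"
  proof (rule \<kappa>_UN[OF B(1)])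
    fix x :: "'a \<Rightarrow> 'b" and i j :: nat assume x: "x \<in> L0 M" and "i \<noteq> j"
    then have "AE \<omega> in M. \<not> (\<omega> \<in> cmem M (P i) x \<and> \<omega> \<in> cmem M (P j) x)"
      using disj cdisjoint_iff[OF CS CS] by blast
    then show "AE \<omega> in M. \<not> ((\<omega>, x \<omega>) \<in> B i \<and> (\<omega>, x \<omega>) \<in> B j)"
      using cmem_cgraph[OF B(1)[of i] x, folded B(2)] cmem_cgraph[OF B(1)[of j] x, folded B(2)]
      by eventually_elim blast
  qed
  have 3: "AE \<omega> in M. \<forall>k. \<mu> (P k) \<omega> = \<kappa> (B k) \<omega>"
    unfolding AE_all_countable B(2) using \<mu>_cgraph[OF B(1)] by blast
  have 4: "AE \<omega> in M. \<mu> (cSup M (L0 M) (range P)) \<omega> = \<kappa> (\<Union>k. B k) \<omega>"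
    unfolding PB cgraph_Union[OF B(1)] by (rule \<mu>_cgraph[OF U])
  show "AE \<omega> in M. \<mu> (cSup M (L0 M) (range P)) \<omega> = (\<Sum>k. \<mu> (P k) \<omega>)"
    using 1 3 4 by eventually_elim simp
qed

end

section \<open>The integral representation\<close>

context represented_functional
begin

abbreviation nn_int :: "(('a \<Rightarrow> 'b) \<Rightarrow> 'a \<Rightarrow> real) \<Rightarrow> 'a \<Rightarrow> ennreal"
  where "nn_int \<equiv> stable_nn_integral M (L0 M) (stable_borel M) \<mu>"

lemma elementary_fun_section:
  assumes B: "\<And>k. k \<le> n \<Longrightarrow> B k \<in> sets N" and x: "x \<in> L0 M"
  shows "AE \<omega> in M. elementary_fun M (L0 M) n r (\<lambda>k. cgraph M (B k)) x \<omega> =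
           (\<Sum>k\<le>n. r k \<omega> * indicator (B k) (\<omega>, x \<omega>))"
proof -
  have "AE \<omega> in M. \<forall>k\<in>{..n}. \<omega> \<in> cmem M (cgraph M (B k)) x \<longleftrightarrow> (\<omega>, x \<omega>) \<in> B k"
    unfolding AE_ball_countable[OF countable_finite[OF finite_atMost]] using cmem_cgraph[OF B x] by auto
  then show ?thesis
    unfolding elementary_fun_def cindicator_eq
    by eventually_elim (auto simp: indicator_def intro!: sum.cong)
qed

text \<open>Random coefficients pull out of \<open>cE\<close>, so an elementary integral is the
  fibre integral of the corresponding function on the product.\<close>

lemma elementary_integral_cE:
  assumes B: "\<And>k. k \<le> n \<Longrightarrow> B k \<in> sets N" and r: "\<And>k. k \<le> n \<Longrightarrow> r k \<in> borel_measurable M"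
  shows "AE \<omega> in M. elementary_integral \<mu> n r (\<lambda>k. cgraph M (B k)) \<omega> =
           cE (\<lambda>p. \<Sum>k\<le>n. ennreal (r k (fst p)) * indicator (B k) p) \<omega>"
proof -
  have rm: "(\<lambda>\<omega>. ennreal (r k \<omega>)) \<in> borel_measurable M" if "k \<le> n" for k using r[OF that] by measurable
  have 1: "AE \<omega> in M. \<forall>k\<in>{..n}. \<mu> (cgraph M (B k)) \<omega> = \<kappa> (B k) \<omega>"
    unfolding AE_ball_countable[OF countable_finite[OF finite_atMost]] using \<mu>_cgraph[OF B] by auto
  have 2: "AE \<omega> in M. \<forall>k\<in>{..n}. ennreal (r k \<omega>) * \<kappa> (B k) \<omega> = cE (\<lambda>p. ennreal (r k (fst p)) * indicator (B k) p) \<omega>"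
    unfolding AE_ball_countable[OF countable_finite[OF finite_atMost]] \<kappa>_def
    using cE_mult[OF ind_m[OF B] rm] by auto
  have 3: "AE \<omega> in M. (\<Sum>k\<le>n. cE (\<lambda>p. ennreal (r k (fst p)) * indicator (B k) p) \<omega>) =
      cE (\<lambda>p. \<Sum>k\<le>n. ennreal (r k (fst p)) * indicator (B k) p) \<omega>"
  proof (rule cE_sum)
    fix k assume k: "k \<le> n"
    note ind_m[OF B[OF k], measurable] rm[OF k, measurable]
    show "(\<lambda>p. ennreal (r k (fst p)) * indicator (B k) p) \<in> borel_measurable m" by measurable
  qed
  show ?thesis using 1 2 3 unfolding elementary_integral_def
  proof eventually_elim
    case (elim \<omega>)
    have "(\<Sum>k\<le>n. ennreal (r k \<omega>) * \<mu> (cgraph M (B k)) \<omega>) =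
        (\<Sum>k\<le>n. cE (\<lambda>p. ennreal (r k (fst p)) * indicator (B k) p) \<omega>)"
      using elim(1,2) by (intro sum.cong refl) simp
    then show ?case unfolding elim(3) .
  qed
qed

text \<open>The integral is picked by choice, so two facts are required: an admissible sequence of
  elementary functions exists, and every admissible sequence gives the same random variable. Both
  are settled on the product, where the value is \<open>cE\<close>.\<close>

lemma nn_int_eq:
  fixes f :: "('a \<Rightarrow> 'b) \<Rightarrow> 'a \<Rightarrow> real"
  assumes F [measurable]: "F \<in> borel_measurable N" and F0: "\<And>p. 0 \<le> F p"
    and fF: "\<And>x. x \<in> L0 M \<Longrightarrow> AE \<omega> in M. f x \<omega> = F (\<omega>, x \<omega>)"
  shows "AE \<omega> in M. nn_int f \<omega> = cE (\<lambda>p. ennreal (F p)) \<omega>"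
proof -
  let ?el = "elementary_fun M (L0 M) :: nat \<Rightarrow> _ \<Rightarrow> _ \<Rightarrow> ('a \<Rightarrow> 'b) \<Rightarrow> 'a \<Rightarrow> real"
  let ?J = "\<lambda>I. I \<in> borel_measurable M \<and> (\<exists>n r P.
           (\<forall>m. elementary_data M (L0 M) (stable_borel M) (n m) (r m) (P m)) \<and>
           (\<forall>m. \<forall>x\<in>L0 M. AE \<omega> in M. ?el (n m) (r m) (P m) x \<omega> \<le> ?el (n (Suc m)) (r (Suc m)) (P (Suc m)) x \<omega>) \<and>
           (\<forall>x\<in>L0 M. AE \<omega> in M. (SUP m. ennreal (?el (n m) (r m) (P m) x \<omega>)) = ennreal (f x \<omega>)) \<and>
           (AE \<omega> in M. I \<omega> = (SUP m. elementary_integral \<mu> (n m) (r m) (P m) \<omega>)))"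
  have Fm: "(\<lambda>p. ennreal (F p)) \<in> borel_measurable m" unfolding borel_m by measurable
  \<comment> \<open>An admissible sequence gives functions \<open>S j\<close> on the product that
    increase to \<open>F\<close> along each random variable; \<open>polar_AE\<close> makes this
    \<open>m\<close>-almost everywhere, and monotone convergence for \<open>cE\<close>
    finishes.\<close>
  have unique: "AE \<omega> in M. I \<omega> = cE (\<lambda>p. ennreal (F p)) \<omega>" if J: "?J I" for I
  proof -
    obtain n r P where
      ed: "\<And>m. elementary_data M (L0 M) (stable_borel M) (n m) (r m) (P m)"
      and inc: "\<And>m x. x \<in> L0 M \<Longrightarrow> AE \<omega> in M. ?el (n m) (r m) (P m) x \<omega> \<le> ?el (n (Suc m)) (r (Suc m)) (P (Suc m)) x \<omega>"
      and sup: "\<And>x. x \<in> L0 M \<Longrightarrow> AE \<omega> in M. (SUP m. ennreal (?el (n m) (r m) (P m) x \<omega>)) = ennreal (f x \<omega>)"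
      and I: "AE \<omega> in M. I \<omega> = (SUP m. elementary_integral \<mu> (n m) (r m) (P m) \<omega>)"
      using J by blast
    have "\<forall>j. \<exists>C. \<forall>k. k \<le> n j \<longrightarrow> C k \<in> sets N \<and> P j k = cgraph M (C k)"
    proof
      fix j
      have "\<forall>k. \<exists>C. k \<le> n j \<longrightarrow> C \<in> sets N \<and> P j k = cgraph M C"
        using ed[of j] unfolding elementary_data_def by (meson stable_borelE)
      from choice[OF this] show "\<exists>C. \<forall>k. k \<le> n j \<longrightarrow> C k \<in> sets N \<and> P j k = cgraph M (C k)" .
    qed
    from choice[OF this] obtain B where B: "\<And>j k. k \<le> n j \<Longrightarrow> B j k \<in> sets N"
      "\<And>j k. k \<le> n j \<Longrightarrow> P j k = cgraph M (B j k)" by blast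
    have r: "r j k \<in> borel_measurable M" "AE \<omega> in M. 0 \<le> r j k \<omega>" if "k \<le> n j" for j k
      using ed[of j] that unfolding elementary_data_def L0_plus_def by auto
    have el_eq: "?el (n j) (r j) (P j) = ?el (n j) (r j) (\<lambda>k. cgraph M (B j k))" for j
      unfolding elementary_fun_def fun_eq_iff using B(2)[of _ j] by simp
    have int_eq: "elementary_integral \<mu> (n j) (r j) (P j) = elementary_integral \<mu> (n j) (r j) (\<lambda>k. cgraph M (B j k))" for j
      unfolding elementary_integral_def fun_eq_iff using B(2)[of _ j] by simp
    define S where "S = (\<lambda>j p. \<Sum>k\<le>n j. ennreal (r j k (fst p)) * indicator (B j k) p)"
    have S_N [measurable]: "S j \<in> borel_measurable N" for j
      unfolding S_def
    proof (rule borel_measurable_sum)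
      fix k assume "k \<in> {..n j}"
      then have k: "k \<le> n j" by simp
      note B(1)[OF k, measurable] r(1)[OF k, measurable]
      show "(\<lambda>p. ennreal (r j k (fst p)) * indicator (B j k) p) \<in> borel_measurable N" by measurable
    qed
    have S_m: "S j \<in> borel_measurable m" for j unfolding borel_m by (rule S_N)
    have el: "AE \<omega> in M. ennreal (?el (n j) (r j) (P j) x \<omega>) = S j (\<omega>, x \<omega>)" if x: "x \<in> L0 M" for j x
    proof -
      have "AE \<omega> in M. ?el (n j) (r j) (P j) x \<omega> = (\<Sum>k\<le>n j. r j k \<omega> * indicator (B j k) (\<omega>, x \<omega>))"
        unfolding el_eq by (rule elementary_fun_section[OF B(1) x])
      moreover have "AE \<omega> in M. \<forall>k\<in>{..n j}. 0 \<le> r j k \<omega>"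
        unfolding AE_ball_countable[OF countable_finite[OF finite_atMost]] using r(2) by auto
      ultimately show ?thesis
      proof eventually_elim
        case (elim \<omega>)
        have "ennreal (\<Sum>k\<le>n j. r j k \<omega> * indicator (B j k) (\<omega>, x \<omega>)) =
            (\<Sum>k\<le>n j. ennreal (r j k \<omega> * indicator (B j k) (\<omega>, x \<omega>)))"
          using elim(2) by (intro sum_ennreal[symmetric]) auto
        also have "\<dots> = S j (\<omega>, x \<omega>)" unfolding S_def
          by (intro sum.cong refl) (simp add: indicator_def)
        finally show ?case using elim(1) by simp
      qed
    qed
    have S_inc: "AE p in m. S j p \<le> S (Suc j) p" for j
    proof (rule polar_AE)
      show "{p\<in>space N. S j p \<le> S (Suc j) p} \<in> sets N" by measurable
      fix x :: "'a \<Rightarrow> 'b" assume x: "x \<in> L0 M"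
      show "AE \<omega> in M. S j (\<omega>, x \<omega>) \<le> S (Suc j) (\<omega>, x \<omega>)"
        using inc[OF x, of j] el[OF x, of j] el[OF x, of "Suc j"]
        by eventually_elim (metis ennreal_leI)
    qed
    have S_sup: "AE p in m. (SUP j. S j p) = ennreal (F p)"
    proof (rule polar_AE)
      show "{p\<in>space N. (SUP j. S j p) = ennreal (F p)} \<in> sets N" by measurable
      fix x :: "'a \<Rightarrow> 'b" assume x: "x \<in> L0 M"
      have "AE \<omega> in M. \<forall>j. ennreal (?el (n j) (r j) (P j) x \<omega>) = S j (\<omega>, x \<omega>)"
        unfolding AE_all_countable using el[OF x] by blast
      then show "AE \<omega> in M. (SUP j. S j (\<omega>, x \<omega>)) = ennreal (F (\<omega>, x \<omega>))"
        using sup[OF x] fF[OF x] by eventually_elim simp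
    qed
    have 1: "AE \<omega> in M. \<forall>j. elementary_integral \<mu> (n j) (r j) (P j) \<omega> = cE (S j) \<omega>"
      unfolding AE_all_countable S_def int_eq by (intro allI elementary_integral_cE B(1) r(1))
    have 2: "AE \<omega> in M. (SUP j. cE (S j) \<omega>) = cE (\<lambda>p. SUP j. S j p) \<omega>" by (rule cE_SUP[of S, OF S_m S_inc])
    have "(\<lambda>p. SUP j. S j p) \<in> borel_measurable m" unfolding borel_m by measurable
    from cE_cong[OF this Fm S_sup] 1 2 I show ?thesis by eventually_elim simp
  qed
  \<comment> \<open>Simple functions increasing to \<open>F\<close> are written over their level
    sets, with their values as constant coefficients.\<close>
  have "\<exists>I. ?J I"
  proof -
    have "\<exists>s. incseq s \<and> (\<forall>i. simple_function N (s i)) \<and> (\<forall>x. bdd_above (range (\<lambda>i. s i x))) \<and>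
             (\<forall>i x. 0 \<le> s i x) \<and> F = (SUP i. s i)"
      by (rule borel_measurable_implies_simple_function_sequence_real[OF F]) (rule F0)
    then obtain s where s: "incseq s" "\<And>i. simple_function N (s i)" "\<And>p. bdd_above (range (\<lambda>i. s i p))"
      "\<And>i p. 0 \<le> s i p" "F = (SUP i. s i)" by blast
    have ne: "space N \<noteq> {}" using not_empty by (simp add: space_pair_measure)
    have fin: "finite (s j ` space N)" for j using s(2)[of j] by (simp add: simple_function_def)
    have "\<exists>h. bij_betw h {0..<card (s j ` space N)} (s j ` space N)" for j
      by (rule ex_bij_betw_nat_finite[OF fin])
    then obtain h where h: "\<And>j. bij_betw (h j) {0..<card (s j ` space N)} (s j ` space N)" by metis
    \<comment> \<open>Elementary data run over \<open>k \<le> n\<close>, hence one less than the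
      number of values; there is at least one value because \<open>space N\<close> is
      non-empty.\<close>
    define n where "n = (\<lambda>j. card (s j ` space N) - 1)"
    have card_pos: "0 < card (s j ` space N)" for j using fin[of j] ne by (simp add: card_gt_0_iff)
    have nn: "{0..<card (s j ` space N)} = {..n j}" for j
      unfolding n_def using card_pos[of j] by auto
    have inj: "inj_on (h j) {..n j}" and img: "h j ` {..n j} = s j ` space N" for j
      using h[of j] unfolding nn bij_betw_def by auto
    define B where "B = (\<lambda>j k. s j -` {h j k} \<inter> space N)"
    have B: "B j k \<in> sets N" for j k unfolding B_def by (rule simple_functionD(2)[OF s(2)])
    define r where "r = (\<lambda>j k (_ :: 'a). h j k)"
    have h0: "0 \<le> h j k" if "k \<le> n j" for j k
    proof -
      have "h j k \<in> s j ` space N" using img[of j] that by blast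
      then show ?thesis using s(4) by auto
    qed
    let ?P = "\<lambda>j k. cgraph M (B j k)"
    have cover: "\<exists>k\<le>n j. p \<in> B j k" if "p \<in> space N" for p j
    proof -
      have "s j p \<in> h j ` {..n j}" using img that by simp
      then show ?thesis unfolding B_def using that by auto
    qed
    have sum_eq: "(\<Sum>k\<le>n j. h j k * indicator (B j k) p) = s j p" if p: "p \<in> space N" for j p
    proof -
      obtain k where k: "k \<le> n j" "p \<in> B j k" using cover[OF p] by blast
      have "(\<Sum>i\<le>n j. h j i * indicator (B j i) p) = (\<Sum>i\<le>n j. if i = k then h j k else 0)"
      proof (intro sum.cong refl)
        fix i assume i: "i \<in> {..n j}"
        show "h j i * indicator (B j i) p = (if i = k then h j k else 0)"
        proof (cases "i = k")
          case False
          have "p \<notin> B j i"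
          proof
            assume "p \<in> B j i"
            then have "h j i = h j k" using k unfolding B_def by simp
            then show False using inj[of j] i k False by (auto dest: inj_onD)
          qed
          then show ?thesis using False by simp
        qed (use k in simp)
      qed
      also have "\<dots> = h j k" using k by simp
      finally show ?thesis using k unfolding B_def by simp
    qed
    have el: "AE \<omega> in M. ?el (n j) (r j) (?P j) x \<omega> = s j (\<omega>, x \<omega>)" if x: "x \<in> L0 M" for j x
      using elementary_fun_section[of "n j" "B j" x "r j", OF B x] AE_space
    proof eventually_elim
      case (elim \<omega>)
      then show ?case using sum_eq[of "(\<omega>, x \<omega>)" j] unfolding r_def by (simp only: space_N fst_conv)
    qed
    have CS: "?P j k \<in> cond_subsets M (L0 M)" for j k using B by simp
    have "elementary_data M (L0 M) (stable_borel M) (n j) (r j) (?P j)" for j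
      unfolding elementary_data_def
    proof (intro conjI allI impI)
      fix k assume k: "k \<le> n j"
      show "r j k \<in> L0_plus M" unfolding L0_plus_def r_def using h0[OF k] by simp
      show "?P j k \<in> stable_borel M" unfolding stable_borel_eq using B by blast
    next
      fix i k assume ik: "i \<le> n j" "k \<le> n j" "i \<noteq> k"
      have d: "B j i \<inter> B j k = {}" using inj[of j] ik unfolding B_def by (auto dest: inj_onD)
      show "cdisjoint M (L0 M) (?P j i) (?P j k)" unfolding cdisjoint_iff[OF CS CS]
      proof
        fix x :: "'a \<Rightarrow> 'b" assume x: "x \<in> L0 M"
        show "AE \<omega> in M. \<not> (\<omega> \<in> cmem M (?P j i) x \<and> \<omega> \<in> cmem M (?P j k) x)"
          using cmem_cgraph[OF B x, of j i] cmem_cgraph[OF B x, of j k] by eventually_elim (use d in blast)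
      qed
    next
      have "countable (?P j ` {..n j})" "?P j ` {..n j} \<subseteq> cond_subsets M (L0 M)" using CS by auto
      from cSup_eq_ctop_iff[OF this] show "cSup M (L0 M) (?P j ` {..n j}) = ctop M (L0 M)"
      proof (rule iffD2, intro ballI)
        fix x :: "'a \<Rightarrow> 'b" assume x: "x \<in> L0 M"
        have "AE \<omega> in M. \<forall>k. \<omega> \<in> cmem M (?P j k) x \<longleftrightarrow> (\<omega>, x \<omega>) \<in> B j k"
          unfolding AE_all_countable using cmem_cgraph[OF B x] by blast
        then show "AE \<omega> in M. \<exists>Q\<in>?P j ` {..n j}. \<omega> \<in> cmem M Q x"
          using AE_space
        proof eventually_elim
          case (elim \<omega>)
          then obtain k where "k \<le> n j" "(\<omega>, x \<omega>) \<in> B j k" using cover[of "(\<omega>, x \<omega>)" j] by (auto simp: space_N)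
          then show ?case using elim by auto
        qed
      qed
    qed
    moreover have "AE \<omega> in M. ?el (n j) (r j) (?P j) x \<omega> \<le> ?el (n (Suc j)) (r (Suc j)) (?P (Suc j)) x \<omega>"
      if x: "x \<in> L0 M" for j x
      using el[OF x, of j] el[OF x, of "Suc j"]
    proof eventually_elim
      case (elim \<omega>)
      have "s j (\<omega>, x \<omega>) \<le> s (Suc j) (\<omega>, x \<omega>)" using incseq_SucD[OF s(1), of j] by (simp add: le_fun_def)
      then show ?case using elim by simp
    qed
    moreover have "AE \<omega> in M. (SUP j. ennreal (?el (n j) (r j) (?P j) x \<omega>)) = ennreal (f x \<omega>)" if x: "x \<in> L0 M" for x
    proof -
      have "AE \<omega> in M. \<forall>j. ?el (n j) (r j) (?P j) x \<omega> = s j (\<omega>, x \<omega>)"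
        unfolding AE_all_countable using el[OF x] by blast
      then show ?thesis using fF[OF x]
      proof eventually_elim
        case (elim \<omega>)
        let ?p = "(\<omega>, x \<omega>)"
        have inc: "incseq (\<lambda>j. s j ?p)" using s(1) by (auto simp: incseq_def le_fun_def)
        have Fp: "F ?p = (SUP i. s i ?p)" unfolding s(5) by (simp add: image_image)
        have "(\<lambda>j. s j ?p) \<longlonglongrightarrow> F ?p" unfolding Fp by (rule LIMSEQ_incseq_SUP[OF s(3) inc])
        then have "(\<lambda>j. ennreal (s j ?p)) \<longlonglongrightarrow> ennreal (F ?p)" by (rule tendsto_ennrealI)
        moreover have "(\<lambda>j. ennreal (s j ?p)) \<longlonglongrightarrow> (SUP j. ennreal (s j ?p))"
          using inc by (intro LIMSEQ_SUP) (auto simp: incseq_def intro: ennreal_leI)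
        ultimately have "(SUP j. ennreal (s j ?p)) = ennreal (F ?p)" using LIMSEQ_unique by blast
        then show ?case using elim by simp
      qed
    qed
    moreover have "(\<lambda>\<omega>. SUP j. elementary_integral \<mu> (n j) (r j) (?P j) \<omega>) \<in> borel_measurable M"
    proof -
      have [measurable]: "r j k \<in> borel_measurable M" "\<mu> Q \<in> borel_measurable M" for j k Q
        unfolding r_def by (simp_all add: \<mu>_measurable)
      show ?thesis unfolding elementary_integral_def by measurable
    qed
    ultimately show ?thesis
      by (intro exI[of _ "\<lambda>\<omega>. SUP j. elementary_integral \<mu> (n j) (r j) (?P j) \<omega>"] conjI exI[of _ n] exI[of _ r] exI[of _ ?P])
        auto
  qed
  from someI_ex[OF this] have "?J (nn_int f)" unfolding stable_nn_integral_def .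
  then show ?thesis by (rule unique)
qed

text \<open>\<open>F\<close> is replaced by its positive part: \<open>f \<ge> 0\<close> controls
  \<open>F\<close> only along random variables, while \<open>nn_int_eq\<close> asks for
  non-negativity everywhere.\<close>

lemma nn_int_L:
  fixes f :: "('a \<Rightarrow> 'b) \<Rightarrow> 'a \<Rightarrow> real"
  assumes f: "f \<in> C_c M" and f0: "\<And>x \<omega>. 0 \<le> f x \<omega>"
  shows "AE \<omega> in M. nn_int f \<omega> = ennreal (L f \<omega>)"
proof -
  obtain F where F: "F \<in> borel_measurable N" "\<And>x. x \<in> L0 M \<Longrightarrow> AE \<omega> in M. f x \<omega> = F (\<omega>, x \<omega>)"
    using C_c_representation[OF f] by blast
  let ?F = "\<lambda>p. max 0 (F p)"
  have Fm: "?F \<in> borel_measurable N" using F(1) by measurable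
  have eq: "AE \<omega> in M. f x \<omega> = ?F (\<omega>, x \<omega>)" if "x \<in> L0 M" for x
    using F(2)[OF that] by eventually_elim (metis f0 max_def)
  have "AE \<omega> in M. ennreal (L f \<omega>) = cE (\<lambda>p. ennreal (?F p)) \<omega>"
    by (rule cE_eq_L[OF f Fm eq]) simp_all
  moreover have "AE \<omega> in M. nn_int f \<omega> = cE (\<lambda>p. ennreal (?F p)) \<omega>"
    by (rule nn_int_eq[OF Fm _ eq]) simp_all
  ultimately show ?thesis by eventually_elim simp
qed

text \<open>The preimage of the conditional set induced by \<open>C\<close> is induced by the
  preimage of \<open>C\<close> under the map that keeps the first coordinate and applies
  \<open>F\<close>.\<close>

lemma stably_measurable_C_c:
  assumes f: "f \<in> C_c M"
  shows "stably_measurable M (L0 M) (stable_borel M) (L0 M) (stable_borel M) (f :: ('a \<Rightarrow> 'b) \<Rightarrow> 'a \<Rightarrow> real)"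
  unfolding stably_measurable_def
proof (intro conjI ballI)
  show st: "stable_fun M (L0 M) (L0 M) f" by (rule C_cD(1)[OF f])
  obtain F where F [measurable]: "F \<in> borel_measurable N"
    and fF: "\<And>x. x \<in> L0 M \<Longrightarrow> AE \<omega> in M. f x \<omega> = F (\<omega>, x \<omega>)"
    using C_c_representation[OF f] by blast
  fix Q :: "('a, real) condset" assume "Q \<in> stable_borel M"
  then obtain C where C: "C \<in> sets (M \<Otimes>\<^sub>M borel)" "Q = cgraph M C" unfolding stable_borel_eq by blast
  have Q: "Q \<in> cond_subsets M (L0 M)" unfolding C(2) using C(1) by simp
  let ?B = "(\<lambda>p. (fst p, F p)) -` C \<inter> space N"
  have B: "?B \<in> sets N" using C(1) by (intro measurable_sets[of _ N "M \<Otimes>\<^sub>M borel"]) measurable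
  have "cpreimage M (L0 M) (L0 M) f Q = cgraph M ?B"
  proof (rule cgraph_eqI[OF cpreimage_cmem(1)[OF st Q] B])
    fix x :: "'a \<Rightarrow> 'b" assume x: "x \<in> L0 M"
    show "AE \<omega> in M. \<omega> \<in> cmem M (cpreimage M (L0 M) (L0 M) f Q) x \<longleftrightarrow> (\<omega>, x \<omega>) \<in> ?B"
      using cpreimage_cmem(2)[OF st Q x] cmem_cgraph[OF C(1) stable_funD(1)[OF st x], folded C(2)] fF[OF x] AE_space
      by eventually_elim (simp add: space_N)
  qed
  then show "cpreimage M (L0 M) (L0 M) f Q \<in> stable_borel M" unfolding stable_borel_eq using B by blast
qed

lemma C_c_parts:
  fixes f :: "('a \<Rightarrow> 'b) \<Rightarrow> 'a \<Rightarrow> real"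
  assumes f: "f \<in> C_c M"
  shows "pos_part f \<in> C_c M" "neg_part f \<in> C_c M"
proof -
  show "pos_part f \<in> C_c M" unfolding pos_part_def by (rule C_c_max[OF f C_c_zero])
  have "(\<lambda>x \<omega>. - 1 * f x \<omega>) \<in> C_c M" using f by (intro C_c_mult) auto
  from C_c_max[OF this C_c_zero] show "neg_part f \<in> C_c M" unfolding neg_part_def by simp
qed

lemma stably_integrable_C_c:
  fixes f :: "('a \<Rightarrow> 'b) \<Rightarrow> 'a \<Rightarrow> real"
  assumes f: "f \<in> C_c M"
  shows "stably_integrable M (L0 M) (stable_borel M) \<mu> f"
    and "AE \<omega> in M. L f \<omega> = stable_integral M (L0 M) (stable_borel M) \<mu> f \<omega>"
proof -
  note pn = C_c_parts[OF f]
  have p: "AE \<omega> in M. nn_int (pos_part f) \<omega> = ennreal (L (pos_part f) \<omega>)"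
    by (rule nn_int_L[OF pn(1)]) (simp add: pos_part_def)
  have n: "AE \<omega> in M. nn_int (neg_part f) \<omega> = ennreal (L (neg_part f) \<omega>)"
    by (rule nn_int_L[OF pn(2)]) (simp add: neg_part_def)
  show "stably_integrable M (L0 M) (stable_borel M) \<mu> f"
    unfolding stably_integrable_def
  proof (intro conjI stably_measurable_C_c[OF f])
    show "AE \<omega> in M. nn_int (pos_part f) \<omega> < \<infinity>" using p by eventually_elim simp
    show "AE \<omega> in M. nn_int (neg_part f) \<omega> < \<infinity>" using n by eventually_elim simp
  qed
  have pp: "AE \<omega> in M. 0 \<le> L (pos_part f) \<omega>" by (rule L_positive[OF pn(1)]) (simp add: pos_part_def)
  have np: "AE \<omega> in M. 0 \<le> L (neg_part f) \<omega>" by (rule L_positive[OF pn(2)]) (simp add: neg_part_def)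
  have "max a 0 - max (- a) 0 = a" for a :: real by auto
  then have "(\<lambda>x \<omega>. pos_part f x \<omega> - neg_part f x \<omega>) = f" unfolding pos_part_def neg_part_def by simp
  then have "AE \<omega> in M. L f \<omega> = L (pos_part f) \<omega> - L (neg_part f) \<omega>" using L_diff[OF pn] by simp
  then show "AE \<omega> in M. L f \<omega> = stable_integral M (L0 M) (stable_borel M) \<mu> f \<omega>"
    using p n pp np unfolding stable_integral_def by eventually_elim simp
qed

section \<open>Stably compact sets: finiteness and inner regularity\<close>

lemma cmem_bounded:
  assumes P: "P \<in> cond_subsets M (L0 M)" and b: "L0_bounded M P"
  obtains R where "R \<in> borel_measurable M"
    "\<And>x. x \<in> L0 M \<Longrightarrow> AE \<omega> in M. \<omega> \<in> cmem M P x \<longrightarrow> norm (x \<omega> :: 'b) \<le> R \<omega>"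
proof -
  obtain R where R: "R \<in> L0_plus M"
    "\<And>v. v \<in> cset M (L0 M) P \<Longrightarrow> AE \<omega> in M. \<omega> \<in> cdom M (L0 M) P \<longrightarrow> norm (v \<omega>) \<le> R \<omega>"
    using b unfolding L0_bounded_def by blast
  show thesis
  proof
    show "R \<in> borel_measurable M" using R(1) unfolding L0_plus_def by auto
    fix x :: "'a \<Rightarrow> 'b" assume x: "x \<in> L0 M"
    obtain v where v: "v \<in> cset M (L0 M) P" "AE \<omega> in M. \<omega> \<in> cmem M P x \<longrightarrow> \<omega> \<in> cdom M (L0 M) P \<and> x \<omega> = v \<omega>"
      using cmem_char0(2)[OF P x] by blast
    show "AE \<omega> in M. \<omega> \<in> cmem M P x \<longrightarrow> norm (x \<omega>) \<le> R \<omega>"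
      using v(2) R(2)[OF v(1)] by eventually_elim auto
  qed
qed

text \<open>A set inducing a bounded conditional set lies in a random ball up to an
  \<open>m\<close>-null set, so its measure is at most \<open>L\<close> of a cutoff, which is
  real-valued. Outside \<open>stable_borel M\<close> the value is 0.\<close>

lemma \<mu>_finite:
  assumes P: "stably_compact M P"
  shows "AE \<omega> in M. \<mu> P \<omega> < \<infinity>"
proof (cases "P \<in> stable_borel M")
  case True
  then obtain B where B: "B \<in> sets N" "P = cgraph M B" by (rule stable_borelE)
  obtain R where R [measurable]: "R \<in> borel_measurable M"
    and Rb: "\<And>x. x \<in> L0 M \<Longrightarrow> AE \<omega> in M. \<omega> \<in> cmem M P x \<longrightarrow> norm (x \<omega> :: 'b) \<le> R \<omega>"
    using cmem_bounded[of P] P unfolding stably_compact_def by blast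
  let ?c = "cutoff R :: 'a \<times> 'b \<Rightarrow> real"
  have c: "(\<lambda>p. ennreal (?c p)) \<in> borel_measurable m" unfolding borel_m by measurable
  have "AE p in m. p \<in> B \<longrightarrow> norm (snd p) \<le> R (fst p)"
  proof (rule polar_AE)
    have "{p\<in>space N. p \<in> B \<longrightarrow> norm (snd p) \<le> R (fst p)} = {p\<in>space N. norm (snd p) \<le> R (fst p)} \<union> (space N - B)" by auto
    then show "{p\<in>space N. p \<in> B \<longrightarrow> norm (snd p) \<le> R (fst p)} \<in> sets N" using B(1) by simp
    fix x :: "'a \<Rightarrow> 'b" assume x: "x \<in> L0 M"
    show "AE \<omega> in M. (\<omega>, x \<omega>) \<in> B \<longrightarrow> norm (snd (\<omega>, x \<omega>)) \<le> R (fst (\<omega>, x \<omega>))"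
      using Rb[OF x] cmem_cgraph[OF B(1) x, folded B(2)] by eventually_elim simp
  qed
  then have "AE p in m. indicator B p \<le> ennreal (?c p)"
  proof eventually_elim
    case (elim p)
    then show ?case by (cases "p \<in> B") (simp_all add: cutoff_one)
  qed
  from cE_mono[OF ind_m[OF B(1)] c this]
  have 1: "AE \<omega> in M. \<kappa> B \<omega> \<le> cE (\<lambda>p. ennreal (?c p)) \<omega>" unfolding \<kappa>_def .
  have 2: "AE \<omega> in M. ennreal (L (section_fun ?c) \<omega>) = cE (\<lambda>p. ennreal (?c p)) \<omega>"
    by (rule cE_eq_L[OF C_c_cutoff[OF R]]) (simp_all add: section_fun_def cutoff_nonneg)
  show ?thesis using 1 2 \<mu>_cgraph[OF B(1), folded B(2)]
  proof eventually_elim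
    case (elim \<omega>)
    then have "\<mu> P \<omega> \<le> ennreal (L (section_fun ?c) \<omega>)" by simp
    then show ?case by (simp add: le_less_trans)
  qed
qed (simp add: \<mu>_def)

text \<open>Pointwise limits stay in the closed sections, and the common radius bounds all elements.
  This is why the inner approximations are built with both properties.\<close>

lemma stably_compact_cgraph:
  assumes K: "K \<in> closed_random_sets M" and b: "K \<subseteq> UNIV \<times> cball 0 r"
  shows "stably_compact M (cgraph M K :: ('a, 'b) condset)"
proof -
  let ?Q = "cgraph M K"
  have KN: "K \<in> sets N" by (rule closed_random_setsD(1)[OF K])
  have CS: "?Q \<in> cond_subsets M (L0 M)" using KN by simp
  let ?V = "cset M (L0 M) ?Q" and ?D = "cdom M (L0 M) ?Q"
  note pQ = presents_cset[OF CS]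
  have mem: "AE \<omega> in M. \<omega> \<in> ?D \<longrightarrow> (\<omega>, v \<omega>) \<in> K" if v: "v \<in> ?V" for v
  proof -
    have "v \<in> L0 M" using v pQ unfolding presents_def by auto
    from cmem_presented[OF pQ v] cmem_cgraph[OF KN this] show ?thesis by eventually_elim blast
  qed
  have bdd: "L0_bounded M ?Q"
    unfolding L0_bounded_def
  proof (intro bexI ballI)
    show "(\<lambda>_. max 0 r) \<in> L0_plus M" unfolding L0_plus_def by simp
    fix v assume "v \<in> ?V"
    from mem[OF this] show "AE \<omega> in M. \<omega> \<in> ?D \<longrightarrow> norm (v \<omega>) \<le> max 0 r"
    proof eventually_elim
      case (elim \<omega>)
      show ?case
      proof
        assume "\<omega> \<in> ?D"
        then have "(\<omega>, v \<omega>) \<in> UNIV \<times> cball 0 r" using elim b by blast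
        then show "norm (v \<omega>) \<le> max 0 r" by simp
      qed
    qed
  qed
  have "sequentially_closed M ?Q"
    unfolding sequentially_closed_def
  proof (intro allI ballI impI)
    fix xs and x :: "'a \<Rightarrow> 'b"
    assume x: "x \<in> L0 M" and xs: "\<forall>k. xs k \<in> ?V" and conv: "cconverges M ?D xs x"
    have "AE \<omega> in M. \<forall>k. \<omega> \<in> ?D \<longrightarrow> (\<omega>, xs k \<omega>) \<in> K" unfolding AE_all_countable using mem xs by blast
    then have "AE \<omega> in M. \<omega> \<in> ?D \<longrightarrow> (\<omega>, x \<omega>) \<in> K" using conv[unfolded cconverges_def]
    proof eventually_elim
      case (elim \<omega>)
      show ?case
      proof
        assume "\<omega> \<in> ?D"
        then have "\<And>k. xs k \<omega> \<in> Pair \<omega> -` K" "(\<lambda>k. xs k \<omega>) \<longlonglongrightarrow> x \<omega>" using elim by auto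
        from closed_sequentially[OF closed_random_setsD(2)[OF K] this] show "(\<omega>, x \<omega>) \<in> K" by simp
      qed
    qed
    then have xD: "AE \<omega> in M. \<omega> \<in> ?D \<longrightarrow> \<omega> \<in> cmem M ?Q x"
      using cmem_cgraph[OF KN x] by eventually_elim blast
    obtain v where v: "v \<in> ?V" "AE \<omega> in M. \<omega> \<in> cmem M ?Q x \<longrightarrow> \<omega> \<in> ?D \<and> x \<omega> = v \<omega>"
      using cmem_char0(2)[OF CS x] by blast
    have "AE \<omega> in M. \<omega> \<in> ?D \<longrightarrow> x \<omega> = v \<omega>" using xD v(2) by eventually_elim blast
    then have "rst M x ?D \<in> restr M ?V ?D" unfolding rst_in_restr_iff using v(1) by blast
    then show "rst M x ?D \<in> ?Q" using pQ unfolding presents_def by metis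
  qed
  then show ?thesis unfolding stably_compact_def using CS bdd by blast
qed

text \<open>The sets \<open>K n\<close> increase to \<open>B\<close> up to an \<open>m\<close>-null
  set, so by monotone convergence their measures increase to that of \<open>P\<close>. An essential
  upper bound of the uncountable family thus has to be compared with countably many members
  only.\<close>

lemma \<mu>_inner_regular:
  assumes P: "P \<in> stable_borel M"
  shows "is_ess_Sup M {\<mu> Q | Q. stably_compact M Q \<and> cle M (L0 M) Q P} (\<mu> P)"
  unfolding is_ess_Sup_def
proof (intro conjI ballI impI)
  obtain B where B: "B \<in> sets N" "P = cgraph M B" using P by (rule stable_borelE)
  have PCS: "P \<in> cond_subsets M (L0 M)" unfolding B(2) using B(1) by simp
  show "\<mu> P \<in> borel_measurable M" by (rule \<mu>_measurable)
  fix y assume "y \<in> {\<mu> Q | Q. stably_compact M Q \<and> cle M (L0 M) Q P}"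
  then obtain Q where Q: "y = \<mu> Q" "stably_compact M Q" "cle M (L0 M) Q P" by blast
  show "AE \<omega> in M. y \<omega> \<le> \<mu> P \<omega>"
  proof (cases "Q \<in> stable_borel M")
    case True
    then obtain C where C: "C \<in> sets N" "Q = cgraph M C" by (rule stable_borelE)
    have QCS: "Q \<in> cond_subsets M (L0 M)" unfolding C(2) using C(1) by simp
    have "AE \<omega> in M. \<kappa> C \<omega> \<le> \<kappa> B \<omega>"
    proof (rule \<kappa>_mono[OF C(1) B(1)])
      fix x :: "'a \<Rightarrow> 'b" assume x: "x \<in> L0 M"
      have "AE \<omega> in M. \<omega> \<in> cmem M Q x \<longrightarrow> \<omega> \<in> cmem M P x"
        using Q(3) x unfolding cle_iff[OF QCS PCS] ae_subset_def by blast
      then show "AE \<omega> in M. (\<omega>, x \<omega>) \<in> C \<longrightarrow> (\<omega>, x \<omega>) \<in> B"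
        using cmem_cgraph[OF B(1) x, folded B(2)] cmem_cgraph[OF C(1) x, folded C(2)]
        by eventually_elim blast
    qed
    then show ?thesis using \<mu>_cgraph[OF B(1), folded B(2)] \<mu>_cgraph[OF C(1), folded C(2)]
      unfolding Q(1) by eventually_elim simp
  qed (simp add: Q(1) \<mu>_def)
next
  obtain B where B: "B \<in> sets N" "P = cgraph M B" using P by (rule stable_borelE)
  have PCS: "P \<in> cond_subsets M (L0 M)" unfolding B(2) using B(1) by simp
  fix t assume t: "t \<in> borel_measurable M"
    and ub: "\<forall>y\<in>{\<mu> Q | Q. stably_compact M Q \<and> cle M (L0 M) Q P}. AE \<omega> in M. y \<omega> \<le> t \<omega>"
  have Bm: "B \<in> sets m" using B(1) sets_m' by simp
  obtain K where K: "incseq K" "\<And>n :: nat. K n \<in> closed_random_sets M" "\<And>n. K n \<subseteq> B"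
    "\<And>n. \<exists>r. K n \<subseteq> UNIV \<times> cball 0 r" "emeasure m (B - (\<Union>n. K n)) = 0"
    by (rule inner_regular[OF Bm]) blast
  have KN: "K n \<in> sets N" for n by (rule closed_random_setsD(1)[OF K(2)])
  have "AE \<omega> in M. \<kappa> (K n) \<omega> \<le> t \<omega>" for n
  proof -
    obtain r where "K n \<subseteq> UNIV \<times> cball 0 r" using K(4) by blast
    then have sc: "stably_compact M (cgraph M (K n))" by (rule stably_compact_cgraph[OF K(2)])
    have QCS: "cgraph M (K n) \<in> cond_subsets M (L0 M)" using KN by simp
    have "cle M (L0 M) (cgraph M (K n)) P"
      unfolding cle_iff[OF QCS PCS] ae_subset_def
    proof
      fix x :: "'a \<Rightarrow> 'b" assume x: "x \<in> L0 M"
      show "AE \<omega> in M. \<omega> \<in> cmem M (cgraph M (K n)) x \<longrightarrow> \<omega> \<in> cmem M P x"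
        using cmem_cgraph[OF B(1) x, folded B(2)] cmem_cgraph[OF KN x, of n]
        by eventually_elim (use K(3) in blast)
    qed
    then have "AE \<omega> in M. \<mu> (cgraph M (K n)) \<omega> \<le> t \<omega>" using ub sc by blast
    then show ?thesis using \<mu>_cgraph[OF KN[of n]] by eventually_elim simp
  qed
  then have 1: "AE \<omega> in M. \<forall>n. \<kappa> (K n) \<omega> \<le> t \<omega>" unfolding AE_all_countable by blast
  have 2: "AE \<omega> in M. (SUP n. \<kappa> (K n) \<omega>) = cE (\<lambda>p. SUP n. indicator (K n) p) \<omega>"
    unfolding \<kappa>_def
  proof (rule cE_SUP[OF ind_m[OF KN]])
    show "AE p in m. indicator (K n) p \<le> (indicator (K (Suc n)) p :: ennreal)" for n
      using incseq_SucD[OF K(1), of n] by (auto simp: indicator_def)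
  qed
  have 3: "AE \<omega> in M. cE (\<lambda>p. SUP n. indicator (K n) p) \<omega> = \<kappa> B \<omega>"
    unfolding \<kappa>_def
  proof (rule cE_cong[OF _ ind_m[OF B(1)]])
    show "(\<lambda>p. SUP n. indicator (K n) p :: ennreal) \<in> borel_measurable m" using ind_m[OF KN] by measurable
    have "B - (\<Union>n. K n) \<in> sets m" using Bm KN sets_m' by auto
    then have "AE p in m. p \<notin> B - (\<Union>n. K n)" using K(5) by (intro AE_not_in) auto
    then show "AE p in m. (SUP n. indicator (K n) p) = (indicator B p :: ennreal)"
    proof eventually_elim
      case (elim p)
      show ?case
      proof (cases "p \<in> B")
        case True
        then obtain n where "p \<in> K n" using elim by blast
        then show ?thesis using True
          by (intro antisym SUP_least SUP_upper2[of n]) (auto simp: indicator_def)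
      next
        case False
        then have "p \<notin> K n" for n using K(3) by blast
        then show ?thesis using False by simp
      qed
    qed
  qed
  show "AE \<omega> in M. \<mu> P \<omega> \<le> t \<omega>"
    using 1 2 3 \<mu>_cgraph[OF B(1), folded B(2)]
  proof eventually_elim
    case (elim \<omega>)
    have "(SUP n. \<kappa> (K n) \<omega>) \<le> t \<omega>" using elim(1) by (intro SUP_least) blast
    then show ?case using elim by simp
  qed
qed

end

theorem theorem5p16:
  fixes M :: "'w measure"
    and L :: "(('w \<Rightarrow> real ^ 'n) \<Rightarrow> 'w \<Rightarrow> real) \<Rightarrow> 'w \<Rightarrow> real"
  assumes "prob_space M" and "complete_measure M"
    and L_maps: "\<And>f. f \<in> C_c M \<Longrightarrow> L f \<in> L0 M"
    and L_well_defined: "\<And>f g. f \<in> C_c M \<Longrightarrow> g \<in> C_c M \<Longrightarrow>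
          (\<And>x. x \<in> L0 M \<Longrightarrow> AE \<omega> in M. f x \<omega> = g x \<omega>) \<Longrightarrow> AE \<omega> in M. L f \<omega> = L g \<omega>"
    and L_stable: "\<And>f A. (\<And>k. f k \<in> C_c M) \<Longrightarrow> partition_of M A \<Longrightarrow>
          AE \<omega> in M. L (\<lambda>x. glue A (\<lambda>k. f k x)) \<omega> = glue A (\<lambda>k. L (f k)) \<omega>"
    and L_linear: "\<And>f g r. f \<in> C_c M \<Longrightarrow> g \<in> C_c M \<Longrightarrow> r \<in> L0 M \<Longrightarrow>
          AE \<omega> in M. L (\<lambda>x \<omega>. f x \<omega> + r \<omega> * g x \<omega>) \<omega> = L f \<omega> + r \<omega> * L g \<omega>"
    and L_positive: "\<And>f. f \<in> C_c M \<Longrightarrow> (\<And>x. x \<in> L0 M \<Longrightarrow> AE \<omega> in M. 0 \<le> f x \<omega>) \<Longrightarrow>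
          AE \<omega> in M. 0 \<le> L f \<omega>"
  shows "\<exists>\<mu> :: ('w, real ^ 'n) condset \<Rightarrow> 'w \<Rightarrow> ennreal.
    stable_measure M (L0 M) (stable_borel M) \<mu> \<and>
    (\<forall>f\<in>C_c M. stably_integrable M (L0 M) (stable_borel M) \<mu> f \<and>
       (AE \<omega> in M. L f \<omega> = stable_integral M (L0 M) (stable_borel M) \<mu> f \<omega>)) \<and>
    (\<forall>x\<in>L0 M. \<forall>y\<in>L0 M. stably_compact M (restr M (L0_interval M x y) (space M)) \<longrightarrow>
       (AE \<omega> in M. \<mu> (restr M (L0_interval M x y) (space M)) \<omega> < \<infinity>)) \<and>
    (\<forall>P\<in>stable_borel M. (AE \<omega> in M. \<mu> P \<omega> < \<infinity>) \<longrightarrow>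
       is_ess_Sup M {\<mu> Q | Q. stably_compact M Q \<and> cle M (L0 M) Q P} (\<mu> P))"
proof -
  interpret pf: positive_functional M L
    using assms(1) by (intro positive_functional.intro positive_functional_axioms.intro L_maps L_well_defined L_linear L_positive)
  obtain m where m: "sets m = sets pf.N"
    "\<And>F. F \<in> pf.H \<Longrightarrow> (\<And>p. p \<in> space pf.N \<Longrightarrow> 0 \<le> F p) \<Longrightarrow> (\<integral>\<^sup>+p. ennreal (F p) \<partial>m) = ennreal (pf.I F)"
    using pf.product_measure_exists by blast
  interpret represented_functional M L m
    by unfold_locales (use m in auto)
  \<comment> \<open>\<open>\<mu>_finite\<close> covers every stably compact set, and with it the
    compact intervals.\<close>
  show ?thesis
    using stable_measure_\<mu> stably_integrable_C_c \<mu>_finite \<mu>_inner_regular by (intro exI[of _ \<mu>]) simp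
qed

end
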